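(* Let $d\ge 1$ be an integer and let $\lambda'>\lambda>0$ be real numbers. (1) Let $v_1,\dots,v_d\in\mathbb{R}^d$ be linearly independent. There is no thickening on $\mathbb{R}^d$ from intensity $\lambda$ to intensity $\lambda'$ which commutes with all of the shifts $\sigma_{v_1},\dots,\sigma_{v_d}$. (2) For every $(d-1)$-dimensional linear subspace $V\subset\mathbb{R}^d$, there exists a thickening on $\mathbb{R}^d$ from intensity $\lambda$ to intensity $\lambda'$ which commutes with the shift $\sigma_v$ for every $v\in V$.
   Context: Let $\mathbb{M}_d$ denote the space of locally finite subsets of $\mathbb{R}^d$, endowed with the minimal $\sigma$-algebra under which all maps $S\mapsto |S\cap B|$, for $B\subset\mathbb{R}^d$ Borel, are measurable. Poisson processes on $\mathbb{R}^d$ (homogeneous, with intensity with respect to Lebesgue measure) are viewed as random elements of $\mathbb{M}_d$. A thickening on $\mathbb{R}^d$ from intensity $\lambda$ to intensity $\lambda'$ is a measurable function $f:\mathbb{M}_d\to\mathbb{M}_d$ such that $X\cup f(X)$ is a Poisson process on $\mathbb{R}^d$ of intensity $\lambda'$ when $X$ is a Poisson process on $\mathbb{R}^d$ of intensity $\lambda$. For $v\in\mathbb{R}^d$, the shift $\sigma_v$ is translation by $v$, acting on $\mathbb{M}_d$ by $\sigma_v(S)=\{s+v: s\in S\}$. The function $f$ commutes with $\sigma_v$ if $\sigma_v\circ f=f\circ\sigma_v$ on $\mathbb{M}_d$. *)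

theory Defs
  imports "HOL-Probability.Probability"
begin

definition locally_finite :: "'a::euclidean_space set \<Rightarrow> bool" where
  "locally_finite S \<longleftrightarrow> (\<forall>B. bounded B \<longrightarrow> finite (S \<inter> B))"

text \<open>The value is \<open>\<infinity>\<close> when \<open>S \<inter> B\<close> is infinite, unlike \<^const>\<open>card\<close>.\<close>

definition count_in :: "'a set \<Rightarrow> 'a set \<Rightarrow> ennreal" where
  "count_in B S = emeasure (count_space UNIV) (S \<inter> B)"

definition configs :: "'a::euclidean_space set measure" where
  "configs = sigma {S. locally_finite S}
     {count_in B -` A \<inter> {S. locally_finite S} | B A. B \<in> sets borel \<and> A \<in> sets borel}"

text \<open>
  \<open>X\<close> is a homogeneous Poisson process of intensity \<open>l\<close>, defined on the probability space \<open>\<Omega>\<close>.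
  The Poisson probabilities are written out because the library's \<open>poisson_pmf\<close> is only specified
  for positive rates, and Lebesgue null sets have rate 0.
\<close>

definition poisson_process ::
  "real \<Rightarrow> 'w measure \<Rightarrow> ('w \<Rightarrow> 'a::euclidean_space set) \<Rightarrow> bool" where
  "poisson_process l \<Omega> X \<longleftrightarrow>
     prob_space \<Omega> \<and> X \<in> measurable \<Omega> configs \<and>
     (\<forall>B \<in> sets borel. emeasure lborel B < \<infinity> \<longrightarrow>
        (\<forall>k::nat. measure \<Omega> {\<omega> \<in> space \<Omega>. count_in B (X \<omega>) = of_nat k} =
           (l * measure lborel B) ^ k / fact k * exp (- (l * measure lborel B)))) \<and>
     (\<forall>(n::nat) B. (\<forall>i<n. B i \<in> sets borel) \<and> disjoint_family_on B {..<n} \<longrightarrow>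
        prob_space.indep_vars \<Omega> (\<lambda>_. borel) (\<lambda>i \<omega>. count_in (B i) (X \<omega>)) {..<n})"

text \<open>
  A definition cannot quantify over the type of the sample space, so \<open>\<Omega>\<close> ranges over the
  probability spaces whose points are subsets of the Euclidean space. This is no restriction: see
  \<open>thickening_any_sample_space\<close> below.
\<close>

definition thickening ::
  "real \<Rightarrow> real \<Rightarrow> ('a::euclidean_space set \<Rightarrow> 'a set) \<Rightarrow> bool" where
  "thickening l l' f \<longleftrightarrow> f \<in> measurable configs configs \<and>
     (\<forall>(\<Omega> :: 'a set measure) X. poisson_process l \<Omega> X \<longrightarrow>
        poisson_process l' \<Omega> (\<lambda>\<omega>. X \<omega> \<union> f (X \<omega>)))"

definition shift :: "'a::euclidean_space \<Rightarrow> 'a set \<Rightarrow> 'a set" where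
  "shift v S = (\<lambda>s. s + v) ` S"

definition commutes_with_shift ::
  "('a::euclidean_space set \<Rightarrow> 'a set) \<Rightarrow> 'a \<Rightarrow> bool" where
  "commutes_with_shift f v \<longleftrightarrow> (\<forall>S \<in> space configs. shift v (f S) = f (shift v S))"

lemma space_configs: "space configs = {S. locally_finite S}"
  unfolding configs_def by (rule space_measure_of) auto

lemma measurable_count_in:
  assumes "B \<in> sets borel"
  shows "count_in B \<in> borel_measurable configs"
proof (rule measurableI)
  fix A :: "ennreal set" assume A: "A \<in> sets borel"
  have "count_in B -` A \<inter> {S. locally_finite S} \<in> sets configs"
    unfolding configs_def using assms A by (subst sets_measure_of) (auto intro!: sigma_sets.Basic)
  then show "count_in B -` A \<inter> space configs \<in> sets configs"
    by (simp add: space_configs)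
qed simp

lemma poisson_process_distr:
  fixes X :: "'w \<Rightarrow> 'a::euclidean_space set" and g :: "'b \<Rightarrow> 'a set"
  assumes \<Omega>: "prob_space \<Omega>" and T: "T \<in> measurable \<Omega> N" and g: "g \<in> measurable N configs"
  shows "poisson_process l (distr \<Omega> N T) g \<longleftrightarrow> poisson_process l \<Omega> (\<lambda>\<omega>. g (T \<omega>))"
proof -
  interpret prob_space \<Omega> by (rule \<Omega>)
  have D: "prob_space (distr \<Omega> N T)" by (rule prob_space_distr[OF T])
  interpret D: prob_space "distr \<Omega> N T" by (rule D)
  have cnt: "(\<lambda>x. count_in B (g x)) \<in> borel_measurable N" if "B \<in> sets borel" for B
    using measurable_compose[OF g measurable_count_in[OF that]] .
  have cnt': "(\<lambda>x. count_in B (g (T x))) \<in> borel_measurable \<Omega>" if "B \<in> sets borel" for B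
    using measurable_compose[OF T cnt[OF that]] .
  have law: "measure (distr \<Omega> N T) {x \<in> space (distr \<Omega> N T). count_in B (g x) = of_nat k} =
      measure \<Omega> {\<omega> \<in> space \<Omega>. count_in B (g (T \<omega>)) = of_nat k}"
    if B: "B \<in> sets borel" for B k
  proof -
    have "(\<lambda>x. count_in B (g x)) -` {of_nat k} \<inter> space N \<in> sets N"
      by (rule measurable_sets[OF cnt[OF B]]) simp
    then have "{x \<in> space N. count_in B (g x) = of_nat k} \<in> sets N"
      by (simp add: vimage_def Int_def conj_commute)
    then show ?thesis
      using measurable_space[OF T] by (subst measure_distr[OF T]) (auto intro!: arg_cong[where f="measure \<Omega>"])
  qed
  have ind: "D.indep_vars (\<lambda>_. borel) (\<lambda>i x. count_in (B i) (g x)) {..<n} \<longleftrightarrow>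
      indep_vars (\<lambda>_. borel) (\<lambda>i \<omega>. count_in (B i) (g (T \<omega>))) {..<n}"
    if B: "\<forall>i<n. B i \<in> sets borel" for B and n :: nat
  proof (cases "n = 0")
    case True
    then show ?thesis
      by (simp add: D.indep_vars_def indep_vars_def D.indep_sets_def indep_sets_def)
  next
    case False
    then have ne: "{..<n} \<noteq> {}" by auto
    have m: "(\<lambda>x. \<lambda>i\<in>{..<n}. count_in (B i) (g x)) \<in> measurable N (PiM {..<n} (\<lambda>_. borel))"
      using B cnt by (intro measurable_restrict) auto
    have j: "distr (distr \<Omega> N T) (PiM {..<n} (\<lambda>_. borel)) (\<lambda>x. \<lambda>i\<in>{..<n}. count_in (B i) (g x)) =
        distr \<Omega> (PiM {..<n} (\<lambda>_. borel)) (\<lambda>\<omega>. \<lambda>i\<in>{..<n}. count_in (B i) (g (T \<omega>)))"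
      using distr_distr[OF m T] by (simp add: comp_def)
    have c: "distr (distr \<Omega> N T) borel (\<lambda>x. count_in (B i) (g x)) =
        distr \<Omega> borel (\<lambda>\<omega>. count_in (B i) (g (T \<omega>)))" if "i \<in> {..<n}" for i
      using distr_distr[OF cnt T] B that by (simp add: comp_def)
    have "D.indep_vars (\<lambda>_. borel) (\<lambda>i x. count_in (B i) (g x)) {..<n} \<longleftrightarrow>
       distr (distr \<Omega> N T) (PiM {..<n} (\<lambda>_. borel)) (\<lambda>x. \<lambda>i\<in>{..<n}. count_in (B i) (g x)) =
       PiM {..<n} (\<lambda>i. distr (distr \<Omega> N T) borel (\<lambda>x. count_in (B i) (g x)))"
      using B cnt by (intro D.indep_vars_iff_distr_eq_PiM'[OF ne]) simp
    also have "\<dots> \<longleftrightarrow> distr \<Omega> (PiM {..<n} (\<lambda>_. borel)) (\<lambda>\<omega>. \<lambda>i\<in>{..<n}. count_in (B i) (g (T \<omega>))) =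
       PiM {..<n} (\<lambda>i. distr \<Omega> borel (\<lambda>\<omega>. count_in (B i) (g (T \<omega>))))"
      unfolding j using PiM_cong[OF refl c, of "{..<n}"] by simp
    also have "\<dots> \<longleftrightarrow> indep_vars (\<lambda>_. borel) (\<lambda>i \<omega>. count_in (B i) (g (T \<omega>))) {..<n}"
      using B cnt' by (intro indep_vars_iff_distr_eq_PiM'[OF ne, symmetric]) simp
    finally show ?thesis .
  qed
  have gT: "(\<lambda>\<omega>. g (T \<omega>)) \<in> measurable \<Omega> configs" by (rule measurable_compose[OF T g])
  show ?thesis
    unfolding poisson_process_def using \<Omega> D g gT by (simp add: law[unfolded space_distr] ind cong: imp_cong conj_cong)
qed

lemma thickening_any_sample_space:
  fixes X :: "'w \<Rightarrow> 'a::euclidean_space set"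
  assumes f: "thickening l l' f" and X: "poisson_process l \<Omega> X"
  shows "poisson_process l' \<Omega> (\<lambda>\<omega>. X \<omega> \<union> f (X \<omega>))"
proof -
  have \<Omega>: "prob_space \<Omega>" and m: "X \<in> measurable \<Omega> configs"
    using X by (auto simp: poisson_process_def)
  have "poisson_process l (distr \<Omega> configs X) (\<lambda>S. S)"
    using poisson_process_distr[OF \<Omega> m measurable_ident_sets[OF refl]] X by simp
  then have D: "poisson_process l' (distr \<Omega> configs X) (\<lambda>S. S \<union> f S)"
    using f by (simp add: thickening_def)
  then have "(\<lambda>S. S \<union> f S) \<in> measurable configs configs"
    by (simp add: poisson_process_def)
  from poisson_process_distr[OF \<Omega> m this] D show ?thesis by simp
qed

end

theory Submission
  imports Defs
begin

text \<open>
  A random set is a Poisson process as soon as it misses each bounded Borel set \<open>B\<close> with probability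
  \<open>exp (- l |B|)\<close> (\<open>poisson_process_iff_void\<close>).

  No thickening commutes with a lattice of shifts. Let \<open>Y = X \<union> f X\<close>, and let \<open>Z = Y - X\<close> be the new points. Divide
  a tile of the lattice into tiny pieces. Up to a rare error, finitely many voids of \<open>X\<close> decide whether a given
  piece receives a new point. By equivariance one rule predicts the pieces in all tiles of a large window, and so
  \<open>X\<close> singles out a region of small volume fraction that contains most points of \<open>Z\<close>. This is impossible: \<open>Y\<close>
  is a Poisson process, and by a union bound over all ways to split its points into two sets, the probability that
  a small region chosen from the first set captures many points of the second decays exponentially in the volume of the window
  (\<open>captured_points_bound\<close>, \<open>captured_by_local_rule\<close>, \<open>no_equivariant_thickening\<close>).

  If only the shifts along a hyperplane must commute, randomness can be hidden in \<open>X\<close> and used up. Take a sequence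
  of boxes, each made of two equal cubes. When a box contains exactly one point, the cube that it lies in is a fair bit.
  The numbers of points added to a box are chosen such that the result says nothing about this bit
  (\<open>balanced_counts\<close>); so the bits of the boxes remain available as independent randomness. Box \<open>j\<close>
  draws its additional points from the bits of boxes with larger indices, and by
  induction on the number of boxes the result is a Poisson process (\<open>hidden_information\<close>,
  \<open>extra_void\<close>). This gives a thickening without any equivariance that looks at \<open>X\<close> only in a thin tube of boxes.

  To make it equivariant, choose nuclei: the projections to the hyperplane of those points of a slab just below it
  that are isolated in it. Their Voronoi cells, extended orthogonally to the hyperplane, cover almost all of the space, and
  each cell contains a tube of boxes above its nucleus. In each cell the points are added by the
  construction that starts at its nucleus. The nuclei depend on the points below the hyperplane and
  the boxes lie above it; so, given the points below, the cells are independent copies of the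
  first construction (\<open>grown_void\<close>, \<open>voronoi_void\<close>).
\<close>

abbreviation vol :: "'a::euclidean_space set \<Rightarrow> real" where "vol \<equiv> measure lborel"

section \<open>Dyadic cells and the measurability of random sets\<close>

definition grid :: "nat \<Rightarrow> 'a::euclidean_space \<Rightarrow> 'a" where
  "grid n x = (\<Sum>b\<in>Basis. of_int \<lfloor>2^n * (x \<bullet> b)\<rfloor> *\<^sub>R b)"

lemma grid_inner: "b \<in> Basis \<Longrightarrow> grid n x \<bullet> b = of_int \<lfloor>2^n * (x \<bullet> b)\<rfloor>"
  by (simp add: grid_def)

lemma grid_eq_iff: "grid n x = grid n y \<longleftrightarrow> (\<forall>b\<in>Basis. \<lfloor>2^n * (x \<bullet> b)\<rfloor> = \<lfloor>2^n * (y \<bullet> b)\<rfloor>)"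
  by (subst euclidean_eq_iff) (simp add: grid_inner)

lemma grid_Suc:
  assumes "grid (Suc n) x = grid (Suc n) y"
  shows "grid n x = grid n y"
proof -
  have "\<lfloor>2^n * a\<rfloor> = \<lfloor>2^Suc n * a\<rfloor> div 2" for a :: real
    using floor_divide_real_eq_div[of 2 "2^Suc n * a"] by simp
  then show ?thesis using assms by (simp add: grid_eq_iff del: power_Suc)
qed

lemma grid_antimono: "m \<le> n \<Longrightarrow> grid n x = grid n y \<Longrightarrow> grid m x = grid m y"
  by (induction n rule: dec_induct) (auto dest: grid_Suc)

lemma grid_measurable [measurable]: "grid n \<in> borel_measurable borel"
  unfolding grid_def by measurable

lemma countable_range_grid: "countable (range (grid n :: 'a::euclidean_space \<Rightarrow> 'a))"
proof -
  have "range (grid n :: 'a \<Rightarrow> 'a) \<subseteq> (\<lambda>f. \<Sum>b\<in>Basis. of_int (f b) *\<^sub>R b) ` (\<Pi>\<^sub>E b\<in>(Basis::'a set). (UNIV::int set))"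
  proof safe
    fix x :: 'a
    show "grid n x \<in> (\<lambda>f. \<Sum>b\<in>Basis. of_int (f b) *\<^sub>R b) ` (\<Pi>\<^sub>E b\<in>(Basis::'a set). (UNIV::int set))"
      by (rule image_eqI[of _ _ "\<lambda>b\<in>Basis. \<lfloor>2^n * (x \<bullet> b)\<rfloor>"]) (auto simp: grid_def intro!: sum.cong)
  qed
  then show ?thesis by (rule countable_subset) (intro countable_image countable_PiE; simp)
qed

lemma finite_grid_bounded:
  assumes "bounded (B::'a::euclidean_space set)" shows "finite (grid n ` B)"
proof -
  from assms obtain M where M: "\<And>x. x \<in> B \<Longrightarrow> norm x \<le> M" by (auto simp: bounded_iff)
  define K where "K = \<lceil>2^n * M\<rceil> + 1"
  have "grid n ` B \<subseteq> (\<lambda>f. \<Sum>b\<in>Basis. of_int (f b) *\<^sub>R b) ` (\<Pi>\<^sub>E b\<in>(Basis::'a set). {-K..K})"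
  proof safe
    fix x :: 'a assume x: "x \<in> B"
    have "\<lfloor>2^n * (x \<bullet> b)\<rfloor> \<in> {-K..K}" if "b \<in> Basis" for b
    proof -
      have "\<bar>x \<bullet> b\<bar> \<le> M" using Basis_le_norm[OF that, of x] M[OF x] by simp
      then have "2^n * (x \<bullet> b) \<le> 2^n * M" "- (2^n * M) \<le> 2^n * (x \<bullet> b)"
        using mult_left_mono[of "x \<bullet> b" M "2^n"] mult_left_mono[of "- M" "x \<bullet> b" "2^n"] by auto
      then show ?thesis unfolding K_def by (simp; linarith)
    qed
    then show "grid n x \<in> (\<lambda>f. \<Sum>b\<in>Basis. of_int (f b) *\<^sub>R b) ` (\<Pi>\<^sub>E b\<in>(Basis::'a set). {-K..K})"
      by (intro image_eqI[of _ _ "\<lambda>b\<in>Basis. \<lfloor>2^n * (x \<bullet> b)\<rfloor>"]) (auto simp: grid_def intro!: sum.cong)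
  qed
  then show ?thesis by (rule finite_subset) (intro finite_imageI finite_PiE; simp)
qed

lemma grid_separates:
  assumes "finite (F::'a::euclidean_space set)"
  obtains n where "inj_on (grid n) F"
proof -
  have sep: "\<exists>n. grid n x \<noteq> grid n y" if "x \<noteq> y" for x y :: 'a
  proof -
    obtain b where b: "b \<in> Basis" "x \<bullet> b \<noteq> y \<bullet> b" using \<open>x \<noteq> y\<close> euclidean_eqI[of x y] by blast
    obtain n where n: "1 / \<bar>x \<bullet> b - y \<bullet> b\<bar> < 2 ^ n" using real_arch_pow[of 2] by auto
    then have "1 < 2^n * \<bar>x \<bullet> b - y \<bullet> b\<bar>" using b by (simp add: field_simps)
    also have "... = \<bar>2^n * (x \<bullet> b) - 2^n * (y \<bullet> b)\<bar>" by (simp add: abs_mult flip: right_diff_distrib)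
    finally have "\<lfloor>2^n * (x \<bullet> b)\<rfloor> \<noteq> \<lfloor>2^n * (y \<bullet> b)\<rfloor>" by linarith
    then show ?thesis using b by (auto simp: grid_eq_iff)
  qed
  have "eventually (\<lambda>n. \<forall>p\<in>F\<times>F. fst p \<noteq> snd p \<longrightarrow> grid n (fst p) \<noteq> grid n (snd p)) sequentially"
    using assms
  proof (intro eventually_ball_finite ballI)
    fix p :: "'a \<times> 'a" assume "p \<in> F \<times> F"
    show "eventually (\<lambda>n. fst p \<noteq> snd p \<longrightarrow> grid n (fst p) \<noteq> grid n (snd p)) sequentially"
    proof (cases "fst p = snd p")
      case False
      then obtain m where m: "grid m (fst p) \<noteq> grid m (snd p)" using sep by blast
      show ?thesis
        using grid_antimono[of m _ "fst p" "snd p"] m by (intro eventually_sequentiallyI[of m]) blast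
    qed simp
  qed auto
  then obtain n where "\<forall>p\<in>F\<times>F. fst p \<noteq> snd p \<longrightarrow> grid n (fst p) \<noteq> grid n (snd p)"
    by (auto simp: eventually_sequentially)
  then show ?thesis by (intro that[of n]) (auto simp: inj_on_def)
qed

definition cell :: "nat \<Rightarrow> 'a::euclidean_space \<Rightarrow> nat" where
  "cell n x = to_nat_on (range (grid n :: 'a \<Rightarrow> 'a)) (grid n x)"

lemma cell_eq_iff: "cell n x = cell n y \<longleftrightarrow> grid n x = grid n y"
  unfolding cell_def using inj_on_to_nat_on[OF countable_range_grid[of n, where 'a='a]]
  by (auto simp: inj_on_def)

lemma cell_measurable [measurable]:
  "(cell n :: 'a::euclidean_space \<Rightarrow> nat) \<in> measurable borel (count_space UNIV)"
proof (rule measurableI)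
  fix A :: "nat set"
  let ?R = "range (grid n :: 'a \<Rightarrow> 'a)"
  have "cell n -` A = (\<Union>k\<in>{k\<in>?R. to_nat_on ?R k \<in> A}. grid n -` {k})"
    by (auto simp: cell_def)
  also have "... \<in> sets borel"
  proof (rule sets.countable_UN'')
    show "countable {k\<in>?R. to_nat_on ?R k \<in> A}"
      using countable_range_grid by (rule countable_subset[rotated]) auto
  qed (simp add: measurable_sets_borel[OF grid_measurable])
  finally show "cell n -` A \<inter> space borel \<in> sets (borel :: 'a measure)" by simp
qed simp

lemma finite_cell_bounded: "bounded B \<Longrightarrow> finite (cell n ` B)"
proof -
  assume "bounded B"
  then have "finite (to_nat_on (range (grid n :: 'a \<Rightarrow> 'a)) ` grid n ` B)"
    by (intro finite_imageI finite_grid_bounded)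
  then show ?thesis by (simp add: image_image cell_def)
qed

lemma cell_separates:
  assumes "finite (F::'a::euclidean_space set)"
  obtains n where "inj_on (cell n) F"
proof -
  obtain n where "inj_on (grid n) F" using grid_separates[OF assms] .
  then have "inj_on (cell n) F" by (simp add: inj_on_def cell_eq_iff)
  then show ?thesis by (rule that)
qed

abbreviation ecard :: "'b set \<Rightarrow> ennreal" where
  "ecard A \<equiv> emeasure (count_space UNIV) A"

lemma ecard_finite: "finite A \<Longrightarrow> ecard A = of_nat (card A)"
  by (simp add: emeasure_count_space)

lemma ecard_infinite: "infinite A \<Longrightarrow> ecard A = \<infinity>"
  by (simp add: emeasure_count_space)

lemma ecard_mono: "A \<subseteq> B \<Longrightarrow> ecard A \<le> ecard B"
  by (rule emeasure_mono) auto

lemma ecard_image_le: "ecard (f ` A) \<le> ecard A"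
  by (cases "finite A") (auto simp: ecard_finite ecard_infinite card_image_le)

text \<open>A fine grid separates any finite number of points.\<close>

lemma ecard_eq_SUP_cell: "ecard T = (SUP n. ecard (cell n ` T))"
proof (rule antisym)
  have fin: "of_nat (card F) \<le> (SUP n. ecard (cell n ` T))" if "finite F" "F \<subseteq> T" for F
  proof -
    obtain n where n: "inj_on (cell n) F" using cell_separates[OF \<open>finite F\<close>] .
    have "of_nat (card F) = ecard (cell n ` F)"
      using that n by (simp add: ecard_finite card_image)
    also have "... \<le> ecard (cell n ` T)" using that by (intro ecard_mono image_mono)
    also have "... \<le> (SUP n. ecard (cell n ` T))" by (rule SUP_upper) simp
    finally show ?thesis .
  qed
  show "ecard T \<le> (SUP n. ecard (cell n ` T))"
  proof (cases "finite T")
    case True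
    then show ?thesis using fin[of T] by (simp add: ecard_finite)
  next
    case False
    have "of_nat m \<le> (SUP n. ecard (cell n ` T))" for m
      using infinite_arbitrarily_large[OF False, of m] fin by auto
    then have "(SUP n. ecard (cell n ` T)) = \<infinity>"
      by (metis ennreal_Ex_less_of_nat infinity_ennreal_def leD less_top)
    then show ?thesis by (simp only: infinity_ennreal_def top_greatest)
  qed
qed (intro SUP_least ecard_image_le)

lemma ecard_nat_sum: "ecard (A::nat set) = (\<Sum>i. indicator A i)"
  by (simp add: nn_integral_count_space_nat flip: nn_integral_indicator)

lemma count_in_eq_SUP:
  "count_in B S = (SUP n. \<Sum>i. indicator {i. S \<inter> (B \<inter> cell n -` {i}) \<noteq> {}} i)"
proof -
  have "cell n ` (S \<inter> B) = {i. S \<inter> (B \<inter> cell n -` {i}) \<noteq> {}}" for n by auto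
  then show ?thesis unfolding count_in_def by (subst ecard_eq_SUP_cell) (simp add: ecard_nat_sum)
qed

lemma count_in_0_iff: "count_in B S = 0 \<longleftrightarrow> S \<inter> B = {}"
  by (cases "finite (S \<inter> B)") (auto simp: count_in_def ecard_finite ecard_infinite)

lemma void_in_configs [measurable]:
  assumes "B \<in> sets borel" shows "{S \<in> space configs. S \<inter> B = {}} \<in> sets configs"
proof -
  have "{S \<in> space configs. S \<inter> B = {}} = count_in B -` {0} \<inter> space configs"
    by (auto simp flip: count_in_0_iff)
  then show ?thesis using measurable_sets[OF measurable_count_in[OF assms], of "{0}"] by simp
qed

lemma void_measurable:
  assumes X: "X \<in> measurable M configs" and B: "B \<in> sets borel"
  shows "{\<nu> \<in> space M. X \<nu> \<inter> B = {}} \<in> sets M"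
proof -
  have "{\<nu> \<in> space M. X \<nu> \<inter> B = {}} = X -` {S \<in> space configs. S \<inter> B = {}} \<inter> space M"
    using measurable_space[OF X] by auto
  then show ?thesis using measurable_sets[OF X void_in_configs[OF B]] by simp
qed

text \<open>The number of points in a set is a limit of numbers of occupied cells, and a cell is occupied unless a void occurs.\<close>

lemma measurable_configsI:
  fixes X :: "'w \<Rightarrow> 'a::euclidean_space set"
  assumes lf: "\<And>\<nu>. \<nu> \<in> space M \<Longrightarrow> locally_finite (X \<nu>)"
    and void: "\<And>B. B \<in> sets borel \<Longrightarrow> bounded B \<Longrightarrow> {\<nu> \<in> space M. X \<nu> \<inter> B = {}} \<in> sets M"
  shows "X \<in> measurable M configs"
proof -
  have void': "{\<nu> \<in> space M. X \<nu> \<inter> B = {}} \<in> sets M" if "B \<in> sets borel" for B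
  proof -
    have "x \<in> ball 0 (real (nat \<lceil>norm x\<rceil> + 1))" for x :: 'a
      by (simp; linarith)
    then have "\<exists>k::nat. x \<in> ball 0 (real k)" for x :: 'a by blast
    then have "{\<nu> \<in> space M. X \<nu> \<inter> B = {}} =
        {\<nu> \<in> space M. \<forall>k::nat. X \<nu> \<inter> (B \<inter> ball 0 (real k)) = {}}"
      by (auto; blast)
    also have "... \<in> sets M"
      using that by (intro sets.sets_Collect_countable_All void) auto
    finally show ?thesis .
  qed
  have cnt: "(\<lambda>\<nu>. count_in B (X \<nu>)) \<in> borel_measurable M" if B: "B \<in> sets borel" for B
  proof -
    have [measurable]: "(\<lambda>\<nu>. indicator {i. X \<nu> \<inter> (B \<inter> cell n -` {i}) \<noteq> {}} i :: ennreal) \<in> borel_measurable M"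
      for n and i :: nat
    proof -
      have "B \<inter> cell n -` {i} \<in> sets borel"
        using B measurable_sets_borel[OF cell_measurable, of "{i}"] by auto
      then have "{\<nu> \<in> space M. X \<nu> \<inter> (B \<inter> cell n -` {i}) = {}} \<in> sets M" by (rule void')
      then have "(\<lambda>\<nu>. of_bool (X \<nu> \<inter> (B \<inter> cell n -` {i}) \<noteq> {}) :: ennreal) \<in> borel_measurable M"
        by measurable
      then show ?thesis by (simp add: indicator_def of_bool_def)
    qed
    show ?thesis unfolding count_in_eq_SUP by measurable
  qed
  show ?thesis unfolding configs_def
  proof (rule measurable_measure_of)
    fix y :: "'a set set"
    assume "y \<in> {count_in B -` A \<inter> {S. locally_finite S} |B A. B \<in> sets borel \<and> A \<in> sets borel}"
    then obtain B A where y: "y = count_in B -` A \<inter> {S. locally_finite S}" "B \<in> sets borel" "A \<in> sets borel"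
      by auto
    have "X -` y \<inter> space M = (\<lambda>\<nu>. count_in B (X \<nu>)) -` A \<inter> space M"
      using lf y by auto
    then show "X -` y \<inter> space M \<in> sets M"
      using measurable_sets[OF cnt[OF y(2)] y(3)] by simp
  qed (use lf in auto)
qed

section \<open>The law of a random set and its void probabilities\<close>

lemma locally_finite_subset: "locally_finite T \<Longrightarrow> S \<subseteq> T \<Longrightarrow> locally_finite S"
  unfolding locally_finite_def by (meson Int_mono finite_subset order_refl)

lemma locally_finite_Un: "locally_finite T \<Longrightarrow> locally_finite S \<Longrightarrow> locally_finite (S \<union> T)"
  unfolding locally_finite_def by (simp add: Int_Un_distrib2)

lemma configs_restrict_measurable [measurable]:
  assumes "B \<in> sets borel" shows "(\<lambda>S. S \<inter> B) \<in> measurable configs configs"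
proof (rule measurable_configsI)
  fix C :: "'a set" assume "C \<in> sets borel"
  then have "{S \<in> space configs. S \<inter> (B \<inter> C) = {}} \<in> sets configs" using assms by simp
  then show "{S \<in> space configs. S \<inter> B \<inter> C = {}} \<in> sets configs" by (simp add: Int_assoc)
qed (auto simp: space_configs intro: locally_finite_subset)

definition void_event :: "'a::euclidean_space set \<Rightarrow> 'a set set" where
  "void_event B = {S. locally_finite S \<and> S \<inter> B = {}}"

abbreviation bounded_void_events :: "'a::euclidean_space set set set" where
  "bounded_void_events \<equiv> {void_event B | B. B \<in> sets borel \<and> bounded B}"

lemma void_event_sets: "B \<in> sets borel \<Longrightarrow> void_event B \<in> sets configs"
  using void_in_configs[of B] by (simp add: void_event_def space_configs)

lemma void_event_Int: "void_event B \<inter> void_event C = void_event (B \<union> C)"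
  by (auto simp: void_event_def)

lemma sets_configs:
  "sets (configs :: 'a::euclidean_space set measure) = sigma_sets (space configs) bounded_void_events"
proof
  let ?N = "sigma (space (configs :: 'a set measure)) bounded_void_events"
  have sub: "bounded_void_events \<subseteq> Pow (space (configs :: 'a set measure))"
    by (auto simp: space_configs void_event_def)
  have m: "(\<lambda>S. S) \<in> measurable ?N configs"
  proof (rule measurable_configsI)
    fix B :: "'a set" assume "B \<in> sets borel" "bounded B"
    moreover have "{S \<in> space ?N. S \<inter> B = {}} = void_event B"
      unfolding space_measure_of[OF sub] by (auto simp: space_configs void_event_def)
    ultimately show "{S \<in> space ?N. S \<inter> B = {}} \<in> sets ?N"
      unfolding sets_measure_of[OF sub] by auto
  qed (simp only: space_measure_of[OF sub], simp add: space_configs)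
  show "sets configs \<subseteq> sigma_sets (space (configs :: 'a set measure)) bounded_void_events"
  proof
    fix A :: "'a set set" assume A: "A \<in> sets configs"
    then have "A \<subseteq> space configs" by (rule sets.sets_into_space)
    then have "(\<lambda>S. S) -` A \<inter> space ?N = A" by (auto simp: space_measure_of[OF sub])
    then show "A \<in> sigma_sets (space configs) bounded_void_events"
      using measurable_sets[OF m A] by (simp add: sets_measure_of[OF sub])
  qed
  show "sigma_sets (space configs) bounded_void_events \<subseteq> sets (configs :: 'a set measure)"
    by (rule sets.sigma_sets_subset) (auto intro: void_event_sets)
qed

lemma Int_stable_bounded_void_events: "Int_stable bounded_void_events"
proof (rule Int_stableI)
  fix a b :: "'a set set" assume "a \<in> bounded_void_events" "b \<in> bounded_void_events"
  then show "a \<inter> b \<in> bounded_void_events"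
    by (auto simp: void_event_Int) (metis bounded_Un sets.Un)
qed

lemma configs_law_eqI:
  fixes P Q :: "'a::euclidean_space set measure"
  assumes s: "sets P = sets configs" "sets Q = sets configs" and P: "finite_measure P"
    and eq: "\<And>B. B \<in> sets borel \<Longrightarrow> bounded B \<Longrightarrow> emeasure P (void_event B) = emeasure Q (void_event B)"
  shows "P = Q"
proof (rule measure_eqI_generator_eq[where \<Omega>="space configs" and E=bounded_void_events and A="\<lambda>_. space configs"])
  show "Int_stable (bounded_void_events :: 'a set set set)" by (rule Int_stable_bounded_void_events)
  show "range (\<lambda>_. space configs) \<subseteq> (bounded_void_events :: 'a set set set)"
    by (auto simp: space_configs void_event_def intro!: exI[of _ "{}"])
  show "emeasure P (space configs) \<noteq> \<infinity>" for i :: nat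
    using finite_measure.emeasure_finite[OF P] by simp
qed (use eq in \<open>auto simp: s sets_configs void_event_def space_configs\<close>)

text \<open>By Renyi's theorem, proved as \<open>poisson_process_iff_void\<close>, this already characterises the Poisson process; so no joint law of counts
  has to be computed for the sets that are constructed later.\<close>

definition poisson_void :: "real \<Rightarrow> 'w measure \<Rightarrow> ('w \<Rightarrow> 'a::euclidean_space set) \<Rightarrow> bool" where
  "poisson_void l M X \<longleftrightarrow> prob_space M \<and> X \<in> measurable M configs \<and>
     (\<forall>B \<in> sets borel. bounded B \<longrightarrow>
        measure M {\<nu> \<in> space M. X \<nu> \<inter> B = {}} = exp (- (l * vol B)))"

lemma poisson_voidD:
  "poisson_void l M X \<Longrightarrow> B \<in> sets borel \<Longrightarrow> bounded B \<Longrightarrow>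
    measure M {\<nu> \<in> space M. X \<nu> \<inter> B = {}} = exp (- (l * vol B))"
  by (auto simp: poisson_void_def)

lemma poisson_void_law_unique:
  fixes X :: "'v \<Rightarrow> 'a::euclidean_space set" and Y :: "'w \<Rightarrow> 'a set"
  assumes X: "poisson_void l M X" and Y: "poisson_void l N Y"
  shows "distr M configs X = distr N configs Y"
proof (rule configs_law_eqI)
  interpret M: prob_space M using X by (simp add: poisson_void_def)
  interpret N: prob_space N using Y by (simp add: poisson_void_def)
  have Xm [measurable]: "X \<in> measurable M configs" and Ym [measurable]: "Y \<in> measurable N configs"
    using X Y by (auto simp: poisson_void_def)
  interpret D: prob_space "distr M configs X" by (rule M.prob_space_distr) simp
  show "finite_measure (distr M configs X)" by (rule D.finite_measure_axioms)
  fix B :: "'a set" assume B: "B \<in> sets borel" "bounded B"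
  have "X -` void_event B \<inter> space M = {\<nu> \<in> space M. X \<nu> \<inter> B = {}}"
    "Y -` void_event B \<inter> space N = {\<nu> \<in> space N. Y \<nu> \<inter> B = {}}"
    using measurable_space[OF Xm] measurable_space[OF Ym] by (auto simp: void_event_def space_configs)
  then show "emeasure (distr M configs X) (void_event B) = emeasure (distr N configs Y) (void_event B)"
    using X Y B by (simp add: emeasure_distr void_event_sets M.emeasure_eq_measure N.emeasure_eq_measure poisson_void_def)
qed simp_all

lemma emeasure_bounded_finite: "bounded B \<Longrightarrow> emeasure lborel B < \<infinity>"
  by (metis emeasure_bounded_finite)

lemma poisson_process_void_prob:
  assumes "poisson_process l M X" "B \<in> sets borel" "emeasure lborel B < \<infinity>"
  shows "measure M {\<nu> \<in> space M. X \<nu> \<inter> B = {}} = exp (- (l * vol B))"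
proof -
  have "measure M {\<nu> \<in> space M. count_in B (X \<nu>) = of_nat 0} =
           (l * vol B) ^ 0 / fact 0 * exp (- (l * vol B))"
    using assms unfolding poisson_process_def by blast
  then show ?thesis by (simp add: count_in_0_iff)
qed

lemma poisson_process_imp_void:
  assumes "poisson_process l M X" shows "poisson_void l M X"
  unfolding poisson_void_def
proof (intro conjI ballI impI)
  show "prob_space M" "X \<in> measurable M configs" using assms by (auto simp: poisson_process_def)
qed (intro poisson_process_void_prob[OF assms] emeasure_bounded_finite; simp)

text \<open>The void probability of a disjoint union factors, and the void events determine the joint law.\<close>

lemma poisson_void_indep:
  fixes X :: "'w \<Rightarrow> 'a::euclidean_space set"
  assumes X: "poisson_void l M X" and B: "\<And>i. i \<in> I \<Longrightarrow> B i \<in> sets borel"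
    and disj: "disjoint_family_on B I"
  shows "prob_space.indep_vars M (\<lambda>_. configs) (\<lambda>i \<nu>. X \<nu> \<inter> B i) I"
proof -
  interpret prob_space M using X by (simp add: poisson_void_def)
  have Xm [measurable]: "X \<in> measurable M configs" using X by (auto simp: poisson_void_def)
  define G where "G i = {{\<nu> \<in> space M. X \<nu> \<inter> C = {}} | C. C \<in> sets borel \<and> bounded C \<and> C \<subseteq> B i}" for i
  have Gsub: "G i \<subseteq> Pow (space M)" for i by (auto simp: G_def)
  have "indep_sets G I"
  proof (rule indep_setsI)
    show "G i \<subseteq> events" for i by (auto simp: G_def intro!: void_measurable)
    fix A J assume J: "J \<noteq> {}" "J \<subseteq> I" "finite J" and A: "\<forall>j\<in>J. A j \<in> G j"
    from A have "\<forall>j\<in>J. \<exists>C. A j = {\<nu> \<in> space M. X \<nu> \<inter> C = {}} \<and> C \<in> sets borel \<and> bounded C \<and> C \<subseteq> B j"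
      by (auto simp: G_def)
    then obtain C where C: "\<And>j. j \<in> J \<Longrightarrow> A j = {\<nu> \<in> space M. X \<nu> \<inter> C j = {}}"
        "\<And>j. j \<in> J \<Longrightarrow> C j \<in> sets borel" "\<And>j. j \<in> J \<Longrightarrow> bounded (C j)" "\<And>j. j \<in> J \<Longrightarrow> C j \<subseteq> B j"
      by (auto simp: bchoice_iff)
    have "(\<Inter>j\<in>J. A j) = {\<nu> \<in> space M. X \<nu> \<inter> (\<Union>j\<in>J. C j) = {}}"
      using J C(1) by auto
    then have "prob (\<Inter>j\<in>J. A j) = exp (- (l * vol (\<Union>j\<in>J. C j)))"
      using X J C by (subst poisson_voidD[OF X, symmetric]) (auto intro!: sets.finite_UN)
    also have "vol (\<Union>j\<in>J. C j) = (\<Sum>j\<in>J. vol (C j))"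
    proof (rule measure_finite_Union)
      show "disjoint_family_on C J" unfolding disjoint_family_on_def
      proof (intro ballI impI)
        fix m n assume mn: "m \<in> J" "n \<in> J" "m \<noteq> n"
        then have "B m \<inter> B n = {}" using disj J(2) by (auto simp: disjoint_family_on_def)
        then show "C m \<inter> C n = {}" using C(4)[OF mn(1)] C(4)[OF mn(2)] by blast
      qed
      show "emeasure lborel (C j) \<noteq> \<infinity>" if "j \<in> J" for j
        using emeasure_bounded_finite[OF C(3)[OF that]] by simp
    qed (use J C in auto)
    also have "exp (- (l * (\<Sum>j\<in>J. vol (C j)))) = (\<Prod>j\<in>J. exp (- (l * vol (C j))))"
      using exp_sum[OF J(3), of "\<lambda>j. - (l * vol (C j))"] by (simp add: sum_distrib_left sum_negf)
    also have "... = (\<Prod>j\<in>J. prob (A j))"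
      using X C by (intro prod.cong) (auto simp: poisson_void_def)
    finally show "prob (\<Inter>j\<in>J. A j) = (\<Prod>j\<in>J. prob (A j))" .
  qed
  moreover have "Int_stable (G i)" for i
  proof (rule Int_stableI)
    fix a b assume "a \<in> G i" "b \<in> G i"
    then obtain C D where "a = {\<nu> \<in> space M. X \<nu> \<inter> C = {}}" "b = {\<nu> \<in> space M. X \<nu> \<inter> D = {}}"
      "C \<in> sets borel" "D \<in> sets borel" "bounded C" "bounded D" "C \<subseteq> B i" "D \<subseteq> B i" by (auto simp: G_def)
    then show "a \<inter> b \<in> G i" unfolding G_def by (auto intro!: exI[of _ "C \<union> D"])
  qed
  ultimately have ind: "indep_sets (\<lambda>i. sigma_sets (space M) (G i)) I" by (rule indep_sets_sigma)
  show ?thesis unfolding indep_vars_def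
  proof (intro conjI ballI)
    show "(\<lambda>\<nu>. X \<nu> \<inter> B i) \<in> measurable M configs" if "i \<in> I" for i
      using measurable_compose[OF Xm configs_restrict_measurable[OF B[OF that]]] .
    show "indep_sets (\<lambda>i. sigma_sets (space M) {(\<lambda>\<nu>. X \<nu> \<inter> B i) -` A \<inter> space M |A. A \<in> sets configs}) I"
    proof (rule indep_sets_mono_sets[OF ind])
      fix i assume i: "i \<in> I"
      let ?N = "sigma (space M) (G i)"
      have m: "(\<lambda>\<nu>. X \<nu> \<inter> B i) \<in> measurable ?N configs"
      proof (rule measurable_configsI)
        show "locally_finite (X \<nu> \<inter> B i)" if "\<nu> \<in> space ?N" for \<nu>
          using that measurable_space[OF Xm, of \<nu>]
          by (auto simp: space_measure_of[OF Gsub] space_configs intro: locally_finite_subset)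
        fix C :: "'a set" assume C: "C \<in> sets borel" "bounded C"
        have "{\<nu> \<in> space M. X \<nu> \<inter> (B i \<inter> C) = {}} \<in> G i"
          unfolding G_def using C B[OF i] by (auto intro!: exI[of _ "B i \<inter> C"] bounded_Int)
        then show "{\<nu> \<in> space ?N. X \<nu> \<inter> B i \<inter> C = {}} \<in> sets ?N"
          by (auto simp: space_measure_of[OF Gsub] sets_measure_of[OF Gsub] Int_assoc)
      qed
      have "{(\<lambda>\<nu>. X \<nu> \<inter> B i) -` A \<inter> space M |A. A \<in> sets configs} \<subseteq> sigma_sets (space M) (G i)"
        using measurable_sets[OF m] by (auto simp: space_measure_of[OF Gsub] sets_measure_of[OF Gsub])
      then show "sigma_sets (space M) {(\<lambda>\<nu>. X \<nu> \<inter> B i) -` A \<inter> space M |A. A \<in> sets configs}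
          \<subseteq> sigma_sets (space M) (G i)"
        by (rule sigma_sets_mono)
    qed
  qed
qed

section \<open>Counts from void probabilities\<close>

text \<open>This identifies the law of a count from its generating function on an interval.\<close>

lemma power_series_zero_coeffs:
  fixes a :: "nat \<Rightarrow> real"
  assumes sa: "summable (\<lambda>k. \<bar>a k\<bar>)"
    and z: "\<And>t. 0 < t \<Longrightarrow> t < 1 \<Longrightarrow> (\<Sum>k. a k * t^k) = 0"
  shows "a k = 0"
proof (induction k rule: less_induct)
  case (less k)
  define A where "A = (\<Sum>j. \<bar>a j\<bar>)"
  have bound: "\<bar>a k\<bar> \<le> t * A" if t: "0 < t" "t < 1" for t
  proof -
    have s: "summable (\<lambda>j. a j * t^j)"
    proof (rule summable_comparison_test'[OF sa, of 0])
      show "norm (a n * t ^ n) \<le> \<bar>a n\<bar>" for n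
        using t by (simp add: abs_mult power_le_one mult_left_le)
    qed
    have s': "summable (\<lambda>j. a (j + Suc k) * t^(j + Suc k))" using summable_ignore_initial_segment[OF s] .
    have "0 = (\<Sum>j. a (j + Suc k) * t^(j + Suc k)) + (\<Sum>j<Suc k. a j * t^j)"
      using z[OF t] suminf_split_initial_segment[OF s, of "Suc k"] by simp
    also have "(\<Sum>j<Suc k. a j * t^j) = a k * t^k" using less by simp
    finally have "a k * t^k = - (\<Sum>j. a (j + Suc k) * t^(j + Suc k))" by simp
    then have "\<bar>a k\<bar> * t^k = \<bar>\<Sum>j. a (j + Suc k) * t^(j + Suc k)\<bar>"
      using t by (metis abs_minus_cancel abs_mult abs_of_pos zero_less_power)
    also have "... \<le> (\<Sum>j. t^Suc k * \<bar>a (j + Suc k)\<bar>)"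
    proof -
      have le: "\<bar>a (j + Suc k) * t^(j + Suc k)\<bar> \<le> t^Suc k * \<bar>a (j + Suc k)\<bar>" for j
      proof -
        have "t^(j + Suc k) \<le> t^Suc k" using t by (intro power_decreasing) auto
        then have "\<bar>a (j + Suc k)\<bar> * t^(j + Suc k) \<le> \<bar>a (j + Suc k)\<bar> * t^Suc k"
          by (rule mult_left_mono) simp
        then show ?thesis using t by (simp add: abs_mult mult.commute)
      qed
      have sR: "summable (\<lambda>j. t^Suc k * \<bar>a (j + Suc k)\<bar>)"
        using summable_ignore_initial_segment[OF sa] by (intro summable_mult)
      have sL: "summable (\<lambda>j. \<bar>a (j + Suc k) * t^(j + Suc k)\<bar>)"
        by (rule summable_comparison_test'[OF sR, of 0]) (use le in auto)
      have "\<bar>\<Sum>j. a (j + Suc k) * t^(j + Suc k)\<bar> \<le> (\<Sum>j. \<bar>a (j + Suc k) * t^(j + Suc k)\<bar>)"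
        by (rule summable_rabs[OF sL])
      also have "... \<le> (\<Sum>j. t^Suc k * \<bar>a (j + Suc k)\<bar>)" by (rule suminf_le[OF le sL sR])
      finally show ?thesis .
    qed
    also have "... = t^Suc k * (\<Sum>j. \<bar>a (j + Suc k)\<bar>)"
      using summable_ignore_initial_segment[OF sa] by (intro suminf_mult)
    also have "... \<le> t^Suc k * A"
    proof (intro mult_left_mono)
      show "(\<Sum>j. \<bar>a (j + Suc k)\<bar>) \<le> A"
        using suminf_split_initial_segment[OF sa, of "Suc k"] by (simp add: A_def sum_nonneg)
    qed (use t in auto)
    finally have "\<bar>a k\<bar> * t^k \<le> (t * A) * t^k" by (simp add: mult_ac)
    then show ?thesis using t by simp
  qed
  have "((\<lambda>t. t * A) \<longlongrightarrow> 0 * A) (at_right 0)" by (intro tendsto_intros)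
  moreover have "\<forall>\<^sub>F t in at_right 0. \<bar>a k\<bar> \<le> t * A"
    using bound by (auto simp: eventually_at_right_field intro!: exI[of _ 1])
  ultimately have "\<bar>a k\<bar> \<le> 0 * A" by (rule tendsto_lowerbound) simp
  then show ?case by simp
qed

lemma cell_volume_le:
  shows "vol (cell n -` {i} :: 'a::euclidean_space set) \<le> 1 / 2^n" "emeasure lborel (cell n -` {i} :: 'a set) < \<infinity>"
proof -
  have sub: "\<exists>y::'a. (cell n -` {i} :: 'a set) \<subseteq> cbox y (y + (1/2^n) *\<^sub>R One)"
  proof (cases "cell n -` {i} = ({} :: 'a set)")
    case False
    then obtain x :: 'a where x: "cell n x = i" by auto
    have "(cell n -` {i} :: 'a set) \<subseteq> cbox ((1/2^n) *\<^sub>R grid n x) ((1/2^n) *\<^sub>R grid n x + (1/2^n) *\<^sub>R One)"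
    proof
      fix y :: 'a assume "y \<in> cell n -` {i}"
      then have g: "grid n y = grid n x" using x by (simp flip: cell_eq_iff)
      have "grid n x \<bullet> b \<le> 2^n * (y \<bullet> b)" "2^n * (y \<bullet> b) \<le> grid n x \<bullet> b + 1" if "b \<in> Basis" for b
        using that unfolding g[symmetric] grid_inner[OF that] by linarith+
      then show "y \<in> cbox ((1/2^n) *\<^sub>R grid n x) ((1/2^n) *\<^sub>R grid n x + (1/2^n) *\<^sub>R One)"
        by (auto simp: mem_box inner_add_left field_simps)
    qed
    then show ?thesis by blast
  qed auto
  then obtain y where y: "(cell n -` {i} :: 'a set) \<subseteq> cbox y (y + (1/2^n) *\<^sub>R One)" by blast
  have m: "vol (cbox y (y + (1/2^n) *\<^sub>R One)) = (1/2^n) ^ DIM('a)"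
    by (subst measure_lborel_cbox) (auto simp: inner_add_left)
  have "vol (cell n -` {i} :: 'a set) \<le> vol (cbox y (y + (1/2^n) *\<^sub>R One))"
    by (rule measure_mono_fmeasurable[OF y]) (auto intro!: measurable_sets_borel[OF cell_measurable])
  also have "... \<le> 1/2^n" unfolding m using power_decreasing[of 1 "DIM('a)" "1/2^n::real"] by simp
  finally show "vol (cell n -` {i} :: 'a set) \<le> 1 / 2^n" .
  show "emeasure lborel (cell n -` {i} :: 'a set) < \<infinity>"
    using y by (intro emeasure_bounded_finite) (rule bounded_subset[OF bounded_cbox])
qed

text \<open>The generating function of a void indicator against that of a Poisson variable.\<close>

lemma bernoulli_poisson_gf_bounds:
  fixes m t :: real assumes "0 \<le> m" "0 \<le> t" "t \<le> 1"
  shows "exp (- ((1-t) * m)) \<le> t + (1-t) * exp (-m)"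
    and "t + (1-t) * exp (-m) \<le> exp (- ((1-t) * m) + m^2/2)"
proof -
  show "exp (- ((1-t) * m)) \<le> t + (1-t) * exp (-m)"
    using convex_onD[OF exp_convex, of "1-t" 0 "-m"] assms by (simp add: mult.commute)
  have q: "1 + m + m^2/2 \<le> exp m" using assms by (intro exp_lower_Taylor_quadratic)
  have "(1 - m + m^2/2) * (1 + m + m^2/2) = 1 + (m^2)^2 / 4"
    by (simp add: field_simps power2_eq_square)
  then have "1 \<le> (1 - m + m^2/2) * (1 + m + m^2/2)" by simp
  also have "... \<le> (1 - m + m^2/2) * exp m"
  proof (rule mult_left_mono[OF q])
    have "0 \<le> (m - 1)^2 + 1" by simp
    then show "0 \<le> 1 - m + m^2/2" by (simp add: power2_eq_square algebra_simps)
  qed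
  finally have e: "exp (-m) \<le> 1 - m + m^2/2" by (simp add: exp_minus field_simps)
  have "t + (1-t) * exp (-m) \<le> t + (1-t) * (1 - m + m^2/2)"
    using e assms by (intro add_left_mono mult_left_mono) auto
  also have "... = 1 + (- ((1-t) * m) + (1-t) * (m^2/2))" by (simp add: algebra_simps)
  also have "... \<le> 1 + (- ((1-t) * m) + m^2/2)"
    using assms by (simp add: mult_left_le_one_le)
  also have "... \<le> exp (- ((1-t) * m) + m^2/2)" by (rule exp_ge_add_one_self)
  finally show "t + (1-t) * exp (-m) \<le> exp (- ((1-t) * m) + m^2/2)" .
qed

lemma count_in_measurable_comp:
  "X \<in> measurable M configs \<Longrightarrow> B \<in> sets borel \<Longrightarrow> (\<lambda>\<nu>. count_in B (X \<nu>)) \<in> borel_measurable M"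
  using measurable_compose[OF _ measurable_count_in] .

lemma count_in_finite:
  "S \<in> space configs \<Longrightarrow> bounded B \<Longrightarrow> count_in B S = of_nat (card (S \<inter> B))"
  by (auto simp: count_in_def space_configs locally_finite_def emeasure_count_space)

text \<open>Cells of mesh \<open>1/2^n\<close> are occupied independently, so the number of occupied cells has an
  explicit generating function; it tends to that of the Poisson distribution.\<close>

lemma poisson_void_gf:
  fixes X :: "'w \<Rightarrow> 'a::euclidean_space set"
  assumes X: "poisson_void l M X" and l: "0 \<le> l" and B: "B \<in> sets borel" "bounded B"
    and t: "0 \<le> t" "t \<le> 1"
  shows "(\<integral>\<nu>. t ^ card (X \<nu> \<inter> B) \<partial>M) = exp (- ((1-t) * (l * vol B)))"
proof -
  interpret prob_space M using X by (simp add: poisson_void_def)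
  have Xm [measurable]: "X \<in> measurable M configs" using X by (auto simp: poisson_void_def)
  define \<mu> where "\<mu> = l * vol B"
  define C where "C n i = B \<inter> cell n -` {i}" for n i
  have C_sets [measurable]: "C n i \<in> sets borel" and C_bdd: "bounded (C n i)" for n i
    using B measurable_sets_borel[OF cell_measurable, of "{i}"] by (auto simp: C_def)
  define m where "m n i = l * vol (C n i)" for n i
  have m0: "0 \<le> m n i" for n i using l by (simp add: m_def)
  define I where "I n = cell n ` B" for n
  have fin: "finite (I n)" for n using finite_cell_bounded[OF B(2)] by (simp add: I_def)
  have disj: "disjoint_family_on (C n) (I n)" for n by (auto simp: disjoint_family_on_def C_def)
  have sum_m: "(\<Sum>i\<in>I n. m n i) = \<mu>" for n
  proof -
    have "B = (\<Union>i\<in>I n. C n i)" by (auto simp: I_def C_def)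
    then have "vol B = vol (\<Union>i\<in>I n. C n i)" by simp
    also have "... = (\<Sum>i\<in>I n. vol (C n i))"
    proof (rule measure_finite_Union[OF fin _ disj])
      show "emeasure lborel (C n i) \<noteq> \<infinity>" for i using emeasure_bounded_finite[OF C_bdd[of n i]] by simp
    qed auto
    finally show ?thesis by (simp add: \<mu>_def m_def sum_distrib_left)
  qed
  have mb: "m n i \<le> l / 2^n" for n i
  proof -
    have "vol (C n i) \<le> vol (cell n -` {i} :: 'a set)"
    proof (rule measure_mono_fmeasurable)
      show "(cell n -` {i} :: 'a set) \<in> fmeasurable lborel"
        unfolding fmeasurable_def using cell_volume_le(2) measurable_sets_borel[OF cell_measurable, of "{i}"] by auto
    qed (use C_sets[of n i] in \<open>auto simp: C_def\<close>)
    also have "... \<le> 1/2^n" by (rule cell_volume_le)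
    finally show ?thesis using mult_left_mono[OF _ l] by (fastforce simp: m_def)
  qed
  define N where "N n \<nu> = card (cell n ` (X \<nu> \<inter> B))" for n \<nu>
  define \<xi> where "\<xi> n i \<nu> = (if X \<nu> \<inter> C n i = {} then 1 else t)" for n i \<nu>
  have \<xi>m [measurable]: "\<xi> n i \<in> borel_measurable M" for n i
    unfolding \<xi>_def using void_measurable[OF Xm C_sets] by measurable
  have prod_\<xi>: "t ^ N n \<nu> = (\<Prod>i\<in>I n. \<xi> n i \<nu>)" for n \<nu>
  proof -
    have "cell n ` (X \<nu> \<inter> B) = {i \<in> I n. X \<nu> \<inter> C n i \<noteq> {}}" unfolding I_def C_def by (intro set_eqI iffI) (auto simp: image_iff, metis IntI)
    then have "t ^ N n \<nu> = (\<Prod>i\<in>{i \<in> I n. X \<nu> \<inter> C n i \<noteq> {}}. t)" by (simp add: N_def)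
    also have "... = (\<Prod>i\<in>I n. if X \<nu> \<inter> C n i \<noteq> {} then t else 1)"
      by (rule prod.inter_filter[OF fin])
    finally show ?thesis by (simp add: \<xi>_def if_distrib cong: if_cong)
       (auto intro!: prod.cong simp: if_distrib)
  qed
  have E\<xi>: "(\<integral>\<nu>. \<xi> n i \<nu> \<partial>M) = t + (1-t) * exp (- m n i)" for n i
  proof -
    have "(\<integral>\<nu>. \<xi> n i \<nu> \<partial>M) = (\<integral>\<nu>. t + (1-t) * indicator {\<nu> \<in> space M. X \<nu> \<inter> C n i = {}} \<nu> \<partial>M)"
      by (intro Bochner_Integration.integral_cong) (auto simp: \<xi>_def)
    also have "... = t + (1-t) * prob {\<nu> \<in> space M. X \<nu> \<inter> C n i = {}}"
    proof -
      have "integrable M (indicator {\<nu> \<in> space M. X \<nu> \<inter> C n i = {}} :: _ \<Rightarrow> real)"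
        using void_measurable[OF Xm C_sets] by (intro integrable_real_indicator) (auto simp: less_top[symmetric])
      then show ?thesis by (simp add: prob_space)
    qed
    finally show ?thesis using poisson_voidD[OF X C_sets C_bdd] by (simp add: m_def)
  qed
  have EN: "(\<integral>\<nu>. t ^ N n \<nu> \<partial>M) = (\<Prod>i\<in>I n. t + (1-t) * exp (- m n i))" for n
  proof -
    have "indep_vars (\<lambda>_. configs) (\<lambda>i \<nu>. X \<nu> \<inter> C n i) (I n)"
      by (rule poisson_void_indep[OF X _ disj]) simp
    then have "indep_vars (\<lambda>_. borel) (\<lambda>i \<nu>. (\<lambda>S. if S \<inter> UNIV = {} then 1 else t) (X \<nu> \<inter> C n i)) (I n)"
    proof (rule indep_vars_compose2)
      have [measurable]: "{S \<in> space configs. S \<inter> (UNIV::'a set) = {}} \<in> sets configs" by measurable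
      show "(\<lambda>S::'a set. if S \<inter> UNIV = {} then 1 else t) \<in> borel_measurable configs" by measurable
    qed
    then have "indep_vars (\<lambda>_. borel) (\<xi> n) (I n)" by (simp add: \<xi>_def[abs_def])
    moreover have "integrable M (\<xi> n i)" for i
    proof (rule integrable_const_bound[of _ 1])
      show "AE \<nu> in M. norm (\<xi> n i \<nu>) \<le> 1" using t by (simp add: \<xi>_def)
    qed (rule \<xi>m)
    ultimately have "(\<integral>\<nu>. (\<Prod>i\<in>I n. \<xi> n i \<nu>) \<partial>M) = (\<Prod>i\<in>I n. \<integral>\<nu>. \<xi> n i \<nu> \<partial>M)"
      by (intro indep_vars_lebesgue_integral fin)
    then show ?thesis by (simp add: prod_\<xi> E\<xi>)
  qed
  have lower: "exp (- ((1-t) * \<mu>)) \<le> (\<integral>\<nu>. t ^ N n \<nu> \<partial>M)" for n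
  proof -
    have "exp (- ((1-t) * \<mu>)) = (\<Prod>i\<in>I n. exp (- ((1-t) * m n i)))"
      using exp_sum[OF fin, of "\<lambda>i. - ((1-t) * m n i)" n] sum_m[of n]
      by (simp add: sum_negf flip: sum_distrib_left)
    also have "... \<le> (\<Prod>i\<in>I n. t + (1-t) * exp (- m n i))"
      using bernoulli_poisson_gf_bounds(1)[OF m0 t] by (intro prod_mono) auto
    finally show ?thesis by (simp add: EN)
  qed
  have upper: "(\<integral>\<nu>. t ^ N n \<nu> \<partial>M) \<le> exp (- ((1-t) * \<mu>) + l * \<mu> / 2 * (1/2)^n)" for n
  proof -
    have "(\<integral>\<nu>. t ^ N n \<nu> \<partial>M) \<le> (\<Prod>i\<in>I n. exp (- ((1-t) * m n i) + (m n i)^2/2))"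
      unfolding EN using bernoulli_poisson_gf_bounds(2)[OF m0 t] t by (intro prod_mono) auto
    also have "... = exp (- ((1-t) * \<mu>) + (\<Sum>i\<in>I n. (m n i)^2/2))"
      using sum_m[of n] by (simp add: exp_sum[OF fin, symmetric] sum_subtractf flip: sum_distrib_left)
    also have "(\<Sum>i\<in>I n. (m n i)^2/2) \<le> (\<Sum>i\<in>I n. (l/2^n) * m n i / 2)"
      using mult_right_mono[OF mb m0] by (intro sum_mono) (simp add: power2_eq_square)
    also have "... = (l/2^n) * \<mu> / 2" using sum_m[of n] by (simp flip: sum_distrib_left sum_divide_distrib)
    finally show ?thesis by (simp add: power_one_over field_simps)
  qed
  have lim1: "(\<lambda>n. \<integral>\<nu>. t ^ N n \<nu> \<partial>M) \<longlonglongrightarrow> exp (- ((1-t) * \<mu>))"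
  proof (rule tendsto_sandwich[OF always_eventually always_eventually tendsto_const])
    have "(\<lambda>n. exp (- ((1-t) * \<mu>) + l * \<mu> / 2 * (1/2)^n)) \<longlonglongrightarrow> exp (- ((1-t) * \<mu>) + l * \<mu> / 2 * 0)"
      by (intro tendsto_intros LIMSEQ_power_zero) simp
    then show "(\<lambda>n. exp (- ((1-t) * \<mu>) + l * \<mu> / 2 * (1/2)^n)) \<longlonglongrightarrow> exp (- ((1-t) * \<mu>))" by simp
  qed (use lower upper in auto)
  have lim2: "(\<lambda>n. \<integral>\<nu>. t ^ N n \<nu> \<partial>M) \<longlonglongrightarrow> (\<integral>\<nu>. t ^ card (X \<nu> \<inter> B) \<partial>M)"
  proof (rule integral_dominated_convergence[where w="\<lambda>_. 1"])
    have ptw: "(\<lambda>n. t ^ N n \<nu>) \<longlonglongrightarrow> t ^ card (X \<nu> \<inter> B)" if "\<nu> \<in> space M" for \<nu>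
    proof -
      have f: "finite (X \<nu> \<inter> B)"
        using measurable_space[OF Xm that] B by (auto simp: space_configs locally_finite_def)
      obtain k where k: "inj_on (cell k) (X \<nu> \<inter> B)" using cell_separates[OF f] .
      have "N n \<nu> = card (X \<nu> \<inter> B)" if "k \<le> n" for n
        unfolding N_def using k grid_antimono[OF that]
        by (intro card_image) (auto simp: inj_on_def cell_eq_iff)
      then show ?thesis
        by (intro tendsto_eventually eventually_sequentiallyI[of k]) simp
    qed
    then show "AE \<nu> in M. (\<lambda>n. t ^ N n \<nu>) \<longlonglongrightarrow> t ^ card (X \<nu> \<inter> B)" by simp
    show "(\<lambda>\<nu>. t ^ N n \<nu>) \<in> borel_measurable M" for n by (simp add: prod_\<xi>)
    show "(\<lambda>\<nu>. t ^ card (X \<nu> \<inter> B)) \<in> borel_measurable M"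
      by (rule borel_measurable_LIMSEQ_real[OF ptw]) (auto simp: prod_\<xi>)
  qed (use t in \<open>auto simp: power_le_one\<close>)
  show ?thesis using LIMSEQ_unique[OF lim2 lim1] by (simp add: \<mu>_def)
qed

lemma poisson_void_count_bounded:
  fixes X :: "'w \<Rightarrow> 'a::euclidean_space set"
  assumes X: "poisson_void l M X" and l: "0 \<le> l" and B: "B \<in> sets borel" "bounded B"
  shows "measure M {\<nu> \<in> space M. count_in B (X \<nu>) = of_nat k} =
    (l * vol B) ^ k / fact k * exp (- (l * vol B))"
proof -
  interpret prob_space M using X by (simp add: poisson_void_def)
  have Xm [measurable]: "X \<in> measurable M configs" using X by (auto simp: poisson_void_def)
  define \<mu> where "\<mu> = l * vol B"
  define E where "E k = {\<nu> \<in> space M. count_in B (X \<nu>) = of_nat k}" for k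
  have cm [measurable]: "(\<lambda>\<nu>. count_in B (X \<nu>)) \<in> borel_measurable M"
    by (rule count_in_measurable_comp[OF Xm B(1)])
  have E_sets [measurable]: "E k \<in> events" for k unfolding E_def by measurable
  have E_iff: "\<nu> \<in> E k \<longleftrightarrow> card (X \<nu> \<inter> B) = k" if "\<nu> \<in> space M" for \<nu> k
    using that count_in_finite[OF measurable_space[OF Xm that] B(2)] by (simp add: E_def)
  define p where "p k = prob (E k)" for k
  have E_disj: "disjoint_family E"
    by (auto simp: disjoint_family_on_def) (metis E_iff E_sets sets.sets_into_space subsetD)
  have sp: "summable p"
  proof -
    have "range E \<subseteq> events" using E_sets by auto
    from finite_measure_UNION[OF this E_disj] show ?thesis by (auto simp: p_def[abs_def] sums_iff)
  qed
  have p0: "0 \<le> p k" for k by (simp add: p_def)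
  define q where "q k = \<mu> ^ k / fact k * exp (-\<mu>)" for k
  have q_sums: "(\<lambda>k. q k * t^k) sums (exp (- ((1-t) * \<mu>)))" for t
  proof -
    have "(\<lambda>k. (\<mu> * t) ^ k /\<^sub>R fact k * exp (-\<mu>)) sums (exp (\<mu> * t) * exp (-\<mu>))"
      by (intro sums_mult2 exp_converges)
    moreover have "exp (\<mu> * t) * exp (-\<mu>) = exp (- ((1-t) * \<mu>))"
      by (simp add: algebra_simps flip: exp_add)
    ultimately show ?thesis by (simp add: q_def power_mult_distrib field_simps)
  qed
  have \<mu>0: "0 \<le> \<mu>" using l by (simp add: \<mu>_def)
  have sq: "summable q" using q_sums[of 1] by (simp add: sums_iff)
  have p_sum: "(\<Sum>k. p k * t^k) = exp (- ((1-t) * \<mu>))" and p_summ: "summable (\<lambda>k. p k * t^k)"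
    if t: "0 < t" "t < 1" for t
  proof -
    show ps: "summable (\<lambda>k. p k * t^k)"
    proof (rule summable_comparison_test'[OF sp, of 0])
      show "norm (p n * t ^ n) \<le> p n" for n
        using t p0[of n] by (simp add: abs_mult power_le_one mult_left_le)
    qed
    have pt: "(\<lambda>k. indicator (E k) \<nu> * t^k) sums (t ^ card (X \<nu> \<inter> B))" if "\<nu> \<in> space M" for \<nu>
    proof -
      have "(\<lambda>k. indicator (E k) \<nu> * t^k) = (\<lambda>k. if k = card (X \<nu> \<inter> B) then t^k else 0)"
        using E_iff[OF that] by (auto simp: fun_eq_iff indicator_def)
      then show ?thesis using sums_single[of "card (X \<nu> \<inter> B)" "\<lambda>k. t^k"] by simp
    qed
    have "exp (- ((1-t) * \<mu>)) = (\<integral>\<nu>. t ^ card (X \<nu> \<inter> B) \<partial>M)"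
      using poisson_void_gf[OF X l B, of t] t by (simp add: \<mu>_def)
    also have "... = (\<integral>\<nu>. (\<Sum>k. indicator (E k) \<nu> * t^k) \<partial>M)"
      using pt by (intro Bochner_Integration.integral_cong) (auto simp: sums_iff)
    also have "... = (\<Sum>k. \<integral>\<nu>. indicator (E k) \<nu> * t^k \<partial>M)"
    proof (rule integral_suminf)
      have "integrable M (indicator (E k) :: _ \<Rightarrow> real)" for k
        by (intro integrable_real_indicator) (auto simp: less_top[symmetric])
      then show "integrable M (\<lambda>\<nu>. indicator (E k) \<nu> * t^k)" for k by simp
      show "AE \<nu> in M. summable (\<lambda>k. norm (indicator (E k) \<nu> * t^k))"
        using pt t by (auto simp: sums_iff abs_mult power_abs)
      show "summable (\<lambda>k. \<integral>\<nu>. norm (indicator (E k) \<nu> * t^k) \<partial>M)"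
        using ps t by (simp add: abs_mult power_abs p_def)
    qed
    also have "... = (\<Sum>k. p k * t^k)" by (simp add: p_def)
    finally show "(\<Sum>k. p k * t^k) = exp (- ((1-t) * \<mu>))" by simp
  qed
  have "p k - q k = 0" for k
  proof (rule power_series_zero_coeffs[of "\<lambda>k. p k - q k"])
    show "summable (\<lambda>k. \<bar>p k - q k\<bar>)"
    proof (rule summable_comparison_test'[of "\<lambda>k. p k + q k" 0])
      show "norm \<bar>p n - q n\<bar> \<le> p n + q n" for n
        using p0[of n] \<mu>0 by (auto simp: q_def abs_le_iff intro: order_trans[of _ 0])
    qed (intro summable_add sp sq)
    show "(\<Sum>k. (p k - q k) * t^k) = 0" if t: "0 < t" "t < 1" for t
      using p_sum[OF t] p_summ[OF t] q_sums[of t] by (simp add: left_diff_distrib sums_iff suminf_diff[symmetric])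
  qed
  then show ?thesis by (simp add: p_def q_def E_def \<mu>_def)
qed

lemma poisson_void_count:
  fixes X :: "'w \<Rightarrow> 'a::euclidean_space set"
  assumes X: "poisson_void l M X" and l: "0 \<le> l" and B: "B \<in> sets borel" "emeasure lborel B < \<infinity>"
  shows "measure M {\<nu> \<in> space M. count_in B (X \<nu>) = of_nat k} =
    (l * vol B) ^ k / fact k * exp (- (l * vol B))"
proof -
  interpret prob_space M using X by (simp add: poisson_void_def)
  have Xm [measurable]: "X \<in> measurable M configs" using X by (auto simp: poisson_void_def)
  define f where "f j \<mu> = \<mu> ^ j / fact j * exp (- \<mu>)" for j and \<mu> :: real
  have cm [measurable]: "(\<lambda>\<nu>. count_in C (X \<nu>)) \<in> borel_measurable M" if "C \<in> sets borel" for C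
    by (rule count_in_measurable_comp[OF Xm that])
  define B' where "B' n = B \<inter> cball 0 (real n)" for n
  have [measurable]: "B' n \<in> sets borel" and B'_bdd: "bounded (B' n)" for n
    using B by (auto simp: B'_def bounded_Int)
  have B'_inc: "incseq B'" by (auto simp: B'_def incseq_def)
  have B'_Un: "(\<Union>n. B' n) = B" using real_arch_simple by (auto simp: B'_def)
  have le: "prob {\<nu> \<in> space M. count_in C (X \<nu>) \<le> of_nat k} = (\<Sum>j\<le>k. prob {\<nu> \<in> space M. count_in C (X \<nu>) = of_nat j})"
    if [measurable]: "C \<in> sets borel" for C k
  proof -
    have "{\<nu> \<in> space M. count_in C (X \<nu>) \<le> of_nat k} = (\<Union>j\<in>{..k}. {\<nu> \<in> space M. count_in C (X \<nu>) = of_nat j})"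
    proof -
      have "c \<le> of_nat k \<longleftrightarrow> (\<exists>j\<le>k. c = of_nat j)" if "c = count_in C S" for c S
        using that by (cases "finite (S \<inter> C)") (auto simp: count_in_def ecard_finite ecard_infinite top_unique)
      then show ?thesis by (auto; blast)
    qed
    moreover have "prob (\<Union>j\<in>{..k}. {\<nu> \<in> space M. count_in C (X \<nu>) = of_nat j}) =
        (\<Sum>j\<le>k. prob {\<nu> \<in> space M. count_in C (X \<nu>) = of_nat j})"
      by (rule finite_measure_finite_Union) (auto simp: disjoint_family_on_def)
    ultimately show ?thesis by simp
  qed
  have cdf: "prob {\<nu> \<in> space M. count_in B (X \<nu>) \<le> of_nat k} = (\<Sum>j\<le>k. f j (l * vol B))" for k
  proof -
    have "count_in B S \<le> of_nat k \<longleftrightarrow> (\<forall>n. count_in (B' n) S \<le> of_nat k)" for S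
    proof -
      have "count_in B S = (SUP n. count_in (B' n) S)"
      proof -
        have "incseq (\<lambda>n. S \<inter> B' n)" using B'_inc unfolding incseq_def by blast
        moreover have "(\<Union>n. S \<inter> B' n) = S \<inter> B" using B'_Un by blast
        ultimately show ?thesis unfolding count_in_def by (subst SUP_emeasure_incseq) auto
      qed
      then show ?thesis by (simp add: SUP_le_iff)
    qed
    then have eq: "{\<nu> \<in> space M. count_in B (X \<nu>) \<le> of_nat k} = (\<Inter>n. {\<nu> \<in> space M. count_in (B' n) (X \<nu>) \<le> of_nat k})"
      by auto
    have "(\<lambda>n. prob {\<nu> \<in> space M. count_in (B' n) (X \<nu>) \<le> of_nat k}) \<longlonglongrightarrow> prob {\<nu> \<in> space M. count_in B (X \<nu>) \<le> of_nat k}"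
      unfolding eq
    proof (rule finite_Lim_measure_decseq)
      have "count_in (B' m) S \<le> count_in (B' n) S" if "m \<le> n" for m n S
        unfolding count_in_def using B'_inc that by (intro ecard_mono) (auto simp: incseq_def)
      then show "decseq (\<lambda>n. {\<nu> \<in> space M. count_in (B' n) (X \<nu>) \<le> of_nat k})"
        by (auto simp: decseq_def intro: order_trans)
    qed auto
    moreover have "prob {\<nu> \<in> space M. count_in (B' n) (X \<nu>) \<le> of_nat k} = (\<Sum>j\<le>k. f j (l * vol (B' n)))" for n
      by (subst le) (simp_all add: poisson_void_count_bounded[OF X l _ B'_bdd] f_def)
    moreover have "(\<lambda>n. \<Sum>j\<le>k. f j (l * vol (B' n))) \<longlonglongrightarrow> (\<Sum>j\<le>k. f j (l * vol B))"
    proof -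
      have "(\<lambda>n. vol (B' n)) \<longlonglongrightarrow> vol (\<Union>n. B' n)"
        using B B'_Un B'_inc by (intro Lim_measure_incseq) auto
      then show ?thesis unfolding f_def B'_Un by (intro tendsto_intros) auto
    qed
    ultimately show ?thesis by (simp add: LIMSEQ_unique)
  qed
  have "prob {\<nu> \<in> space M. count_in B (X \<nu>) = of_nat k} = f k (l * vol B)"
  proof (cases k)
    case 0
    then show ?thesis using cdf[of 0] le[of B 0] B by simp
  next
    case (Suc j)
    then show ?thesis using cdf[of k] cdf[of j] le[of B k] le[of B j] B by simp
  qed
  then show ?thesis by (simp add: f_def)
qed

text \<open>Renyi's theorem for a homogeneous process.\<close>

theorem poisson_process_iff_void:
  fixes X :: "'w \<Rightarrow> 'a::euclidean_space set"
  assumes l: "0 \<le> l"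
  shows "poisson_process l M X \<longleftrightarrow> poisson_void l M X"
proof
  assume X: "poisson_void l M X"
  interpret prob_space M using X by (simp add: poisson_void_def)
  have Xm [measurable]: "X \<in> measurable M configs" using X by (auto simp: poisson_void_def)
  show "poisson_process l M X"
    unfolding poisson_process_def
  proof (intro conjI ballI allI impI)
    fix n :: nat and B :: "nat \<Rightarrow> 'a set"
    assume B: "(\<forall>i<n. B i \<in> sets borel) \<and> disjoint_family_on B {..<n}"
    then have "indep_vars (\<lambda>_. configs) (\<lambda>i \<nu>. X \<nu> \<inter> B i) {..<n}"
      by (intro poisson_void_indep[OF X]) auto
    then have "indep_vars (\<lambda>_. borel) (\<lambda>i \<nu>. count_in UNIV (X \<nu> \<inter> B i)) {..<n}"
      by (rule indep_vars_compose2) (auto intro: measurable_count_in)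
    then show "indep_vars (\<lambda>_. borel) (\<lambda>i \<nu>. count_in (B i) (X \<nu>)) {..<n}"
      by (simp add: count_in_def)
  qed (use prob_space_axioms Xm poisson_void_count[OF X l] in auto)
qed (rule poisson_process_imp_void)

section \<open>Shifts and random points\<close>

lemma measure_lborel_vimage_plus:
  fixes B :: "'a::euclidean_space set"
  assumes "B \<in> sets borel" shows "vol ((\<lambda>x. x + v) -` B) = vol B"
proof -
  have "vol B = measure (distr lborel borel ((+) v)) B" by (simp add: lborel_distr_plus)
  also have "... = vol ((\<lambda>x. x + v) -` B)"
    using assms by (subst measure_distr) (auto simp: add.commute vimage_def)
  finally show ?thesis by simp
qed

lemma bounded_vimage_plus: "bounded B \<Longrightarrow> bounded ((\<lambda>x::'a::euclidean_space. x + v) -` B)"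
proof -
  assume B: "bounded B"
  have "(\<lambda>x. x + v) -` B \<subseteq> (\<lambda>x. (-v) + x) ` B"
  proof
    fix x assume "x \<in> (\<lambda>x. x + v) -` B"
    then show "x \<in> (\<lambda>x. (-v) + x) ` B" by (intro image_eqI[of _ _ "x + v"]) auto
  qed
  then show ?thesis using bounded_translation[OF B, of "-v"] bounded_subset by blast
qed

lemma locally_finite_shift: "locally_finite S \<Longrightarrow> locally_finite (shift v S)"
  unfolding locally_finite_def
proof safe
  fix B :: "'a set" assume *: "\<forall>B. bounded B \<longrightarrow> finite (S \<inter> B)" "bounded B"
  have "shift v S \<inter> B \<subseteq> (\<lambda>s. s + v) ` (S \<inter> (\<lambda>x. x + v) -` B)" by (auto simp: shift_def)
  moreover have "bounded ((\<lambda>x. x + v) -` B)" using *(2) by (rule bounded_vimage_plus)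
  ultimately show "finite (shift v S \<inter> B)" using *(1) by (meson finite_imageI finite_subset)
qed

lemma shift_Int_empty_iff: "shift v S \<inter> B = {} \<longleftrightarrow> S \<inter> (\<lambda>x. x + v) -` B = {}"
  by (auto simp: shift_def)

lemma shift_shift: "shift v (shift w S) = shift (v + w) S"
  by (auto simp: shift_def image_image add_ac)

lemma shift_0 [simp]: "shift 0 S = S"
  by (simp add: shift_def)

lemma vimage_plus_borel [measurable]:
  fixes B :: "'a::euclidean_space set"
  shows "B \<in> sets borel \<Longrightarrow> (\<lambda>x. x + v) -` B \<in> sets borel"
  by (rule measurable_sets_borel[where M=borel]) auto

lemma shift_measurable [measurable]: "shift v \<in> measurable configs (configs :: 'a::euclidean_space set measure)"
proof (rule measurable_configsI)
  fix B :: "'a set" assume "B \<in> sets borel"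
  then have "{S \<in> space configs. S \<inter> (\<lambda>x. x + v) -` B = {}} \<in> sets (configs :: 'a set measure)"
    by measurable
  then show "{S \<in> space configs. shift v S \<inter> B = {}} \<in> sets (configs :: 'a set measure)"
    by (simp add: shift_Int_empty_iff)
qed (simp add: space_configs locally_finite_shift)

lemma poisson_void_shift:
  assumes X: "poisson_void l M X" shows "poisson_void l M (\<lambda>\<nu>. shift v (X \<nu>))"
  unfolding poisson_void_def
proof (intro conjI ballI impI)
  show "prob_space M" "(\<lambda>\<nu>. shift v (X \<nu>)) \<in> measurable M configs"
    using X measurable_compose[OF _ shift_measurable] by (auto simp: poisson_void_def)
qed (simp add: shift_Int_empty_iff poisson_voidD[OF X] bounded_vimage_plus measure_lborel_vimage_plus)

text \<open>For product sets \<open>A\<close> this is the measurability of counts; the general case follows by induction on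
  the \<open>\<sigma>\<close>-algebra.\<close>

lemma measurable_count_param:
  fixes \<sigma> :: "'t \<Rightarrow> 'a::euclidean_space set"
  assumes \<sigma> [measurable]: "\<sigma> \<in> measurable N configs" and A: "A \<in> sets (N \<Otimes>\<^sub>M borel)"
  shows "(\<lambda>t. count_in (Pair t -` A) (\<sigma> t)) \<in> borel_measurable N"
proof -
  define c where "c k A t = count_in (Pair t -` A \<inter> cball 0 (real k)) (\<sigma> t)" for k :: nat and A t
  have fin: "finite (\<sigma> t \<inter> cball 0 (real k))" if "t \<in> space N" for t k
    using measurable_space[OF \<sigma> that] by (auto simp: space_configs locally_finite_def)
  have *: "c k A \<in> borel_measurable N" for k
    using Int_stable_pair_measure_generator pair_measure_closed A unfolding sets_pair_measure
  proof (induction A rule: sigma_sets_induct_disjoint)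
  case (basic A)
    then obtain a b where A: "A = a \<times> b" "a \<in> sets N" and [measurable]: "a \<in> sets N" "b \<in> sets borel" by auto
    have "(\<lambda>t. count_in (b \<inter> cball 0 (real k)) (\<sigma> t)) \<in> borel_measurable N"
      by (rule count_in_measurable_comp[OF \<sigma>]) simp
    then have "(\<lambda>t. indicator a t * count_in (b \<inter> cball 0 (real k)) (\<sigma> t)) \<in> borel_measurable N"
      by measurable
    moreover have "c k A t = indicator a t * count_in (b \<inter> cball 0 (real k)) (\<sigma> t)" for t
      by (auto simp: c_def A count_in_def indicator_def)
    ultimately show ?case by (simp cong: measurable_cong)
  next
    case empty
    then show ?case by (simp add: c_def count_in_def)
  next
    case (compl A)
    have "c k (space N \<times> space borel - A) t = count_in (cball 0 (real k)) (\<sigma> t) - c k A t" if "t \<in> space N" for t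
    proof -
      have "\<sigma> t \<inter> (Pair t -` (space N \<times> space borel - A) \<inter> cball 0 (real k)) =
          \<sigma> t \<inter> cball 0 (real k) - \<sigma> t \<inter> (Pair t -` A \<inter> cball 0 (real k))" using that by auto
      moreover have "finite (\<sigma> t \<inter> (Pair t -` A \<inter> cball 0 (real k)))"
        using fin[OF that, of k] by (rule finite_subset[rotated]) auto
      ultimately show ?thesis unfolding c_def count_in_def
        by (simp only:) (subst emeasure_Diff, auto simp: ecard_finite)
    qed
    moreover have "(\<lambda>t. count_in (cball 0 (real k)) (\<sigma> t) - c k A t) \<in> borel_measurable N"
      using compl count_in_measurable_comp[OF \<sigma>] by measurable
    ultimately show ?case by (simp cong: measurable_cong)
  next
    case (union A)
    have "c k (\<Union>i. A i) t = (\<Sum>i. c k (A i) t)" for t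
    proof -
      have "\<sigma> t \<inter> (Pair t -` (\<Union>i. A i) \<inter> cball 0 (real k)) = (\<Union>i. \<sigma> t \<inter> (Pair t -` A i \<inter> cball 0 (real k)))"
        by auto
      then show ?thesis using union(1) unfolding c_def count_in_def
        by (simp only:) (subst suminf_emeasure, auto simp: disjoint_family_on_def)
    qed
    then show ?case using union by simp
  qed
  have "count_in (Pair t -` A) (\<sigma> t) = (SUP k. c k A t)" for t
  proof -
    have "incseq (\<lambda>k::nat. \<sigma> t \<inter> (Pair t -` A \<inter> cball 0 (real k)))" by (auto simp: incseq_def)
    moreover have "(\<Union>k::nat. \<sigma> t \<inter> (Pair t -` A \<inter> cball 0 (real k))) = \<sigma> t \<inter> Pair t -` A"
      using real_arch_simple by auto
    ultimately show ?thesis unfolding c_def count_in_def by (subst SUP_emeasure_incseq) auto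
  qed
  then show ?thesis using * by simp
qed

corollary measurable_ex_point:
  fixes \<sigma> :: "'t \<Rightarrow> 'a::euclidean_space set"
  assumes \<sigma>: "\<sigma> \<in> measurable N configs" and A: "{p \<in> space (N \<Otimes>\<^sub>M borel). P (fst p) (snd p)} \<in> sets (N \<Otimes>\<^sub>M borel)"
  shows "{t \<in> space N. \<exists>y\<in>\<sigma> t. P t y} \<in> sets N"
proof -
  let ?A = "{p \<in> space (N \<Otimes>\<^sub>M borel). P (fst p) (snd p)}"
  have "(\<lambda>t. count_in (Pair t -` ?A) (\<sigma> t)) \<in> borel_measurable N" by (rule measurable_count_param[OF \<sigma> A])
  then have "{t \<in> space N. count_in (Pair t -` ?A) (\<sigma> t) \<noteq> 0} \<in> sets N" by measurable
  also have "{t \<in> space N. count_in (Pair t -` ?A) (\<sigma> t) \<noteq> 0} = {t \<in> space N. \<exists>y\<in>\<sigma> t. P t y}"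
    by (auto simp: count_in_0_iff space_pair_measure)
  finally show ?thesis .
qed

section \<open>Products\<close>

lemma PiM_distr:
  fixes M :: "'i \<Rightarrow> 'a measure" and N :: "'i \<Rightarrow> 'b measure"
  assumes M: "\<And>i. prob_space (M i)" and f [measurable]: "\<And>i. f i \<in> measurable (M i) (N i)"
  shows "distr (PiM UNIV M) (PiM UNIV N) (\<lambda>\<nu> i. f i (\<nu> i)) = PiM UNIV (\<lambda>i. distr (M i) (N i) (f i))"
proof -
  let ?D = "\<lambda>i. distr (M i) (N i) (f i)"
  have D: "prob_space (?D i)" for i by (rule prob_space.prob_space_distr[OF M f])
  have fm: "(\<lambda>\<nu> i. f i (\<nu> i)) \<in> measurable (PiM UNIV M) (PiM UNIV N)"
    by (rule measurable_PiM_single') (auto simp: space_PiM intro: measurable_space[OF f])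
  show ?thesis
  proof (rule measure_eqI_PiM_infinite[symmetric, where M=N and I=UNIV])
    fix A J assume J: "finite J" and A: "\<And>i. i \<in> J \<Longrightarrow> A i \<in> sets (N i)"
    have "emeasure (PiM UNIV ?D) (prod_emb UNIV N J (Pi\<^sub>E J A)) = emeasure (PiM UNIV ?D) (prod_emb UNIV ?D J (Pi\<^sub>E J A))"
      by (simp add: prod_emb_def)
    also have "... = (\<Prod>i\<in>J. emeasure (?D i) (A i))" using J A by (intro emeasure_PiM_emb D) auto
    also have "... = (\<Prod>i\<in>J. emeasure (M i) (f i -` A i \<inter> space (M i)))"
      using A by (intro prod.cong) (auto simp: emeasure_distr)
    also have "... = emeasure (PiM UNIV M) (prod_emb UNIV M J (Pi\<^sub>E J (\<lambda>i. f i -` A i \<inter> space (M i))))"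
      using J A by (intro emeasure_PiM_emb[symmetric] M) (auto intro: measurable_sets[OF f])
    also have "prod_emb UNIV M J (Pi\<^sub>E J (\<lambda>i. f i -` A i \<inter> space (M i))) =
        (\<lambda>\<nu> i. f i (\<nu> i)) -` prod_emb UNIV N J (Pi\<^sub>E J A) \<inter> space (PiM UNIV M)"
      using measurable_space[OF f] by (auto simp: prod_emb_def space_PiM PiE_def Pi_iff)
    also have "emeasure (PiM UNIV M) ... = emeasure (distr (PiM UNIV M) (PiM UNIV N) (\<lambda>\<nu> i. f i (\<nu> i))) (prod_emb UNIV N J (Pi\<^sub>E J A))"
      using J A by (intro emeasure_distr[symmetric] fm sets_PiM_I) auto
    finally show "emeasure (PiM UNIV ?D) (prod_emb UNIV N J (Pi\<^sub>E J A)) =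
      emeasure (distr (PiM UNIV M) (PiM UNIV N) (\<lambda>\<nu> i. f i (\<nu> i))) (prod_emb UNIV N J (Pi\<^sub>E J A))" .
  qed (auto intro!: sets_PiM_cong prob_space.finite_measure prob_space_PiM D)
qed

definition merge_at :: "'i set \<Rightarrow> ('i \<Rightarrow> 'a) \<Rightarrow> ('i \<Rightarrow> 'a) \<Rightarrow> 'i \<Rightarrow> 'a" where
  "merge_at J u w i = (if i \<in> J then u i else w i)"

lemma merge_at_measurable [measurable]:
  "(\<lambda>(u, w). merge_at J u w) \<in> measurable (PiM UNIV M' \<Otimes>\<^sub>M PiM UNIV M) (PiM UNIV (\<lambda>i. if i \<in> J then M' i else M i))"
proof (rule measurable_PiM_single')
  show "(\<lambda>x. (case x of (u, w) \<Rightarrow> merge_at J u w) i) \<in> measurable (PiM UNIV M' \<Otimes>\<^sub>M PiM UNIV M) (if i \<in> J then M' i else M i)"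
    for i by (cases "i \<in> J") (simp_all add: merge_at_def split_beta)
qed (auto simp: space_PiM space_pair_measure merge_at_def PiE_iff)

text \<open>This replaces some coordinates of a product by fresh ones and keeps the others.\<close>

lemma distr_merge_at:
  fixes M M' :: "'i \<Rightarrow> 'a measure"
  assumes M: "\<And>i. prob_space (M i)" and M': "\<And>i. prob_space (M' i)"
  shows "distr (PiM UNIV M' \<Otimes>\<^sub>M PiM UNIV M) (PiM UNIV (\<lambda>i. if i \<in> J then M' i else M i)) (\<lambda>(u, w). merge_at J u w)
    = PiM UNIV (\<lambda>i. if i \<in> J then M' i else M i)"
proof -
  let ?N = "\<lambda>i. if i \<in> J then M' i else M i"
  have N: "prob_space (?N i)" for i using M M' by simp
  interpret P: prob_space "PiM UNIV M" by (rule prob_space_PiM) (rule M)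
  interpret P': prob_space "PiM UNIV M'" by (rule prob_space_PiM) (rule M')
  show ?thesis
  proof (rule measure_eqI_PiM_infinite[symmetric, OF refl])
    fix A K assume K: "finite K" and A: "\<And>i. i \<in> K \<Longrightarrow> A i \<in> sets (?N i)"
    have "emeasure (PiM UNIV ?N) (prod_emb UNIV ?N K (Pi\<^sub>E K A)) = (\<Prod>i\<in>K. emeasure (?N i) (A i))"
      using K A by (intro emeasure_PiM_emb N) auto
    also have "... = (\<Prod>i\<in>K \<inter> J. emeasure (M' i) (A i)) * (\<Prod>i\<in>K - J. emeasure (M i) (A i))"
      using K by (subst prod.Int_Diff[of K _ J]) (auto intro!: arg_cong2[where f="(*)"] prod.cong)
    also have "... = emeasure (PiM UNIV M') (prod_emb UNIV M' (K \<inter> J) (Pi\<^sub>E (K \<inter> J) A)) *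
        emeasure (PiM UNIV M) (prod_emb UNIV M (K - J) (Pi\<^sub>E (K - J) A))"
    proof (subst (1 2) emeasure_PiM_emb)
      show "A i \<in> sets (M' i)" if "i \<in> K \<inter> J" for i using A[of i] that by auto
      show "A i \<in> sets (M i)" if "i \<in> K - J" for i using A[of i] that by auto
    qed (use K M M' in auto)
    also have "... = emeasure (PiM UNIV M' \<Otimes>\<^sub>M PiM UNIV M)
        (prod_emb UNIV M' (K \<inter> J) (Pi\<^sub>E (K \<inter> J) A) \<times> prod_emb UNIV M (K - J) (Pi\<^sub>E (K - J) A))"
    proof (rule P.emeasure_pair_measure_Times[symmetric])
      show "prod_emb UNIV M' (K \<inter> J) (Pi\<^sub>E (K \<inter> J) A) \<in> sets (PiM UNIV M')"
        using K A by (intro sets_PiM_I) (auto dest: A)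
      show "prod_emb UNIV M (K - J) (Pi\<^sub>E (K - J) A) \<in> sets (PiM UNIV M)"
        using K A by (intro sets_PiM_I) (auto dest: A)
    qed
    also have "prod_emb UNIV M' (K \<inter> J) (Pi\<^sub>E (K \<inter> J) A) \<times> prod_emb UNIV M (K - J) (Pi\<^sub>E (K - J) A) =
      (\<lambda>(u, w). merge_at J u w) -` prod_emb UNIV ?N K (Pi\<^sub>E K A) \<inter> space (PiM UNIV M' \<Otimes>\<^sub>M PiM UNIV M)"
      by (auto simp: prod_emb_def space_PiM space_pair_measure PiE_iff merge_at_def split: if_splits)
    finally show "emeasure (PiM UNIV ?N) (prod_emb UNIV ?N K (Pi\<^sub>E K A)) =
      emeasure (distr (PiM UNIV M' \<Otimes>\<^sub>M PiM UNIV M) (PiM UNIV ?N) (\<lambda>(u, w). merge_at J u w)) (prod_emb UNIV ?N K (Pi\<^sub>E K A))"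
      using K A by (subst emeasure_distr) (auto intro!: sets_PiM_I)
  qed (auto intro!: prob_space.finite_measure prob_space_PiM N)
qed

lemma distr_PiM_regroup:
  fixes M :: "'k \<Rightarrow> 'a measure" and \<phi> :: "'i \<Rightarrow> 'j \<Rightarrow> 'k"
  assumes M: "\<And>i. prob_space (M i)" and inj: "inj (\<lambda>(i, j). \<phi> i j)"
  shows "distr (PiM UNIV M) (PiM UNIV (\<lambda>i. PiM UNIV (\<lambda>j. M (\<phi> i j)))) (\<lambda>\<nu> i j. \<nu> (\<phi> i j)) =
    PiM UNIV (\<lambda>i. PiM UNIV (\<lambda>j. M (\<phi> i j)))"
proof -
  interpret P: prob_space "PiM UNIV M" by (rule prob_space_PiM) (rule M)
  have inj': "inj (\<phi> i)" for i using inj by (auto simp: inj_on_def)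
  have "P.indep_vars M (\<lambda>j \<nu>. \<nu> j) UNIV"
    using distr_PiM_component[of UNIV M, OF M] by (subst P.indep_vars_iff_distr_eq_PiM) (auto simp: restrict_UNIV)
  then have "P.indep_vars (\<lambda>i. PiM (range (\<phi> i)) M) (\<lambda>i \<nu>. restrict (\<lambda>j. \<nu> j) (range (\<phi> i))) UNIV"
    using inj by (intro P.indep_vars_restrict) (auto simp: disjoint_family_on_def inj_on_def)
  then have "P.indep_vars (\<lambda>i. PiM UNIV (\<lambda>j. M (\<phi> i j))) (\<lambda>i \<nu>. (\<lambda>w j. w (\<phi> i j)) (restrict (\<lambda>j. \<nu> j) (range (\<phi> i)))) UNIV"
  proof (rule P.indep_vars_compose2)
    show "(\<lambda>w j. w (\<phi> i j)) \<in> measurable (PiM (range (\<phi> i)) M) (PiM UNIV (\<lambda>j. M (\<phi> i j)))" for i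
      by (rule measurable_PiM_single') (auto simp: space_PiM)
  qed
  then have ind: "P.indep_vars (\<lambda>i. PiM UNIV (\<lambda>j. M (\<phi> i j))) (\<lambda>i \<nu> j. \<nu> (\<phi> i j)) UNIV" by simp
  have m: "(\<lambda>\<nu> j. \<nu> (\<phi> i j)) \<in> measurable (PiM UNIV M) (PiM UNIV (\<lambda>j. M (\<phi> i j)))" for i
    by (rule measurable_PiM_single') (auto simp: space_PiM)
  have "distr (PiM UNIV M) (PiM UNIV (\<lambda>j. M (\<phi> i j))) (\<lambda>\<nu> j. \<nu> (\<phi> i j)) = PiM UNIV (\<lambda>j. M (\<phi> i j))" for i
    using distr_PiM_reindex[of UNIV M "\<phi> i" UNIV] M inj'[of i] by (simp add: restrict_UNIV)
  then show ?thesis using ind m by (subst (asm) P.indep_vars_iff_distr_eq_PiM) (auto simp: restrict_UNIV)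
qed

lemma PiM_prob_Ball:
  assumes M: "\<And>i. prob_space (M i)" and J: "finite J" and A: "\<And>j. j \<in> J \<Longrightarrow> A j \<in> sets (M j)"
  shows "emeasure (PiM UNIV M) {\<nu> \<in> space (PiM UNIV M). \<forall>j\<in>J. \<nu> j \<in> A j} = (\<Prod>j\<in>J. emeasure (M j) (A j))"
proof -
  have "{\<nu> \<in> space (PiM UNIV M). \<forall>j\<in>J. \<nu> j \<in> A j} = prod_emb UNIV M J (Pi\<^sub>E J A)"
    by (auto simp: prod_emb_def space_PiM PiE_iff)
  then show ?thesis using emeasure_PiM_emb[OF M, of J UNIV A] J A by simp
qed

section \<open>Uniform variables from coin flips\<close>

abbreviation coin :: "bool measure" where
  "coin \<equiv> measure_pmf (bernoulli_pmf (1/2))"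

abbreviation coins :: "(nat \<Rightarrow> bool) measure" where
  "coins \<equiv> PiM UNIV (\<lambda>_::nat. coin)"

definition U01 :: "real measure" where
  "U01 = uniform_measure lborel {0..<1}"

lemma prob_space_U01 [simp, intro]: "prob_space U01"
  unfolding U01_def by (rule prob_space_uniform_measure) auto

lemma sets_U01 [simp, measurable_cong]: "sets U01 = sets borel"
  and space_U01 [simp]: "space U01 = UNIV"
  by (auto simp: U01_def)

lemma emeasure_U01: "A \<in> sets borel \<Longrightarrow> emeasure U01 A = emeasure lborel ({0..<1} \<inter> A)"
  by (simp add: U01_def divide_ennreal_def)

definition binary_real :: "(nat \<Rightarrow> bool) \<Rightarrow> real" where
  "binary_real b = (\<Sum>i. of_bool (b i) * (1/2)^Suc i)"

lemma summable_binary_real: "summable (\<lambda>i. of_bool (b i) * (1/2::real)^Suc i)"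
proof (rule summable_comparison_test'[of "\<lambda>i. (1/2::real)^Suc i" 0])
  show "summable (\<lambda>i. (1/2::real)^Suc i)" using power_half_series by (rule sums_summable)
qed auto

lemma binary_real_measurable [measurable]: "binary_real \<in> borel_measurable coins"
  unfolding binary_real_def by measurable

lemma binary_real_case_nat: "binary_real (case_nat s b) = of_bool s / 2 + binary_real b / 2"
proof -
  have "binary_real (case_nat s b) = of_bool s / 2 + (\<Sum>i. of_bool (b i) * (1/2)^Suc (Suc i))"
    unfolding binary_real_def using suminf_split_head[OF summable_binary_real[of "case_nat s b"]] by simp
  also have "(\<Sum>i. of_bool (b i) * (1/2::real)^Suc (Suc i)) = (\<Sum>i. (1/2) * (of_bool (b i) * (1/2)^Suc i))"
    by (simp add: mult_ac)
  also have "... = binary_real b / 2"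
    unfolding binary_real_def by (subst suminf_mult[OF summable_binary_real]) simp
  finally show ?thesis .
qed

lemma binary_real_bounds: "0 \<le> binary_real b" "binary_real b \<le> 1"
proof -
  show "0 \<le> binary_real b" unfolding binary_real_def by (intro suminf_nonneg summable_binary_real) simp
  have "binary_real b \<le> (\<Sum>i. (1/2::real)^Suc i)"
    unfolding binary_real_def using power_half_series
    by (intro suminf_le summable_binary_real) (auto simp: sums_iff)
  then show "binary_real b \<le> 1" using power_half_series by (simp add: sums_iff)
qed

lemma distr_binary_real: "distr coins borel binary_real = U01"
proof -
  interpret C: prob_space coins by (rule prob_space_PiM) (rule prob_space_measure_pmf)
  interpret S: sequence_space coin by unfold_locales
  interpret CC: pair_prob_space coin coins by unfold_locales
  define F where "F x = C.prob {b \<in> space coins. binary_real b \<le> x}" for x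
  define c where "c x = max 0 (min 1 x)" for x :: real
  have "distr (coin \<Otimes>\<^sub>M coins) coins (\<lambda>(s, \<nu>). case_nat s \<nu>) = coins" by (rule S.PiM_iter)
  note it = this[symmetric]
  have mm [measurable]: "(\<lambda>(s, \<nu>). case_nat s \<nu>) \<in> measurable (coin \<Otimes>\<^sub>M coins) coins"
    by measurable
  have ev [measurable]: "{b \<in> space coins. binary_real b \<le> x} \<in> sets coins" for x by measurable
  have rec: "F x = (F (2 * x) + F (2 * x - 1)) / 2" for x
  proof -
    have "F x = measure (coin \<Otimes>\<^sub>M coins) ((\<lambda>(s, \<nu>). case_nat s \<nu>) -` {b \<in> space coins. binary_real b \<le> x} \<inter> space (coin \<Otimes>\<^sub>M coins))"
      unfolding F_def by (subst it, subst measure_distr[OF mm ev], rule refl)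
    also have "(\<lambda>(s, \<nu>). case_nat s \<nu>) -` {b \<in> space coins. binary_real b \<le> x} \<inter> space (coin \<Otimes>\<^sub>M coins) =
      {True} \<times> {b \<in> space coins. binary_real b \<le> 2 * x - 1} \<union> {False} \<times> {b \<in> space coins. binary_real b \<le> 2 * x}"
      by (intro set_eqI; case_tac xa; case_tac a) (auto simp: space_pair_measure space_PiM binary_real_case_nat)
    also have "measure (coin \<Otimes>\<^sub>M coins) ... = measure (coin \<Otimes>\<^sub>M coins) ({True} \<times> {b \<in> space coins. binary_real b \<le> 2 * x - 1}) +
        measure (coin \<Otimes>\<^sub>M coins) ({False} \<times> {b \<in> space coins. binary_real b \<le> 2 * x})"
      by (rule CC.P.finite_measure_Union) auto
    also have "... = (F (2 * x) + F (2 * x - 1)) / 2"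
    proof -
      have "measure (coin \<Otimes>\<^sub>M coins) (A \<times> B) = measure coin A * C.prob B" if "B \<in> sets coins" for A B
        using that by (simp add: measure_def C.emeasure_pair_measure_Times enn2real_mult)
      then show ?thesis unfolding F_def by (simp add: measure_pmf_single)
    qed
    finally show ?thesis .
  qed
  have crec: "c x = (c (2 * x) + c (2 * x - 1)) / 2" for x by (auto simp: c_def max_def min_def)
  have out: "F x = c x" if "x < 0 \<or> 1 \<le> x" for x
  proof (cases "x < 0")
    case True
    then have "\<not> binary_real b \<le> x" for b using binary_real_bounds(1)[of b] by linarith
    then have "{b \<in> space coins. binary_real b \<le> x} = {}" by auto
    then show ?thesis using True by (simp only: F_def c_def) simp
  next
    case False
    then have "binary_real b \<le> x" for b using binary_real_bounds(2)[of b] that by linarith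
    then have "{b \<in> space coins. binary_real b \<le> x} = space coins" by auto
    then show ?thesis using that False by (simp only: F_def c_def C.prob_space) simp
  qed
  \<comment> \<open>Both sides solve the same self-similar equation, and the difference of two solutions halves at each step.\<close>
  have "\<bar>F x - c x\<bar> \<le> (1/2)^n" for x n
  proof (induction n arbitrary: x)
    case 0
    have "0 \<le> F x" "F x \<le> 1" "0 \<le> c x" "c x \<le> 1" by (auto simp: F_def c_def)
    then show ?case by (simp add: abs_le_iff)
  next
    case (Suc n)
    have "\<bar>F x - c x\<bar> \<le> (\<bar>F (2 * x) - c (2 * x)\<bar> + \<bar>F (2 * x - 1) - c (2 * x - 1)\<bar>) / 2"
    proof -
      have "F x - c x = ((F (2 * x) - c (2 * x)) + (F (2 * x - 1) - c (2 * x - 1))) / 2"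
        using rec[of x] crec[of x] by (simp add: field_simps)
      then have "\<bar>F x - c x\<bar> = \<bar>(F (2 * x) - c (2 * x)) + (F (2 * x - 1) - c (2 * x - 1))\<bar> / 2"
        by (simp only: abs_divide abs_numeral)
      also have "... \<le> (\<bar>F (2 * x) - c (2 * x)\<bar> + \<bar>F (2 * x - 1) - c (2 * x - 1)\<bar>) / 2"
        by (intro divide_right_mono abs_triangle_ineq) simp
      finally show ?thesis .
    qed
    also have "... \<le> (1/2)^n / 2"
    proof (cases "2 * x < 1")
      case True
      then show ?thesis using Suc.IH[of "2 * x"] out[of "2 * x - 1"] by simp
    next
      case False
      then show ?thesis using Suc.IH[of "2 * x - 1"] out[of "2 * x"] by simp
    qed
    finally show ?case by simp
  qed
  then have Fc: "F x = c x" for x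
    using LIMSEQ_le_const[OF LIMSEQ_power_zero[of "1/2::real"], of "\<bar>F x - c x\<bar>"] by auto
  show ?thesis
  proof (rule cdf_unique)
    interpret D: prob_space "distr coins borel binary_real" by (rule C.prob_space_distr) simp
    show "real_distribution (distr coins borel binary_real)" by unfold_locales auto
    interpret U: prob_space U01 by simp
    show "real_distribution U01" by unfold_locales auto
    show "cdf (distr coins borel binary_real) = cdf U01"
    proof
      fix x
      have "cdf (distr coins borel binary_real) x = F x"
        by (simp add: cdf_def measure_distr F_def vimage_def Int_def conj_commute)
      moreover have "cdf U01 x = c x"
      proof -
        have "{0..<1} \<inter> {..x} = (if 1 \<le> x then {0..<1} else {0..x})" by auto
        then have "emeasure U01 {..x} = ennreal (c x)" by (auto simp: emeasure_U01 c_def max_def min_def ennreal_neg)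
        moreover have "0 \<le> c x" by (simp add: c_def)
        ultimately show ?thesis by (simp add: cdf_def measure_def)
      qed
      ultimately show "cdf (distr coins borel binary_real) x = cdf U01 x" using Fc by simp
    qed
  qed
qed

abbreviation Us :: "(nat \<Rightarrow> real) measure" where
  "Us \<equiv> PiM UNIV (\<lambda>_::nat. U01)"

abbreviation Uss :: "(nat \<Rightarrow> nat \<Rightarrow> real) measure" where
  "Uss \<equiv> PiM UNIV (\<lambda>_::nat. Us)"

definition rows :: "(nat \<Rightarrow> 'a) \<Rightarrow> nat \<Rightarrow> nat \<Rightarrow> 'a" where
  "rows u i j = u (prod_encode (i, j))"

lemma rows_measurable [measurable]:
  "rows \<in> measurable (PiM UNIV (\<lambda>_::nat. M)) (PiM UNIV (\<lambda>_::nat. PiM UNIV (\<lambda>_::nat. M)))"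
  unfolding rows_def by (intro measurable_PiM_single') (auto simp: space_PiM)

lemma inj_prod_encode': "inj (\<lambda>(i, j). prod_encode (i, j))"
  using inj_prod_encode[of UNIV] by (simp add: case_prod_eta)

lemma distr_rows:
  "prob_space M \<Longrightarrow> distr (PiM UNIV (\<lambda>_::nat. M)) (PiM UNIV (\<lambda>_::nat. PiM UNIV (\<lambda>_::nat. M))) rows =
    PiM UNIV (\<lambda>_::nat. PiM UNIV (\<lambda>_::nat. M))"
  using distr_PiM_regroup[of "\<lambda>_. M" "\<lambda>i j. prod_encode (i, j)", OF _ inj_prod_encode']
  by (simp add: rows_def[abs_def])

definition uniforms_of_coins :: "(nat \<Rightarrow> bool) \<Rightarrow> nat \<Rightarrow> real" where
  "uniforms_of_coins b i = binary_real (rows b i)"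

lemma uniforms_of_coins_measurable [measurable]: "uniforms_of_coins \<in> measurable coins Us"
  unfolding uniforms_of_coins_def by (intro measurable_PiM_single') (auto simp: space_PiM)

lemma distr_uniforms_of_coins: "distr coins Us uniforms_of_coins = Us"
proof -
  have C: "prob_space coins" by (rule prob_space_PiM) (rule prob_space_measure_pmf)
  have [measurable]: "(\<lambda>w i. binary_real (w i)) \<in> measurable (PiM UNIV (\<lambda>_::nat. coins)) (PiM UNIV (\<lambda>_. borel))"
    by (intro measurable_PiM_single') (auto simp: space_PiM)
  have UB: "sets Us = sets (PiM UNIV (\<lambda>_::nat. borel::real measure))" by (intro sets_PiM_cong) auto
  have "distr coins Us uniforms_of_coins = distr coins (PiM UNIV (\<lambda>_. borel)) uniforms_of_coins"
    by (intro distr_cong) (auto simp: UB)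
  also have "... = distr (distr coins (PiM UNIV (\<lambda>_. coins)) rows) (PiM UNIV (\<lambda>_. borel)) (\<lambda>w i. binary_real (w i))"
    by (subst distr_distr) (auto simp: comp_def uniforms_of_coins_def[abs_def])
  also have "... = Us"
    by (subst distr_rows[OF prob_space_measure_pmf], subst PiM_distr) (auto simp: C distr_binary_real)
  finally show ?thesis .
qed

section \<open>Sampling from a discrete distribution\<close>

definition quantile_nat :: "nat pmf \<Rightarrow> real \<Rightarrow> nat" where
  "quantile_nat p u = (LEAST n. u < (\<Sum>i\<le>n. pmf p i))"

definition quantile :: "'c::countable pmf \<Rightarrow> real \<Rightarrow> 'c" where
  "quantile p u = from_nat (quantile_nat (map_pmf to_nat p) u)"

lemma quantile_nat_measurable [measurable]: "quantile_nat p \<in> measurable borel (count_space UNIV)"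
  unfolding quantile_nat_def by measurable

lemma quantile_measurable [measurable]: "quantile p \<in> measurable borel (count_space UNIV)"
  unfolding quantile_def by measurable

lemma distr_quantile_nat: "distr U01 (count_space UNIV) (quantile_nat p) = measure_pmf p"
proof (rule measure_eqI_countable[where A=UNIV])
  fix n :: nat
  define S where "S k = (\<Sum>i<k. pmf p i)" for k
  have Smono: "mono S" unfolding S_def by (intro monoI sum_mono2) auto
  have "(\<lambda>i. pmf p i) sums 1"
  proof -
    have "(\<lambda>i. ennreal (pmf p i)) sums 1"
    proof -
      have "(\<integral>\<^sup>+i. pmf p i \<partial>count_space UNIV) = 1" by (simp add: nn_integral_pmf)
      then show ?thesis by (simp add: nn_integral_count_space_nat sums_iff)
    qed
    then show ?thesis using sums_ennreal[of "\<lambda>i. pmf p i" 1] by simp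
  qed
  then have S1: "S \<longlonglongrightarrow> 1" by (simp add: sums_def S_def[abs_def])
  have q: "quantile_nat p u = n \<longleftrightarrow> S n \<le> u \<and> u < S (Suc n)" if u: "0 \<le> u" "u < 1" for u n
  proof -
    have Suc: "(\<Sum>i\<le>k. pmf p i) = S (Suc k)" for k by (simp add: S_def lessThan_Suc_atMost)
    obtain k where k: "u < S (Suc k)"
      using order_tendstoD(1)[OF S1 u(2)] by (auto simp: eventually_sequentially) (meson le_Suc_eq order_refl le_SucI)
    show ?thesis
    proof
      assume e: "quantile_nat p u = n"
      have "u < S (Suc n)" unfolding e[symmetric] quantile_nat_def Suc by (rule LeastI[of _ k]) (rule k)
      moreover have "S n \<le> u"
      proof (cases n)
        case (Suc m)
        then have "\<not> u < S (Suc m)" using not_less_Least[of m "\<lambda>n. u < S (Suc n)"] e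
          unfolding quantile_nat_def \<open>\<And>k. (\<Sum>i\<le>k. pmf p i) = S (Suc k)\<close> by auto
        then show ?thesis using Suc by simp
      qed (use u in \<open>simp add: S_def\<close>)
      ultimately show "S n \<le> u \<and> u < S (Suc n)" by simp
    next
      assume "S n \<le> u \<and> u < S (Suc n)"
      then show "quantile_nat p u = n" unfolding quantile_nat_def Suc
      proof (intro Least_equality)
        show "n \<le> y" if "u < S (Suc y)" for y
          using \<open>S n \<le> u \<and> _\<close> that monoD[OF Smono, of "Suc y" n] by (meson Suc_leI leI less_le_trans not_le order_trans)
      qed simp
    qed
  qed
  have S01: "0 \<le> S k" "S k \<le> 1" for k
    using incseq_le[OF Smono S1, of k] by (auto simp: S_def intro: sum_nonneg)
  have "{0..<1} \<inter> quantile_nat p -` {n} = {S n..<S (Suc n)}"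
  proof (intro set_eqI)
    show "u \<in> {0..<1} \<inter> quantile_nat p -` {n} \<longleftrightarrow> u \<in> {S n..<S (Suc n)}" for u
      using q[of u n] S01[of n] S01[of "Suc n"] by (cases "0 \<le> u \<and> u < 1") auto
  qed
  moreover have "quantile_nat p -` {n} \<in> sets borel"
    using measurable_sets[OF quantile_nat_measurable, of "{n}" p] by simp
  ultimately have "emeasure U01 (quantile_nat p -` {n}) = ennreal (S (Suc n) - S n)"
    using monoD[OF Smono, of n "Suc n"] by (simp add: emeasure_U01)
  then show "emeasure (distr U01 (count_space UNIV) (quantile_nat p)) {n} = emeasure (measure_pmf p) {n}"
    by (simp add: emeasure_distr S_def emeasure_pmf_single)
qed auto

lemma distr_quantile: "distr U01 (count_space UNIV) (quantile p) = measure_pmf p"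
proof -
  have "distr U01 (count_space UNIV) (quantile p) =
      distr (distr U01 (count_space UNIV) (quantile_nat (map_pmf to_nat p))) (count_space UNIV) from_nat"
    by (subst distr_distr) (auto simp: comp_def quantile_def[abs_def])
  also have "... = measure_pmf (map_pmf from_nat (map_pmf to_nat p))"
    by (simp add: distr_quantile_nat map_pmf_rep_eq)
  also have "map_pmf from_nat (map_pmf to_nat p) = p" by (simp add: pmf.map_comp comp_def)
  finally show ?thesis .
qed

lemma nn_integral_quantile: "(\<integral>\<^sup>+u. g (quantile p u) \<partial>U01) = (\<integral>\<^sup>+m. g m \<partial>p)"
  by (subst distr_quantile[symmetric], subst nn_integral_distr) auto

section \<open>Uniform points in cubes\<close>

definition hcube :: "'a::euclidean_space \<Rightarrow> real \<Rightarrow> 'a set" where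
  "hcube a s = {x. \<forall>b\<in>Basis. a \<bullet> b \<le> x \<bullet> b \<and> x \<bullet> b < a \<bullet> b + s}"

lemma emeasure_lborel_rectangle:
  assumes A: "\<And>b. b \<in> Basis \<Longrightarrow> A b \<in> sets borel"
  shows "emeasure lborel {x::'a::euclidean_space. \<forall>b\<in>Basis. x \<bullet> b \<in> A b} = (\<Prod>b\<in>Basis. emeasure lborel (A b))"
proof -
  interpret L: product_sigma_finite "\<lambda>_::'a. lborel :: real measure" by unfold_locales
  let ?f = "\<lambda>f. \<Sum>b\<in>(Basis::'a set). f b *\<^sub>R b"
  have [measurable]: "?f \<in> measurable (PiM Basis (\<lambda>_. lborel)) (borel :: 'a measure)" by measurable
  have S: "{x::'a. \<forall>b\<in>Basis. x \<bullet> b \<in> A b} = (\<Inter>b\<in>Basis. (\<lambda>x. x \<bullet> b) -` A b)" by auto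
  have "{x::'a. \<forall>b\<in>Basis. x \<bullet> b \<in> A b} \<in> sets borel"
    unfolding S using A by (intro sets.finite_INT) (auto intro!: measurable_sets_borel[where M=borel])
  then have "emeasure lborel {x::'a. \<forall>b\<in>Basis. x \<bullet> b \<in> A b} =
    emeasure (PiM Basis (\<lambda>_. lborel)) (?f -` {x. \<forall>b\<in>Basis. x \<bullet> b \<in> A b} \<inter> space (PiM Basis (\<lambda>_::'a. lborel)))"
    by (subst lborel_def) (simp add: lborel_eq_real[symmetric] emeasure_distr)
  also have "?f -` {x. \<forall>b\<in>Basis. x \<bullet> b \<in> A b} \<inter> space (PiM Basis (\<lambda>_::'a. lborel)) = Pi\<^sub>E Basis A"
    by (auto simp: space_PiM PiE_iff)
  also have "emeasure (PiM Basis (\<lambda>_. lborel)) (Pi\<^sub>E Basis A) = (\<Prod>b\<in>Basis. emeasure lborel (A b))"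
    using A by (intro L.emeasure_PiM) auto
  finally show ?thesis .
qed

lemma hcube_sets [measurable]: "hcube a s \<in> sets borel"
proof -
  have "hcube a s = (\<Inter>b\<in>Basis. (\<lambda>x. x \<bullet> b) -` {a \<bullet> b..<a \<bullet> b + s})" by (auto simp: hcube_def)
  then show ?thesis by (auto intro!: sets.finite_INT measurable_sets_borel[where M=borel])
qed

lemma emeasure_hcube: "0 \<le> s \<Longrightarrow> emeasure lborel (hcube (a::'a::euclidean_space) s) = ennreal (s ^ DIM('a))"
proof -
  assume s: "0 \<le> s"
  have "hcube a s = {x. \<forall>b\<in>Basis. x \<bullet> b \<in> {a \<bullet> b..<a \<bullet> b + s}}" by (auto simp: hcube_def)
  also have "emeasure lborel ... = (\<Prod>b\<in>Basis. emeasure lborel {a \<bullet> b..<a \<bullet> b + s})"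
    by (rule emeasure_lborel_rectangle) simp
  finally show ?thesis using s by (simp add: ennreal_power)
qed

lemma measure_hcube: "0 \<le> s \<Longrightarrow> vol (hcube (a::'a::euclidean_space) s) = s ^ DIM('a)"
  by (simp add: measure_def emeasure_hcube)

lemma bounded_hcube: "bounded (hcube a s)"
proof (rule bounded_subset[OF bounded_cbox])
  show "hcube a s \<subseteq> cbox a (a + s *\<^sub>R One)" by (auto simp: hcube_def mem_box inner_add_left less_imp_le)
qed

definition point_of :: "(nat \<Rightarrow> real) \<Rightarrow> 'a::euclidean_space" where
  "point_of u = (\<Sum>b\<in>Basis. u (to_nat_on (Basis::'a set) b) *\<^sub>R b)"

lemma point_of_measurable [measurable]: "point_of \<in> measurable Us borel"
  unfolding point_of_def by measurable

lemma prob_space_Us [simp, intro]: "prob_space Us"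
  by (rule prob_space_PiM) simp

lemma prob_space_Uss [simp, intro]: "prob_space Uss"
  by (rule prob_space_PiM) simp

lemma distr_point_of:
  "distr Us borel (point_of :: _ \<Rightarrow> 'a::euclidean_space) = uniform_measure lborel (hcube 0 1)"
proof (rule measure_eqI_generator_eq[where \<Omega>=UNIV and E="range (\<lambda>(a, b). box a b :: 'a set)" and A="\<lambda>n. box (- (real n *\<^sub>R One)) (real n *\<^sub>R One)"])
  interpret Us: prob_space Us by simp
  interpret D: prob_space "distr Us borel (point_of :: _ \<Rightarrow> 'a)" by (rule Us.prob_space_distr) simp
  show "Int_stable (range (\<lambda>(a, b). box a b :: 'a set))"
    by (auto simp: Int_stable_def box_Int_box)
  show "(\<Union>n. box (- (real n *\<^sub>R One)) (real n *\<^sub>R One)) = (UNIV :: 'a set)" by (rule UN_box_eq_UNIV)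
  show "emeasure (distr Us borel (point_of :: _ \<Rightarrow> 'a)) (box (- (real n *\<^sub>R One)) (real n *\<^sub>R One)) \<noteq> \<infinity>" for n
    using D.emeasure_finite by simp
  fix X assume "X \<in> range (\<lambda>(a, b). box a b :: 'a set)"
  then obtain l r where X: "X = box l r" by auto
  let ?i = "to_nat_on (Basis :: 'a set)"
  have inj: "inj_on ?i Basis" by (rule inj_on_to_nat_on) (simp add: countable_finite)
  let ?A = "\<lambda>b. {l \<bullet> b<..<r \<bullet> b}"
  let ?B = "\<lambda>j. ?A (the_inv_into Basis ?i j)"
  have 0: "(point_of u :: 'a) \<bullet> b = u (?i b)" if "b \<in> Basis" for u b
    using that by (simp add: point_of_def)
  have "point_of -` X \<inter> space Us = {u \<in> space Us. \<forall>j\<in>?i ` Basis. u j \<in> ?B j}"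
    using inj by (auto simp: X mem_box 0 the_inv_into_f_f)
  moreover have "emeasure (distr Us borel point_of) X = emeasure Us (point_of -` X \<inter> space Us)"
    by (rule emeasure_distr) (auto simp: X)
  moreover have "emeasure Us {u \<in> space Us. \<forall>j\<in>?i ` Basis. u j \<in> ?B j} = (\<Prod>j\<in>?i ` Basis. emeasure U01 (?B j))"
    by (rule PiM_prob_Ball) auto
  ultimately have "emeasure (distr Us borel point_of) X = (\<Prod>j\<in>?i ` Basis. emeasure U01 (?B j))"
    by simp
  also have "... = (\<Prod>b\<in>Basis. emeasure U01 (?A b))"
    using inj by (subst prod.reindex) (auto simp: the_inv_into_f_f)
  also have "... = (\<Prod>b\<in>Basis. emeasure lborel ({0..<1} \<inter> ?A b))" by (simp add: emeasure_U01)
  also have "... = emeasure lborel {x::'a. \<forall>b\<in>Basis. x \<bullet> b \<in> {0..<1} \<inter> ?A b}"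
    by (rule emeasure_lborel_rectangle[symmetric]) auto
  also have "{x::'a. \<forall>b\<in>Basis. x \<bullet> b \<in> {0..<1} \<inter> ?A b} = hcube 0 1 \<inter> X"
    by (auto simp: X hcube_def mem_box)
  also have "emeasure lborel (hcube 0 1 \<inter> X) = emeasure (uniform_measure lborel (hcube 0 1)) X"
    by (simp add: X emeasure_hcube divide_ennreal_def)
  finally show "emeasure (distr Us borel point_of) X = emeasure (uniform_measure lborel (hcube 0 1)) X" .
qed (auto simp: borel_eq_box)

text \<open>The points lie in the cube for almost every seed; the intersection makes this hold for every seed.\<close>

definition throw :: "'a::euclidean_space \<Rightarrow> real \<Rightarrow> nat \<Rightarrow> (nat \<Rightarrow> nat \<Rightarrow> real) \<Rightarrow> 'a set" where
  "throw a s m v = (\<lambda>i. a + s *\<^sub>R point_of (v i)) ` {..<m} \<inter> hcube a s"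

lemma finite_throw: "finite (throw a s m v)" and throw_subset: "throw a s m v \<subseteq> hcube a s"
  by (auto simp: throw_def)

definition miss :: "'a::euclidean_space set \<Rightarrow> 'a \<Rightarrow> real \<Rightarrow> (nat \<Rightarrow> real) set" where
  "miss B a s = {u. a + s *\<^sub>R point_of u \<notin> B \<inter> hcube a s}"

lemma throw_Int_empty_iff: "throw a s m v \<inter> B = {} \<longleftrightarrow> (\<forall>i<m. v i \<in> miss B a s)"
  by (auto simp: throw_def miss_def)

lemma miss_sets [measurable]:
  assumes B: "B \<in> sets borel" shows "miss B a s \<in> sets Us"
proof -
  have "(\<lambda>u. a + s *\<^sub>R point_of u) -` (- (B \<inter> hcube a s)) \<inter> space Us \<in> sets Us"
    using B by (intro measurable_sets[of _ _ borel]) auto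
  also have "(\<lambda>u. a + s *\<^sub>R point_of u) -` (- (B \<inter> hcube a s)) \<inter> space Us = miss B a s"
    by (auto simp: miss_def space_PiM)
  finally show ?thesis .
qed

lemma emeasure_miss:
  fixes B :: "'a::euclidean_space set"
  assumes B [measurable]: "B \<in> sets borel" and s: "0 < s"
  shows "emeasure Us (miss B a s) = ennreal (1 - vol (B \<inter> hcube a s) / s ^ DIM('a))"
proof -
  interpret Us: prob_space Us by simp
  let ?C = "B \<inter> hcube a s"
  let ?T = "\<lambda>x. a + s *\<^sub>R x :: 'a"
  have T [measurable]: "?T -` ?C \<in> sets borel" by (rule measurable_sets_borel) measurable
  have "emeasure lborel ?C = emeasure (density (distr lborel borel ?T) (\<lambda>_. ennreal (\<bar>s\<bar> ^ DIM('a)))) ?C"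
    using lborel_affine[of s a] s by simp
  also have "... = ennreal (s ^ DIM('a)) * emeasure lborel (?T -` ?C)"
    using s by (subst emeasure_density) (auto simp: nn_integral_cmult emeasure_distr)
  finally have e: "emeasure lborel ?C = ennreal (s ^ DIM('a)) * emeasure lborel (?T -` ?C)" .
  have sub: "?T -` ?C \<subseteq> hcube 0 1"
    using s by (auto simp: hcube_def inner_add_left zero_le_mult_iff)
  have m: "vol (?T -` ?C) = vol ?C / s ^ DIM('a)"
    using e s by (simp add: measure_def enn2real_mult)
  have "Us.prob (point_of -` (?T -` ?C) \<inter> space Us) = measure (distr Us borel point_of) (?T -` ?C)"
    by (rule measure_distr[symmetric]) auto
  also have "... = vol (hcube 0 1 \<inter> ?T -` ?C)"
    unfolding distr_point_of using T
    by (simp add: measure_def emeasure_hcube divide_ennreal_def)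
  also have "hcube 0 1 \<inter> ?T -` ?C = ?T -` ?C" using sub by auto
  finally have p: "Us.prob (point_of -` (?T -` ?C) \<inter> space Us) = vol ?C / s ^ DIM('a)" unfolding m .
  have "miss B a s = space Us - (point_of -` (?T -` ?C) \<inter> space Us)" by (auto simp: miss_def space_PiM)
  then have "Us.prob (miss B a s) = 1 - vol ?C / s ^ DIM('a)"
    using Us.prob_compl[of "point_of -` (?T -` ?C) \<inter> space Us"] p by simp
  then show ?thesis by (simp add: Us.emeasure_eq_measure)
qed

lemma throw_void_sets:
  fixes B :: "'a::euclidean_space set"
  shows "B \<in> sets borel \<Longrightarrow> {v \<in> space Uss. throw a s m v \<inter> B = {}} \<in> sets Uss"
  unfolding throw_Int_empty_iff by (intro sets.sets_Collect_countable_All) (auto intro!: sets_Collect_single')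

lemma throw_void_prob:
  fixes B :: "'a::euclidean_space set"
  assumes B: "B \<in> sets borel" and s: "0 < s"
  shows "emeasure Uss {v \<in> space Uss. throw a s m v \<inter> B = {}} =
    ennreal ((1 - vol (B \<inter> hcube a s) / s ^ DIM('a)) ^ m)"
proof -
  have "{v \<in> space Uss. throw a s m v \<inter> B = {}} = {v \<in> space Uss. \<forall>i\<in>{..<m}. v i \<in> miss B a s}"
    by (auto simp: throw_Int_empty_iff)
  also have "emeasure Uss ... = (\<Prod>i\<in>{..<m}. emeasure Us (miss B a s))"
    using B by (intro PiM_prob_Ball) auto
  also have "... = ennreal ((1 - vol (B \<inter> hcube a s) / s ^ DIM('a)) ^ m)"
  proof -
    have "vol (B \<inter> hcube a s) \<le> vol (hcube a s)"
      using B s by (intro measure_mono_fmeasurable) (auto simp: fmeasurable_def emeasure_hcube)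
    then have "0 \<le> 1 - vol (B \<inter> hcube a s) / s ^ DIM('a)" using s by (simp add: measure_hcube)
    then show ?thesis using emeasure_miss[OF B s, of a] by (simp add: ennreal_power)
  qed
  finally show ?thesis .
qed

lemma poisson_pgf:
  assumes r: "0 < r" and x: "0 \<le> x"
  shows "(\<integral>\<^sup>+m. ennreal (x ^ m) \<partial>(poisson_pmf r)) = ennreal (exp (- (r * (1 - x))))"
proof -
  have "(\<lambda>m. (r * x) ^ m /\<^sub>R fact m * exp (-r)) sums (exp (r * x) * exp (-r))"
    by (intro sums_mult2 exp_converges)
  moreover have "exp (r * x) * exp (-r) = exp (- (r * (1 - x)))"
    by (simp add: algebra_simps flip: exp_add)
  ultimately have s: "(\<lambda>m. pmf (poisson_pmf r) m * x ^ m) sums exp (- (r * (1 - x)))"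
    using r by (simp add: power_mult_distrib field_simps)
  have "(\<integral>\<^sup>+m. ennreal (x ^ m) \<partial>(poisson_pmf r)) = (\<integral>\<^sup>+m. ennreal (pmf (poisson_pmf r) m * x ^ m) \<partial>count_space UNIV)"
    using x by (simp add: nn_integral_measure_pmf ennreal_mult)
  also have "... = (\<Sum>m. ennreal (pmf (poisson_pmf r) m * x ^ m))" by (rule nn_integral_count_space_nat)
  also have "... = ennreal (exp (- (r * (1 - x))))"
    using s x by (intro suminf_ennreal_eq) auto
  finally show ?thesis .
qed

section \<open>Existence of the Poisson process\<close>

text \<open>The number and the positions of the points of cell \<open>k\<close> are read off the \<open>k\<close>-th row of the seed.\<close>

definition cell_corner :: "nat \<Rightarrow> 'a::euclidean_space" where
  "cell_corner k = grid 0 (SOME x. cell 0 x = k)"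

lemma cell_0_hcube:
  assumes "k \<in> range (cell 0 :: 'a::euclidean_space \<Rightarrow> nat)"
  shows "cell 0 -` {k} = hcube (cell_corner k :: 'a) 1"
proof -
  define x :: 'a where "x = (SOME x. cell 0 x = k)"
  have x: "cell 0 x = k" unfolding x_def using assms by (metis (mono_tags) imageE someI_ex)
  have "cell 0 y = k \<longleftrightarrow> y \<in> hcube (grid 0 x) 1" for y
  proof -
    have "cell 0 y = k \<longleftrightarrow> (\<forall>b\<in>Basis. \<lfloor>y \<bullet> b\<rfloor> = \<lfloor>x \<bullet> b\<rfloor>)" unfolding x[symmetric] by (simp add: cell_eq_iff grid_eq_iff)
    also have "... \<longleftrightarrow> y \<in> hcube (grid 0 x) 1"
      by (auto simp: hcube_def grid_inner floor_eq_iff)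
    finally show ?thesis .
  qed
  then show ?thesis unfolding cell_corner_def x_def[symmetric] by blast
qed

definition cell_points :: "real \<Rightarrow> nat \<Rightarrow> (nat \<Rightarrow> nat \<Rightarrow> real) \<Rightarrow> 'a::euclidean_space set" where
  "cell_points r k v = (if k \<in> range (cell 0 :: 'a \<Rightarrow> nat)
     then throw (cell_corner k) 1 (quantile (poisson_pmf r) (v 0 0)) (\<lambda>i. v (Suc i)) else {})"

definition poisson_of :: "real \<Rightarrow> (nat \<Rightarrow> real) \<Rightarrow> 'a::euclidean_space set" where
  "poisson_of r u = (\<Union>k. cell_points r k (rows (rows u k)))"

lemma Uss_shift_measurable [measurable]: "(\<lambda>v i. v (Suc i)) \<in> measurable Uss Uss"
  by (rule measurable_PiM_single') (auto simp: space_PiM)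

lemma Uss_coordinate_measurable: "(\<lambda>v. v i j) \<in> borel_measurable Uss"
proof -
  have 1: "(\<lambda>v. v i) \<in> measurable Uss Us" by (rule measurable_component_singleton) (rule UNIV_I)
  have 2: "(\<lambda>w. w j) \<in> measurable Us U01" by (rule measurable_component_singleton) (rule UNIV_I)
  have "(\<lambda>v. v i j) \<in> measurable Uss U01" by (rule measurable_compose[OF 1 2])
  then show ?thesis by (subst (asm) measurable_cong_sets[OF refl sets_U01])
qed

lemma cell_points_void_sets:
  fixes B :: "'a::euclidean_space set"
  assumes B: "B \<in> sets borel"
  shows "{v \<in> space Uss. cell_points r k v \<inter> B = {}} \<in> sets Uss"
proof (cases "k \<in> range (cell 0 :: 'a \<Rightarrow> nat)")
  case True
  have "{v \<in> space Uss. cell_points r k v \<inter> B = {}} =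
    (\<Union>m. {v \<in> space Uss. quantile (poisson_pmf r) (v 0 0) = m} \<inter>
      ((\<lambda>v i. v (Suc i)) -` {v \<in> space Uss. throw (cell_corner k) 1 m v \<inter> B = {}} \<inter> space Uss))"
    using True by (auto simp: cell_points_def space_PiM)
  also have "... \<in> sets Uss"
  proof -
    have "{v \<in> space Uss. quantile (poisson_pmf r) (v 0 0) = m} \<in> sets Uss" for m
      using measurable_sets[OF measurable_compose[OF Uss_coordinate_measurable[of 0 0] quantile_measurable[of "poisson_pmf r"]], of "{m}"]
      by (simp add: vimage_def Int_def conj_commute)
    moreover have "(\<lambda>v i. v (Suc i)) -` {v \<in> space Uss. throw (cell_corner k) 1 m v \<inter> B = {}} \<inter> space Uss \<in> sets Uss" for m
      by (rule measurable_sets[OF Uss_shift_measurable throw_void_sets[OF B]])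
    ultimately show ?thesis by (intro sets.countable_UN) blast
  qed
  finally show ?thesis .
qed (simp add: cell_points_def)

lemma cell_points_void_prob:
  fixes B :: "'a::euclidean_space set"
  assumes B: "B \<in> sets borel" and r: "0 < r"
  shows "emeasure Uss {v \<in> space Uss. cell_points r k v \<inter> B = {}} = ennreal (exp (- (r * vol (B \<inter> cell 0 -` {k}))))"
proof (cases "k \<in> range (cell 0 :: 'a \<Rightarrow> nat)")
  case True
  interpret Uss: prob_space Uss by simp
  interpret Us: prob_space Us by simp
  interpret S: sequence_space Us by unfold_locales
  let ?a = "cell_corner k :: 'a"
  define x where "x = 1 - vol (B \<inter> hcube ?a 1)"
  have x: "0 \<le> x"
  proof -
    have "vol (B \<inter> hcube ?a 1) \<le> vol (hcube ?a 1)"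
      using B by (intro measure_mono_fmeasurable) (auto simp: fmeasurable_def emeasure_hcube)
    then show ?thesis by (simp add: x_def measure_hcube)
  qed
  let ?E = "{v \<in> space Uss. cell_points r k v \<inter> B = {}}"
  have E: "?E \<in> sets Uss" by (rule cell_points_void_sets[OF B])
  have it: "distr (Us \<Otimes>\<^sub>M Uss) Uss (\<lambda>(w, v). case_nat w v) = Uss" by (rule S.PiM_iter)
  have cm: "(\<lambda>(w, v). case_nat w v) \<in> measurable (Us \<Otimes>\<^sub>M Uss) Uss" by measurable
  have pre [measurable]: "(\<lambda>(w, v). case_nat w v) -` ?E \<inter> space (Us \<Otimes>\<^sub>M Uss) \<in> sets (Us \<Otimes>\<^sub>M Uss)"
    by (rule measurable_sets[OF cm E])
  have "emeasure Uss ?E = emeasure (distr (Us \<Otimes>\<^sub>M Uss) Uss (\<lambda>(w, v). case_nat w v)) ?E" unfolding it ..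
  also have "... = emeasure (Us \<Otimes>\<^sub>M Uss) ((\<lambda>(w, v). case_nat w v) -` ?E \<inter> space (Us \<Otimes>\<^sub>M Uss))"
    by (rule emeasure_distr[OF cm E])
  also have "... = (\<integral>\<^sup>+w. emeasure Uss (Pair w -` ((\<lambda>(w, v). case_nat w v) -` ?E \<inter> space (Us \<Otimes>\<^sub>M Uss))) \<partial>Us)"
    by (rule Uss.emeasure_pair_measure_alt) (rule pre)
  also have "... = (\<integral>\<^sup>+w. ennreal (x ^ quantile (poisson_pmf r) (w 0)) \<partial>Us)"
  proof (rule nn_integral_cong)
    fix w assume w: "w \<in> space Us"
    have "Pair w -` ((\<lambda>(w, v). case_nat w v) -` ?E \<inter> space (Us \<Otimes>\<^sub>M Uss)) =
      {v \<in> space Uss. throw ?a 1 (quantile (poisson_pmf r) (w 0)) v \<inter> B = {}}"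
      using w True by (auto simp: space_pair_measure cell_points_def space_PiM PiE_iff split: nat.splits)
    then show "emeasure Uss (Pair w -` ((\<lambda>(w, v). case_nat w v) -` ?E \<inter> space (Us \<Otimes>\<^sub>M Uss))) =
      ennreal (x ^ quantile (poisson_pmf r) (w 0))"
      by (simp add: throw_void_prob[OF B] x_def)
  qed
  also have "... = (\<integral>\<^sup>+u. ennreal (x ^ quantile (poisson_pmf r) u) \<partial>distr Us U01 (\<lambda>w. w 0))"
  proof (rule nn_integral_distr[symmetric])
    have "(\<lambda>u. ennreal (x ^ quantile (poisson_pmf r) u)) \<in> borel_measurable borel"
      by (rule measurable_compose[OF quantile_measurable]) simp
    then show "(\<lambda>u. ennreal (x ^ quantile (poisson_pmf r) u)) \<in> borel_measurable (distr Us U01 (\<lambda>w. w 0))"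
      by (subst measurable_cong_sets[OF _ refl, of _ borel]) (simp_all only: sets_distr sets_U01)
  qed (rule measurable_component_singleton, simp)
  also have "distr Us U01 (\<lambda>w. w 0) = U01" by (rule distr_PiM_component) auto
  also have "(\<integral>\<^sup>+u. ennreal (x ^ quantile (poisson_pmf r) u) \<partial>U01) = ennreal (exp (- (r * (1 - x))))"
    using nn_integral_quantile[of "\<lambda>m. ennreal (x ^ m)"] poisson_pgf[OF r x] by simp
  finally show ?thesis using cell_0_hcube[OF True] by (simp add: x_def)
next
  case False
  interpret Uss: prob_space Uss by simp
  have "cell 0 -` {k} = ({} :: 'a set)" using False by auto
  then show ?thesis using False by (simp add: cell_points_def Uss.emeasure_space_1)
qed

lemma cell_points_subset: "cell_points r k v \<subseteq> (cell 0 -` {k} :: 'a::euclidean_space set)"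
proof (cases "k \<in> range (cell 0 :: 'a \<Rightarrow> nat)")
  case True
  then show ?thesis unfolding cell_0_hcube[OF True] by (simp add: cell_points_def throw_subset)
qed (simp add: cell_points_def)

lemma poisson_of_locally_finite: "locally_finite (poisson_of r u :: 'a::euclidean_space set)"
  unfolding locally_finite_def
proof (intro allI impI)
  fix B :: "'a set" assume B: "bounded B"
  have "poisson_of r u \<inter> B \<subseteq> (\<Union>k\<in>cell 0 ` B. cell_points r k (rows (rows u k)))"
    using cell_points_subset by (fastforce simp: poisson_of_def)
  moreover have "finite (cell_points r k v)" for k v by (simp add: cell_points_def finite_throw)
  ultimately show "finite (poisson_of r u \<inter> B)"
    by (meson finite_UN finite_cell_bounded[OF B] finite_subset)
qed

lemma rows_rows_measurable [measurable]:
  "(\<lambda>u k. rows (rows u k)) \<in> measurable Us (PiM UNIV (\<lambda>_::nat. Uss))"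
proof (rule measurable_PiM_single')
  show "(\<lambda>u. rows (rows u k)) \<in> measurable Us Uss" for k
  proof -
    have "(\<lambda>u. rows u k) \<in> measurable Us Us"
      using measurable_compose[OF rows_measurable[of U01] measurable_component_singleton[of k UNIV "\<lambda>_. Us"]] by simp
    then show ?thesis by (rule measurable_compose[OF _ rows_measurable])
  qed
qed (auto simp: space_PiM)

lemma distr_rows_rows: "distr Us (PiM UNIV (\<lambda>_::nat. Uss)) (\<lambda>u k. rows (rows u k)) = PiM UNIV (\<lambda>_::nat. Uss)"
proof -
  have m: "(\<lambda>w k. rows (w k)) \<in> measurable Uss (PiM UNIV (\<lambda>_::nat. Uss))"
  proof (rule measurable_PiM_single')
    show "(\<lambda>w. rows (w k)) \<in> measurable Uss Uss" for k
      using measurable_compose[OF measurable_component_singleton[of k UNIV "\<lambda>_. Us"] rows_measurable[of U01]] by simp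
  qed (auto simp: space_PiM)
  have "distr Us (PiM UNIV (\<lambda>_::nat. Uss)) (\<lambda>u k. rows (rows u k)) = distr (distr Us Uss rows) (PiM UNIV (\<lambda>_::nat. Uss)) (\<lambda>w k. rows (w k))"
    by (subst distr_distr[OF m rows_measurable]) (simp add: comp_def)
  also have "... = distr Uss (PiM UNIV (\<lambda>_::nat. Uss)) (\<lambda>w k. rows (w k))"
    by (simp only: distr_rows[OF prob_space_U01])
  also have "... = PiM UNIV (\<lambda>_::nat. distr Us Uss rows)"
    by (rule PiM_distr) (rule prob_space_Us, rule rows_measurable)
  also have "... = PiM UNIV (\<lambda>_::nat. Uss)"
    by (simp only: distr_rows[OF prob_space_U01])
  finally show ?thesis .
qed

lemma poisson_of_void:
  assumes r: "0 < r"
  shows "poisson_void r Us (poisson_of r :: _ \<Rightarrow> 'a::euclidean_space set)"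
proof -
  interpret Us: prob_space Us by simp
  have fin: "{u \<in> space Us. poisson_of r u \<inter> B = {}} =
      (\<lambda>u k. rows (rows u k)) -` {w \<in> space (PiM UNIV (\<lambda>_::nat. Uss)). \<forall>k\<in>cell 0 ` B. w k \<in> {v \<in> space Uss. cell_points r k v \<inter> B = {}}} \<inter> space Us"
    for B :: "'a set"
  proof -
    have "cell_points r k v \<inter> B = {}" if "k \<notin> cell 0 ` B" for k and v
      using cell_points_subset[of r k v] that by fastforce
    then have "poisson_of r u \<inter> B = {} \<longleftrightarrow> (\<forall>k\<in>cell 0 ` B. cell_points r k (rows (rows u k)) \<inter> B = {})" for u
      unfolding poisson_of_def by blast
    then show ?thesis by (auto simp: space_PiM)
  qed
  have ev: "{w \<in> space (PiM UNIV (\<lambda>_::nat. Uss)). \<forall>k\<in>cell 0 ` B. w k \<in> {v \<in> space Uss. cell_points r k v \<inter> B = {}}} \<in> sets (PiM UNIV (\<lambda>_::nat. Uss))"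
    if "B \<in> sets borel" "bounded B" for B :: "'a set"
    using that finite_cell_bounded[of B 0] 
    by (intro sets.sets_Collect_finite_All sets_Collect_single') (auto intro!: cell_points_void_sets)
  have m: "poisson_of r \<in> measurable Us (configs :: 'a set measure)"
  proof (rule measurable_configsI[OF poisson_of_locally_finite])
    show "{u \<in> space Us. poisson_of r u \<inter> B = {}} \<in> sets Us" if "B \<in> sets borel" "bounded B" for B :: "'a set"
      unfolding fin by (rule measurable_sets[OF rows_rows_measurable ev[OF that]])
  qed
  show ?thesis unfolding poisson_void_def
  proof (intro conjI ballI impI m)
    fix B :: "'a set" assume B [measurable]: "B \<in> sets borel" and bB: "bounded B"
    let ?K = "cell 0 ` B"
    have K: "finite ?K" using bB by (rule finite_cell_bounded)
    have C [measurable]: "B \<inter> cell 0 -` {k} \<in> sets borel" for k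
      using sets.Int[OF B measurable_sets_borel[OF cell_measurable, of "{k}" 0]] by simp
    have "emeasure Us {u \<in> space Us. poisson_of r u \<inter> B = {}} =
      emeasure (PiM UNIV (\<lambda>_::nat. Uss)) {w \<in> space (PiM UNIV (\<lambda>_::nat. Uss)). \<forall>k\<in>?K. w k \<in> {v \<in> space Uss. cell_points r k v \<inter> B = {}}}"
      unfolding fin using emeasure_distr[OF rows_rows_measurable ev[OF B bB]] by (simp add: distr_rows_rows)
    also have "... = (\<Prod>k\<in>?K. emeasure Uss {v \<in> space Uss. cell_points r k v \<inter> B = {}})"
      using K by (intro PiM_prob_Ball) (auto intro: cell_points_void_sets)
    also have "... = ennreal (\<Prod>k\<in>?K. exp (- (r * vol (B \<inter> cell 0 -` {k}))))"
      by (simp add: cell_points_void_prob[OF B r] prod_ennreal)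
    also have "(\<Prod>k\<in>?K. exp (- (r * vol (B \<inter> cell 0 -` {k})))) = exp (- (r * (\<Sum>k\<in>?K. vol (B \<inter> cell 0 -` {k}))))"
      by (simp add: sum_distrib_left exp_sum[OF K, symmetric] sum_negf)
    also have "(\<Sum>k\<in>?K. vol (B \<inter> cell 0 -` {k})) = vol (\<Union>k\<in>?K. B \<inter> cell 0 -` {k})"
    proof (rule measure_finite_Union[symmetric, OF K])
      show "disjoint_family_on (\<lambda>k. B \<inter> cell 0 -` {k}) ?K" by (auto simp: disjoint_family_on_def)
      show "emeasure lborel (B \<inter> cell 0 -` {k}) \<noteq> \<infinity>" for k
        using emeasure_bounded_finite[OF bounded_subset[OF bB], of "B \<inter> cell 0 -` {k}"] by auto
    qed (use C in auto)
    also have "(\<Union>k\<in>?K. B \<inter> cell 0 -` {k}) = B" by auto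
    finally show "measure Us {u \<in> space Us. poisson_of r u \<inter> B = {}} = exp (- (r * vol B))"
      by (simp add: measure_def)
  qed simp
qed

section \<open>Moments of Poisson counts\<close>

lemma card_measurable:
  fixes X :: "'w \<Rightarrow> 'a::euclidean_space set"
  assumes X: "X \<in> measurable M configs" and B: "B \<in> sets borel" "bounded B"
  shows "(\<lambda>\<nu>. card (X \<nu> \<inter> B)) \<in> measurable M (count_space UNIV)"
proof (rule measurable_count_space_eq2_countable[THEN iffD2])
  have "(\<lambda>\<nu>. card (X \<nu> \<inter> B)) -` {k} \<inter> space M = {\<nu> \<in> space M. count_in B (X \<nu>) = of_nat k}" for k
    using count_in_finite[OF measurable_space[OF X] B(2)] by auto
  moreover have "{\<nu> \<in> space M. count_in B (X \<nu>) = of_nat k} \<in> sets M" for k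
    using measurable_sets[OF count_in_measurable_comp[OF X B(1)], of "{of_nat k}"]
    by (simp add: vimage_def Int_def conj_commute)
  ultimately show "(\<lambda>\<nu>. card (X \<nu> \<inter> B)) \<in> space M \<rightarrow> UNIV \<and> (\<forall>a\<in>UNIV. (\<lambda>\<nu>. card (X \<nu> \<inter> B)) -` {a} \<inter> space M \<in> sets M)"
    by simp
qed

lemma poisson_void_distr_card:
  fixes X :: "'w \<Rightarrow> 'a::euclidean_space set"
  assumes X: "poisson_void l M X" and l: "0 < l" and B: "B \<in> sets borel" "bounded B" "0 < vol B"
  shows "distr M (count_space UNIV) (\<lambda>\<nu>. card (X \<nu> \<inter> B)) = measure_pmf (poisson_pmf (l * vol B))"
proof (rule measure_eqI_countable[where A=UNIV])
  interpret prob_space M using X by (simp add: poisson_void_def)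
  have Xm: "X \<in> measurable M configs" using X by (auto simp: poisson_void_def)
  note cm = card_measurable[OF Xm B(1,2)]
  fix k
  have "(\<lambda>\<nu>. card (X \<nu> \<inter> B)) -` {k} \<inter> space M = {\<nu> \<in> space M. count_in B (X \<nu>) = of_nat k}"
    using count_in_finite[OF measurable_space[OF Xm] B(2)] by auto
  then have "emeasure (distr M (count_space UNIV) (\<lambda>\<nu>. card (X \<nu> \<inter> B))) {k} = prob {\<nu> \<in> space M. count_in B (X \<nu>) = of_nat k}"
    using emeasure_distr[OF cm, of "{k}"] by (simp add: emeasure_eq_measure)
  also have "... = emeasure (measure_pmf (poisson_pmf (l * vol B))) {k}"
    using l B by (simp add: poisson_void_count_bounded[OF X] emeasure_pmf_single)
  finally show "emeasure (distr M (count_space UNIV) (\<lambda>\<nu>. card (X \<nu> \<inter> B))) {k} =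
    emeasure (measure_pmf (poisson_pmf (l * vol B))) {k}" .
qed auto

lemma poisson_void_nn_integral_card:
  fixes X :: "'w \<Rightarrow> 'a::euclidean_space set"
  assumes X: "poisson_void l M X" and l: "0 < l" and B: "B \<in> sets borel" "bounded B" "0 < vol B"
  shows "(\<integral>\<^sup>+\<nu>. g (card (X \<nu> \<inter> B)) \<partial>M) = (\<integral>\<^sup>+k. g k \<partial>(poisson_pmf (l * vol B)))"
proof -
  have Xm: "X \<in> measurable M configs" using X by (auto simp: poisson_void_def)
  show ?thesis unfolding poisson_void_distr_card[OF assms, symmetric]
    by (rule nn_integral_distr[symmetric, OF card_measurable[OF Xm B(1,2)]]) simp
qed

lemma poisson_moments:
  assumes r: "0 < r"
  shows poisson_mean: "(\<integral>\<^sup>+k. ennreal (real k) \<partial>(poisson_pmf r)) = ennreal r"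
    and poisson_second_moment: "(\<integral>\<^sup>+k. ennreal ((real k)\<^sup>2) \<partial>(poisson_pmf r)) = ennreal (r\<^sup>2 + r)"
    and poisson_variance: "(\<integral>\<^sup>+k. ennreal ((real k - r)\<^sup>2) \<partial>(poisson_pmf r)) = ennreal r"
proof -
  let ?p = "\<lambda>k. pmf (poisson_pmf r) k"
  have p: "?p (Suc k) * real (Suc k) = r * ?p k" for k
  proof -
    have "?p (Suc k) * real (Suc k) = r ^ Suc k * exp (-r) * (real (Suc k) / (real (Suc k) * fact k))"
      using r by (simp del: of_nat_Suc)
    also have "real (Suc k) / (real (Suc k) * fact k) = 1 / fact k" by simp
    finally show ?thesis using r by simp
  qed
  have s0: "(\<lambda>k. ?p k) sums 1"
    using poisson_pgf[OF r, of 1]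
  proof -
    have "(\<lambda>k. r ^ k /\<^sub>R fact k * exp (-r)) sums (exp r * exp (-r))" by (intro sums_mult2 exp_converges)
    then show ?thesis using r by (simp add: field_simps flip: exp_add)
  qed
  have s1: "(\<lambda>k. ?p k * real k) sums r"
  proof -
    have "(\<lambda>k. ?p (Suc k) * real (Suc k)) sums (r * 1)" unfolding p by (intro sums_mult s0)
    then show ?thesis by (subst (asm) sums_Suc_iff) simp
  qed
  have s2: "(\<lambda>k. ?p k * (real k * (real k - 1))) sums (r\<^sup>2)"
  proof -
    have "(\<lambda>k. ?p (Suc k) * (real (Suc k) * (real (Suc k) - 1))) = (\<lambda>k. r * (?p k * real k))"
    proof
      fix k
      have "?p (Suc k) * (real (Suc k) * (real (Suc k) - 1)) = (?p (Suc k) * real (Suc k)) * real k" by simp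
      then show "?p (Suc k) * (real (Suc k) * (real (Suc k) - 1)) = r * (?p k * real k)" by (simp only: p mult.assoc)
    qed
    moreover have "(\<lambda>k. r * (?p k * real k)) sums (r * r)" by (intro sums_mult s1)
    ultimately have "(\<lambda>k. ?p (Suc k) * (real (Suc k) * (real (Suc k) - 1))) sums (r * r)" by simp
    then show ?thesis by (subst (asm) sums_Suc_iff) (simp add: power2_eq_square)
  qed
  have nn: "(\<integral>\<^sup>+k. ennreal (g k) \<partial>(poisson_pmf r)) = ennreal c"
    if "(\<lambda>k. ?p k * g k) sums c" "\<And>k. 0 \<le> g k" for g c
  proof -
    have "(\<integral>\<^sup>+k. ennreal (g k) \<partial>(poisson_pmf r)) = (\<Sum>k. ennreal (?p k * g k))"
      using that by (simp only: nn_integral_measure_pmf nn_integral_count_space_nat ennreal_mult pmf_nonneg)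
    also have "... = ennreal c" using that by (intro suminf_ennreal_eq) auto
    finally show ?thesis .
  qed
  show "(\<integral>\<^sup>+k. ennreal (real k) \<partial>(poisson_pmf r)) = ennreal r" by (rule nn[OF s1]) simp
  have s2': "(\<lambda>k. ?p k * (real k)\<^sup>2) sums (r\<^sup>2 + r)"
    using sums_add[OF s2 s1] by (simp add: algebra_simps power2_eq_square)
  then show "(\<integral>\<^sup>+k. ennreal ((real k)\<^sup>2) \<partial>(poisson_pmf r)) = ennreal (r\<^sup>2 + r)" by (rule nn) simp
  have "(\<lambda>k. ?p k * (real k)\<^sup>2 + (- (2 * r)) * (?p k * real k) + r\<^sup>2 * ?p k) sums ((r\<^sup>2 + r) + (- (2 * r)) * r + r\<^sup>2 * 1)"
    by (intro sums_add sums_mult s2' s1 s0)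
  moreover have "?p k * (real k)\<^sup>2 + (- (2 * r)) * (?p k * real k) + r\<^sup>2 * ?p k = ?p k * (real k - r)\<^sup>2" for k
    by (simp add: power2_eq_square algebra_simps)
  ultimately have "(\<lambda>k. ?p k * (real k - r)\<^sup>2) sums r" by (simp add: power2_eq_square)
  then show "(\<integral>\<^sup>+k. ennreal ((real k - r)\<^sup>2) \<partial>(poisson_pmf r)) = ennreal r" by (rule nn) simp
qed

lemma (in prob_space) nn_Markov:
  assumes u: "u \<in> borel_measurable M" and le: "(\<integral>\<^sup>+\<nu>. u \<nu> \<partial>M) \<le> ennreal m" and c: "0 < c" and m: "0 \<le> m"
  shows "prob {\<nu> \<in> space M. ennreal c \<le> u \<nu>} \<le> m / c"
proof -
  have S: "{\<nu> \<in> space M. ennreal c \<le> u \<nu>} \<in> events" using u by measurable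
  have "ennreal c * emeasure M {\<nu> \<in> space M. ennreal c \<le> u \<nu>} = (\<integral>\<^sup>+\<nu>. ennreal c * indicator {\<nu> \<in> space M. ennreal c \<le> u \<nu>} \<nu> \<partial>M)"
    by (rule nn_integral_cmult_indicator[OF S, symmetric])
  also have "... \<le> (\<integral>\<^sup>+\<nu>. u \<nu> \<partial>M)" by (intro nn_integral_mono) (auto simp: indicator_def)
  also note le
  finally have "ennreal (c * prob {\<nu> \<in> space M. ennreal c \<le> u \<nu>}) \<le> ennreal m"
    using c by (simp add: emeasure_eq_measure ennreal_mult)
  then show ?thesis using c m by (simp add: field_simps)
qed

lemma poisson_void_Chebyshev:
  fixes X :: "'w \<Rightarrow> 'a::euclidean_space set"
  assumes X: "poisson_void l M X" and l: "0 < l" and B: "B \<in> sets borel" "bounded B" "0 < vol B" and c: "0 < c"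
  shows "measure M {\<nu> \<in> space M. c \<le> \<bar>real (card (X \<nu> \<inter> B)) - l * vol B\<bar>} \<le> l * vol B / c\<^sup>2"
proof -
  interpret prob_space M using X by (simp add: poisson_void_def)
  have Xm: "X \<in> measurable M configs" using X by (auto simp: poisson_void_def)
  let ?r = "l * vol B"
  have r: "0 < ?r" using l B by simp
  have um: "(\<lambda>\<nu>. ennreal ((real (card (X \<nu> \<inter> B)) - ?r)\<^sup>2)) \<in> borel_measurable M"
    by (rule measurable_compose[OF card_measurable[OF Xm B(1,2)]]) simp
  have "prob {\<nu> \<in> space M. ennreal (c\<^sup>2) \<le> ennreal ((real (card (X \<nu> \<inter> B)) - ?r)\<^sup>2)} \<le> ?r / c\<^sup>2"
  proof (rule nn_Markov[OF um])
    show "(\<integral>\<^sup>+\<nu>. ennreal ((real (card (X \<nu> \<inter> B)) - ?r)\<^sup>2) \<partial>M) \<le> ennreal ?r"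
      using poisson_void_nn_integral_card[OF X l B, of "\<lambda>k. ennreal ((real k - ?r)\<^sup>2)"] poisson_variance[OF r]
      by (simp only: order_refl)
  qed (use r c in simp_all)
  moreover have "ennreal (c\<^sup>2) \<le> ennreal (y\<^sup>2) \<longleftrightarrow> c \<le> \<bar>y\<bar>" for y :: real
    using c abs_le_square_iff[of c y] by simp
  ultimately show ?thesis by (simp only:)
qed

section \<open>The union bound\<close>

lemma nn_integral_PiE_prod:
  fixes b :: "'i \<Rightarrow> nat \<Rightarrow> ennreal"
  assumes I: "finite I"
  shows "(\<integral>\<^sup>+q. (\<Prod>i\<in>I. b i (q i)) \<partial>count_space (I \<rightarrow>\<^sub>E UNIV)) = (\<Prod>i\<in>I. \<Sum>k. b i k)"
proof -
  interpret product_sigma_finite "\<lambda>_::'i. count_space (UNIV::nat set)"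
    by (intro product_sigma_finite.intro sigma_finite_measure_count_space)
  have "(\<integral>\<^sup>+q. (\<Prod>i\<in>I. b i (q i)) \<partial>PiM I (\<lambda>_. count_space UNIV)) = (\<Prod>i\<in>I. \<integral>\<^sup>+k. b i k \<partial>count_space UNIV)"
    using I by (intro product_nn_integral_prod) auto
  then show ?thesis
    by (simp add: count_space_PiM_finite[OF I] nn_integral_count_space_nat)
qed

lemma exp_series_ennreal: "0 \<le> x \<Longrightarrow> (\<Sum>k. ennreal (x ^ k / fact k)) = ennreal (exp x)"
  using exp_converges[of x] by (intro suminf_ennreal_eq) (auto simp: divide_inverse mult.commute)

text \<open>The pair of patterns \<open>(x, z)\<close> determines the pattern \<open>x + z\<close>, whose probability is known; so the
  probability that \<open>z\<close> puts at least \<open>c\<close> points into a set of small total volume that is read off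
  \<open>x\<close> is at most a sum over pairs of patterns. The factor \<open>t\<close> to the power of the number of
  captured points is a Chernoff weight.\<close>

lemma captured_points_bound:
  fixes x z :: "'i \<Rightarrow> 'w \<Rightarrow> nat" and s :: "'i \<Rightarrow> real"
  assumes M: "prob_space M" and I: "finite I" and r: "0 \<le> r" and s: "\<And>i. i \<in> I \<Longrightarrow> 0 \<le> s i"
    and [measurable]: "\<And>i. i \<in> I \<Longrightarrow> x i \<in> measurable M (count_space UNIV)" "\<And>i. i \<in> I \<Longrightarrow> z i \<in> measurable M (count_space UNIV)"
    and law: "\<And>k. measure M {\<nu> \<in> space M. \<forall>i\<in>I. x i \<nu> + z i \<nu> = k i} = (\<Prod>i\<in>I. (r * s i) ^ k i / fact (k i) * exp (- (r * s i)))"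
    and H: "\<And>p. H p \<subseteq> I" "\<And>p. (\<Sum>i\<in>H p. s i) \<le> b" and t: "1 \<le> t"
  shows "measure M {\<nu> \<in> space M. c \<le> (\<Sum>i\<in>H (\<lambda>i\<in>I. x i \<nu>). z i \<nu>)} * t ^ c \<le> exp (r * ((\<Sum>i\<in>I. s i) + t * b))"
proof -
  interpret prob_space M by fact
  define K where "K = I \<rightarrow>\<^sub>E (UNIV :: nat set)"
  have K: "countable K" unfolding K_def using I by (intro countable_PiE) auto
  define E where "E p q = {\<nu> \<in> space M. (\<forall>i\<in>I. x i \<nu> = p i) \<and> (\<forall>i\<in>I. z i \<nu> = q i)}" for p q
  have E_sets [measurable]: "E p q \<in> events" for p q
    unfolding E_def using I by (intro sets.sets_Collect_conj sets.sets_Collect_finite_All) measurable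
  define F where "F p q = (if c \<le> (\<Sum>i\<in>H p. q i) then E p q else {})" for p q
  have F_sets [measurable]: "F p q \<in> events" for p q by (simp add: F_def)
  let ?A = "{\<nu> \<in> space M. c \<le> (\<Sum>i\<in>H (\<lambda>i\<in>I. x i \<nu>). z i \<nu>)}"
  have Hr: "(\<Sum>i\<in>H p. z i \<nu>) = (\<Sum>i\<in>H p. q i)" if "\<forall>i\<in>I. z i \<nu> = q i" for p q \<nu>
    using that H(1)[of p] by (intro sum.cong) auto
  have A: "?A = (\<Union>p\<in>K. \<Union>q\<in>K. F p q)"
  proof (intro set_eqI iffI)
    fix \<nu> assume w: "\<nu> \<in> ?A"
    let ?p = "\<lambda>i\<in>I. x i \<nu>" and ?q = "\<lambda>i\<in>I. z i \<nu>"
    have "\<nu> \<in> F ?p ?q" using w Hr[of \<nu> ?q ?p] by (auto simp: F_def E_def)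
    moreover have "?p \<in> K" "?q \<in> K" by (auto simp: K_def)
    ultimately show "\<nu> \<in> (\<Union>p\<in>K. \<Union>q\<in>K. F p q)" by blast
  next
    fix \<nu> assume "\<nu> \<in> (\<Union>p\<in>K. \<Union>q\<in>K. F p q)"
    then obtain p q where pq: "p \<in> K" "q \<in> K" "\<nu> \<in> F p q" by blast
    then have w: "\<nu> \<in> E p q" "c \<le> (\<Sum>i\<in>H p. q i)" by (auto simp: F_def split: if_splits)
    then have "(\<lambda>i\<in>I. x i \<nu>) = p" using pq(1) by (intro ext) (auto simp: E_def K_def PiE_iff extensional_def)
    then show "\<nu> \<in> ?A" using w Hr[of \<nu> q p] by (auto simp: E_def)
  qed
  have disj: "disjoint_family_on (\<lambda>p. \<Union>q\<in>K. F p q) K" "disjoint_family_on (F p) K" for p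
  proof -
    have *: "p = p' \<and> q = q'" if "\<nu> \<in> F p q" "\<nu> \<in> F p' q'" "p \<in> K" "p' \<in> K" "q \<in> K" "q' \<in> K" for \<nu> p q p' q'
      using that by (auto simp: F_def E_def K_def split: if_splits intro!: PiE_ext[of _ I "\<lambda>_. UNIV"])
    show "disjoint_family_on (\<lambda>p. \<Union>q\<in>K. F p q) K" unfolding disjoint_family_on_def using * by blast
    show "disjoint_family_on (F p) K" unfolding disjoint_family_on_def F_def E_def K_def
      by (auto split: if_splits intro!: PiE_ext[of _ I "\<lambda>_. UNIV"])
  qed
  define a where "a i k = ennreal ((r * s i) ^ k / fact k * exp (- (r * s i)))" for i and k :: nat
  define e where "e p i k = ennreal ((r * s i * (if i \<in> H p then t else 1)) ^ k / fact k)" for p i and k :: nat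
  have rs: "0 \<le> r * s i" if "i \<in> I" for i using r s[OF that] by simp
  have bound: "ennreal (t ^ c) * emeasure M (F p q) \<le> (\<Prod>i\<in>I. a i (p i)) * (\<Prod>i\<in>I. e p i (q i))" for p q
  proof (cases "c \<le> (\<Sum>i\<in>H p. q i)")
    case True
    have "emeasure M (F p q) \<le> emeasure M {\<nu> \<in> space M. \<forall>i\<in>I. x i \<nu> + z i \<nu> = p i + q i}"
      using I by (intro emeasure_mono sets.sets_Collect_finite_All) (auto simp: F_def E_def)
    also have "... = ennreal (\<Prod>i\<in>I. (r * s i) ^ (p i + q i) / fact (p i + q i) * exp (- (r * s i)))"
      using law[of "\<lambda>i. p i + q i"] by (simp add: emeasure_eq_measure)
    finally have 1: "emeasure M (F p q) \<le> ennreal (\<Prod>i\<in>I. (r * s i) ^ (p i + q i) / fact (p i + q i) * exp (- (r * s i)))" .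
    have "ennreal (t ^ c) * emeasure M (F p q) \<le> ennreal (t ^ (\<Sum>i\<in>H p. q i)) * ennreal (\<Prod>i\<in>I. (r * s i) ^ (p i + q i) / fact (p i + q i) * exp (- (r * s i)))"
      using t True by (intro mult_mono 1 ennreal_leI power_increasing) auto
    also have "... = ennreal (t ^ (\<Sum>i\<in>H p. q i) * (\<Prod>i\<in>I. (r * s i) ^ (p i + q i) / fact (p i + q i) * exp (- (r * s i))))"
      using t rs by (intro ennreal_mult[symmetric] prod_nonneg) auto
    also have "t ^ (\<Sum>i\<in>H p. q i) = (\<Prod>i\<in>I. (if i \<in> H p then t else 1) ^ q i)"
    proof -
      have "t ^ (\<Sum>i\<in>H p. q i) = (\<Prod>i\<in>H p. (if i \<in> H p then t else 1) ^ q i)" by (simp add: power_sum)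
      also have "... = (\<Prod>i\<in>I. (if i \<in> H p then t else 1) ^ q i)" using H(1)[of p] I by (intro prod.mono_neutral_left) auto
      finally show ?thesis .
    qed
    also have "(\<Prod>i\<in>I. (if i \<in> H p then t else 1) ^ q i) * (\<Prod>i\<in>I. (r * s i) ^ (p i + q i) / fact (p i + q i) * exp (- (r * s i))) =
        (\<Prod>i\<in>I. (if i \<in> H p then t else 1) ^ q i * ((r * s i) ^ (p i + q i) / fact (p i + q i) * exp (- (r * s i))))"
      by (rule prod.distrib[symmetric])
    also have "... \<le> (\<Prod>i\<in>I. ((r * s i) ^ p i / fact (p i) * exp (- (r * s i))) * ((r * s i * (if i \<in> H p then t else 1)) ^ q i / fact (q i)))"
    proof (intro prod_mono conjI)
      fix i assume i: "i \<in> I"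
      let ?w = "if i \<in> H p then t else 1"
      have w: "0 \<le> ?w" using t by auto
      show "0 \<le> ?w ^ q i * ((r * s i) ^ (p i + q i) / fact (p i + q i) * exp (- (r * s i)))"
        using rs[OF i] w by simp
      have "fact (p i) * fact (q i) \<le> (fact (p i + q i) :: real)"
        by (metis fact_fact_dvd_fact fact_nonzero dvd_imp_le fact_gt_zero of_nat_fact of_nat_le_iff of_nat_mult)
      then have "1 / (fact (p i + q i) :: real) \<le> 1 / (fact (p i) * fact (q i))" by (intro divide_left_mono) auto
      then have "(?w ^ q i * (r * s i) ^ (p i + q i) * exp (- (r * s i))) * (1 / fact (p i + q i)) \<le>
          (?w ^ q i * (r * s i) ^ (p i + q i) * exp (- (r * s i))) * (1 / (fact (p i) * fact (q i)))"
        using rs[OF i] w by (intro mult_left_mono) auto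
      then show "?w ^ q i * ((r * s i) ^ (p i + q i) / fact (p i + q i) * exp (- (r * s i))) \<le>
        ((r * s i) ^ p i / fact (p i) * exp (- (r * s i))) * ((r * s i * ?w) ^ q i / fact (q i))"
        by (simp add: power_add power_mult_distrib mult_ac)
    qed
    also have "ennreal (\<Prod>i\<in>I. ((r * s i) ^ p i / fact (p i) * exp (- (r * s i))) * ((r * s i * (if i \<in> H p then t else 1)) ^ q i / fact (q i))) =
        (\<Prod>i\<in>I. a i (p i)) * (\<Prod>i\<in>I. e p i (q i))"
    proof -
      have pa: "(\<Prod>i\<in>I. a i (p i)) = ennreal (\<Prod>i\<in>I. (r * s i) ^ p i / fact (p i) * exp (- (r * s i)))"
        unfolding a_def by (rule prod_ennreal) (use rs in simp)
      have pe: "(\<Prod>i\<in>I. e p i (q i)) = ennreal (\<Prod>i\<in>I. (r * s i * (if i \<in> H p then t else 1)) ^ q i / fact (q i))"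
        unfolding e_def by (rule prod_ennreal) (use rs t in simp)
      show ?thesis unfolding pa pe
        by (subst prod.distrib, rule ennreal_mult) (use rs t in \<open>auto intro!: prod_nonneg\<close>)
    qed
    finally show ?thesis by (simp add: ennreal_leI)
  next
    case False
    then show ?thesis by (simp add: F_def)
  qed
  have suma: "(\<Sum>k. a i k) = 1" if "i \<in> I" for i
  proof -
    have "(\<Sum>k. a i k) = (\<Sum>k. ennreal (exp (- (r * s i))) * ennreal ((r * s i) ^ k / fact k))"
      using rs[OF that] by (simp add: a_def ennreal_mult[symmetric] mult.commute)
    also have "... = ennreal (exp (- (r * s i))) * ennreal (exp (r * s i))"
      using exp_series_ennreal[OF rs[OF that]] by simp
    also have "... = 1" by (simp add: ennreal_mult[symmetric] flip: exp_add)
    finally show ?thesis .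
  qed
  have sume: "(\<Prod>i\<in>I. \<Sum>k. e p i k) \<le> ennreal (exp (r * ((\<Sum>i\<in>I. s i) + t * b)))" for p
  proof -
    have "(\<Prod>i\<in>I. \<Sum>k. e p i k) = (\<Prod>i\<in>I. ennreal (exp (r * s i * (if i \<in> H p then t else 1))))"
      unfolding e_def using rs t by (intro prod.cong refl exp_series_ennreal) auto
    also have "... = ennreal (exp (\<Sum>i\<in>I. r * s i * (if i \<in> H p then t else 1)))"
      using I by (simp add: prod_ennreal exp_sum)
    also have "(\<Sum>i\<in>I. r * s i * (if i \<in> H p then t else 1)) \<le> (\<Sum>i\<in>I. r * s i + r * t * (if i \<in> H p then s i else 0))"
      using rs t r s by (intro sum_mono) (auto simp: mult_ac)
    also have "... = r * (\<Sum>i\<in>I. s i) + r * t * (\<Sum>i\<in>H p. s i)"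
    proof -
      have "(\<Sum>i\<in>I. if i \<in> H p then s i else 0) = (\<Sum>i\<in>H p. s i)"
        using H(1)[of p] I by (simp add: sum.If_cases Int_absorb1)
      then show ?thesis by (simp add: sum.distrib flip: sum_distrib_left)
    qed
    also have "... \<le> r * ((\<Sum>i\<in>I. s i) + t * b)"
      using mult_left_mono[OF H(2)[of p], of "r * t"] r t by (simp add: algebra_simps)
    finally show ?thesis by (simp add: ennreal_leI)
  qed
  have "ennreal (t ^ c) * emeasure M ?A = ennreal (t ^ c) * (\<integral>\<^sup>+p. \<integral>\<^sup>+q. emeasure M (F p q) \<partial>count_space K \<partial>count_space K)"
  proof -
    have "emeasure M ?A = (\<integral>\<^sup>+p. emeasure M (\<Union>q\<in>K. F p q) \<partial>count_space K)"
      unfolding A using K by (intro emeasure_UN_countable disj) auto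
    also have "... = (\<integral>\<^sup>+p. \<integral>\<^sup>+q. emeasure M (F p q) \<partial>count_space K \<partial>count_space K)"
      using K by (intro nn_integral_cong emeasure_UN_countable disj) auto
    finally show ?thesis by simp
  qed
  also have "... = (\<integral>\<^sup>+p. \<integral>\<^sup>+q. ennreal (t ^ c) * emeasure M (F p q) \<partial>count_space K \<partial>count_space K)"
    by (simp add: nn_integral_cmult)
  also have "... \<le> (\<integral>\<^sup>+p. \<integral>\<^sup>+q. (\<Prod>i\<in>I. a i (p i)) * (\<Prod>i\<in>I. e p i (q i)) \<partial>count_space K \<partial>count_space K)"
    by (intro nn_integral_mono bound)
  also have "... = (\<integral>\<^sup>+p. (\<Prod>i\<in>I. a i (p i)) * (\<Prod>i\<in>I. \<Sum>k. e p i k) \<partial>count_space K)"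
    by (simp add: nn_integral_cmult nn_integral_PiE_prod[OF I] K_def)
  also have "... \<le> (\<integral>\<^sup>+p. (\<Prod>i\<in>I. a i (p i)) * ennreal (exp (r * ((\<Sum>i\<in>I. s i) + t * b))) \<partial>count_space K)"
    by (intro nn_integral_mono mult_left_mono sume) simp
  also have "... = (\<Prod>i\<in>I. \<Sum>k. a i k) * ennreal (exp (r * ((\<Sum>i\<in>I. s i) + t * b)))"
    by (simp add: nn_integral_multc nn_integral_PiE_prod[OF I] K_def)
  also have "... = ennreal (exp (r * ((\<Sum>i\<in>I. s i) + t * b)))" by (simp add: suma)
  finally have "ennreal (t ^ c * prob ?A) \<le> ennreal (exp (r * ((\<Sum>i\<in>I. s i) + t * b)))"
    using t by (simp add: emeasure_eq_measure ennreal_mult)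
  then show ?thesis by (simp add: mult.commute)
qed

section \<open>Events that are determined by finitely many bounded sets\<close>

definition local_event :: "'a::euclidean_space set set \<Rightarrow> 'a set set set \<Rightarrow> 'a set set" where
  "local_event \<B> \<T> = {S \<in> space configs. {B \<in> \<B>. S \<inter> B = {}} \<in> \<T>}"

definition local_events :: "'a::euclidean_space set set set" where
  "local_events = {local_event \<B> \<T> | \<B> \<T>. finite \<B> \<and> (\<forall>B\<in>\<B>. B \<in> sets borel \<and> bounded B)}"

lemma local_events_compl: "A \<in> local_events \<Longrightarrow> space configs - A \<in> local_events"
proof -
  assume "A \<in> local_events"
  then obtain \<B> \<T> where A: "A = local_event \<B> \<T>" "finite \<B>" "\<forall>B\<in>\<B>. B \<in> sets borel \<and> bounded B"
    by (auto simp: local_events_def)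
  then have "space configs - A = local_event \<B> (- \<T>)" by (auto simp: local_event_def)
  then show ?thesis unfolding local_events_def using A by blast
qed

lemma local_events_Un: "A \<in> local_events \<Longrightarrow> A' \<in> local_events \<Longrightarrow> A \<union> A' \<in> local_events"
proof -
  assume "A \<in> local_events" "A' \<in> local_events"
  then obtain \<B> \<T> \<B>' \<T>' where A: "A = local_event \<B> \<T>" "finite \<B>" "\<forall>B\<in>\<B>. B \<in> sets borel \<and> bounded B"
    and A': "A' = local_event \<B>' \<T>'" "finite \<B>'" "\<forall>B\<in>\<B>'. B \<in> sets borel \<and> bounded B"
    by (auto simp: local_events_def)
  have i: "{B \<in> \<B> \<union> \<B>'. S \<inter> B = {}} \<inter> \<B> = {B \<in> \<B>. S \<inter> B = {}}"
    "{B \<in> \<B> \<union> \<B>'. S \<inter> B = {}} \<inter> \<B>' = {B \<in> \<B>'. S \<inter> B = {}}" for S by auto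
  have "A \<union> A' = local_event (\<B> \<union> \<B>') {T. T \<inter> \<B> \<in> \<T> \<or> T \<inter> \<B>' \<in> \<T>'}"
    unfolding A(1) A'(1) local_event_def mem_Collect_eq i by auto
  then show ?thesis unfolding local_events_def using A A' by blast
qed

lemma local_events_void: "B \<in> sets borel \<Longrightarrow> bounded B \<Longrightarrow> void_event B \<in> local_events"
proof -
  assume B: "B \<in> sets borel" "bounded B"
  have "void_event B = local_event {B} {{B}}" by (auto simp: local_event_def void_event_def space_configs)
  then show ?thesis unfolding local_events_def using B by blast
qed

lemma local_events_sets: "A \<in> local_events \<Longrightarrow> A \<in> sets configs"
proof -
  assume "A \<in> local_events"
  then obtain \<B> \<T> where A: "A = local_event \<B> \<T>" "finite \<B>" "\<forall>B\<in>\<B>. B \<in> sets borel \<and> bounded B"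
    by (auto simp: local_events_def)
  have "A = (\<Union>T\<in>\<T> \<inter> Pow \<B>. {S \<in> space configs. \<forall>B\<in>\<B>. (S \<inter> B = {}) = (B \<in> T)})"
  proof -
    have "(\<forall>B\<in>\<B>. (S \<inter> B = {}) = (B \<in> T)) \<longleftrightarrow> T = {B \<in> \<B>. S \<inter> B = {}}" if "T \<subseteq> \<B>" for T S
      using that by blast
    then have "(\<Union>T\<in>\<T> \<inter> Pow \<B>. {S \<in> space configs. \<forall>B\<in>\<B>. (S \<inter> B = {}) = (B \<in> T)}) =
        (\<Union>T\<in>\<T> \<inter> Pow \<B>. {S \<in> space configs. T = {B \<in> \<B>. S \<inter> B = {}}})" by simp
    also have "... = local_event \<B> \<T>" unfolding local_event_def by auto
    finally show ?thesis using A by simp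
  qed
  also have "... \<in> sets configs"
  proof (intro sets.finite_UN sets.sets_Collect_finite_All)
    show "finite (\<T> \<inter> Pow \<B>)" using A by simp
    show "{S \<in> space configs. (S \<inter> B = {}) = (B \<in> T)} \<in> sets configs" if "B \<in> \<B>" for B T
    proof -
      have v: "{S \<in> space configs. S \<inter> B = {}} \<in> sets configs" using void_in_configs[of B] A that by blast
      have "{S \<in> space configs. (S \<inter> B = {}) = (B \<in> T)} = (if B \<in> T then {S \<in> space configs. S \<inter> B = {}}
        else space configs - {S \<in> space configs. S \<inter> B = {}})" by auto
      then show ?thesis using v by (cases "B \<in> T") (simp_all only: if_True if_False sets.compl_sets)
    qed
  qed (use A in auto)
  finally show ?thesis .
qed

lemma local_events_approximate:
  fixes P :: "'a::euclidean_space set measure"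
  assumes P: "prob_space P" "sets P = sets configs" and A: "A \<in> sets configs" and e: "0 < e"
  shows "\<exists>L\<in>local_events. measure P (sym_diff A L) < e"
proof -
  interpret prob_space P by fact
  have sp: "space P = space configs" using P(2) by (rule sets_eq_imp_space_eq)
  have Ls: "L \<in> local_events \<Longrightarrow> L \<in> events" for L using local_events_sets P by simp
  have A': "A \<in> sigma_sets (space configs) bounded_void_events" using A by (simp add: sets_configs)
  then have Ae: "A \<in> events" using A P by simp
  from A' have "\<forall>e>0. \<exists>L\<in>local_events. prob (sym_diff A L) < e"
  proof (induction A rule: sigma_sets.induct)
    case (Basic a)
    then have "a \<in> local_events" by (auto intro: local_events_void)
    then show ?case by (auto intro!: bexI[of _ a])
  next
    case Empty
    have "{} \<in> local_events" unfolding local_events_def local_event_def by (auto intro!: exI[of _ "{}"])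
    then show ?case by (auto intro!: bexI[of _ "{}"])
  next
    case (Compl a)
    show ?case
    proof (intro allI impI)
      fix e :: real assume "0 < e"
      then obtain L where L: "L \<in> local_events" "prob (sym_diff a L) < e" using Compl.IH by blast
      have "a \<subseteq> space configs" using Compl.hyps sets.sets_into_space[of a configs] by (simp add: sets_configs)
      moreover have "L \<subseteq> space configs" using L(1) local_events_sets sets.sets_into_space by blast
      ultimately have "sym_diff (space configs - a) (space configs - L) = sym_diff a L" by blast
      then show "\<exists>L\<in>local_events. prob (sym_diff (space configs - a) L) < e"
        using L by (intro bexI[of _ "space configs - L"] local_events_compl) auto
    qed
  next
    case (Union a)
    have ae: "a i \<in> events" for i using Union.hyps P by (simp add: sets_configs)
    show ?case
    proof (intro allI impI)
      fix e :: real assume e: "0 < e"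
      have "(\<lambda>n. prob (\<Union>i<n. a i)) \<longlonglongrightarrow> prob (\<Union>n. \<Union>i<n. a i)"
        using ae by (intro finite_Lim_measure_incseq incseq_SucI) (auto simp: less_Suc_eq)
      moreover have "(\<Union>n. \<Union>i<n. a i) = (\<Union>i. a i)" by blast
      ultimately have lim: "(\<lambda>n. prob (\<Union>i<n. a i)) \<longlonglongrightarrow> prob (\<Union>i. a i)" by simp
      have "\<forall>\<^sub>F n in sequentially. prob (\<Union>i. a i) - e / 2 < prob (\<Union>i<n. a i)"
        by (rule order_tendstoD(1)[OF lim]) (use e in simp)
      then obtain n where n: "prob (\<Union>i. a i) - e / 2 < prob (\<Union>i<n. a i)"
        by (auto simp: eventually_sequentially)
      have fin: "\<exists>L\<in>local_events. prob (sym_diff (\<Union>i<m. a i) L) < d" if "0 < d" for d :: real and m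
        using that
      proof (induction m arbitrary: d)
        case 0
        have "{} \<in> local_events" unfolding local_events_def local_event_def by (auto intro!: exI[of _ "{}"])
        then show ?case using 0 by (auto intro!: bexI[of _ "{}"])
      next
        case (Suc m)
        have d: "0 < d/2" using Suc.prems by simp
        obtain L where L: "L \<in> local_events" "prob (sym_diff (\<Union>i<m. a i) L) < d/2" using Suc.IH[OF d] by blast
        obtain L' where L': "L' \<in> local_events" "prob (sym_diff (a m) L') < d/2"
          using Union.IH[of m, rule_format, OF d] by blast
        have "prob (sym_diff (\<Union>i<Suc m. a i) (L \<union> L')) \<le> prob (sym_diff (\<Union>i<m. a i) L \<union> sym_diff (a m) L')"
        proof (rule finite_measure_mono)
          have "(\<Union>i<Suc m. a i) = (\<Union>i<m. a i) \<union> a m" by (auto simp: less_Suc_eq)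
          then show "sym_diff (\<Union>i<Suc m. a i) (L \<union> L') \<subseteq> sym_diff (\<Union>i<m. a i) L \<union> sym_diff (a m) L'" by blast
        qed (use L L' ae Ls in auto)
        also have "... \<le> prob (sym_diff (\<Union>i<m. a i) L) + prob (sym_diff (a m) L')"
          using L L' ae Ls by (intro measure_Un_le) auto
        finally show ?case using L L' by (intro bexI[of _ "L \<union> L'"] local_events_Un) auto
      qed
      from fin[of "e/2" n] e obtain L where L: "L \<in> local_events" "prob (sym_diff (\<Union>i<n. a i) L) < e/2" by auto
      have "prob (sym_diff (\<Union>i. a i) L) \<le> prob (((\<Union>i. a i) - (\<Union>i<n. a i)) \<union> sym_diff (\<Union>i<n. a i) L)"
        using L ae Ls by (intro finite_measure_mono) auto
      also have "... \<le> prob ((\<Union>i. a i) - (\<Union>i<n. a i)) + prob (sym_diff (\<Union>i<n. a i) L)"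
        using L ae Ls by (intro measure_Un_le) auto
      also have "prob ((\<Union>i. a i) - (\<Union>i<n. a i)) = prob (\<Union>i. a i) - prob (\<Union>i<n. a i)"
        using ae by (intro finite_measure_Diff) auto
      finally show "\<exists>L\<in>local_events. prob (sym_diff (\<Union>i. a i) L) < e"
        using L n by (intro bexI[of _ L]) auto
    qed
  qed
  then show ?thesis using e by blast
qed

text \<open>A set that is chosen after looking only at which sets of a finite family meet \<open>X\<close>, and that has small
  volume, cannot capture many points of \<open>Y - X\<close>. The atoms of the family carry the patterns.\<close>

lemma captured_by_local_rule:
  fixes X Y :: "'w \<Rightarrow> 'a::euclidean_space set"
  assumes Y: "poisson_void r M Y" and r: "0 \<le> r" and X: "X \<in> measurable M configs"
    and sub: "\<And>\<nu>. \<nu> \<in> space M \<Longrightarrow> X \<nu> \<subseteq> Y \<nu>"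
    and F: "finite \<F>" "\<And>F. F \<in> \<F> \<Longrightarrow> F \<in> sets borel" "\<And>F. F \<in> \<F> \<Longrightarrow> F \<subseteq> W"
    and W: "W \<in> sets borel" "bounded W"
    and \<Psi>: "\<And>N. \<Psi> N \<subseteq> \<F>" and t: "1 \<le> t" and b: "0 \<le> b"
    and E: "E \<subseteq> {\<nu> \<in> space M. vol (\<Union>(\<Psi> {F \<in> \<F>. X \<nu> \<inter> F = {}})) \<le> b \<and>
      c \<le> card ((Y \<nu> - X \<nu>) \<inter> \<Union>(\<Psi> {F \<in> \<F>. X \<nu> \<inter> F = {}}))}"
  shows "measure M E * t ^ c \<le> exp (r * (vol W + t * b))"
proof -
  interpret prob_space M using Y by (simp add: poisson_void_def)
  have Ym: "Y \<in> measurable M configs" using Y by (auto simp: poisson_void_def)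
  define N where "N \<nu> = {F \<in> \<F>. X \<nu> \<inter> F = {}}" for \<nu>
  define sig where "sig y = {F \<in> \<F>. y \<in> F}" for y
  define I where "I = Pow \<F> - {{}}"
  define atom where "atom T = {y. sig y = T}" for T
  have I: "finite I" using F by (simp add: I_def)
  have atom_sets: "atom T \<in> sets borel" if "T \<in> I" for T
  proof -
    have "atom T = (\<Inter>F\<in>\<F>. if F \<in> T then F else - F)"
      using that unfolding atom_def sig_def I_def by (auto split: if_splits)
    moreover have "(\<Inter>F\<in>\<F>. if F \<in> T then F else - F) \<in> sets borel"
    proof (rule sets.finite_INT[OF F(1)])
      show "\<F> \<noteq> {}" using that by (auto simp: I_def)
      show "(if F \<in> T then F else - F) \<in> sets borel" if "F \<in> \<F>" for F
        using F(2)[OF that] by (cases "F \<in> T") auto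
    qed
    ultimately show ?thesis by (simp only:)
  qed
  have atom_W: "atom T \<subseteq> W" if "T \<in> I" for T
  proof
    fix y assume "y \<in> atom T"
    then have "sig y = T" by (simp add: atom_def)
    moreover have "T \<noteq> {}" using that by (simp add: I_def)
    ultimately obtain F where "F \<in> sig y" by blast
    then show "y \<in> W" using F(3) by (auto simp: sig_def)
  qed
  have atom_bdd: "bounded (atom T)" if "T \<in> I" for T
    using atom_W[OF that] W by (meson bounded_subset)
  have atom_disj: "disjoint_family_on atom J" for J by (auto simp: disjoint_family_on_def atom_def)
  have atom_fin: "emeasure lborel (atom T) \<noteq> \<infinity>" if "T \<in> I" for T
    using emeasure_bounded_finite[OF atom_bdd[OF that]] by simp
  have Un: "\<Union>G = (\<Union>T\<in>{T \<in> I. T \<inter> G \<noteq> {}}. atom T)" if "G \<subseteq> \<F>" for G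
  proof (intro set_eqI iffI)
    fix y assume "y \<in> \<Union>G"
    then obtain F where F: "F \<in> G" "y \<in> F" by blast
    then have "F \<in> sig y" "sig y \<subseteq> \<F>" using that by (auto simp: sig_def)
    then have "sig y \<in> {T \<in> I. T \<inter> G \<noteq> {}}" using F by (auto simp: I_def)
    moreover have "y \<in> atom (sig y)" by (simp add: atom_def)
    ultimately show "y \<in> (\<Union>T\<in>{T \<in> I. T \<inter> G \<noteq> {}}. atom T)" by blast
  next
    fix y assume "y \<in> (\<Union>T\<in>{T \<in> I. T \<inter> G \<noteq> {}}. atom T)"
    then obtain T F where T: "y \<in> atom T" "F \<in> T" "F \<in> G" by blast
    then have "F \<in> sig y" by (simp add: atom_def)
    then show "y \<in> \<Union>G" using T by (auto simp: sig_def)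
  qed
  define x where "x T \<nu> = card (X \<nu> \<inter> atom T)" for T \<nu>
  define y where "y T \<nu> = card (Y \<nu> \<inter> atom T)" for T \<nu>
  define z where "z T \<nu> = card ((Y \<nu> - X \<nu>) \<inter> atom T)" for T \<nu>
  have finY: "finite (Y \<nu> \<inter> atom T)" if "\<nu> \<in> space M" "T \<in> I" for \<nu> T
    using measurable_space[OF Ym that(1)] atom_bdd[OF that(2)] by (auto simp: space_configs locally_finite_def)
  have xyz: "x T \<nu> + z T \<nu> = y T \<nu>" if "\<nu> \<in> space M" "T \<in> I" for \<nu> T
  proof -
    have "Y \<nu> \<inter> atom T = (X \<nu> \<inter> atom T) \<union> ((Y \<nu> - X \<nu>) \<inter> atom T)" using sub[OF that(1)] by auto
    moreover have "finite (X \<nu> \<inter> atom T)" using finY[OF that] sub[OF that(1)] by (meson Int_mono finite_subset order_refl)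
    moreover have "finite ((Y \<nu> - X \<nu>) \<inter> atom T)" using finY[OF that] by (rule finite_subset[rotated]) auto
    moreover have "(X \<nu> \<inter> atom T) \<inter> ((Y \<nu> - X \<nu>) \<inter> atom T) = {}" by auto
    ultimately show ?thesis unfolding x_def y_def z_def
      by (simp only: card_Un_disjoint)
  qed
  have xm: "x T \<in> measurable M (count_space UNIV)" if "T \<in> I" for T
    unfolding x_def using that by (intro card_measurable X atom_sets atom_bdd)
  have ym: "y T \<in> measurable M (count_space UNIV)" if "T \<in> I" for T
    unfolding y_def using that by (intro card_measurable Ym atom_sets atom_bdd)
  have zm: "z T \<in> measurable M (count_space UNIV)" if T: "T \<in> I" for T
  proof -
    have [measurable]: "x T \<in> measurable M (count_space UNIV)" "y T \<in> measurable M (count_space UNIV)"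
      using xm ym T by auto
    have "(\<lambda>\<nu>. y T \<nu> - x T \<nu>) \<in> measurable M (count_space UNIV)" by measurable
    moreover have "z T \<nu> = y T \<nu> - x T \<nu>" if "\<nu> \<in> space M" for \<nu>
      using xyz[OF that T] by simp
    ultimately show ?thesis by (subst measurable_cong)
  qed
  have law: "prob {\<nu> \<in> space M. \<forall>T\<in>I. x T \<nu> + z T \<nu> = k T} =
    (\<Prod>T\<in>I. (r * vol (atom T)) ^ k T / fact (k T) * exp (- (r * vol (atom T))))" for k
  proof (cases "I = {}")
    case True
    then show ?thesis by (simp add: prob_space)
  next
    case False
    have ind: "indep_vars (\<lambda>_. borel) (\<lambda>T \<nu>. count_in UNIV (Y \<nu> \<inter> atom T)) I"
      by (rule indep_vars_compose2[OF poisson_void_indep[OF Y atom_sets atom_disj]])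
        (simp_all add: measurable_count_in)
    have "prob (\<Inter>T\<in>I. (\<lambda>\<nu>. count_in UNIV (Y \<nu> \<inter> atom T)) -` {of_nat (k T)} \<inter> space M) =
      (\<Prod>T\<in>I. prob ((\<lambda>\<nu>. count_in UNIV (Y \<nu> \<inter> atom T)) -` {of_nat (k T)} \<inter> space M))"
      by (rule indep_varsD[OF ind False I]) auto
    moreover have "(\<lambda>\<nu>. count_in UNIV (Y \<nu> \<inter> atom T)) -` {of_nat (k T)} \<inter> space M =
        {\<nu> \<in> space M. count_in (atom T) (Y \<nu>) = of_nat (k T)}" for T
      by (auto simp: count_in_def)
    moreover have "{\<nu> \<in> space M. \<forall>T\<in>I. x T \<nu> + z T \<nu> = k T} =
        (\<Inter>T\<in>I. {\<nu> \<in> space M. count_in (atom T) (Y \<nu>) = of_nat (k T)})"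
    proof -
      have "count_in (atom T) (Y \<nu>) = of_nat (k T) \<longleftrightarrow> x T \<nu> + z T \<nu> = k T" if "\<nu> \<in> space M" "T \<in> I" for \<nu> T
        using that by (simp add: xyz y_def count_in_finite[OF measurable_space[OF Ym] atom_bdd])
      then show ?thesis using False by auto
    qed
    ultimately show ?thesis
      by (simp add: poisson_void_count_bounded[OF Y r atom_sets atom_bdd])
  qed
  have sumW: "(\<Sum>T\<in>I. vol (atom T)) \<le> vol W"
  proof -
    have "(\<Sum>T\<in>I. vol (atom T)) = vol (\<Union>T\<in>I. atom T)"
      using I atom_sets atom_disj atom_fin by (intro measure_finite_Union[symmetric]) auto
    also have "... \<le> vol W"
      using emeasure_bounded_finite[OF W(2)] I atom_sets atom_W W
      by (intro measure_mono_fmeasurable) (auto simp: fmeasurable_def intro!: sets.finite_UN)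
    finally show ?thesis .
  qed
  define N' where "N' k = {F \<in> \<F>. \<forall>T\<in>I. F \<in> T \<longrightarrow> k T = (0::nat)}" for k
  define H where "H k = (let J = {T \<in> I. T \<inter> \<Psi> (N' k) \<noteq> {}} in if (\<Sum>T\<in>J. vol (atom T)) \<le> b then J else {})" for k
  have N'_N: "N' (\<lambda>T\<in>I. x T \<nu>) = N \<nu>" if w: "\<nu> \<in> space M" for \<nu>
  proof -
    have "X \<nu> \<inter> F = {} \<longleftrightarrow> (\<forall>T\<in>I. F \<in> T \<longrightarrow> x T \<nu> = 0)" if "F \<in> \<F>" for F
    proof -
      have "F = (\<Union>T\<in>{T \<in> I. F \<in> T}. atom T)" using Un[of "{F}"] that by auto
      then have "X \<nu> \<inter> F = {} \<longleftrightarrow> (\<forall>T\<in>I. F \<in> T \<longrightarrow> X \<nu> \<inter> atom T = {})" by blast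
      moreover have "X \<nu> \<inter> atom T = {} \<longleftrightarrow> x T \<nu> = 0" if "T \<in> I" for T
        using finY[OF w that] sub[OF w] unfolding x_def
        by (metis Int_mono card_0_eq finite_subset order_refl)
      ultimately show ?thesis by simp
    qed
    then show ?thesis by (auto simp: N'_def N_def)
  qed
  have "prob E \<le> prob {\<nu> \<in> space M. c \<le> (\<Sum>T\<in>H (\<lambda>T\<in>I. x T \<nu>). z T \<nu>)}"
  proof (rule finite_measure_mono)
    show "E \<subseteq> {\<nu> \<in> space M. c \<le> (\<Sum>T\<in>H (\<lambda>T\<in>I. x T \<nu>). z T \<nu>)}"
    proof
      fix \<nu> assume "\<nu> \<in> E"
      then have w: "\<nu> \<in> space M" and le: "vol (\<Union>(\<Psi> (N \<nu>))) \<le> b"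
        and c: "c \<le> card ((Y \<nu> - X \<nu>) \<inter> \<Union>(\<Psi> (N \<nu>)))" using E by (auto simp: N_def)
      define J where "J = {T \<in> I. T \<inter> \<Psi> (N \<nu>) \<noteq> {}}"
      have J: "J \<subseteq> I" "finite J" using I by (auto simp: J_def)
      have U: "\<Union>(\<Psi> (N \<nu>)) = (\<Union>T\<in>J. atom T)" unfolding J_def by (rule Un[OF \<Psi>])
      have "vol (\<Union>(\<Psi> (N \<nu>))) = (\<Sum>T\<in>J. vol (atom T))"
        unfolding U using J atom_sets atom_disj atom_fin by (intro measure_finite_Union) auto
      then have HJ: "H (\<lambda>T\<in>I. x T \<nu>) = J" using le N'_N[OF w] by (simp add: H_def J_def Let_def)
      have "card ((Y \<nu> - X \<nu>) \<inter> (\<Union>T\<in>J. atom T)) = card (\<Union>T\<in>J. (Y \<nu> - X \<nu>) \<inter> atom T)"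
        by (simp only: Int_UN_distrib)
      also have "... = (\<Sum>T\<in>J. z T \<nu>)" unfolding z_def
      proof (rule card_UN_disjoint[OF J(2)])
        show "\<forall>T\<in>J. finite ((Y \<nu> - X \<nu>) \<inter> atom T)"
        proof
          fix T assume "T \<in> J"
          then have "finite (Y \<nu> \<inter> atom T)" using finY[OF w] J(1) by blast
          then show "finite ((Y \<nu> - X \<nu>) \<inter> atom T)" by (rule finite_subset[rotated]) blast
        qed
        show "\<forall>T\<in>J. \<forall>T'\<in>J. T \<noteq> T' \<longrightarrow> ((Y \<nu> - X \<nu>) \<inter> atom T) \<inter> ((Y \<nu> - X \<nu>) \<inter> atom T') = {}"
          unfolding atom_def by blast
      qed
      finally show "\<nu> \<in> {\<nu> \<in> space M. c \<le> (\<Sum>T\<in>H (\<lambda>T\<in>I. x T \<nu>). z T \<nu>)}" using c w by (simp add: HJ U)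
    qed
    have [measurable]: "x T \<in> measurable M (count_space UNIV)" "z T \<in> measurable M (count_space UNIV)" if "T \<in> I" for T
      using that xm zm by auto
    have Hsub: "H k \<subseteq> I" for k by (auto simp: H_def Let_def)
    have "{\<nu> \<in> space M. c \<le> (\<Sum>T\<in>H (\<lambda>T\<in>I. x T \<nu>). z T \<nu>)} =
      (\<Union>p\<in>I \<rightarrow>\<^sub>E UNIV. {\<nu> \<in> space M. (\<forall>T\<in>I. x T \<nu> = p T) \<and> c \<le> (\<Sum>T\<in>H p. z T \<nu>)})"
    proof (intro set_eqI iffI)
      fix \<nu> assume "\<nu> \<in> {\<nu> \<in> space M. c \<le> (\<Sum>T\<in>H (\<lambda>T\<in>I. x T \<nu>). z T \<nu>)}"
      then show "\<nu> \<in> (\<Union>p\<in>I \<rightarrow>\<^sub>E UNIV. {\<nu> \<in> space M. (\<forall>T\<in>I. x T \<nu> = p T) \<and> c \<le> (\<Sum>T\<in>H p. z T \<nu>)})"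
        by (intro UN_I[of "\<lambda>T\<in>I. x T \<nu>"]) auto
    next
      fix \<nu> assume "\<nu> \<in> (\<Union>p\<in>I \<rightarrow>\<^sub>E UNIV. {\<nu> \<in> space M. (\<forall>T\<in>I. x T \<nu> = p T) \<and> c \<le> (\<Sum>T\<in>H p. z T \<nu>)})"
      then obtain p where p: "p \<in> I \<rightarrow>\<^sub>E UNIV" "\<nu> \<in> space M" "\<forall>T\<in>I. x T \<nu> = p T" "c \<le> (\<Sum>T\<in>H p. z T \<nu>)" by blast
      then have "(\<lambda>T\<in>I. x T \<nu>) = p" by (intro ext) (auto simp: PiE_iff extensional_def)
      then show "\<nu> \<in> {\<nu> \<in> space M. c \<le> (\<Sum>T\<in>H (\<lambda>T\<in>I. x T \<nu>). z T \<nu>)}" using p by simp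
    qed
    also have "... \<in> events"
    proof (rule sets.countable_UN'')
      show "countable (I \<rightarrow>\<^sub>E (UNIV :: nat set))" using I by (intro countable_PiE) auto
      fix p
      have [measurable]: "(\<lambda>\<nu>. \<Sum>T\<in>H p. z T \<nu>) \<in> measurable M (count_space UNIV)"
        using Hsub[of p] I zm by (intro measurable_sum_nat) (auto intro: finite_subset)
      show "{\<nu> \<in> space M. (\<forall>T\<in>I. x T \<nu> = p T) \<and> c \<le> (\<Sum>T\<in>H p. z T \<nu>)} \<in> events"
        using I by (intro sets.sets_Collect_conj sets.sets_Collect_finite_All) measurable
    qed
    finally show "{\<nu> \<in> space M. c \<le> (\<Sum>T\<in>H (\<lambda>T\<in>I. x T \<nu>). z T \<nu>)} \<in> events" .
  qed
  then have "prob E * t ^ c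
    \<le> prob {\<nu> \<in> space M. c \<le> (\<Sum>T\<in>H (\<lambda>T\<in>I. x T \<nu>). z T \<nu>)} * t ^ c"
    using t by (intro mult_right_mono) auto
  also have "... \<le> exp (r * ((\<Sum>T\<in>I. vol (atom T)) + t * b))"
    using b by (intro captured_points_bound[OF prob_space_axioms I r _ xm zm law _ _ t]) (auto simp: H_def Let_def)
  also have "... \<le> exp (r * (vol W + t * b))"
    using sumW r by (intro exp_mono) (simp add: mult_left_mono)
  finally show ?thesis .
qed

section \<open>The obstruction to equivariance\<close>

definition translate :: "'a::euclidean_space \<Rightarrow> 'a set \<Rightarrow> 'a set" where
  "translate \<gamma> B = (\<lambda>x. x + (- \<gamma>)) -` B"

lemma translate_borel: "B \<in> sets borel \<Longrightarrow> translate \<gamma> B \<in> sets borel"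
  unfolding translate_def by (rule vimage_plus_borel)

lemma bounded_translate: "bounded B \<Longrightarrow> bounded (translate \<gamma> B)"
  unfolding translate_def by (rule bounded_vimage_plus)

lemma measure_translate: "B \<in> sets borel \<Longrightarrow> vol (translate \<gamma> B) = vol B"
  unfolding translate_def by (rule measure_lborel_vimage_plus)

lemma Int_translate_empty_iff: "S \<inter> translate \<gamma> B = {} \<longleftrightarrow> shift (- \<gamma>) S \<inter> B = {}"
  unfolding translate_def by (rule shift_Int_empty_iff[symmetric])

lemma card_Int_translate: "card (S \<inter> translate \<gamma> B) = card (shift (- \<gamma>) S \<inter> B)"
proof -
  have "shift (- \<gamma>) S \<inter> B = (\<lambda>x. x + (- \<gamma>)) ` (S \<inter> translate \<gamma> B)"
    by (auto simp: shift_def translate_def)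
  then show ?thesis by (simp add: card_image inj_on_def)
qed

lemma shift_Diff: "shift v (S - T) = shift v S - shift v T"
  unfolding shift_def by (rule image_set_diff) (simp add: inj_on_def)

lemma commutes_with_shift_uminus:
  assumes "commutes_with_shift f v" "S \<in> space configs"
  shows "shift (- v) (f S) = f (shift (- v) S)"
proof -
  have "shift (- v) S \<in> space configs" using measurable_space[OF shift_measurable assms(2)] .
  then have "shift v (f (shift (- v) S)) = f S"
    using assms(1) by (simp add: commutes_with_shift_def shift_shift)
  then show ?thesis by (metis add.left_inverse shift_0 shift_shift)
qed

lemma poisson_law_exists:
  assumes l: "0 < l"
  obtains P :: "'a::euclidean_space set measure"
  where "sets P = sets configs" "poisson_void l P (\<lambda>S. S)"
proof
  let ?P = "distr Us configs (poisson_of l :: _ \<Rightarrow> 'a set)"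
  have pv: "poisson_void l Us (poisson_of l :: _ \<Rightarrow> 'a set)" by (rule poisson_of_void[OF l])
  then have pp: "poisson_process l Us (poisson_of l :: _ \<Rightarrow> 'a set)" using l by (simp add: poisson_process_iff_void)
  have m: "(poisson_of l :: _ \<Rightarrow> 'a set) \<in> measurable Us configs" using pv by (auto simp: poisson_void_def)
  show "sets ?P = sets configs" by simp
  have "poisson_process l ?P (\<lambda>S. S)"
    using poisson_process_distr[OF prob_space_Us m measurable_ident_sets[OF refl]] pp by blast
  then show "poisson_void l ?P (\<lambda>S. S)" by (rule poisson_process_imp_void)
qed

text \<open>Suppose that there are arbitrarily large finite families of commuting shifts under which the
  translates of \<open>Q\<close> are disjoint, each family filling its surroundings up to the factor \<open>\<kappa>\<close>.
  The points that are added in one piece of \<open>Q\<close> are predicted, up to rare errors, by finitely many void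
  events of \<open>X\<close>. By equivariance the same prediction works in each translate. So the thin region that
  is predicted from \<open>X\<close> contains most of the added points, a linear number, with probability at least
  1/2; this contradicts \<open>captured_by_local_rule\<close>.\<close>

theorem no_equivariant_thickening:
  fixes f :: "'a::euclidean_space set \<Rightarrow> 'a set" and Q :: "'a set"
  assumes l: "0 < l" "l < l'" and thick: "thickening l l' f"
    and Q: "Q \<in> sets borel" "bounded Q" "0 < vol Q" and \<kappa>: "0 < \<kappa>"
    and tile: "\<And>D N. bounded D \<Longrightarrow> \<exists>Z W. finite Z \<and> N \<le> card Z \<and> (\<forall>\<gamma>\<in>Z. commutes_with_shift f \<gamma>) \<and>
      disjoint_family_on (\<lambda>\<gamma>. translate \<gamma> Q) Z \<and> W \<in> sets borel \<and> bounded W \<and>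
      (\<forall>\<gamma>\<in>Z. translate \<gamma> D \<subseteq> W) \<and> vol W \<le> \<kappa> * real (card Z)"
  shows False
proof -
  obtain P :: "'a set measure" where sP: "sets P = sets configs" and pX: "poisson_void l P (\<lambda>S. S)"
    using poisson_law_exists[OF l(1)] by blast
  have spP: "space P = space configs" using sP by (rule sets_eq_imp_space_eq)
  interpret prob_space P using pX by (simp add: poisson_void_def)
  have Xm: "(\<lambda>S. S) \<in> measurable P configs" using pX by (auto simp: poisson_void_def)
  have fm: "f \<in> measurable configs configs" using thick by (simp add: thickening_def)
  have "poisson_process l' P (\<lambda>S. S \<union> f S)"
    using thick pX l by (simp add: thickening_def poisson_process_iff_void)
  then have pY: "poisson_void l' P (\<lambda>S. S \<union> f S)" by (rule poisson_process_imp_void)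
  have Ym: "(\<lambda>S. S \<union> f S) \<in> measurable P configs" using pY by (auto simp: poisson_void_def)
  have l': "0 < l'" using l by simp
  define cX where "cX B S = card (S \<inter> B)" for B S :: "'a set"
  define cY where "cY B S = card ((S \<union> f S) \<inter> B)" for B S :: "'a set"
  define cZ where "cZ B S = card ((f S - S) \<inter> B)" for B S :: "'a set"
  have fin: "finite (S \<inter> B)" "finite ((S \<union> f S) \<inter> B)" "finite ((f S - S) \<inter> B)" if "S \<in> space P" "bounded B" for S B
  proof -
    show "finite ((S \<union> f S) \<inter> B)" using measurable_space[OF Ym that(1)] that(2) by (auto simp: space_configs locally_finite_def)
    then show "finite (S \<inter> B)" "finite ((f S - S) \<inter> B)" by (auto elim: finite_subset[rotated])
  qed
  have cYXZ: "cY B S = cX B S + cZ B S" if "S \<in> space P" "bounded B" for S B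
  proof -
    have "(S \<union> f S) \<inter> B = (S \<inter> B) \<union> ((f S - S) \<inter> B)" "(S \<inter> B) \<inter> ((f S - S) \<inter> B) = {}" by auto
    then show ?thesis unfolding cX_def cY_def cZ_def using fin[OF that] by (simp only: card_Un_disjoint)
  qed
  have cXm: "cX B \<in> measurable P (count_space UNIV)" and cYm: "cY B \<in> measurable P (count_space UNIV)"
    if "B \<in> sets borel" "bounded B" for B
    unfolding cX_def cY_def using that card_measurable[OF Xm] card_measurable[OF Ym] by auto
  have cZm: "cZ B \<in> measurable P (count_space UNIV)" if B: "B \<in> sets borel" "bounded B" for B
  proof -
    have [measurable]: "cX B \<in> measurable P (count_space UNIV)" "cY B \<in> measurable P (count_space UNIV)"
      using cXm cYm B by auto
    have "(\<lambda>S. cY B S - cX B S) \<in> measurable P (count_space UNIV)" by measurable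
    moreover have "cZ B S = cY B S - cX B S" if "S \<in> space P" for S using cYXZ[OF that B(2)] by simp
    ultimately show ?thesis by (subst measurable_cong)
  qed
  have cZ_translate: "cZ (translate \<gamma> B) S = cZ B (shift (- \<gamma>) S)" if "commutes_with_shift f \<gamma>" "S \<in> space P" for \<gamma> B S
    unfolding cZ_def card_Int_translate shift_Diff
    using commutes_with_shift_uminus[OF that(1)] that(2) by (simp add: spP)
  have law: "distr P configs (shift v) = P" for v
  proof -
    have "distr P configs (\<lambda>S. shift v S) = distr P configs (\<lambda>S. S)"
      by (rule poisson_void_law_unique[OF poisson_void_shift[OF pX] pX])
    also have "... = P" by (rule distr_id2) (rule sP[symmetric])
    finally show ?thesis .
  qed
  have shm: "shift v \<in> measurable P configs" for v
    using shift_measurable by (subst measurable_cong_sets[OF sP refl])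
  have nn_shift: "(\<integral>\<^sup>+S. g (shift v S) \<partial>P) = (\<integral>\<^sup>+S. g S \<partial>P)" if "g \<in> borel_measurable P" for g v
  proof -
    have "(\<integral>\<^sup>+S. g S \<partial>distr P configs (shift v)) = (\<integral>\<^sup>+S. g (shift v S) \<partial>P)"
      by (rule nn_integral_distr[OF shm]) (unfold law, rule that)
    then show ?thesis by (simp only: law)
  qed
  \<comment> \<open>The constants: \<open>4 a\<close> is the density of added points, \<open>\<delta>\<close> the density of the region that is predicted.\<close>
  define q where "q = vol Q"
  have q: "0 < q" using Q by (simp add: q_def)
  define a where "a = (l' - l) * q / 4"
  have a: "0 < a" using l q by (simp add: a_def)
  define C where "C = exp (l' * (\<kappa> + 1))"
  have C1: "1 \<le> C" using l' \<kappa> by (simp add: C_def)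
  define \<delta> where "\<delta> = (1 / (4 * C)) powr (1 / a)"
  have \<delta>0: "0 < \<delta>" using C1 by (simp add: \<delta>_def)
  have \<delta>1: "\<delta> \<le> 1" unfolding \<delta>_def using C1 a by (intro powr_le1) auto
  have \<delta>a: "\<delta> powr a = 1 / (4 * C)" using C1 a by (simp add: \<delta>_def powr_powr)
  obtain m where m: "16 * l' * q / \<delta> < 2 ^ m" using real_arch_pow[of 2] by auto
  define J where "J = cell m ` Q"
  have J: "finite J" unfolding J_def by (rule finite_cell_bounded[OF Q(2)])
  define piece where "piece i = Q \<inter> cell m -` {i}" for i
  have piece_sets: "piece i \<in> sets borel" for i
    unfolding piece_def by (rule sets.Int[OF Q(1) measurable_sets_borel[OF cell_measurable]]) simp
  have piece_sub: "piece i \<subseteq> Q" for i by (simp add: piece_def)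
  have piece_bdd: "bounded (piece i)" for i using Q(2) piece_sub by (rule bounded_subset)
  have piece_disj: "disjoint_family_on piece J" by (auto simp: disjoint_family_on_def piece_def)
  have piece_UN: "(\<Union>i\<in>J. piece i) = Q" by (auto simp: J_def piece_def)
  have piece_vol: "vol (piece i) \<le> 1 / 2 ^ m" for i
  proof -
    have "vol (piece i) \<le> vol (cell m -` {i} :: 'a set)"
      using piece_sets[of i] cell_volume_le(2)[of m i] measurable_sets_borel[OF cell_measurable, of "{i}" m]
      by (intro measure_mono_fmeasurable) (auto simp: fmeasurable_def piece_def)
    also have "... \<le> 1 / 2 ^ m" by (rule cell_volume_le)
    finally show ?thesis .
  qed
  have piece_sum: "(\<Sum>i\<in>J. vol (piece i)) = q"
  proof -
    have "(\<Sum>i\<in>J. vol (piece i)) = vol (\<Union>i\<in>J. piece i)"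
      using J piece_sets piece_disj emeasure_bounded_finite[OF piece_bdd]
      by (intro measure_finite_Union[symmetric]) (auto simp: less_top)
    then show ?thesis by (simp add: piece_UN q_def)
  qed
  \<comment> \<open>Whether a piece receives a new point is a function of \<open>X\<close>, hence nearly decided by finitely many voids.\<close>
  define E2 where "E2 = (l' * q)\<^sup>2 + l' * q"
  have E2: "0 < E2" using l' q by (simp add: E2_def add_nonneg_pos)
  have nnY2: "(\<integral>\<^sup>+S. ennreal ((real (cY Q S))\<^sup>2) \<partial>P) = ennreal E2"
    using poisson_void_nn_integral_card[OF pY l' Q, of "\<lambda>k. ennreal ((real k)\<^sup>2)"] poisson_second_moment[of "l' * q"] l' q
    by (simp add: cY_def E2_def q_def)
  define K where "K = 16 * (card J + 1) * E2 / a"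
  have K: "0 < K" using E2 a by (simp add: K_def)
  define \<eta> where "\<eta> = min (\<delta> / (16 * q)) (a / (16 * (card J + 1) * K))"
  have \<eta>: "0 < \<eta>" using \<delta>0 q a K by (simp add: \<eta>_def)
  define A where "A i = {S \<in> space P. cZ (piece i) S \<noteq> 0}" for i
  have A_sets: "A i \<in> events" for i
  proof -
    have "A i = cZ (piece i) -` (- {0}) \<inter> space P" by (auto simp: A_def)
    then show ?thesis using measurable_sets[OF cZm[OF piece_sets piece_bdd], of "- {0}" i] by simp
  qed
  have "\<forall>i. \<exists>L\<in>local_events. prob (sym_diff (A i) L) < \<eta>"
    using local_events_approximate[OF prob_space_axioms sP _ \<eta>] A_sets sP by auto
  then obtain L where L: "\<And>i. L i \<in> local_events" "\<And>i. prob (sym_diff (A i) (L i)) < \<eta>" by metis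
  have L_sets: "L i \<in> events" for i using local_events_sets[OF L(1)] sP by simp
  have "\<forall>i. \<exists>\<B> \<T>. L i = local_event \<B> \<T> \<and> finite \<B> \<and> (\<forall>B\<in>\<B>. B \<in> sets borel \<and> bounded B)"
    using L(1) by (auto simp: local_events_def)
  then obtain \<B> \<T> where \<B>: "\<And>i. L i = local_event (\<B> i) (\<T> i)" "\<And>i. finite (\<B> i)"
      "\<And>i B. B \<in> \<B> i \<Longrightarrow> B \<in> sets borel" "\<And>i B. B \<in> \<B> i \<Longrightarrow> bounded B" by metis
  have PA: "prob (A i) \<le> l' * vol (piece i)" for i
  proof -
    have "prob (A i) \<le> prob (space P - {S \<in> space P. (S \<union> f S) \<inter> piece i = {}})"
    proof (rule finite_measure_mono)
      show "A i \<subseteq> space P - {S \<in> space P. (S \<union> f S) \<inter> piece i = {}}" 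
      proof
        fix S assume "S \<in> A i"
        then have S: "S \<in> space P" and "card ((f S - S) \<inter> piece i) \<noteq> 0" by (auto simp: A_def cZ_def)
        then have "(f S - S) \<inter> piece i \<noteq> {}" by (metis card.empty)
        then show "S \<in> space P - {S \<in> space P. (S \<union> f S) \<inter> piece i = {}}" using S by blast
      qed
      show "space P - {S \<in> space P. (S \<union> f S) \<inter> piece i = {}} \<in> events"
        using void_measurable[OF Ym piece_sets] by auto
    qed
    also have "... = 1 - exp (- (l' * vol (piece i)))"
      using void_measurable[OF Ym piece_sets, of i] by (subst prob_compl) (simp_all add: poisson_voidD[OF pY piece_sets piece_bdd])
    also have "... \<le> l' * vol (piece i)" using exp_ge_add_one_self[of "- (l' * vol (piece i))"] by simp
    finally show ?thesis .
  qed
  have PL: "prob (L i) \<le> prob (A i) + \<eta>" for i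
  proof -
    have "prob (L i) \<le> prob (A i \<union> sym_diff (A i) (L i))" using A_sets L_sets by (intro finite_measure_mono) auto
    also have "... \<le> prob (A i) + prob (sym_diff (A i) (L i))" using A_sets L_sets by (intro measure_Un_le) auto
    finally show ?thesis using L(2)[of i] by simp
  qed
  have volL: "(\<Sum>i\<in>J. vol (piece i) * prob (L i)) \<le> \<delta> / 8"
  proof -
    have "(\<Sum>i\<in>J. vol (piece i) * prob (L i)) \<le> (\<Sum>i\<in>J. vol (piece i) * (l' * (1 / 2 ^ m) + \<eta>))"
    proof (intro sum_mono mult_left_mono)
      fix i
      have "prob (L i) \<le> l' * vol (piece i) + \<eta>" using PL[of i] PA[of i] by simp
      also have "... \<le> l' * (1 / 2 ^ m) + \<eta>" using piece_vol[of i] l' by (intro add_right_mono mult_left_mono) auto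
      finally show "prob (L i) \<le> l' * (1 / 2 ^ m) + \<eta>" .
    qed simp
    also have "... = q * (l' * (1 / 2 ^ m) + \<eta>)" by (simp add: piece_sum flip: sum_distrib_right)
    also have "... = l' * q / 2 ^ m + q * \<eta>" by (simp add: algebra_simps)
    also have "l' * q / 2 ^ m \<le> \<delta> / 16" using m \<delta>0 by (simp add: field_simps)
    also have "q * \<eta> \<le> q * (\<delta> / (16 * q))" using q by (intro mult_left_mono) (auto simp: \<eta>_def)
    also have "... = \<delta> / 16" using q by simp
    finally show ?thesis by simp
  qed
  define w where "w i S = ennreal (indicator (space P - L i) S * real (cZ (piece i) S))" for i S
  have w_meas: "w i \<in> borel_measurable P" for i
  proof -
    have "(\<lambda>S. real (cZ (piece i) S)) \<in> borel_measurable P"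
      by (rule measurable_compose[OF cZm[OF piece_sets piece_bdd]]) simp
    then have "(\<lambda>S. indicator (space P - L i) S * real (cZ (piece i) S)) \<in> borel_measurable P"
      by (intro borel_measurable_times borel_measurable_indicator sets.compl_sets L_sets)
    then show ?thesis unfolding w_def by (rule measurable_compose[OF _ measurable_ennreal])
  qed
  have wint: "(\<integral>\<^sup>+S. w i S \<partial>P) \<le> ennreal (a / (8 * (card J + 1)))" for i
  proof -
    let ?D = "A i - L i"
    have D: "?D \<in> events" using A_sets L_sets by auto
    have PD: "prob ?D \<le> \<eta>"
    proof -
      have "prob ?D \<le> prob (sym_diff (A i) (L i))" using A_sets L_sets by (intro finite_measure_mono) auto
      then show ?thesis using L(2)[of i] by simp
    qed
    have "(\<integral>\<^sup>+S. w i S \<partial>P) \<le> (\<integral>\<^sup>+S. ennreal K * indicator ?D S + ennreal (1 / K) * ennreal ((real (cY Q S))\<^sup>2) \<partial>P)"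
    proof (rule nn_integral_mono)
      fix S assume S: "S \<in> space P"
      show "w i S \<le> ennreal K * indicator ?D S + ennreal (1 / K) * ennreal ((real (cY Q S))\<^sup>2)"
      proof (cases "S \<in> ?D")
        case True
        have "cZ (piece i) S \<le> cY Q S" unfolding cZ_def cY_def
          using fin(2)[OF S Q(2)] piece_sub[of i] by (intro card_mono) auto
        then have zy: "real (cZ (piece i) S) \<le> real (cY Q S)" by simp
        have "real (cY Q S) \<le> K + 1 / K * (real (cY Q S))\<^sup>2"
        proof (cases "real (cY Q S) \<le> K")
          case True
          then show ?thesis using K by (simp add: add_increasing2)
        next
          case False
          then have "real (cY Q S) * K \<le> (real (cY Q S))\<^sup>2" by (simp add: power2_eq_square mult_left_mono)
          then show ?thesis using K by (simp add: field_simps add_increasing)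
        qed
        then have "w i S \<le> ennreal (K + 1 / K * (real (cY Q S))\<^sup>2)"
          unfolding w_def using zy by (intro ennreal_leI) (auto simp: indicator_def)
        also have "... = ennreal K * indicator ?D S + ennreal (1 / K) * ennreal ((real (cY Q S))\<^sup>2)"
        proof -
          have "ennreal (1 / K * (real (cY Q S))\<^sup>2) = ennreal (1 / K) * ennreal ((real (cY Q S))\<^sup>2)"
            using K by (intro ennreal_mult) auto
          moreover have "ennreal (K + 1 / K * (real (cY Q S))\<^sup>2) = ennreal K + ennreal (1 / K * (real (cY Q S))\<^sup>2)"
            using K by (intro ennreal_plus) auto
          ultimately show ?thesis using True by simp
        qed
        finally show ?thesis .
      next
        case False
        then have "w i S = 0" using S by (auto simp: w_def A_def indicator_def)
        then show ?thesis by simp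
      qed
    qed
    also have "... = ennreal K * emeasure P ?D + ennreal (1 / K) * ennreal E2"
    proof -
      have cq: "(\<lambda>S. ennreal ((real (cY Q S))\<^sup>2)) \<in> borel_measurable P"
        by (rule measurable_compose[OF cYm[OF Q(1,2)]]) simp
      have "(\<integral>\<^sup>+S. ennreal K * indicator ?D S + ennreal (1 / K) * ennreal ((real (cY Q S))\<^sup>2) \<partial>P) =
        (\<integral>\<^sup>+S. ennreal K * indicator ?D S \<partial>P) + (\<integral>\<^sup>+S. ennreal (1 / K) * ennreal ((real (cY Q S))\<^sup>2) \<partial>P)"
        using D cq by (intro nn_integral_add borel_measurable_times_ennreal borel_measurable_indicator borel_measurable_const)
      also have "(\<integral>\<^sup>+S. ennreal K * indicator ?D S \<partial>P) = ennreal K * emeasure P ?D"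
        by (rule nn_integral_cmult_indicator[OF D])
      also have "(\<integral>\<^sup>+S. ennreal (1 / K) * ennreal ((real (cY Q S))\<^sup>2) \<partial>P) = ennreal (1 / K) * (\<integral>\<^sup>+S. ennreal ((real (cY Q S))\<^sup>2) \<partial>P)"
        by (rule nn_integral_cmult[OF cq])
      finally show ?thesis by (simp only: nnY2)
    qed
    also have "... = ennreal (K * prob ?D + 1 / K * E2)"
    proof -
      have "ennreal (K * prob ?D + 1 / K * E2) = ennreal (K * prob ?D) + ennreal (1 / K * E2)"
        using K E2 by (intro ennreal_plus) auto
      also have "ennreal (K * prob ?D) = ennreal K * ennreal (prob ?D)" using K by (intro ennreal_mult) auto
      also have "ennreal (1 / K * E2) = ennreal (1 / K) * ennreal E2" using K E2 by (intro ennreal_mult) auto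
      finally show ?thesis by (simp only: emeasure_eq_measure)
    qed
    also have "... \<le> ennreal (a / (8 * (card J + 1)))"
    proof (rule ennreal_leI)
      have "K * prob ?D \<le> K * \<eta>" using PD K by simp
      also have "... \<le> K * (a / (16 * (card J + 1) * K))" using K by (intro mult_left_mono) (auto simp: \<eta>_def)
      also have "... = a / (16 * (card J + 1))" using K by simp
      finally have "K * prob ?D \<le> a / (16 * (card J + 1))" .
      moreover have "1 / K * E2 = a / (16 * (card J + 1))" using E2 a by (simp add: K_def)
      moreover have "x / (16 * y) + x / (16 * y) = x / (8 * y)" for x y :: real by (cases "y = 0") (auto simp: field_simps)
      from this[of a "card J + 1"] have "a / (16 * (card J + 1)) + a / (16 * (card J + 1)) = a / (8 * (card J + 1))" by simp
      ultimately show "K * prob ?D + 1 / K * E2 \<le> a / (8 * (card J + 1))"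
        by (metis add_right_mono)
    qed
    finally show ?thesis .
  qed
  \<comment> \<open>Everything that decides about one tile lies in \<open>D\<close>.\<close>
  define D where "D = Q \<union> (\<Union>i\<in>J. \<Union>(\<B> i))"
  have D: "bounded D" unfolding D_def using Q J \<B> by (auto intro!: bounded_Union)
  define N0 where "N0 = nat \<lceil>8 * l' * q / a\<^sup>2\<rceil> + 1"
  obtain Z W where Z: "finite Z" "N0 \<le> card Z" "\<And>\<gamma>. \<gamma> \<in> Z \<Longrightarrow> commutes_with_shift f \<gamma>"
      "disjoint_family_on (\<lambda>\<gamma>. translate \<gamma> Q) Z" "W \<in> sets borel" "bounded W"
      "\<And>\<gamma>. \<gamma> \<in> Z \<Longrightarrow> translate \<gamma> D \<subseteq> W" "vol W \<le> \<kappa> * real (card Z)"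
    using tile[OF D, of N0] by blast
  define V where "V = real (card Z)"
  have V1: "1 \<le> V" using Z(2) by (simp add: V_def N0_def)
  have VN: "8 * l' * q / a\<^sup>2 \<le> V"
  proof -
    have "8 * l' * q / a\<^sup>2 \<le> real N0" unfolding N0_def by linarith
    then show ?thesis using Z(2) by (simp add: V_def)
  qed
  define \<Lambda> where "\<Lambda> = (\<Union>\<gamma>\<in>Z. translate \<gamma> Q)"
  have \<Lambda>_sets: "\<Lambda> \<in> sets borel" unfolding \<Lambda>_def using Z Q by (intro sets.finite_UN) (auto intro: translate_borel)
  have \<Lambda>_bdd: "bounded \<Lambda>" unfolding \<Lambda>_def using Z Q by (intro bounded_UN) (auto intro: bounded_translate)
  have \<Lambda>_vol: "vol \<Lambda> = q * V"
  proof -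
    have "vol \<Lambda> = (\<Sum>\<gamma>\<in>Z. vol (translate \<gamma> Q))"
      unfolding \<Lambda>_def using Z Q emeasure_bounded_finite[OF bounded_translate[OF Q(2)]]
      by (intro measure_finite_Union) (auto simp: less_top intro: translate_borel)
    then show ?thesis by (simp add: measure_translate[OF Q(1)] V_def q_def)
  qed
  have \<Lambda>_pos: "0 < vol \<Lambda>" using \<Lambda>_vol q V1 by simp
  have trp_sets: "translate \<gamma> (piece i) \<in> sets borel" and trp_bdd: "bounded (translate \<gamma> (piece i))" for \<gamma> i
    using piece_sets piece_bdd by (auto intro: translate_borel bounded_translate)
  have trp_disj: "translate \<gamma> (piece i) \<inter> translate \<gamma>' (piece i') = {}"
    if "\<gamma> \<in> Z" "\<gamma>' \<in> Z" "(\<gamma>, i) \<noteq> (\<gamma>', i')" for \<gamma> \<gamma>' i i'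
  proof (cases "\<gamma> = \<gamma>'")
    case True
    then have "i \<noteq> i'" using that by simp
    then show ?thesis using True by (auto simp: translate_def piece_def)
  next
    case False
    then have "translate \<gamma> Q \<inter> translate \<gamma>' Q = {}" using Z(4) that by (auto simp: disjoint_family_on_def)
    then show ?thesis using piece_sub unfolding translate_def by blast
  qed
  have cZ_UN: "cZ (\<Union>(\<gamma>, i)\<in>G. translate \<gamma> (piece i)) S = (\<Sum>(\<gamma>, i)\<in>G. cZ (translate \<gamma> (piece i)) S)"
    if S: "S \<in> space P" and G: "G \<subseteq> Z \<times> J" for G S
  proof -
    have "finite G" using G Z(1) J by (meson finite_SigmaI finite_subset)
    have "(f S - S) \<inter> (\<Union>(\<gamma>, i)\<in>G. translate \<gamma> (piece i)) = (\<Union>p\<in>G. (f S - S) \<inter> translate (fst p) (piece (snd p)))"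
      by auto
    then have "cZ (\<Union>(\<gamma>, i)\<in>G. translate \<gamma> (piece i)) S = card (\<Union>p\<in>G. (f S - S) \<inter> translate (fst p) (piece (snd p)))"
      by (simp only: cZ_def)
    also have "... = (\<Sum>p\<in>G. card ((f S - S) \<inter> translate (fst p) (piece (snd p))))"
    proof (rule card_UN_disjoint[OF \<open>finite G\<close>])
      show "\<forall>p\<in>G. finite ((f S - S) \<inter> translate (fst p) (piece (snd p)))" using fin(3)[OF S trp_bdd] by blast
      show "\<forall>p\<in>G. \<forall>p'\<in>G. p \<noteq> p' \<longrightarrow>
        ((f S - S) \<inter> translate (fst p) (piece (snd p))) \<inter> ((f S - S) \<inter> translate (fst p') (piece (snd p'))) = {}"
      proof (intro ballI impI)
        fix p p' assume p: "p \<in> G" "p' \<in> G" "p \<noteq> p'"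
        then have "translate (fst p) (piece (snd p)) \<inter> translate (fst p') (piece (snd p')) = {}"
          using G by (intro trp_disj) (auto simp: prod_eq_iff)
        then show "((f S - S) \<inter> translate (fst p) (piece (snd p))) \<inter> ((f S - S) \<inter> translate (fst p') (piece (snd p'))) = {}" by blast
      qed
    qed
    finally show ?thesis by (simp add: cZ_def split_beta)
  qed
  have \<Lambda>_UN: "\<Lambda> = (\<Union>(\<gamma>, i)\<in>Z \<times> J. translate \<gamma> (piece i))"
  proof -
    have "translate \<gamma> Q = (\<Union>i\<in>J. translate \<gamma> (piece i))" for \<gamma>
      unfolding piece_UN[symmetric] translate_def by blast
    then show ?thesis unfolding \<Lambda>_def by auto
  qed
  \<comment> \<open>The pieces, over all tiles, that \<open>S\<close> alone predicts to receive a new point.\<close>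
  define pred where "pred S = {(\<gamma>, i) \<in> Z \<times> J. shift (- \<gamma>) S \<in> L i}" for S
  have pred_sub: "pred S \<subseteq> Z \<times> J" for S by (auto simp: pred_def)
  define bad where "bad S = (\<Sum>(\<gamma>, i)\<in>Z \<times> J - pred S. real (cZ (translate \<gamma> (piece i)) S))" for S
  define vl where "vl S = (\<Sum>(\<gamma>, i)\<in>pred S. vol (piece i))" for S
  have fZJ: "finite (Z \<times> J)" using Z(1) J by simp
  have shsp: "shift v S \<in> space P" if "S \<in> space P" for v S
    using measurable_space[OF shm that] by (simp add: spP)
  have bad_eq: "ennreal (bad S) = (\<Sum>(\<gamma>, i)\<in>Z \<times> J. w i (shift (- \<gamma>) S))" if S: "S \<in> space P" for S
  proof -
    have "bad S = (\<Sum>p\<in>Z \<times> J. if p \<in> pred S then 0 else real (cZ (translate (fst p) (piece (snd p))) S))"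
      unfolding bad_def using fZJ by (simp add: sum.If_cases split_beta Diff_eq Int_commute)
    also have "... = (\<Sum>p\<in>Z \<times> J. indicator (space P - L (snd p)) (shift (- fst p) S) * real (cZ (piece (snd p)) (shift (- fst p) S)))"
      using Z(3) S shsp[OF S] by (intro sum.cong refl) (auto simp: pred_def indicator_def cZ_translate)
    also have "ennreal ... = (\<Sum>p\<in>Z \<times> J. w (snd p) (shift (- fst p) S))"
      by (subst sum_ennreal[symmetric]) (auto simp: w_def)
    finally show ?thesis by (simp add: split_beta)
  qed
  have vl_eq: "ennreal (vl S) = (\<Sum>(\<gamma>, i)\<in>Z \<times> J. ennreal (vol (piece i)) * indicator (L i) (shift (- \<gamma>) S))" for S
  proof -
    have "vl S = (\<Sum>p\<in>Z \<times> J. if p \<in> pred S then vol (piece (snd p)) else 0)"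
      unfolding vl_def using fZJ pred_sub[of S] by (simp add: sum.If_cases split_beta Int_absorb1)
    also have "... = (\<Sum>p\<in>Z \<times> J. vol (piece (snd p)) * indicator (L (snd p)) (shift (- fst p) S))"
      by (intro sum.cong refl) (auto simp: pred_def indicator_def)
    also have "ennreal ... = (\<Sum>p\<in>Z \<times> J. ennreal (vol (piece (snd p))) * indicator (L (snd p)) (shift (- fst p) S))"
    proof -
      have "ennreal (\<Sum>p\<in>Z \<times> J. vol (piece (snd p)) * indicator (L (snd p)) (shift (- fst p) S)) =
          (\<Sum>p\<in>Z \<times> J. ennreal (vol (piece (snd p)) * indicator (L (snd p)) (shift (- fst p) S)))"
        by (rule sum_ennreal[symmetric]) simp
      also have "... = (\<Sum>p\<in>Z \<times> J. ennreal (vol (piece (snd p))) * indicator (L (snd p)) (shift (- fst p) S))"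
        by (intro sum.cong refl) (auto split: split_indicator)
      finally show ?thesis .
    qed
    finally show ?thesis by (simp add: split_beta)
  qed
  have wshm: "(\<lambda>S. w i (shift v S)) \<in> borel_measurable P" for i v
    using measurable_compose[OF shm, of "w i" borel v] w_meas[of i] by (simp add: measurable_cong_sets[OF sP refl])
  have Lshm: "(\<lambda>S. ennreal c * indicator (L i) (shift v S)) \<in> borel_measurable P" for i v c
  proof -
    have "(\<lambda>S. ennreal c * indicator (L i) S :: ennreal) \<in> borel_measurable configs"
      using local_events_sets[OF L(1)[of i]] by (intro borel_measurable_times_ennreal borel_measurable_indicator) auto
    from measurable_compose[OF shm this] show ?thesis .
  qed
  have Ebad: "prob {S \<in> space P. a * V \<le> bad S} \<le> 1 / 8"
  proof -
    have "(\<integral>\<^sup>+S. (\<Sum>p\<in>Z \<times> J. w (snd p) (shift (- fst p) S)) \<partial>P) = (\<Sum>p\<in>Z \<times> J. \<integral>\<^sup>+S. w (snd p) (shift (- fst p) S) \<partial>P)"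
      by (rule nn_integral_sum) (rule wshm)
    also have "... \<le> (\<Sum>p\<in>Z \<times> J. ennreal (a / (8 * (card J + 1))))"
      by (intro sum_mono) (simp only: nn_shift[OF w_meas] wint)
    also have "... = ennreal (real (card Z * card J) * (a / (8 * (card J + 1))))"
    proof -
      have "(\<Sum>p\<in>Z \<times> J. ennreal (a / (8 * (card J + 1)))) = ennreal (real (card (Z \<times> J))) * ennreal (a / (8 * (card J + 1)))"
        by (simp only: sum_constant ennreal_of_nat_eq_real_of_nat)
      also have "... = ennreal (real (card (Z \<times> J)) * (a / (8 * (card J + 1))))"
        using a by (intro ennreal_mult[symmetric]) auto
      finally show ?thesis by (simp only: card_cartesian_product)
    qed
    also have "... \<le> ennreal (V * a / 8)"
    proof (rule ennreal_leI)
      have "real (card J) * (a / (8 * (card J + 1))) \<le> a / 8" using a by (simp add: field_simps)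
      from mult_left_mono[OF this, of V] show "real (card Z * card J) * (a / (8 * (card J + 1))) \<le> V * a / 8"
        by (simp add: V_def mult.assoc)
    qed
    finally have le: "(\<integral>\<^sup>+S. (\<Sum>p\<in>Z \<times> J. w (snd p) (shift (- fst p) S)) \<partial>P) \<le> ennreal (V * a / 8)" .
    have "prob {S \<in> space P. ennreal (a * V) \<le> (\<Sum>p\<in>Z \<times> J. w (snd p) (shift (- fst p) S))} \<le> (V * a / 8) / (a * V)"
      by (rule nn_Markov[OF borel_measurable_sum[OF wshm] le]) (use a V1 in auto)
    also have "(V * a / 8) / (a * V) = 1 / 8" using a V1 by simp
    also have "{S \<in> space P. ennreal (a * V) \<le> (\<Sum>p\<in>Z \<times> J. w (snd p) (shift (- fst p) S))} = {S \<in> space P. a * V \<le> bad S}"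
    proof -
      have "0 \<le> bad S" for S unfolding bad_def by (intro sum_nonneg) auto
      then have "ennreal (a * V) \<le> (\<Sum>p\<in>Z \<times> J. w (snd p) (shift (- fst p) S)) \<longleftrightarrow> a * V \<le> bad S" if "S \<in> space P" for S
        using bad_eq[OF that] by (simp add: split_beta flip: ennreal_le_iff)
      then show ?thesis by auto
    qed
    finally show ?thesis .
  qed
  have Evol: "prob {S \<in> space P. \<delta> * V \<le> vl S} \<le> 1 / 8"
  proof -
    let ?g = "\<lambda>p S. ennreal (vol (piece (snd p))) * indicator (L (snd p)) (shift (- fst p) S)"
    have "(\<integral>\<^sup>+S. (\<Sum>p\<in>Z \<times> J. ?g p S) \<partial>P) = (\<Sum>p\<in>Z \<times> J. \<integral>\<^sup>+S. ?g p S \<partial>P)"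
      by (rule nn_integral_sum) (rule Lshm)
    also have "... = (\<Sum>p\<in>Z \<times> J. ennreal (vol (piece (snd p)) * prob (L (snd p))))"
    proof (intro sum.cong refl)
      fix p
      have "(\<integral>\<^sup>+S. ?g p S \<partial>P) = (\<integral>\<^sup>+S. ennreal (vol (piece (snd p))) * indicator (L (snd p)) S \<partial>P)"
        using L_sets by (intro nn_shift[of "\<lambda>S. ennreal (vol (piece (snd p))) * indicator (L (snd p)) S"]
          borel_measurable_times_ennreal borel_measurable_indicator borel_measurable_const)
      also have "... = ennreal (vol (piece (snd p)) * prob (L (snd p)))"
        using L_sets by (simp add: nn_integral_cmult_indicator emeasure_eq_measure ennreal_mult)
      finally show "(\<integral>\<^sup>+S. ?g p S \<partial>P) = ennreal (vol (piece (snd p)) * prob (L (snd p)))" .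
    qed
    also have "... = ennreal (\<Sum>p\<in>Z \<times> J. vol (piece (snd p)) * prob (L (snd p)))"
      by (rule sum_ennreal) simp
    also have "(\<Sum>p\<in>Z \<times> J. vol (piece (snd p)) * prob (L (snd p))) = V * (\<Sum>i\<in>J. vol (piece i) * prob (L i))"
    proof -
      have "(\<Sum>p\<in>Z \<times> J. vol (piece (snd p)) * prob (L (snd p))) =
          (\<Sum>\<gamma>\<in>Z. \<Sum>i\<in>J. vol (piece i) * prob (L i))"
        by (simp only: sum.cartesian_product split_def)
      then show ?thesis by (simp add: V_def)
    qed
    also have "ennreal ... \<le> ennreal (V * (\<delta> / 8))" using volL V1 by (intro ennreal_leI mult_left_mono) auto
    finally have le: "(\<integral>\<^sup>+S. (\<Sum>p\<in>Z \<times> J. ?g p S) \<partial>P) \<le> ennreal (V * (\<delta> / 8))" .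
    have "prob {S \<in> space P. ennreal (\<delta> * V) \<le> (\<Sum>p\<in>Z \<times> J. ?g p S)} \<le> (V * (\<delta> / 8)) / (\<delta> * V)"
      by (rule nn_Markov[OF borel_measurable_sum[OF Lshm] le]) (use \<delta>0 V1 in auto)
    also have "(V * (\<delta> / 8)) / (\<delta> * V) = 1 / 8" using \<delta>0 V1 by simp
    also have "{S \<in> space P. ennreal (\<delta> * V) \<le> (\<Sum>p\<in>Z \<times> J. ?g p S)} = {S \<in> space P. \<delta> * V \<le> vl S}"
    proof -
      have "0 \<le> vl S" for S unfolding vl_def by (intro sum_nonneg) auto
      then have "ennreal (\<delta> * V) \<le> (\<Sum>p\<in>Z \<times> J. ?g p S) \<longleftrightarrow> \<delta> * V \<le> vl S" for S
        using vl_eq[of S] by (simp add: split_beta flip: ennreal_le_iff)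
      then show ?thesis by auto
    qed
    finally show ?thesis .
  qed
  have EX: "prob {S \<in> space P. a * V \<le> \<bar>real (cX \<Lambda> S) - l * (q * V)\<bar>} \<le> 1 / 8"
    and EY: "prob {S \<in> space P. a * V \<le> \<bar>real (cY \<Lambda> S) - l' * (q * V)\<bar>} \<le> 1 / 8"
  proof -
    have aV: "0 < a * V" using a V1 by simp
    have b: "l'' * (q * V) / (a * V)\<^sup>2 \<le> 1 / 8" if "0 < l''" "l'' \<le> l'" for l''
    proof -
      have "l'' * (q * V) / (a * V)\<^sup>2 = l'' * q / (a\<^sup>2 * V)" using V1 by (simp add: power2_eq_square)
      also have "... \<le> l' * q / (a\<^sup>2 * V)" using that q a V1 by (intro divide_right_mono mult_right_mono) auto
      also have "... \<le> 1 / 8" using VN a V1 by (simp add: field_simps)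
      finally show ?thesis .
    qed
    show "prob {S \<in> space P. a * V \<le> \<bar>real (cX \<Lambda> S) - l * (q * V)\<bar>} \<le> 1 / 8"
    proof -
      have "prob {S \<in> space P. a * V \<le> \<bar>real (cX \<Lambda> S) - l * (q * V)\<bar>} \<le> l * (q * V) / (a * V)\<^sup>2"
        using poisson_void_Chebyshev[OF pX l(1) \<Lambda>_sets \<Lambda>_bdd \<Lambda>_pos aV] by (simp only: cX_def \<Lambda>_vol)
      also have "... \<le> 1 / 8" using l by (intro b) auto
      finally show ?thesis .
    qed
    show "prob {S \<in> space P. a * V \<le> \<bar>real (cY \<Lambda> S) - l' * (q * V)\<bar>} \<le> 1 / 8"
    proof -
      have "prob {S \<in> space P. a * V \<le> \<bar>real (cY \<Lambda> S) - l' * (q * V)\<bar>} \<le> l' * (q * V) / (a * V)\<^sup>2"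
        using poisson_void_Chebyshev[OF pY l' \<Lambda>_sets \<Lambda>_bdd \<Lambda>_pos aV] by (simp only: cY_def \<Lambda>_vol)
      also have "... \<le> 1 / 8" using l by (intro b) auto
      finally show ?thesis .
    qed
  qed
  \<comment> \<open>The captured region in the form that \<open>captured_by_local_rule\<close> asks for.\<close>
  define \<F> where "\<F> = (\<Union>\<gamma>\<in>Z. \<Union>i\<in>J. insert (translate \<gamma> (piece i)) (translate \<gamma> ` \<B> i))"
  define pred' where "pred' N = {(\<gamma>, i) \<in> Z \<times> J. {B \<in> \<B> i. translate \<gamma> B \<in> N} \<in> \<T> i}" for N
  define \<Psi> where "\<Psi> N = (\<lambda>(\<gamma>, i). translate \<gamma> (piece i)) ` pred' N" for N
  have F: "finite \<F>" unfolding \<F>_def using Z(1) J \<B>(2) by auto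
  have F_sets: "F \<in> sets borel" if "F \<in> \<F>" for F
    using that \<B>(3) trp_sets by (auto simp: \<F>_def intro: translate_borel)
  have F_W: "F \<subseteq> W" if "F \<in> \<F>" for F
  proof -
    obtain \<gamma> B where "F = translate \<gamma> B" "\<gamma> \<in> Z" "B \<subseteq> D"
      using \<open>F \<in> \<F>\<close> piece_sub unfolding \<F>_def D_def by blast
    then show ?thesis using Z(7) unfolding translate_def by blast
  qed
  have \<Psi>_sub: "\<Psi> N \<subseteq> \<F>" for N unfolding \<Psi>_def pred'_def \<F>_def by auto
  have pred'_eq: "pred' {F \<in> \<F>. S \<inter> F = {}} = pred S" if S: "S \<in> space P" for S
  proof -
    have "{B \<in> \<B> i. translate \<gamma> B \<in> {F \<in> \<F>. S \<inter> F = {}}} = {B \<in> \<B> i. shift (- \<gamma>) S \<inter> B = {}}"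
      if "\<gamma> \<in> Z" "i \<in> J" for \<gamma> i
      using that unfolding \<F>_def by (auto simp: Int_translate_empty_iff)
    then show ?thesis using shsp[OF S] by (auto simp: pred'_def pred_def \<B>(1) local_event_def spP)
  qed
  have U_eq: "\<Union>(\<Psi> {F \<in> \<F>. S \<inter> F = {}}) = (\<Union>(\<gamma>, i)\<in>pred S. translate \<gamma> (piece i))" if "S \<in> space P" for S
    unfolding \<Psi>_def pred'_eq[OF that] by auto
  let ?U = "\<lambda>S. \<Union>(\<Psi> {F \<in> \<F>. S \<inter> F = {}})"
  define c where "c = nat \<lceil>a * V\<rceil>"
  let ?G = "{S \<in> space P. vol (?U S) \<le> \<delta> * V \<and> c \<le> card ((S \<union> f S - S) \<inter> ?U S)}"
  have up: "prob E' * (1 / \<delta>) ^ c \<le> exp (l' * (vol W + 1 / \<delta> * (\<delta> * V)))"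
    if "E' \<subseteq> ?G" for E'
    by (rule captured_by_local_rule[OF pY _ Xm _ F F_sets F_W Z(5,6) \<Psi>_sub])
      (use l' \<delta>0 \<delta>1 V1 that in auto)
  have G_small: "prob E' \<le> 1 / 4" if E': "E' \<subseteq> ?G" for E'
  proof -
    have "exp (l' * (vol W + 1 / \<delta> * (\<delta> * V))) \<le> exp (l' * ((\<kappa> + 1) * V))"
    proof (intro exp_mono mult_left_mono)
      show "vol W + 1 / \<delta> * (\<delta> * V) \<le> (\<kappa> + 1) * V" using Z(8) \<delta>0 by (simp add: V_def algebra_simps)
    qed (use l' in simp)
    also have "... = C powr V" by (simp add: C_def powr_def mult_ac)
    finally have 1: "prob E' * (1 / \<delta>) ^ c \<le> C powr V" using up[OF E'] by linarith
    have "(4 * C) powr V = (1 / \<delta>) powr (a * V)"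
    proof -
      have "(1 / \<delta>) powr (a * V) = ((1 / \<delta>) powr a) powr V" by (simp add: powr_powr)
      also have "(1 / \<delta>) powr a = 4 * C" using \<delta>a \<delta>0 by (simp add: powr_divide)
      finally show ?thesis by simp
    qed
    also have "... \<le> (1 / \<delta>) powr (real c)"
    proof (rule powr_mono)
      show "a * V \<le> real c" unfolding c_def by linarith
    qed (use \<delta>0 \<delta>1 in simp)
    also have "... = (1 / \<delta>) ^ c" using \<delta>0 by (simp add: powr_realpow)
    finally have "prob E' * (4 * C) powr V \<le> prob E' * (1 / \<delta>) ^ c" by (intro mult_left_mono) auto
    then have "prob E' * (4 * C) powr V \<le> C powr V" using 1 by linarith
    then have "prob E' * 4 powr V * C powr V \<le> 1 * C powr V" using C1 by (simp add: powr_mult mult.assoc)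
    then have "prob E' * 4 powr V \<le> 1" using C1 by simp
    moreover have "4 \<le> (4::real) powr V" using powr_mono[of 1 V 4] V1 by simp
    ultimately have "prob E' * 4 \<le> 1" using mult_left_mono[of 4 "4 powr V" "prob E'"] by simp
    then show ?thesis by simp
  qed
  have ge_ev: "{S \<in> space P. c \<le> g S} \<in> events" if "g \<in> borel_measurable P" for g :: "'a set \<Rightarrow> real" and c
  proof -
    have "{S \<in> space P. c \<le> g S} = g -` {c..} \<inter> space P" by auto
    then show ?thesis by (simp only: measurable_sets[OF that borel_closed[OF closed_atLeast]])
  qed
  have bad_ev: "{S \<in> space P. a * V \<le> bad S} \<in> events"
  proof (rule ge_ev)
    have "(\<lambda>S. \<Sum>p\<in>Z \<times> J. w (snd p) (shift (- fst p) S)) \<in> borel_measurable P"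
      by (rule borel_measurable_sum) (rule wshm)
    then
    have "(\<lambda>S. enn2real (\<Sum>p\<in>Z \<times> J. w (snd p) (shift (- fst p) S))) \<in> borel_measurable P" by (rule borel_measurable_enn2real)
    moreover have "bad S = enn2real (\<Sum>p\<in>Z \<times> J. w (snd p) (shift (- fst p) S))" if "S \<in> space P" for S
    proof -
      have "0 \<le> bad S" unfolding bad_def by (intro sum_nonneg) auto
      then have "bad S = enn2real (ennreal (bad S))" by simp
      then show ?thesis by (simp only: bad_eq[OF that] split_def)
    qed
    ultimately show "bad \<in> borel_measurable P" by (subst measurable_cong)
  qed
  have vol_ev: "{S \<in> space P. \<delta> * V \<le> vl S} \<in> events"
  proof (rule ge_ev)
    have "(\<lambda>S. \<Sum>p\<in>Z \<times> J. ennreal (vol (piece (snd p))) * indicator (L (snd p)) (shift (- fst p) S)) \<in> borel_measurable P"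
      by (rule borel_measurable_sum) (rule Lshm)
    then
    have "(\<lambda>S. enn2real (\<Sum>p\<in>Z \<times> J. ennreal (vol (piece (snd p))) * indicator (L (snd p)) (shift (- fst p) S))) \<in> borel_measurable P" by (rule borel_measurable_enn2real)
    moreover have "vl S = enn2real (\<Sum>p\<in>Z \<times> J. ennreal (vol (piece (snd p))) * indicator (L (snd p)) (shift (- fst p) S))" for S
    proof -
      have "0 \<le> vl S" unfolding vl_def by (intro sum_nonneg) auto
      then have "vl S = enn2real (ennreal (vl S))" by simp
      then show ?thesis by (simp only: vl_eq split_def)
    qed
    ultimately show "vl \<in> borel_measurable P" by (subst measurable_cong)
  qed
  have X_ev: "{S \<in> space P. a * V \<le> \<bar>real (cX \<Lambda> S) - l * (q * V)\<bar>} \<in> events"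
    by (rule ge_ev, rule measurable_compose[OF cXm[OF \<Lambda>_sets \<Lambda>_bdd]]) simp
  have Y_ev: "{S \<in> space P. a * V \<le> \<bar>real (cY \<Lambda> S) - l' * (q * V)\<bar>} \<in> events"
    by (rule ge_ev, rule measurable_compose[OF cYm[OF \<Lambda>_sets \<Lambda>_bdd]]) simp
  let ?E1 = "{S \<in> space P. a * V \<le> bad S}" and ?E2 = "{S \<in> space P. \<delta> * V \<le> vl S}"
    and ?E3 = "{S \<in> space P. a * V \<le> \<bar>real (cX \<Lambda> S) - l * (q * V)\<bar>}" and ?E4 = "{S \<in> space P. a * V \<le> \<bar>real (cY \<Lambda> S) - l' * (q * V)\<bar>}"
  let ?E = "(?E1 \<union> ?E2) \<union> (?E3 \<union> ?E4)"
  have ev12: "?E1 \<union> ?E2 \<in> events" by (rule sets.Un[OF bad_ev vol_ev])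
  have ev34: "?E3 \<union> ?E4 \<in> events" by (rule sets.Un[OF X_ev Y_ev])
  have "prob ?E \<le> 1 / 2"
    using measure_Un_le[OF ev12 ev34] measure_Un_le[OF bad_ev vol_ev] measure_Un_le[OF X_ev Y_ev] Ebad Evol EX EY by linarith
  then have half: "1 / 2 \<le> prob (space P - ?E)" using prob_compl[OF sets.Un[OF ev12 ev34]] by linarith
  have good: "space P - ?E \<subseteq> ?G"
  proof
    fix S assume SE: "S \<in> space P - ?E"
    then have S: "S \<in> space P" and e: "bad S < a * V" "vl S < \<delta> * V"
        "\<bar>real (cX \<Lambda> S) - l * (q * V)\<bar> < a * V" "\<bar>real (cY \<Lambda> S) - l' * (q * V)\<bar> < a * V" by auto
    have "vol (?U S) \<le> (\<Sum>p\<in>pred S. vol (translate (fst p) (piece (snd p))))"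
      unfolding U_eq[OF S] split_beta
    proof (rule measure_UNION_le)
      show "finite (pred S)" using pred_sub fZJ by (rule finite_subset)
    qed (simp add: trp_sets)
    also have "... = vl S" unfolding vl_def by (simp add: measure_translate[OF piece_sets] split_beta)
    finally have volU: "vol (?U S) \<le> \<delta> * V" using e by simp
    have "real (cZ \<Lambda> S) = real (cY \<Lambda> S) - real (cX \<Lambda> S)" using cYXZ[OF S \<Lambda>_bdd] by simp
    moreover have "l' * (q * V) - l * (q * V) = 4 * (a * V)" by (simp add: a_def algebra_simps)
    ultimately have "2 * (a * V) < real (cZ \<Lambda> S)" using e by linarith
    also have "cZ \<Lambda> S = (\<Sum>p\<in>Z \<times> J. cZ (translate (fst p) (piece (snd p))) S)"
      using cZ_UN[OF S order_refl] by (simp add: \<Lambda>_UN split_beta)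
    also have "... = (\<Sum>p\<in>Z \<times> J - pred S. cZ (translate (fst p) (piece (snd p))) S) + (\<Sum>p\<in>pred S. cZ (translate (fst p) (piece (snd p))) S)"
      by (rule sum.subset_diff[OF pred_sub fZJ])
    also have "real ... = bad S + real (cZ (?U S) S)"
      using cZ_UN[OF S pred_sub] by (simp add: bad_def U_eq[OF S] split_beta)
    finally have "a * V < real (cZ (?U S) S)" using e(1) by linarith
    then have "c \<le> cZ (?U S) S" unfolding c_def by linarith
    moreover have "(S \<union> f S - S) = f S - S" by blast
    ultimately show "S \<in> ?G" using S volU by (simp add: cZ_def)
  qed
  then have "prob (space P - ?E) \<le> 1 / 4" by (rule G_small)
  then show False using half by simp
qed

lemma commutes_with_shift_0: "commutes_with_shift f 0"
  by (simp add: commutes_with_shift_def)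

lemma commutes_with_shift_add:
  assumes "commutes_with_shift f v" "commutes_with_shift f w"
  shows "commutes_with_shift f (v + w)"
  unfolding commutes_with_shift_def
proof
  fix S :: "'a set" assume S: "S \<in> space configs"
  then have "shift w S \<in> space configs" using measurable_space[OF shift_measurable] by blast
  then show "shift (v + w) (f S) = f (shift (v + w) S)"
    using assms S by (simp add: commutes_with_shift_def flip: shift_shift)
qed

lemma commutes_with_shift_sum:
  assumes "finite I" "\<And>i. i \<in> I \<Longrightarrow> commutes_with_shift f (v i)"
  shows "commutes_with_shift f (\<Sum>i\<in>I. real (k i) *\<^sub>R v i)"
  using assms
proof (induction I rule: finite_induct)
  case empty
  then show ?case by (simp add: commutes_with_shift_0)
next
  case (insert i I)
  have "commutes_with_shift f (real n *\<^sub>R v i)" for n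
  proof (induction n)
    case 0
    then show ?case by (simp add: commutes_with_shift_0)
  next
    case (Suc n)
    then show ?case using commutes_with_shift_add[of f "real n *\<^sub>R v i" "v i"] insert.prems
      by (simp add: algebra_simps)
  qed
  then show ?case using insert by (simp add: commutes_with_shift_add)
qed

lemma hcube_vec: "hcube (\<chi> i. a) s = {t :: real ^ 'd::finite. \<forall>i. a \<le> t $ i \<and> t $ i < a + s}"
  by (auto simp: hcube_def Basis_vec_def inner_axis)

text \<open>Large boxes of a lattice satisfy the hypotheses of \<open>no_equivariant_thickening\<close>.\<close>

theorem no_lattice_thickening:
  fixes v :: "'d::finite \<Rightarrow> real ^ 'd" and f :: "(real ^ 'd) set \<Rightarrow> (real ^ 'd) set"
  assumes l: "0 < l" "l < l'" and v: "inj v" "independent (range v)"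
    and thick: "thickening l l' f" and comm: "\<And>i. commutes_with_shift f (v i)"
  shows False
proof -
  define A where "A t = (\<Sum>i\<in>UNIV. t $ i *\<^sub>R v i)" for t :: "real ^ 'd"
  have linA: "linear A"
    by (rule linearI) (simp_all add: A_def scaleR_left_distrib sum.distrib scaleR_sum_right)
  have injA: "inj A"
  proof (subst linear_injective_0[OF linA], intro allI impI)
    fix t assume t: "A t = 0"
    have "t $ i = 0" for i
    proof -
      have "(\<Sum>x\<in>range v. t $ (inv v x) *\<^sub>R x) = 0"
        using t v(1) by (simp add: sum.reindex A_def)
      then have "t $ (inv v (v i)) = 0"
        using independentD[OF v(2), of "range v" "\<lambda>x. t $ (inv v x)" "v i"] by simp
      then show ?thesis using v(1) by simp
    qed
    then show "t = 0" by (simp add: vec_eq_iff)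
  qed
  obtain G where G: "linear G" "\<And>t. G (A t) = t" "\<And>y. A (G y) = y"
    using linear_injective_isomorphism[OF linA injA] by blast
  define Bx where "Bx a s = {y. \<forall>i. a \<le> G y $ i \<and> G y $ i < a + s}" for a s :: real
  have Bx_image: "Bx a s = A ` hcube (\<chi> i. a) s" for a s
  proof (intro set_eqI iffI)
    fix y assume "y \<in> Bx a s"
    then show "y \<in> A ` hcube (\<chi> i. a) s" by (intro image_eqI[of _ _ "G y"]) (auto simp: Bx_def hcube_vec G)
  qed (auto simp: Bx_def hcube_vec G)
  have Bx_sets: "Bx a s \<in> sets borel" for a s
  proof -
    have "Bx a s = G -` hcube (\<chi> i. a) s" by (auto simp: Bx_def hcube_vec)
    moreover have "G \<in> borel_measurable borel"
      by (rule borel_measurable_continuous_onI) (rule linear_continuous_on, rule linear_conv_bounded_linear[THEN iffD1, OF G(1)])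
    ultimately show ?thesis using measurable_sets_borel[OF _ hcube_sets] by metis
  qed
  have Bx_bdd: "bounded (Bx a s)" for a s
    unfolding Bx_image using linA by (intro bounded_linear_image bounded_hcube) (simp add: linear_conv_bounded_linear)
  define q where "q = vol (Bx 0 1)"
  have q: "0 < q"
  proof -
    let ?c = "A (\<chi> i. 1 / 2)"
    have "continuous_on UNIV G" by (rule linear_continuous_on) (rule linear_conv_bounded_linear[THEN iffD1, OF G(1)])
    then have "isCont G ?c" by (simp add: continuous_on_eq_continuous_at)
    then obtain e where e: "0 < e" "\<And>y. dist y ?c < e \<Longrightarrow> dist (G y) (G ?c) < 1 / 2"
      unfolding continuous_at_eps_delta by (metis half_gt_zero_iff zero_less_one)
    have "ball ?c e \<subseteq> Bx 0 1"
    proof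
      fix y assume "y \<in> ball ?c e"
      then have d: "norm (G y - (\<chi> i. 1 / 2)) < 1 / 2" using e(2)[of y] by (simp add: dist_commute G dist_norm)
      have "\<bar>G y $ i - 1 / 2\<bar> < 1 / 2" for i
        using component_le_norm_cart[of "G y - (\<chi> i. 1 / 2)" i] d by simp
      then have "0 \<le> G y $ i \<and> G y $ i < 0 + 1" for i by (smt (verit) field_sum_of_halves)
      then show "y \<in> Bx 0 1" by (simp add: Bx_def)
    qed
    then have "vol (ball ?c e) \<le> q"
      unfolding q_def using Bx_sets emeasure_bounded_finite[OF Bx_bdd]
      by (intro measure_mono_fmeasurable) (auto simp: fmeasurable_def)
    then show ?thesis using content_ball_pos[OF e(1), of ?c] by linarith
  qed
  have Bx_vol: "vol (Bx a s) = q * s ^ CARD('d)" if s: "0 < s" for a s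
  proof -
    let ?T = "\<lambda>x. A (\<chi> i. a) + s *\<^sub>R x"
    have vim: "?T -` Bx a s = Bx 0 1"
      using s by (auto simp: Bx_def linear_add[OF G(1)] linear_scale[OF G(1)] G zero_le_mult_iff)
    have "emeasure lborel (Bx a s) = emeasure (density (distr lborel borel ?T) (\<lambda>_. ennreal (\<bar>s\<bar> ^ DIM(real ^ 'd)))) (Bx a s)"
      using lborel_affine[of s "A (\<chi> i. a)"] s by simp
    also have "... = ennreal (s ^ CARD('d)) * emeasure lborel (?T -` Bx a s)"
      using s Bx_sets[of a s] by (subst emeasure_density) (auto simp: nn_integral_cmult emeasure_distr)
    finally show ?thesis using s unfolding vim by (simp add: q_def measure_def enn2real_mult)
  qed
  define Q where "Q = Bx 0 1"
  define pt where "pt z = A (\<chi> i. real (z i))" for z :: "'d \<Rightarrow> nat"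
  have inj_pt: "inj pt"
  proof (rule injI)
    fix z z' assume "pt z = pt z'"
    then have "(\<chi> i. real (z i)) = (\<chi> i. real (z' i))" using injA by (simp add: pt_def inj_eq)
    then show "z = z'" by (auto simp: vec_eq_iff)
  qed
  have Gt: "G (y + (- pt z)) $ i = G y $ i - real (z i)" for y z i
    using linear_add[OF G(1), of y "- pt z"] linear_neg[OF G(1), of "pt z"] by (simp add: pt_def G)
  show False
  proof (rule no_equivariant_thickening[OF l thick, of Q "q * 2 ^ CARD('d)"])
    show "Q \<in> sets borel" "bounded Q" unfolding Q_def by (rule Bx_sets, rule Bx_bdd)
    show "0 < vol Q" using Bx_vol[of 1 0] q by (simp add: Q_def)
    show "0 < q * 2 ^ CARD('d)" using q by simp
    fix D :: "(real ^ 'd) set" and N :: nat assume D: "bounded D"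
    have "bounded (G ` D)" using D G(1) by (intro bounded_linear_image) (simp_all add: linear_conv_bounded_linear)
    then obtain r where r: "\<And>y. y \<in> D \<Longrightarrow> norm (G y) \<le> r" by (auto simp: bounded_iff)
    define R where "R = nat \<lceil>r\<rceil> + 1"
    have R: "\<bar>G y $ i\<bar> < real R" if "y \<in> D" for y i
      using r[OF that] component_le_norm_cart[of "G y" i] unfolding R_def by linarith
    define n where "n = N + 2 * R + 1"
    define Z where "Z = pt ` (UNIV \<rightarrow>\<^sub>E {..<n})"
    have cardZ: "card Z = n ^ CARD('d)"
      unfolding Z_def using inj_pt by (subst card_image) (auto simp: card_PiE intro: inj_on_subset)
    have finZ: "finite Z" unfolding Z_def by (intro finite_imageI finite_PiE) auto
    have "N \<le> card Z"
    proof -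
      have "n ^ 1 \<le> n ^ CARD('d)" by (rule power_increasing) (auto simp: n_def Suc_leI)
      then show ?thesis by (simp add: cardZ n_def)
    qed
    moreover have "\<forall>\<gamma>\<in>Z. commutes_with_shift f \<gamma>"
      using commutes_with_shift_sum[of UNIV f v] comm by (auto simp: Z_def pt_def A_def)
    moreover have "disjoint_family_on (\<lambda>\<gamma>. translate \<gamma> Q) Z"
    proof -
      have "z = z'" if "y + (- pt z) \<in> Q" "y + (- pt z') \<in> Q" for y z z'
      proof
        fix i
        have "0 \<le> G y $ i - real (z i)" "G y $ i - real (z i) < 1" "0 \<le> G y $ i - real (z' i)" "G y $ i - real (z' i) < 1"
          using that Gt[of y z i] Gt[of y z' i] by (auto simp: Q_def Bx_def elim!: allE[of _ i])
        then have "real (z i) < real (z' i) + 1" "real (z' i) < real (z i) + 1" by linarith+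
        then show "z i = z' i" by linarith
      qed
      then show ?thesis unfolding disjoint_family_on_def Z_def translate_def by blast
    qed
    moreover have "\<forall>\<gamma>\<in>Z. translate \<gamma> D \<subseteq> Bx (- real R) (real (n + 2 * R))"
    proof (intro ballI subsetI)
      fix \<gamma> y assume "\<gamma> \<in> Z" and y: "y \<in> translate \<gamma> D"
      then obtain z where z: "\<gamma> = pt z" "\<And>i. z i < n" by (auto simp: Z_def)
      have "- real R \<le> G y $ i \<and> G y $ i < - real R + real (n + 2 * R)" for i
      proof -
        have "\<bar>G y $ i - real (z i)\<bar> < real R" using R[of "y + (- pt z)" i] y z(1) Gt[of y z i] by (simp add: translate_def)
        moreover have "real (z i) + 1 \<le> real n" using z(2)[of i] by linarith
        ultimately show ?thesis by (simp; linarith)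
      qed
      then show "y \<in> Bx (- real R) (real (n + 2 * R))" by (simp add: Bx_def)
    qed
    moreover have "vol (Bx (- real R) (real (n + 2 * R))) \<le> q * 2 ^ CARD('d) * real (card Z)"
    proof -
      have "vol (Bx (- real R) (real (n + 2 * R))) = q * real (n + 2 * R) ^ CARD('d)" by (rule Bx_vol) (simp add: n_def)
      also have "... \<le> q * (2 * real n) ^ CARD('d)" using q by (intro mult_left_mono power_mono) (auto simp: n_def)
      finally show ?thesis by (simp add: cardZ power_mult_distrib)
    qed
    ultimately show "\<exists>Z W. finite Z \<and> N \<le> card Z \<and> (\<forall>\<gamma>\<in>Z. commutes_with_shift f \<gamma>) \<and>
      disjoint_family_on (\<lambda>\<gamma>. translate \<gamma> Q) Z \<and> W \<in> sets borel \<and> bounded W \<and>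
      (\<forall>\<gamma>\<in>Z. translate \<gamma> D \<subseteq> W) \<and> vol W \<le> q * 2 ^ CARD('d) * real (card Z)"
      using finZ Bx_sets[of "- real R" "real (n + 2 * R)"] Bx_bdd[of "- real R" "real (n + 2 * R)"]
      by - (rule exI[of _ Z], rule exI[of _ "Bx (- real R) (real (n + 2 * R))"], intro conjI; assumption)
  qed
qed

section \<open>Fair bits from symmetric occupation patterns\<close>

text \<open>The states \<open>Left\<close> and \<open>Right\<close> stand for exactly one point in the box, in the cube of that name.\<close>

datatype occ = Empty | Left | Right | Many

lemma finite_UNIV_occ: "finite (UNIV :: occ set)"
proof -
  have "(UNIV :: occ set) \<subseteq> {Empty, Left, Right, Many}" using occ.exhaust by auto
  then show ?thesis by (rule finite_subset) simp
qed

text \<open>The first box of the row that contains exactly one point decides.\<close>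

definition first_bit :: "(nat \<Rightarrow> occ) \<Rightarrow> bool" where
  "first_bit w \<longleftrightarrow> (\<exists>l. w l = Right \<and> (\<forall>j<l. w j \<notin> {Left, Right}))"

definition hidden_seed :: "(nat \<Rightarrow> occ) \<Rightarrow> nat \<Rightarrow> real" where
  "hidden_seed w = uniforms_of_coins (\<lambda>i. first_bit (rows w i))"

abbreviation pmfs :: "(nat \<Rightarrow> 'c pmf) \<Rightarrow> (nat \<Rightarrow> 'c) measure" where
  "pmfs q \<equiv> PiM UNIV (\<lambda>i. measure_pmf (q i))"

lemma prob_space_pmfs: "prob_space (pmfs q)"
  by (rule prob_space_PiM) (rule prob_space_measure_pmf)

lemma measurable_PiM_UNIV:
  assumes "\<And>i. (\<lambda>w. f w i) \<in> measurable M (N i)" and "\<And>i. space (N i) = UNIV"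
  shows "f \<in> measurable M (PiM UNIV N)"
proof -
  have "(\<lambda>w i. f w i) \<in> measurable M (PiM UNIV N)"
    by (rule measurable_PiM_single'[OF assms(1)]) (auto simp: assms(2) PiE_iff)
  then show ?thesis .
qed

lemma space_pmfs: "space (pmfs q) = UNIV"
  by (simp add: space_PiM)

lemma pmfs_component_sets: "{w \<in> space (pmfs q). P (w l)} \<in> sets (pmfs q)"
  by (rule sets_Collect_single') simp_all

lemma pmfs_coordinate: "(\<lambda>w. w i) \<in> measurable (pmfs q) (measure_pmf (q i))"
  by (rule measurable_component_singleton) simp

lemma pmfs_coordinate_pmf: "(\<lambda>w. g (w i)) \<in> measurable (pmfs q) (measure_pmf p)"
  using pmfs_coordinate[of i q] by (rule measurable_compose) simp

lemma sets_pmfs: "sets (pmfs q) = sets (PiM UNIV (\<lambda>_. count_space UNIV))"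
  by (rule sets_PiM_cong) simp_all

lemma first_bit_sets: "{w \<in> space (pmfs q). first_bit w} \<in> sets (pmfs q)"
  unfolding first_bit_def
  by (intro sets.sets_Collect_countable_Ex sets.sets_Collect_conj sets.sets_Collect_countable_All
      sets.sets_Collect_imp pmfs_component_sets)

lemma first_bit_measurable: "first_bit \<in> measurable (pmfs q) coin"
proof -
  have "first_bit \<in> measurable (pmfs q) (count_space UNIV)"
    using first_bit_sets[of q] unfolding pred_def[symmetric] .
  then show ?thesis by simp
qed

fun swap :: "occ \<Rightarrow> occ" where
  "swap Left = Right" | "swap Right = Left" | "swap Empty = Empty" | "swap Many = Many"

lemma swap_swap [simp]: "swap (swap x) = x"
  by (cases x) auto

lemma map_pmf_swap:
  assumes "pmf p Left = pmf p Right" shows "map_pmf swap p = p"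
proof (rule pmf_eqI)
  fix i
  have "inj swap" by (metis injI swap_swap)
  then have "pmf (map_pmf swap p) (swap (swap i)) = pmf p (swap i)" by (rule pmf_map_inj')
  also have "... = pmf p i" using assms by (cases i) auto
  finally show "pmf (map_pmf swap p) i = pmf p i" by simp
qed

text \<open>Exchanging \<open>Left\<close> and \<open>Right\<close> in the whole row preserves the law and flips the first bit.\<close>

lemma distr_first_bit:
  assumes sym: "\<And>k. pmf (p k) Left = pmf (p k) Right" and c: "0 < c" and ev: "\<And>k. n0 \<le> k \<Longrightarrow> c \<le> pmf (p k) Left"
  shows "distr (pmfs p) coin first_bit = coin"
proof -
  interpret prob_space "pmfs p" by (rule prob_space_pmfs)
  let ?E = "\<lambda>r. {w \<in> space (pmfs p). \<exists>l. w l = r \<and> (\<forall>j<l. w j \<notin> {Left, Right})}"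
  have E_sets: "?E r \<in> events" for r
    by (intro sets.sets_Collect_countable_Ex sets.sets_Collect_conj sets.sets_Collect_countable_All
      sets.sets_Collect_imp pmfs_component_sets)
  have sm: "(\<lambda>w k. swap (w k)) \<in> measurable (pmfs p) (pmfs p)"
    by (rule measurable_PiM_UNIV) (simp_all only: pmfs_coordinate_pmf space_measure_pmf)
  have inv: "distr (pmfs p) (pmfs p) (\<lambda>w k. swap (w k)) = pmfs p"
  proof -
    have "distr (pmfs p) (pmfs p) (\<lambda>w k. swap (w k)) = PiM UNIV (\<lambda>k. distr (measure_pmf (p k)) (measure_pmf (p k)) swap)"
      by (rule PiM_distr) (simp_all add: prob_space_measure_pmf)
    also have "(\<lambda>k. distr (measure_pmf (p k)) (measure_pmf (p k)) swap) = (\<lambda>k. measure_pmf (p k))"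
    proof
      fix k
      have "distr (measure_pmf (p k)) (measure_pmf (p k)) swap = distr (measure_pmf (p k)) (count_space UNIV) swap"
        by (rule distr_cong) simp_all
      also have "... = measure_pmf (p k)" using map_pmf_swap[OF sym, of k] by (simp flip: map_pmf_rep_eq)
      finally show "distr (measure_pmf (p k)) (measure_pmf (p k)) swap = measure_pmf (p k)" .
    qed
    finally show ?thesis .
  qed
  have swLR: "swap x \<in> {Left, Right} \<longleftrightarrow> x \<in> {Left, Right}" "swap x = Left \<longleftrightarrow> x = Right" for x by (cases x; simp)+
  have "prob (?E Left) = measure (distr (pmfs p) (pmfs p) (\<lambda>w k. swap (w k))) (?E Left)" by (simp only: inv)
  also have "... = prob ((\<lambda>w k. swap (w k)) -` ?E Left \<inter> space (pmfs p))" by (rule measure_distr[OF sm E_sets])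
  also have "(\<lambda>w k. swap (w k)) -` ?E Left \<inter> space (pmfs p) = ?E Right"
    unfolding vimage_def mem_Collect_eq swLR by (auto simp: space_PiM)
  finally have eq: "prob (?E Left) = prob (?E Right)" .
  have disj: "?E Left \<inter> ?E Right = {}"
  proof -
    have False if "w l = Left" "\<forall>j<l. w j \<notin> {Left, Right}" "w l' = Right" "\<forall>j<l'. w j \<notin> {Left, Right}" for w :: "nat \<Rightarrow> occ" and l l' :: nat
      using that by (cases l l' rule: linorder_cases) auto
    then show ?thesis by blast
  qed
  have never: "prob (space (pmfs p) - (?E Left \<union> ?E Right)) = 0"
  proof -
    have le: "prob (space (pmfs p) - (?E Left \<union> ?E Right)) \<le> (1 - c) ^ n" for n
    proof -
      let ?F = "{w \<in> space (pmfs p). \<forall>k\<in>{n0..<n0 + n}. w k \<in> - {Left}}"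
      have F_sets: "?F \<in> events" by (intro sets.sets_Collect_finite_All sets_Collect_single') auto
      have sub: "space (pmfs p) - (?E Left \<union> ?E Right) \<subseteq> ?F"
      proof
        fix w assume w: "w \<in> space (pmfs p) - (?E Left \<union> ?E Right)"
        have "w k \<noteq> Left" for k
        proof
          assume k: "w k = Left"
          define l where "l = (LEAST l. w l \<in> {Left, Right})"
          have "w l \<in> {Left, Right}" unfolding l_def by (rule LeastI[of _ k]) (simp add: k)
          moreover have "\<forall>j<l. w j \<notin> {Left, Right}" unfolding l_def using not_less_Least by blast
          ultimately show False using w by blast
        qed
        then show "w \<in> ?F" using w by auto
      qed
      have "emeasure (pmfs p) ?F = (\<Prod>k\<in>{n0..<n0 + n}. emeasure (measure_pmf (p k)) (- {Left}))"
        by (rule PiM_prob_Ball) (simp_all add: prob_space_measure_pmf)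
      also have "... = (\<Prod>k\<in>{n0..<n0 + n}. ennreal (1 - pmf (p k) Left))"
      proof (intro prod.cong refl)
        fix k
        have "measure (measure_pmf (p k)) (- {Left}) = 1 - pmf (p k) Left"
          using measure_pmf.prob_compl[of "{Left}" "p k"] by (simp add: Compl_eq_Diff_UNIV measure_pmf_single)
        then show "emeasure (measure_pmf (p k)) (- {Left}) = ennreal (1 - pmf (p k) Left)"
          by (simp add: measure_pmf.emeasure_eq_measure)
      qed
      also have "... = ennreal (\<Prod>k\<in>{n0..<n0 + n}. 1 - pmf (p k) Left)"
        by (rule prod_ennreal) (simp add: pmf_le_1)
      also have "... \<le> ennreal (\<Prod>k\<in>{n0..<n0 + n}. 1 - c)"
        using ev by (intro ennreal_leI prod_mono conjI) (simp_all add: pmf_le_1)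
      also have "... = ennreal ((1 - c) ^ n)" by simp
      finally have "prob ?F \<le> (1 - c) ^ n"
        using c ev[of n0] pmf_le_1[of "p n0" Left] by (simp add: emeasure_eq_measure)
      then show ?thesis using finite_measure_mono[OF sub F_sets] by linarith
    qed
    have "(\<lambda>n. (1 - c) ^ n) \<longlonglongrightarrow> 0"
      using c ev[of n0] pmf_le_1[of "p n0" Left] by (intro LIMSEQ_power_zero) auto
    then have "prob (space (pmfs p) - (?E Left \<union> ?E Right)) \<le> 0"
      using le by (intro LIMSEQ_le_const) auto
    then show ?thesis using measure_nonneg[of "pmfs p" "space (pmfs p) - (?E Left \<union> ?E Right)"] by linarith
  qed
  have "prob (?E Left) + prob (?E Right) = 1"
    using prob_compl[OF sets.Un[OF E_sets[of Left] E_sets[of Right]]] never finite_measure_Union[OF E_sets E_sets disj] by linarith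
  then have half: "prob (?E Right) = 1 / 2" using eq by linarith
  have ER: "{w \<in> space (pmfs p). first_bit w} = ?E Right" by (simp add: first_bit_def)
  show ?thesis
  proof (rule measure_eqI_countable[where A=UNIV])
    fix b
    have "first_bit -` {True} \<inter> space (pmfs p) = ?E Right" "first_bit -` {False} \<inter> space (pmfs p) = space (pmfs p) - ?E Right"
      unfolding ER[symmetric] by auto
    then have hp: "prob (first_bit -` {b} \<inter> space (pmfs p)) = 1 / 2"
      using half prob_compl[OF E_sets[of Right]] by (cases b) simp_all
    have c1: "emeasure coin {b} = ennreal (1 / 2)" by (cases b) (simp_all add: emeasure_pmf_single)
    show "emeasure (distr (pmfs p) coin first_bit) {b} = emeasure coin {b}"
      by (subst emeasure_distr[OF first_bit_measurable]) (simp, simp only: emeasure_eq_measure hp c1)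
  qed auto
qed

lemma hidden_coins_measurable: "(\<lambda>w i. first_bit (rows w i)) \<in> measurable (pmfs p) coins"
proof (rule measurable_PiM_UNIV)
  fix i
  have "(\<lambda>w. rows w i) \<in> measurable (pmfs p) (pmfs (\<lambda>j. p (prod_encode (i, j))))"
  proof (rule measurable_PiM_UNIV)
    show "(\<lambda>w. rows w i j) \<in> measurable (pmfs p) (measure_pmf (p (prod_encode (i, j))))" for j
      unfolding rows_def by (rule pmfs_coordinate)
  qed (simp_all only: space_pmfs space_measure_pmf)
  from measurable_compose[OF this first_bit_measurable[of "\<lambda>j. p (prod_encode (i, j))"]]
  show "(\<lambda>w. first_bit (rows w i)) \<in> measurable (pmfs p) coin" .
qed (simp_all only: space_pmfs space_measure_pmf)

lemma hidden_seed_measurable: "hidden_seed \<in> measurable (pmfs p) Us"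
  unfolding hidden_seed_def by (rule measurable_compose[OF hidden_coins_measurable uniforms_of_coins_measurable])

lemma distr_hidden_seed:
  assumes sym: "\<And>k. pmf (p k) Left = pmf (p k) Right" and c: "0 < c" and ev: "\<And>k. n0 \<le> k \<Longrightarrow> c \<le> pmf (p k) Left"
  shows "distr (pmfs p) Us hidden_seed = Us"
proof -
  let ?P = "\<lambda>i. pmfs (\<lambda>j. p (prod_encode (i, j)))"
  have rm: "rows \<in> measurable (pmfs p) (PiM UNIV ?P)"
  proof (rule measurable_PiM_UNIV)
    show "(\<lambda>w. rows w i) \<in> measurable (pmfs p) (?P i)" for i
    proof (rule measurable_PiM_UNIV)
      show "(\<lambda>w. rows w i j) \<in> measurable (pmfs p) (measure_pmf (p (prod_encode (i, j))))" for j
        unfolding rows_def by (rule pmfs_coordinate)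
    qed (simp_all only: space_pmfs space_measure_pmf)
  qed (simp_all only: space_pmfs space_measure_pmf)
  have fm: "(\<lambda>v i. first_bit (v i)) \<in> measurable (PiM UNIV ?P) coins"
  proof (rule measurable_PiM_UNIV)
    fix i :: nat
    have "(\<lambda>v. v i) \<in> measurable (PiM UNIV ?P) (?P i)" by (rule measurable_component_singleton) simp
    from measurable_compose[OF this first_bit_measurable[of "\<lambda>j. p (prod_encode (i, j))"]]
    show "(\<lambda>v. first_bit (v i)) \<in> measurable (PiM UNIV ?P) coin" .
  qed (simp_all only: space_pmfs space_measure_pmf)
  have "distr (pmfs p) coins (\<lambda>w i. first_bit (rows w i)) = distr (distr (pmfs p) (PiM UNIV ?P) rows) coins (\<lambda>v i. first_bit (v i))"
    by (subst distr_distr[OF fm rm]) (simp add: comp_def)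
  also have "distr (pmfs p) (PiM UNIV ?P) rows = PiM UNIV ?P"
    using distr_PiM_regroup[of "\<lambda>i. measure_pmf (p i)", OF prob_space_measure_pmf inj_prod_encode']
    by (simp add: rows_def[abs_def])
  also have "distr (PiM UNIV ?P) coins (\<lambda>v i. first_bit (v i)) = PiM UNIV (\<lambda>i. distr (?P i) coin first_bit)"
    by (rule PiM_distr) (rule prob_space_pmfs, rule first_bit_measurable)
  also have "(\<lambda>i. distr (?P i) coin first_bit) = (\<lambda>i. coin)"
  proof
    fix i
    show "distr (?P i) coin first_bit = coin"
    proof (rule distr_first_bit[OF sym c, of n0])
      show "c \<le> pmf (p (prod_encode (i, k))) Left" if "n0 \<le> k" for k
        using that le_prod_encode_2[of k i] by (intro ev) simp
    qed
  qed
  finally have 1: "distr (pmfs p) coins (\<lambda>w i. first_bit (rows w i)) = coins" .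
  have "distr (pmfs p) Us hidden_seed = distr (distr (pmfs p) coins (\<lambda>w i. first_bit (rows w i))) Us uniforms_of_coins"
    by (subst distr_distr[OF uniforms_of_coins_measurable hidden_coins_measurable]) (simp add: comp_def hidden_seed_def[abs_def])
  then show ?thesis by (simp only: 1 distr_uniforms_of_coins)
qed

section \<open>The hidden information\<close>

text \<open>Seed \<open>m\<close> is read off the boxes \<open>prod_encode (m, k)\<close>, whose indices are at least \<open>m\<close>; so box \<open>j\<close> does not
  contribute to the seed \<open>j + 1\<close> that it uses.\<close>

definition seed :: "nat \<Rightarrow> (nat \<Rightarrow> occ \<times> bool) \<Rightarrow> nat \<Rightarrow> real" where
  "seed m \<nu> = hidden_seed (\<lambda>k. fst (\<nu> (prod_encode (m, k))))"

definition symmetric :: "(occ \<times> bool) pmf \<Rightarrow> bool" where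
  "symmetric q \<longleftrightarrow> pmf (map_pmf fst q) Left = pmf (map_pmf fst q) Right"

lemma row_measurable: "(\<lambda>\<nu> k. fst (\<nu> (prod_encode (m, k)))) \<in> measurable (pmfs q) (pmfs (\<lambda>k. map_pmf fst (q (prod_encode (m, k)))))"
proof (rule measurable_PiM_UNIV)
  fix k
  show "(\<lambda>\<nu>. fst (\<nu> (prod_encode (m, k)))) \<in> measurable (pmfs q) (measure_pmf (map_pmf fst (q (prod_encode (m, k)))))"
    by (rule pmfs_coordinate_pmf)
qed (simp_all only: space_pmfs space_measure_pmf)

lemma seed_measurable: "seed m \<in> measurable (pmfs q) Us"
  unfolding seed_def by (rule measurable_compose[OF row_measurable hidden_seed_measurable])

lemma distr_seed:
  assumes sym: "\<And>k. symmetric (q k)" and c: "0 < c" and ev: "\<And>k. n0 \<le> k \<Longrightarrow> c \<le> pmf (map_pmf fst (q k)) Left"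
  shows "distr (pmfs q) Us (seed m) = Us"
proof -
  let ?p = "\<lambda>k. map_pmf fst (q (prod_encode (m, k)))"
  let ?q = "\<lambda>k. q (prod_encode (m, k))"
  have inj: "inj (\<lambda>k. prod_encode (m, k))" by (auto simp: inj_on_def)
  have rm: "(\<lambda>\<nu> k. \<nu> (prod_encode (m, k))) \<in> measurable (pmfs q) (pmfs ?q)"
    by (rule measurable_PiM_UNIV) (simp_all only: pmfs_coordinate space_measure_pmf)
  have fm: "(\<lambda>\<nu> k. fst (\<nu> k)) \<in> measurable (pmfs ?q) (pmfs ?p)"
  proof (rule measurable_PiM_UNIV)
    show "(\<lambda>\<nu>. fst (\<nu> k)) \<in> measurable (pmfs ?q) (measure_pmf (?p k))" for k
      by (rule pmfs_coordinate_pmf)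
  qed (simp_all only: space_pmfs space_measure_pmf)
  have "distr (pmfs q) (pmfs ?p) (\<lambda>\<nu> k. fst (\<nu> (prod_encode (m, k)))) = distr (distr (pmfs q) (pmfs ?q) (\<lambda>\<nu> k. \<nu> (prod_encode (m, k)))) (pmfs ?p) (\<lambda>\<nu> k. fst (\<nu> k))"
    by (subst distr_distr[OF fm rm]) (simp add: comp_def)
  also have "distr (pmfs q) (pmfs ?q) (\<lambda>\<nu> k. \<nu> (prod_encode (m, k))) = pmfs ?q"
    using distr_PiM_reindex[of UNIV "\<lambda>i. measure_pmf (q i)" "\<lambda>k. prod_encode (m, k)" UNIV] inj
    by (simp add: prob_space_measure_pmf restrict_UNIV)
  also have "distr (pmfs ?q) (pmfs ?p) (\<lambda>\<nu> k. fst (\<nu> k)) = PiM UNIV (\<lambda>k. distr (measure_pmf (?q k)) (measure_pmf (?p k)) fst)"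
    by (rule PiM_distr) (simp_all add: prob_space_measure_pmf)
  also have "(\<lambda>k. distr (measure_pmf (?q k)) (measure_pmf (?p k)) fst) = (\<lambda>k. measure_pmf (?p k))"
  proof
    fix k
    show "distr (measure_pmf (?q k)) (measure_pmf (?p k)) fst = measure_pmf (?p k)"
      unfolding map_pmf_rep_eq by (rule distr_cong) simp_all
  qed
  finally have 1: "distr (pmfs q) (pmfs ?p) (\<lambda>\<nu> k. fst (\<nu> (prod_encode (m, k)))) = pmfs ?p" .
  have "distr (pmfs q) Us (seed m) = distr (distr (pmfs q) (pmfs ?p) (\<lambda>\<nu> k. fst (\<nu> (prod_encode (m, k))))) Us hidden_seed"
    by (subst distr_distr[OF hidden_seed_measurable row_measurable]) (simp add: comp_def seed_def[abs_def])
  also have "... = distr (pmfs ?p) Us hidden_seed" by (simp only: 1)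
  also have "... = Us"
  proof (rule distr_hidden_seed[OF _ c, of _ n0])
    show "pmf (?p k) Left = pmf (?p k) Right" for k using sym by (simp add: symmetric_def)
    show "c \<le> pmf (?p k) Left" if "n0 \<le> k" for k
      using that le_prod_encode_2[of k m] by (intro ev) simp
  qed
  finally show ?thesis .
qed

lemma nn_integral_resample:
  assumes f: "f \<in> borel_measurable (pmfs (q(n := t)))"
  shows "(\<integral>\<^sup>+\<nu>. f \<nu> \<partial>pmfs (q(n := t))) = (\<integral>\<^sup>+x. \<integral>\<^sup>+w. f (w(n := x)) \<partial>pmfs q \<partial>t)"
proof -
  let ?T = "PiM UNIV (\<lambda>_::nat. measure_pmf t)" and ?Q = "PiM UNIV (\<lambda>i. if i \<in> {n} then measure_pmf t else measure_pmf (q i))"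
  interpret T: prob_space ?T by (rule prob_space_PiM) (rule prob_space_measure_pmf)
  interpret Q: prob_space "pmfs q" by (rule prob_space_pmfs)
  have Q: "?Q = pmfs (q(n := t))" by (rule PiM_cong) auto
  have mm: "(\<lambda>(u, w). merge_at {n} u w) \<in> measurable (?T \<Otimes>\<^sub>M pmfs q) ?Q" by (rule merge_at_measurable)
  have d: "distr (?T \<Otimes>\<^sub>M pmfs q) ?Q (\<lambda>(u, w). merge_at {n} u w) = ?Q"
    by (rule distr_merge_at) (simp_all add: prob_space_measure_pmf)
  have fQ: "f \<in> borel_measurable ?Q" using f by (simp only: Q)
  have fm: "(\<lambda>(u, w). f (merge_at {n} u w)) \<in> borel_measurable (?T \<Otimes>\<^sub>M pmfs q)"
    using measurable_compose[OF mm fQ] by (simp add: split_def)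
  have "(\<integral>\<^sup>+\<nu>. f \<nu> \<partial>pmfs (q(n := t))) = (\<integral>\<^sup>+\<nu>. f \<nu> \<partial>distr (?T \<Otimes>\<^sub>M pmfs q) ?Q (\<lambda>(u, w). merge_at {n} u w))"
    by (simp only: d) (simp only: Q)
  also have "... = (\<integral>\<^sup>+p. f (case p of (u, w) \<Rightarrow> merge_at {n} u w) \<partial>(?T \<Otimes>\<^sub>M pmfs q))"
    by (rule nn_integral_distr[OF mm]) (simp only: d fQ)
  also have "... = (\<integral>\<^sup>+p. (case p of (u, w) \<Rightarrow> f (merge_at {n} u w)) \<partial>(?T \<Otimes>\<^sub>M pmfs q))"
    by (simp add: split_def)
  also have "... = (\<integral>\<^sup>+u. \<integral>\<^sup>+w. f (merge_at {n} u w) \<partial>pmfs q \<partial>?T)"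
    using Q.nn_integral_fst[OF fm] by simp
  also have "... = (\<integral>\<^sup>+u. \<integral>\<^sup>+w. f (w(n := u n)) \<partial>pmfs q \<partial>?T)"
  proof -
    have "merge_at {n} u w = w(n := u n)" for u w :: "nat \<Rightarrow> 'a" by (auto simp: merge_at_def)
    then show ?thesis by simp
  qed
  also have "... = (\<integral>\<^sup>+x. \<integral>\<^sup>+w. f (w(n := x)) \<partial>pmfs q \<partial>distr ?T (measure_pmf t) (\<lambda>u. u n))"
    by (subst nn_integral_distr) (simp_all add: measurable_component_singleton[OF UNIV_I])
  also have "distr ?T (measure_pmf t) (\<lambda>u. u n) = measure_pmf t"
    by (rule distr_PiM_component) (simp_all add: prob_space_measure_pmf)
  finally show ?thesis .
qed

lemma nn_integral_split_coordinates:
  fixes q :: "nat \<Rightarrow> 'c pmf"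
  assumes f: "f \<in> borel_measurable (pmfs q)"
  shows "(\<integral>\<^sup>+\<nu>. f \<nu> \<partial>pmfs q) = (\<integral>\<^sup>+w. \<integral>\<^sup>+u. f (merge_at J u w) \<partial>pmfs q \<partial>pmfs q)"
proof -
  let ?Q = "PiM UNIV (\<lambda>i. if i \<in> J then measure_pmf (q i) else measure_pmf (q i))"
  interpret Q: prob_space "pmfs q" by (rule prob_space_pmfs)
  interpret P: pair_sigma_finite "pmfs q" "pmfs q" by unfold_locales
  have Q: "?Q = pmfs q" by simp
  have mm: "(\<lambda>(u, w). merge_at J u w) \<in> measurable (pmfs q \<Otimes>\<^sub>M pmfs q) (pmfs q)"
    using merge_at_measurable[of J "\<lambda>i. measure_pmf (q i)" "\<lambda>i. measure_pmf (q i)"] by (simp only: Q)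
  have d: "distr (pmfs q \<Otimes>\<^sub>M pmfs q) (pmfs q) (\<lambda>(u, w). merge_at J u w) = pmfs q"
    using distr_merge_at[of "\<lambda>i. measure_pmf (q i)" "\<lambda>i. measure_pmf (q i)" J, OF prob_space_measure_pmf prob_space_measure_pmf]
    by (simp only: Q)
  have fm: "(\<lambda>(u, w). f (merge_at J u w)) \<in> borel_measurable (pmfs q \<Otimes>\<^sub>M pmfs q)"
    using measurable_compose[OF mm f] by (simp add: split_def)
  have "(\<integral>\<^sup>+\<nu>. f \<nu> \<partial>pmfs q) = (\<integral>\<^sup>+\<nu>. f \<nu> \<partial>distr (pmfs q \<Otimes>\<^sub>M pmfs q) (pmfs q) (\<lambda>(u, w). merge_at J u w))"
    by (simp only: d)
  also have "... = (\<integral>\<^sup>+p. f (case p of (u, w) \<Rightarrow> merge_at J u w) \<partial>(pmfs q \<Otimes>\<^sub>M pmfs q))"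
    by (rule nn_integral_distr[OF mm]) (simp only: d f)
  also have "... = (\<integral>\<^sup>+p. (case p of (u, w) \<Rightarrow> f (merge_at J u w)) \<partial>(pmfs q \<Otimes>\<^sub>M pmfs q))"
    by (simp add: split_def)
  also have "... = (\<integral>\<^sup>+w. \<integral>\<^sup>+u. f (merge_at J u w) \<partial>pmfs q \<partial>pmfs q)"
    using P.nn_integral_snd[OF fm] by simp
  finally show ?thesis .
qed

lemma seed_cong: "(\<And>k. fst (\<nu> (prod_encode (m, k))) = fst (\<nu>' (prod_encode (m, k)))) \<Longrightarrow> seed m \<nu> = seed m \<nu>'"
  by (simp add: seed_def)

text \<open>Box \<open>j\<close> acts on the seed \<open>j + 1\<close>, which is read off boxes with larger indices. Under the balance
  condition the outcome in box \<open>j\<close> carries no information on the side \<open>Left\<close>/\<open>Right\<close> of the point in it,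
  so conditioning on the outcome changes the law of the pattern of box \<open>j\<close> only to another symmetric law;
  and every product of symmetric laws gives uniform seeds.\<close>

theorem hidden_information:
  fixes A0 :: "(nat \<Rightarrow> real) set" and A :: "nat \<Rightarrow> occ \<Rightarrow> (nat \<Rightarrow> real) set"
  assumes A0: "A0 \<in> sets Us" and A: "\<And>j x. A j x \<in> sets Us"
    and sym: "\<And>k. symmetric (q k)" and c: "0 < c" and ev: "\<And>k. n0 \<le> k \<Longrightarrow> c \<le> pmf (map_pmf fst (q k)) Left"
    and balance: "\<And>j. j < n \<Longrightarrow> pmf (q j) (Left, True) * measure Us (A j Left) = pmf (q j) (Right, True) * measure Us (A j Right)"
  shows "emeasure (pmfs q) {\<nu> \<in> space (pmfs q). seed 0 \<nu> \<in> A0 \<and> (\<forall>j<n. snd (\<nu> j) \<and> seed (Suc j) \<nu> \<in> A j (fst (\<nu> j)))} =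
    emeasure Us A0 * (\<Prod>j<n. \<integral>\<^sup>+x. of_bool (snd x) * emeasure Us (A j (fst x)) \<partial>(q j))"
  using sym ev balance
proof (induction n arbitrary: q n0)
  case 0
  have "emeasure (distr (pmfs q) Us (seed 0)) A0 = emeasure (pmfs q) (seed 0 -` A0 \<inter> space (pmfs q))"
    by (rule emeasure_distr[OF seed_measurable A0])
  moreover have "distr (pmfs q) Us (seed 0) = Us" by (rule distr_seed[OF 0(1) c 0(2)])
  ultimately show ?case by (simp add: vimage_def Int_def conj_commute)
next
  case (Suc n)
  interpret Us: prob_space Us by simp
  define Ev where "Ev = (\<lambda>\<nu>. seed 0 \<nu> \<in> A0 \<and> (\<forall>j<n. snd (\<nu> j) \<and> seed (Suc j) \<nu> \<in> A j (fst (\<nu> j))))"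
  define h where "h x = of_bool (snd x) * emeasure Us (A n (fst x))" for x :: "occ \<times> bool"
  have seed_sets: "{\<nu> \<in> space (pmfs q). seed m \<nu> \<in> B} \<in> sets (pmfs q)" if "B \<in> sets Us" for m B and q :: "nat \<Rightarrow> (occ \<times> bool) pmf"
    using measurable_sets[OF seed_measurable that, of m q] by (simp add: vimage_def Int_def conj_commute)
  have step_sets: "{\<nu> \<in> space (pmfs q). snd (\<nu> j) \<and> seed (Suc j) \<nu> \<in> A j (fst (\<nu> j))} \<in> sets (pmfs q)" for j and q :: "nat \<Rightarrow> (occ \<times> bool) pmf"
  proof -
    have "{\<nu> \<in> space (pmfs q). snd (\<nu> j) \<and> seed (Suc j) \<nu> \<in> A j (fst (\<nu> j))} =
        (\<Union>x\<in>UNIV. {\<nu> \<in> space (pmfs q). snd (\<nu> j) \<and> fst (\<nu> j) = x} \<inter> {\<nu> \<in> space (pmfs q). seed (Suc j) \<nu> \<in> A j x})"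
      by auto
    also have "... \<in> sets (pmfs q)"
      using finite_UNIV_occ by (intro sets.finite_UN sets.Int seed_sets A pmfs_component_sets[where P="\<lambda>z. snd z \<and> fst z = x" for x])
    finally show ?thesis .
  qed
  have Ev_sets: "{\<nu> \<in> space (pmfs q). Ev \<nu>} \<in> sets (pmfs q)" for q
  proof -
    have a: "{\<nu> \<in> space (pmfs q). seed 0 \<nu> \<in> A0} \<in> sets (pmfs q)" by (rule seed_sets[OF A0])
    have b: "{\<nu> \<in> space (pmfs q). \<forall>j<n. snd (\<nu> j) \<and> seed (Suc j) \<nu> \<in> A j (fst (\<nu> j))} \<in> sets (pmfs q)"
      by (intro sets.sets_Collect_countable_All sets.sets_Collect_imp step_sets sets.sets_Collect_const)
    have "{\<nu> \<in> space (pmfs q). Ev \<nu>} = {\<nu> \<in> space (pmfs q). seed 0 \<nu> \<in> A0} \<inter>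
        {\<nu> \<in> space (pmfs q). \<forall>j<n. snd (\<nu> j) \<and> seed (Suc j) \<nu> \<in> A j (fst (\<nu> j))}" by (auto simp: Ev_def)
    then show ?thesis using sets.Int[OF a b] by (simp only:)
  qed
  have Ev_meas: "(\<lambda>\<nu>. of_bool (Ev \<nu>) :: ennreal) \<in> borel_measurable (pmfs q)" for q
  proof -
    have "(indicator {\<nu> \<in> space (pmfs q). Ev \<nu>} :: _ \<Rightarrow> ennreal) \<in> borel_measurable (pmfs q)"
      by (rule borel_measurable_indicator[OF Ev_sets])
    then show ?thesis by (subst measurable_cong[where g="indicator {\<nu> \<in> space (pmfs q). Ev \<nu>}"]) (auto simp: indicator_def)
  qed
  \<comment> \<open>The row that feeds seed \<open>n + 1\<close> is used for nothing else in boxes \<open>0, \<dots>, n\<close>.\<close>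
  define J where "J = range (\<lambda>k. prod_encode (Suc n, k))"
  have J_small: "j \<notin> J" if "j \<le> n" for j
  proof
    assume "j \<in> J"
    then obtain k where "j = prod_encode (Suc n, k)" unfolding J_def by (rule rangeE)
    then show False using that le_prod_encode_1[of "Suc n" k] by linarith
  qed
  have merge_Ev: "Ev (merge_at J u w) = Ev w" for u w
  proof -
    have "seed m (merge_at J u w) = seed m w" if "m \<le> n" for m
      using that by (intro seed_cong) (auto simp: merge_at_def J_def)
    then show ?thesis using J_small by (auto simp: Ev_def merge_at_def)
  qed
  have merge_seed: "seed (Suc n) (merge_at J u w) = seed (Suc n) u" for u w
    by (intro seed_cong) (auto simp: merge_at_def J_def)
  let ?E = "{\<nu> \<in> space (pmfs q). seed 0 \<nu> \<in> A0 \<and> (\<forall>j<Suc n. snd (\<nu> j) \<and> seed (Suc j) \<nu> \<in> A j (fst (\<nu> j)))}"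
  have E_iff: "\<nu> \<in> ?E \<longleftrightarrow> Ev \<nu> \<and> snd (\<nu> n) \<and> seed (Suc n) \<nu> \<in> A n (fst (\<nu> n))" for \<nu>
    by (auto simp: Ev_def less_Suc_eq space_PiM)
  have E_sets: "?E \<in> sets (pmfs q)"
  proof -
    have "?E = {\<nu> \<in> space (pmfs q). Ev \<nu>} \<inter> {\<nu> \<in> space (pmfs q). snd (\<nu> n) \<and> seed (Suc n) \<nu> \<in> A n (fst (\<nu> n))}"
      using E_iff by (auto simp: space_PiM)
    then show ?thesis using sets.Int[OF Ev_sets step_sets] by (simp only:)
  qed
  have "emeasure (pmfs q) ?E = (\<integral>\<^sup>+\<nu>. indicator ?E \<nu> \<partial>pmfs q)"
    using E_sets by (rule nn_integral_indicator[symmetric])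
  also have "... = (\<integral>\<^sup>+w. \<integral>\<^sup>+u. indicator ?E (merge_at J u w) \<partial>pmfs q \<partial>pmfs q)"
    by (rule nn_integral_split_coordinates) (rule borel_measurable_indicator[OF E_sets])
  also have "... = (\<integral>\<^sup>+w. of_bool (Ev w) * h (w n) \<partial>pmfs q)"
  proof (rule nn_integral_cong)
    fix w
    have "(\<integral>\<^sup>+u. indicator ?E (merge_at J u w) \<partial>pmfs q) =
        (\<integral>\<^sup>+u. of_bool (Ev w) * of_bool (snd (w n)) * indicator (A n (fst (w n))) (seed (Suc n) u) \<partial>pmfs q)"
    proof (rule nn_integral_cong)
      fix u
      have "merge_at J u w n = w n" using J_small[of n] by (simp add: merge_at_def)
      then show "indicator ?E (merge_at J u w) = (of_bool (Ev w) * of_bool (snd (w n)) * indicator (A n (fst (w n))) (seed (Suc n) u) :: ennreal)"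
        unfolding indicator_def E_iff merge_Ev merge_seed by simp
    qed
    also have "... = of_bool (Ev w) * of_bool (snd (w n)) * (\<integral>\<^sup>+u. indicator (A n (fst (w n))) (seed (Suc n) u) \<partial>pmfs q)"
      by (intro nn_integral_cmult measurable_compose[OF seed_measurable] borel_measurable_indicator A)
    also have "(\<integral>\<^sup>+u. indicator (A n (fst (w n))) (seed (Suc n) u) \<partial>pmfs q) = (\<integral>\<^sup>+u. indicator (A n (fst (w n))) u \<partial>distr (pmfs q) Us (seed (Suc n)))"
      by (rule nn_integral_distr[symmetric, OF seed_measurable]) (simp only: measurable_distr_eq1 borel_measurable_indicator[OF A])
    also have "distr (pmfs q) Us (seed (Suc n)) = Us" by (rule distr_seed[OF Suc.prems(1) c Suc.prems(2)])
    also have "(\<integral>\<^sup>+u. indicator (A n (fst (w n))) u \<partial>Us) = emeasure Us (A n (fst (w n)))" by (rule nn_integral_indicator[OF A])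
    finally show "(\<integral>\<^sup>+u. indicator ?E (merge_at J u w) \<partial>pmfs q) = of_bool (Ev w) * h (w n)"
      by (simp add: h_def mult.assoc)
  qed
  also have "... = (\<integral>\<^sup>+x. \<integral>\<^sup>+w. of_bool (Ev (w(n := x))) * h x \<partial>pmfs q \<partial>(q n))"
  proof -
    have "(\<lambda>w. of_bool (Ev w) * h (w n)) \<in> borel_measurable (pmfs (q(n := q n)))"
    proof (intro borel_measurable_times_ennreal Ev_meas)
      show "(\<lambda>w. h (w n)) \<in> borel_measurable (pmfs (q(n := q n)))"
        using pmfs_coordinate[of n "q(n := q n)"] by (rule measurable_compose) simp
    qed
    from nn_integral_resample[OF this] show ?thesis by simp
  qed
  also have "... = (\<integral>\<^sup>+x. h x * (\<integral>\<^sup>+w. of_bool (Ev (w(n := x))) \<partial>pmfs q) \<partial>(q n))"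
  proof (rule nn_integral_cong)
    fix x
    have "(\<lambda>w. w(n := x)) \<in> measurable (pmfs q) (pmfs q)"
    proof (rule measurable_PiM_UNIV)
      show "(\<lambda>w. (w(n := x)) i) \<in> measurable (pmfs q) (measure_pmf (q i))" for i
        using pmfs_coordinate[of i q] by (cases "i = n") simp_all
    qed (simp_all only: space_pmfs space_measure_pmf)
    from measurable_compose[OF this Ev_meas[of q]]
    have "(\<lambda>w. of_bool (Ev (w(n := x))) :: ennreal) \<in> borel_measurable (pmfs q)" .
    from nn_integral_multc[OF this, of "h x"]
    show "(\<integral>\<^sup>+w. of_bool (Ev (w(n := x))) * h x \<partial>pmfs q) = h x * (\<integral>\<^sup>+w. of_bool (Ev (w(n := x))) \<partial>pmfs q)"
      by (simp add: mult.commute)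
  qed
  finally have total: "emeasure (pmfs q) ?E = (\<integral>\<^sup>+x. h x * (\<integral>\<^sup>+w. of_bool (Ev (w(n := x))) \<partial>pmfs q) \<partial>(q n))" .
  define m where "m = (\<integral>\<^sup>+x. h x \<partial>(q n))"
  have h1: "h x \<le> 1" for x using Us.emeasure_le_1 by (auto simp: h_def)
  have m1: "m \<le> 1"
  proof -
    have "m \<le> (\<integral>\<^sup>+x. 1 \<partial>(q n))" unfolding m_def by (intro nn_integral_mono h1)
    then show ?thesis by (simp add: measure_pmf.emeasure_space_1)
  qed
  show ?case
  proof (cases "m = 0")
    case True
    then have "AE x in measure_pmf (q n). h x = 0" unfolding m_def by (subst (asm) nn_integral_0_iff_AE) auto
    then have "emeasure (pmfs q) ?E = 0" unfolding total
      by (subst nn_integral_0_iff_AE) auto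
    then show ?thesis using True by (simp add: m_def h_def)
  next
    case False
    define M where "M = enn2real m"
    have mM: "m = ennreal M" and M: "0 < M"
    proof -
      have "m \<noteq> \<top>" using m1 by (auto simp: top_unique)
      then show "m = ennreal M" by (simp add: M_def less_top)
      then show "0 < M" using False by (auto simp: M_def less_le)
    qed
    define H where "H x = enn2real (h x)" for x
    have hH: "h x = ennreal (H x)" for x
    proof -
      have "h x \<noteq> \<top>" using h1[of x] by (auto simp: top_unique)
      then show ?thesis by (simp add: H_def less_top)
    qed
    have H0: "0 \<le> H x" for x by (simp add: H_def)
    define t where "t = embed_pmf (\<lambda>x. pmf (q n) x * H x / M)"
    have pmf_t: "pmf t x = pmf (q n) x * H x / M" for x
      unfolding t_def
    proof (rule pmf_embed_pmf)
      show "0 \<le> pmf (q n) x * H x / M" for x using H0 M by simp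
      have "(\<integral>\<^sup>+x. ennreal (pmf (q n) x * H x / M) \<partial>count_space UNIV) = (\<integral>\<^sup>+x. ennreal (pmf (q n) x) * (h x * ennreal (1 / M)) \<partial>count_space UNIV)"
        using H0 M by (intro nn_integral_cong) (simp add: hH ennreal_mult[symmetric])
      also have "... = (\<integral>\<^sup>+x. h x * ennreal (1 / M) \<partial>(q n))" by (simp add: nn_integral_measure_pmf)
      also have "... = m * ennreal (1 / M)" unfolding m_def by (rule nn_integral_multc) simp
      also have "... = 1" using M by (simp add: mM ennreal_mult[symmetric])
      finally show "(\<integral>\<^sup>+x. ennreal (pmf (q n) x * H x / M) \<partial>count_space UNIV) = 1" .
    qed
    have tilt: "(\<integral>\<^sup>+x. h x * F x \<partial>(q n)) = m * (\<integral>\<^sup>+x. F x \<partial>t)" for F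
    proof -
      have "m * (\<integral>\<^sup>+x. F x \<partial>t) = (\<integral>\<^sup>+x. m * (ennreal (pmf t x) * F x) \<partial>count_space UNIV)"
        by (simp add: nn_integral_measure_pmf nn_integral_cmult)
      also have "... = (\<integral>\<^sup>+x. ennreal (pmf (q n) x) * (h x * F x) \<partial>count_space UNIV)"
      proof (rule nn_integral_cong)
        fix x
        have "m * ennreal (pmf t x) = ennreal (pmf (q n) x) * h x"
          using M H0 by (simp add: pmf_t mM hH ennreal_mult[symmetric])
        then show "m * (ennreal (pmf t x) * F x) = ennreal (pmf (q n) x) * (h x * F x)"
          by (metis mult.assoc)
      qed
      finally show ?thesis by (simp add: nn_integral_measure_pmf)
    qed
    let ?q = "q(n := t)"
    have t_sym: "symmetric t"
    proof -
      have z: "pmf t (y, False) = 0" for y by (simp add: pmf_t H_def h_def)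
      have "pmf (map_pmf fst t) y = pmf t (y, True)" for y
      proof -
        have "pmf (map_pmf fst t) y = measure t {(y, True), (y, False)}"
          unfolding pmf_map by (rule arg_cong[where f="measure t"]) auto
        then show ?thesis using z[of y] by (simp add: measure_measure_pmf_finite)
      qed
      moreover have "H (y, True) = measure Us (A n y)" for y by (simp add: H_def h_def measure_def)
      ultimately show ?thesis using Suc.prems(3)[of n] by (simp add: symmetric_def pmf_t)
    qed
    have IH: "emeasure (pmfs ?q) {\<nu> \<in> space (pmfs ?q). Ev \<nu>} =
      emeasure Us A0 * (\<Prod>j<n. \<integral>\<^sup>+x. of_bool (snd x) * emeasure Us (A j (fst x)) \<partial>(?q j))"
      unfolding Ev_def
    proof (rule Suc.IH[of ?q "max n0 (Suc n)"])
      show "symmetric (?q k)" for k using Suc.prems(1) t_sym by simp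
      show "c \<le> pmf (map_pmf fst (?q k)) Left" if "max n0 (Suc n) \<le> k" for k using Suc.prems(2)[of k] that by simp
      show "pmf (?q j) (Left, True) * measure Us (A j Left) = pmf (?q j) (Right, True) * measure Us (A j Right)" if "j < n" for j
        using Suc.prems(3)[of j] that by simp
    qed
    have "emeasure (pmfs q) ?E = m * (\<integral>\<^sup>+x. \<integral>\<^sup>+w. of_bool (Ev (w(n := x))) \<partial>pmfs q \<partial>t)"
      unfolding total by (rule tilt)
    also have "(\<integral>\<^sup>+x. \<integral>\<^sup>+w. of_bool (Ev (w(n := x))) \<partial>pmfs q \<partial>t) = (\<integral>\<^sup>+\<nu>. of_bool (Ev \<nu>) \<partial>pmfs ?q)"
      by (rule nn_integral_resample[OF Ev_meas, symmetric])
    also have "... = (\<integral>\<^sup>+\<nu>. indicator {\<nu> \<in> space (pmfs ?q). Ev \<nu>} \<nu> \<partial>pmfs ?q)"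
      by (rule nn_integral_cong) (simp add: indicator_def)
    also have "... = emeasure (pmfs ?q) {\<nu> \<in> space (pmfs ?q). Ev \<nu>}" by (rule nn_integral_indicator[OF Ev_sets])
    also note IH
    also have "(\<Prod>j<n. \<integral>\<^sup>+x. of_bool (snd x) * emeasure Us (A j (fst x)) \<partial>(?q j)) =
      (\<Prod>j<n. \<integral>\<^sup>+x. of_bool (snd x) * emeasure Us (A j (fst x)) \<partial>(q j))"
      by (rule prod.cong) auto
    finally show ?thesis by (simp add: m_def h_def mult_ac)
  qed
qed

section \<open>Numbers of points that hide the occupied half\<close>

text \<open>The probability that uniform points, \<open>fst m\<close> in one cube and \<open>snd m\<close> in another, miss a set, if \<open>x\<close> and \<open>z\<close>
  are the fractions of the cubes outside the set.\<close>

definition pgf2 :: "(nat \<times> nat) pmf \<Rightarrow> real \<Rightarrow> real \<Rightarrow> ennreal" where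
  "pgf2 p x z = (\<integral>\<^sup>+m. ennreal (x ^ fst m * z ^ snd m) \<partial>p)"

lemma nn_integral_pair_pmf_prod:
  "(\<integral>\<^sup>+p. f (fst p) * h (snd p) \<partial>(pair_pmf A B)) = (\<integral>\<^sup>+m. f m \<partial>A) * (\<integral>\<^sup>+n. h n \<partial>B)"
  by (simp add: nn_integral_pair_pmf' nn_integral_cmult nn_integral_multc)

lemma pgf2_pair_poisson:
  assumes "0 < y" "0 \<le> x" "0 \<le> z"
  shows "pgf2 (pair_pmf (poisson_pmf y) (poisson_pmf y)) x z = ennreal (exp (- (y * (2 - x - z))))"
proof -
  have "pgf2 (pair_pmf (poisson_pmf y) (poisson_pmf y)) x z =
      (\<integral>\<^sup>+p. ennreal (x ^ fst p) * ennreal (z ^ snd p) \<partial>(pair_pmf (poisson_pmf y) (poisson_pmf y)))"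
    unfolding pgf2_def using assms by (intro nn_integral_cong) (simp add: ennreal_mult)
  also have "... = (\<integral>\<^sup>+m. ennreal (x ^ m) \<partial>(poisson_pmf y)) * (\<integral>\<^sup>+m. ennreal (z ^ m) \<partial>(poisson_pmf y))"
    by (rule nn_integral_pair_pmf_prod)
  also have "... = ennreal (exp (- (y * (1 - x))) * exp (- (y * (1 - z))))"
    unfolding poisson_pgf[OF assms(1,2)] poisson_pgf[OF assms(1,3)] by (simp add: ennreal_mult)
  also have "exp (- (y * (1 - x))) * exp (- (y * (1 - z))) = exp (- (y * (2 - x - z)))"
    unfolding exp_add[symmetric] by (simp add: algebra_simps)
  finally show ?thesis .
qed

lemma poisson_positive:
  assumes "0 < y"
  shows "(\<integral>\<^sup>+m. indicator {1..} m \<partial>(poisson_pmf y)) = ennreal (1 - exp (- y))"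
proof -
  have "measure (measure_pmf (poisson_pmf y)) (UNIV - {0}) = 1 - exp (- y)"
    using measure_pmf.prob_compl[of "{0}" "poisson_pmf y"] assms by (simp add: measure_pmf_single)
  moreover have "UNIV - {0} = {1::nat..}" by auto
  ultimately show ?thesis by (simp add: measure_pmf.emeasure_eq_measure)
qed

definition mix :: "real \<Rightarrow> 'c pmf \<Rightarrow> 'c pmf \<Rightarrow> 'c pmf" where
  "mix t p q = bind_pmf (bernoulli_pmf t) (\<lambda>b. if b then p else q)"

lemma nn_integral_mix:
  assumes "0 \<le> t" "t \<le> 1"
  shows "(\<integral>\<^sup>+m. g m \<partial>(mix t p q)) = ennreal t * (\<integral>\<^sup>+m. g m \<partial>p) + ennreal (1 - t) * (\<integral>\<^sup>+m. g m \<partial>q)"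
  unfolding mix_def using assms by (simp add: nn_integral_bernoulli_pmf mult.commute)

text \<open>
  Given one point in the left half, let \<open>m\<close>, \<open>n\<close> be the numbers of points in the two halves after the points
  are added; given one point in the right half, do the same with the halves exchanged. If the laws of \<open>(m, n)\<close> are
  the same in both cases and charge only \<open>m, n \<ge> 1\<close>, the outcome says nothing about the half that was
  occupied before. The weights of the outcomes from at most one point are prescribed in total, and the part that starts with
  one point has weight \<open>2a\<close>; it can be taken from \<open>m, n \<ge> 1\<close> if the prescribed weight there is at
  least \<open>2a\<close>. This is the inequality in the hypotheses.
\<close>

lemma balanced_counts:
  fixes a y :: real
  assumes y: "0 < y" and a: "0 < a" and ay: "2 * a * exp (- y) \<le> (1 - exp (- y))\<^sup>2"
  obtains G0 GL GR :: "(nat \<times> nat) pmf" where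
    "\<And>x z. 0 \<le> x \<Longrightarrow> 0 \<le> z \<Longrightarrow> ennreal x * pgf2 GL x z = ennreal z * pgf2 GR x z"
    "\<And>x z. 0 \<le> x \<Longrightarrow> 0 \<le> z \<Longrightarrow> pgf2 G0 x z + ennreal a * (ennreal x * pgf2 GL x z + ennreal z * pgf2 GR x z) =
      ennreal ((1 + a * (x + z)) * exp (- (y * (2 - x - z))))"
proof -
  let ?P = "poisson_pmf y"
  define PP where "PP = pair_pmf ?P ?P"
  define t where "t = 2 * a / (1 + 2 * a)"
  define CC where "CC = mix t (mix (1/2) (map_pmf (\<lambda>p. (Suc (fst p), snd p)) PP) (map_pmf (\<lambda>p. (fst p, Suc (snd p))) PP)) PP"
  have t: "0 \<le> t" "t \<le> 1" "(1 + 2 * a) * t = 2 * a" "(1 + 2 * a) * (1 - t) = 1" using a by (auto simp: t_def field_simps)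
  have CC: "ennreal (1 + 2 * a) * (\<integral>\<^sup>+p. g p \<partial>CC) =
      (\<integral>\<^sup>+p. g p \<partial>PP) + ennreal a * ((\<integral>\<^sup>+p. g (Suc (fst p), snd p) \<partial>PP) + (\<integral>\<^sup>+p. g (fst p, Suc (snd p)) \<partial>PP))" for g
  proof -
    have half: "ennreal (1 - 1 / 2) = ennreal (1 / 2)" by simp
    have "(\<integral>\<^sup>+p. g p \<partial>CC) =
        ennreal t * (ennreal (1/2) * (\<integral>\<^sup>+p. g (Suc (fst p), snd p) \<partial>PP) + ennreal (1/2) * (\<integral>\<^sup>+p. g (fst p, Suc (snd p)) \<partial>PP))
        + ennreal (1 - t) * (\<integral>\<^sup>+p. g p \<partial>PP)" (is "_ = ennreal t * (_ * ?A + _ * ?B) + _ * ?C")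
      unfolding CC_def using t(1,2) by (simp add: nn_integral_mix nn_integral_map_pmf)
    then have "ennreal (1 + 2 * a) * (\<integral>\<^sup>+p. g p \<partial>CC) =
        (ennreal (1 + 2 * a) * ennreal t * ennreal (1/2)) * (?A + ?B) + (ennreal (1 + 2 * a) * ennreal (1 - t)) * ?C"
      by (simp add: algebra_simps)
    also have "ennreal (1 + 2 * a) * ennreal t * ennreal (1/2) = ennreal ((1 + 2 * a) * t * (1/2))"
      by (subst ennreal_mult'', simp, subst ennreal_mult'', rule t(1), rule refl)
    also have "(1 + 2 * a) * t * (1/2) = a" using t(3) by simp
    also have "ennreal (1 + 2 * a) * ennreal (1 - t) = 1"
      using a t by (simp add: ennreal_mult[symmetric] del: ennreal_plus)
    finally show ?thesis by (simp add: add.commute)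
  qed
  define S where "S = {1::nat..} \<times> {1::nat..}"
  have ey: "exp (- y) < 1" using y by simp
  let ?d = "1 - exp (- y)"
  have S: "2 * a \<le> (1 + 2 * a) * measure CC S"
  proof -
    have one: "(\<integral>\<^sup>+m. 1 \<partial>measure_pmf ?P) = 1" by (simp add: measure_pmf.emeasure_space_1)
    have A: "(\<integral>\<^sup>+p. indicator S p \<partial>PP) = ennreal (?d * ?d)"
    proof -
      have "(\<integral>\<^sup>+p. indicator S p \<partial>PP) = (\<integral>\<^sup>+p. indicator {1..} (fst p) * indicator {1..} (snd p) \<partial>PP)"
        by (intro nn_integral_cong) (auto simp: S_def indicator_def)
      then show ?thesis unfolding PP_def nn_integral_pair_pmf_prod poisson_positive[OF y] using ey by (simp add: ennreal_mult)
    qed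
    have B: "(\<integral>\<^sup>+p. indicator S (Suc (fst p), snd p) \<partial>PP) = ennreal ?d"
    proof -
      have "(\<integral>\<^sup>+p. indicator S (Suc (fst p), snd p) \<partial>PP) = (\<integral>\<^sup>+p. 1 * indicator {1..} (snd p) \<partial>PP)"
        by (intro nn_integral_cong) (auto simp: S_def indicator_def)
      then show ?thesis
        unfolding PP_def nn_integral_pair_pmf_prod[where f="\<lambda>_. 1"] poisson_positive[OF y] one by simp
    qed
    have C: "(\<integral>\<^sup>+p. indicator S (fst p, Suc (snd p)) \<partial>PP) = ennreal ?d"
    proof -
      have "(\<integral>\<^sup>+p. indicator S (fst p, Suc (snd p)) \<partial>PP) = (\<integral>\<^sup>+p. indicator {1..} (fst p) * 1 \<partial>PP)"
        by (intro nn_integral_cong) (auto simp: S_def indicator_def)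
      then show ?thesis
        unfolding PP_def nn_integral_pair_pmf_prod[where h="\<lambda>_. 1"] poisson_positive[OF y] one by simp
    qed
    have "ennreal ((1 + 2 * a) * measure CC S) = ennreal (1 + 2 * a) * (\<integral>\<^sup>+p. indicator S p \<partial>CC)"
      using a by (simp add: ennreal_mult measure_pmf.emeasure_eq_measure del: ennreal_plus)
    also have "... = ennreal (?d * ?d) + ennreal a * (ennreal ?d + ennreal ?d)" unfolding CC A B C ..
    also have "... = ennreal (?d * ?d + a * (?d + ?d))"
      using ey a by (simp add: ennreal_mult[symmetric] ennreal_plus[symmetric] del: ennreal_plus)
    finally have "(1 + 2 * a) * measure CC S = ?d * ?d + a * (?d + ?d)"
      using ey a by (subst (asm) ennreal_inj) simp_all
    moreover have "2 * a \<le> ?d * ?d + a * (?d + ?d)" using ay by (simp add: power2_eq_square algebra_simps)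
    ultimately show ?thesis by linarith
  qed
  then have mS: "0 < measure CC S" using a by (smt (verit) mult_nonneg_nonpos)
  then have ne: "set_pmf CC \<inter> S \<noteq> {}" by (metis measure_Int_set_pmf measure_empty less_irrefl Int_commute)
  define K where "K = cond_pmf CC S"
  have pmf_K: "pmf K p = (if p \<in> S then pmf CC p / measure CC S else 0)" for p unfolding K_def by (rule pmf_cond[OF ne])
  have set_K: "p \<in> S" if "p \<in> set_pmf K" for p using that ne by (simp add: K_def)
  define g where "g p = (1 + 2 * a) * pmf CC p - 2 * a * pmf K p" for p
  have g0: "0 \<le> g p" for p
  proof (cases "p \<in> S")
    case True
    have "2 * a * pmf K p = 2 * a / measure CC S * pmf CC p" using True by (simp add: pmf_K)
    also have "... \<le> (1 + 2 * a) * pmf CC p" using S mS by (intro mult_right_mono) (simp_all add: pos_divide_le_eq)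
    finally show ?thesis by (simp add: g_def)
  qed (use a in \<open>simp add: g_def pmf_K\<close>)
  have g_sum: "ennreal (g p) + ennreal (2 * a) * ennreal (pmf K p) = ennreal (1 + 2 * a) * ennreal (pmf CC p)" for p
    using g0[of p] a by (simp add: ennreal_mult[symmetric] ennreal_plus[symmetric] g_def del: ennreal_plus)
  define G0 where "G0 = embed_pmf g"
  have "(\<integral>\<^sup>+p. ennreal (g p) \<partial>count_space UNIV) + ennreal (2 * a) = 1 + ennreal (2 * a)"
  proof -
    have "(\<integral>\<^sup>+p. ennreal (g p) \<partial>count_space UNIV) + ennreal (2 * a) * (\<integral>\<^sup>+p. ennreal (pmf K p) \<partial>count_space UNIV) =
        (\<integral>\<^sup>+p. ennreal (g p) + ennreal (2 * a) * ennreal (pmf K p) \<partial>count_space UNIV)"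
      by (simp add: nn_integral_add nn_integral_cmult)
    also have "... = ennreal (1 + 2 * a) * (\<integral>\<^sup>+p. ennreal (pmf CC p) \<partial>count_space UNIV)"
      unfolding g_sum by (rule nn_integral_cmult) simp
    finally show ?thesis using a by (simp add: nn_integral_pmf measure_pmf.emeasure_space_1[simplified])
  qed
  then have g1: "(\<integral>\<^sup>+p. ennreal (g p) \<partial>count_space UNIV) = 1" by simp
  have pmf_G0: "pmf G0 p = g p" for p unfolding G0_def by (rule pmf_embed_pmf[OF g0 g1])
  have e_G0: "(\<integral>\<^sup>+p. h p \<partial>G0) + ennreal (2 * a) * (\<integral>\<^sup>+p. h p \<partial>K) = ennreal (1 + 2 * a) * (\<integral>\<^sup>+p. h p \<partial>CC)" for h
  proof -
    have "(\<integral>\<^sup>+p. h p \<partial>G0) + ennreal (2 * a) * (\<integral>\<^sup>+p. h p \<partial>K) =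
       (\<integral>\<^sup>+p. ennreal (g p) * h p + ennreal (2 * a) * (ennreal (pmf K p) * h p) \<partial>count_space UNIV)"
      by (simp add: nn_integral_measure_pmf pmf_G0 nn_integral_add nn_integral_cmult)
    also have "... = (\<integral>\<^sup>+p. ennreal (1 + 2 * a) * (ennreal (pmf CC p) * h p) \<partial>count_space UNIV)"
      by (rule nn_integral_cong) (metis g_sum mult.assoc distrib_right)
    finally show ?thesis by (simp add: nn_integral_measure_pmf nn_integral_cmult)
  qed
  define GL where "GL = map_pmf (\<lambda>p. (fst p - 1, snd p)) K"
  define GR where "GR = map_pmf (\<lambda>p. (fst p, snd p - 1)) K"
  have L: "ennreal x * pgf2 GL x z = pgf2 K x z" if "0 \<le> x" "0 \<le> z" for x z
  proof -
    have "ennreal x * pgf2 GL x z = (\<integral>\<^sup>+p. ennreal x * ennreal (x ^ (fst p - 1) * z ^ snd p) \<partial>K)"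
      by (simp add: pgf2_def GL_def nn_integral_map_pmf nn_integral_cmult)
    also have "... = pgf2 K x z" unfolding pgf2_def
    proof (rule nn_integral_cong_AE, unfold AE_measure_pmf_iff, rule ballI)
      fix p assume "p \<in> set_pmf K"
      then obtain k where "fst p = Suc k" using set_K[of p] by (cases "fst p") (auto simp: S_def)
      then show "ennreal x * ennreal (x ^ (fst p - 1) * z ^ snd p) = ennreal (x ^ fst p * z ^ snd p)"
        using that by (subst ennreal_mult[symmetric]) (simp_all add: mult.assoc)
    qed
    finally show ?thesis .
  qed
  have R: "ennreal z * pgf2 GR x z = pgf2 K x z" if "0 \<le> x" "0 \<le> z" for x z
  proof -
    have "ennreal z * pgf2 GR x z = (\<integral>\<^sup>+p. ennreal z * ennreal (x ^ fst p * z ^ (snd p - 1)) \<partial>K)"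
      by (simp add: pgf2_def GR_def nn_integral_map_pmf nn_integral_cmult)
    also have "... = pgf2 K x z" unfolding pgf2_def
    proof (rule nn_integral_cong_AE, unfold AE_measure_pmf_iff, rule ballI)
      fix p assume "p \<in> set_pmf K"
      then obtain k where "snd p = Suc k" using set_K[of p] by (cases "snd p") (auto simp: S_def)
      then show "ennreal z * ennreal (x ^ fst p * z ^ (snd p - 1)) = ennreal (x ^ fst p * z ^ snd p)"
        using that by (subst ennreal_mult[symmetric]) (simp_all add: mult.left_commute)
    qed
    finally show ?thesis .
  qed
  show thesis
  proof (rule that[of GL GR G0])
    fix x z :: real assume xz: "0 \<le> x" "0 \<le> z"
    show "ennreal x * pgf2 GL x z = ennreal z * pgf2 GR x z" by (simp only: L[OF xz] R[OF xz])
    let ?E = "ennreal (exp (- (y * (2 - x - z))))"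
    have PP: "pgf2 PP x z = ?E" unfolding PP_def by (rule pgf2_pair_poisson[OF y xz])
    have s1: "(\<integral>\<^sup>+p. ennreal (x ^ Suc (fst p) * z ^ snd p) \<partial>PP) = ennreal x * ?E"
    proof -
      have "(\<integral>\<^sup>+p. ennreal (x ^ Suc (fst p) * z ^ snd p) \<partial>PP) = (\<integral>\<^sup>+p. ennreal x * ennreal (x ^ fst p * z ^ snd p) \<partial>PP)"
        using xz by (intro nn_integral_cong, subst ennreal_mult[symmetric]) (simp_all only: power_Suc mult.assoc zero_le_power mult_nonneg_nonneg)
      also have "... = ennreal x * pgf2 PP x z" unfolding pgf2_def by (rule nn_integral_cmult) simp
      finally show ?thesis unfolding PP .
    qed
    have s2: "(\<integral>\<^sup>+p. ennreal (x ^ fst p * z ^ Suc (snd p)) \<partial>PP) = ennreal z * ?E"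
    proof -
      have "(\<integral>\<^sup>+p. ennreal (x ^ fst p * z ^ Suc (snd p)) \<partial>PP) = (\<integral>\<^sup>+p. ennreal z * ennreal (x ^ fst p * z ^ snd p) \<partial>PP)"
        using xz by (intro nn_integral_cong, subst ennreal_mult[symmetric]) (simp_all only: power_Suc mult.left_commute zero_le_power mult_nonneg_nonneg)
      also have "... = ennreal z * pgf2 PP x z" unfolding pgf2_def by (rule nn_integral_cmult) simp
      finally show ?thesis unfolding PP .
    qed
    have "pgf2 G0 x z + ennreal a * (ennreal x * pgf2 GL x z + ennreal z * pgf2 GR x z) = pgf2 G0 x z + ennreal a * (pgf2 K x z + pgf2 K x z)"
      by (simp only: L[OF xz] R[OF xz])
    also have "ennreal a * (pgf2 K x z + pgf2 K x z) = ennreal (2 * a) * pgf2 K x z"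
    proof -
      have "ennreal (2 * a) = ennreal a + ennreal a" using a by (simp add: ennreal_plus[symmetric] del: ennreal_plus)
      then show ?thesis by (simp only: distrib_left distrib_right)
    qed
    also have "pgf2 G0 x z + ennreal (2 * a) * pgf2 K x z = ennreal (1 + 2 * a) * pgf2 CC x z"
      unfolding pgf2_def by (rule e_G0)
    also have "... = pgf2 PP x z + ennreal a * (ennreal x * ?E + ennreal z * ?E)"
      unfolding pgf2_def CC fst_conv snd_conv s1 s2 ..
    also have "... = ennreal (exp (- (y * (2 - x - z))) + a * (x * exp (- (y * (2 - x - z))) + z * exp (- (y * (2 - x - z)))))"
      unfolding PP using a xz by (simp add: ennreal_mult)
    also have "exp (- (y * (2 - x - z))) + a * (x * exp (- (y * (2 - x - z))) + z * exp (- (y * (2 - x - z)))) = (1 + a * (x + z)) * exp (- (y * (2 - x - z)))"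
      by (simp add: algebra_simps)
    finally show "pgf2 G0 x z + ennreal a * (ennreal x * pgf2 GL x z + ennreal z * pgf2 GR x z) = ennreal ((1 + a * (x + z)) * exp (- (y * (2 - x - z))))" .
  qed
qed

lemma Collect_conj_eq2: "{x \<in> A. P x \<and> Q x} = {x \<in> A. P x} \<inter> {x \<in> A. Q x}"
  by blast

lemma UNIV_occ: "(UNIV :: occ set) = {Empty, Left, Right, Many}"
  using occ.exhaust by auto

lemma space_Us: "space Us = UNIV"
  by (simp add: space_PiM)

section \<open>Adding points in two cubes\<close>

lemma rows_throw_sets:
  fixes B :: "'a::euclidean_space set"
  assumes "B \<in> sets borel" shows "{u \<in> space Us. throw a s m (rows u) \<inter> B = {}} \<in> sets Us"
  using measurable_sets[OF rows_measurable throw_void_sets[OF assms]]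
  by (simp add: vimage_def Int_def conj_commute space_PiM)

lemma rows_throw_prob:
  fixes B :: "'a::euclidean_space set"
  assumes "B \<in> sets borel" "0 < s"
  shows "emeasure Us {u \<in> space Us. throw a s m (rows u) \<inter> B = {}} = ennreal ((1 - vol (B \<inter> hcube a s) / s ^ DIM('a)) ^ m)"
proof -
  have "emeasure (distr Us Uss rows) {v \<in> space Uss. throw a s m v \<inter> B = {}} =
      emeasure Us (rows -` {v \<in> space Uss. throw a s m v \<inter> B = {}} \<inter> space Us)"
    by (rule emeasure_distr[OF rows_measurable throw_void_sets[OF assms(1)]])
  then show ?thesis unfolding distr_rows[OF prob_space_U01] throw_void_prob[OF assms]
    by (simp add: vimage_def Int_def conj_commute space_PiM)
qed

lemma quantile_first_sets: "{u \<in> space Us. quantile p (u 0) = m} \<in> sets Us"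
proof -
  have "(\<lambda>u. u 0) \<in> measurable Us U01" by (rule measurable_component_singleton) simp
  then have "(\<lambda>u. u 0) \<in> borel_measurable Us" by (subst (asm) measurable_cong_sets[OF refl sets_U01])
  from measurable_sets[OF measurable_compose[OF this quantile_measurable[of p]], of "{m}"]
  show ?thesis by (simp add: vimage_def Int_def conj_commute)
qed

lemma quantile_first_prob: "emeasure Us {u \<in> space Us. quantile p (u 0) = m} = ennreal (pmf p m)"
proof -
  have m0: "(\<lambda>u. u 0) \<in> measurable Us U01" by (rule measurable_component_singleton) simp
  have mq: "quantile p \<in> measurable U01 (count_space UNIV)" by (subst measurable_cong_sets[OF sets_U01 refl]) (rule quantile_measurable)
  have "distr Us U01 (\<lambda>u. u 0) = U01" by (rule distr_PiM_component) simp_all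
  then have "measure_pmf p = distr (distr Us U01 (\<lambda>u. u 0)) (count_space UNIV) (quantile p)" by (simp only: distr_quantile)
  also have "... = distr Us (count_space UNIV) (\<lambda>u. quantile p (u 0))" by (subst distr_distr[OF mq m0]) (simp add: comp_def)
  finally have d: "measure_pmf p = distr Us (count_space UNIV) (\<lambda>u. quantile p (u 0))" .
  have "ennreal (pmf p m) = emeasure (distr Us (count_space UNIV) (\<lambda>u. quantile p (u 0))) {m}"
    unfolding d[symmetric] by (simp add: emeasure_pmf_single)
  also have "... = emeasure Us ((\<lambda>u. quantile p (u 0)) -` {m} \<inter> space Us)"
    by (rule emeasure_distr[OF measurable_compose[OF m0 mq]]) simp
  also have "(\<lambda>u. quantile p (u 0)) -` {m} \<inter> space Us = {u \<in> space Us. quantile p (u 0) = m}" by auto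
  finally show ?thesis by simp
qed

definition throw_counts :: "'a::euclidean_space \<Rightarrow> 'a \<Rightarrow> real \<Rightarrow> (nat \<times> nat) pmf \<Rightarrow> (nat \<Rightarrow> real) \<Rightarrow> 'a set" where
  "throw_counts a b s p u = (let m = quantile p (rows u 0 0) in
     throw a s (fst m) (rows (rows u 1)) \<union> throw b s (snd m) (rows (rows u 2)))"

lemma throw_counts_subset: "throw_counts a b s p u \<subseteq> hcube a s \<union> hcube b s"
  using throw_subset by (fastforce simp: throw_counts_def Let_def)

lemma finite_throw_counts: "finite (throw_counts a b s p u)"
  by (simp add: throw_counts_def Let_def finite_throw)

context
  fixes B :: "'a::euclidean_space set" and a b :: 'a and s :: real and p :: "(nat \<times> nat) pmf"
  assumes B: "B \<in> sets borel"
begin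

definition part :: "nat \<times> nat \<Rightarrow> nat \<Rightarrow> (nat \<Rightarrow> real) set" where
  "part m i = (if i = 0 then {u \<in> space Us. quantile p (u 0) = m}
     else if i = 1 then {u \<in> space Us. throw a s (fst m) (rows u) \<inter> B = {}}
     else {u \<in> space Us. throw b s (snd m) (rows u) \<inter> B = {}})"

lemma part_sets: "part m i \<in> sets Us"
  by (simp add: part_def quantile_first_sets rows_throw_sets[OF B])

lemma parts_sets: "{v \<in> space Uss. \<forall>i\<in>{0,1,2}. v i \<in> part m i} \<in> sets Uss"
proof (rule sets.sets_Collect_finite_All)
  fix i :: nat
  have "(\<lambda>v. v i) \<in> measurable Uss Us" by (rule measurable_component_singleton) simp
  from measurable_sets[OF this part_sets[of m i]]
  show "{v \<in> space Uss. v i \<in> part m i} \<in> sets Uss" by (simp add: vimage_def Int_def conj_commute)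
qed simp

lemma throw_counts_parts:
  "{u \<in> space Us. throw_counts a b s p u \<inter> B = {}} = rows -` (\<Union>m. {v \<in> space Uss. \<forall>i\<in>{0,1,2}. v i \<in> part m i}) \<inter> space Us"
proof -
  have "throw_counts a b s p u \<inter> B = {} \<longleftrightarrow> (\<exists>m. \<forall>i\<in>{0,1,2}. rows u i \<in> part m i)" for u
    by (auto simp: throw_counts_def Let_def part_def space_PiM)
  then show ?thesis by (auto simp: space_PiM)
qed

lemma throw_counts_void_sets: "{u \<in> space Us. throw_counts a b s p u \<inter> B = {}} \<in> sets Us"
  unfolding throw_counts_parts by (rule measurable_sets[OF rows_measurable]) (intro sets.countable_UN image_subsetI parts_sets)

lemma throw_counts_void_prob:
  assumes s: "0 < s"
  shows "emeasure Us {u \<in> space Us. throw_counts a b s p u \<inter> B = {}} =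
    pgf2 p (1 - vol (B \<inter> hcube a s) / s ^ DIM('a)) (1 - vol (B \<inter> hcube b s) / s ^ DIM('a))"
    (is "_ = pgf2 p ?x ?z")
proof -
  let ?E = "\<lambda>m. {v \<in> space Uss. \<forall>i\<in>{0,1,2}. v i \<in> part m i}"
  have x: "0 \<le> ?x" "0 \<le> ?z"
  proof -
    have "vol (B \<inter> hcube c s) \<le> vol (hcube c s)" for c :: 'a
      using B s by (intro measure_mono_fmeasurable) (auto simp: fmeasurable_def emeasure_hcube)
    then show "0 \<le> ?x" "0 \<le> ?z" using s by (simp_all add: measure_hcube)
  qed
  have ps: "prob_space Us" by (rule prob_space_Us)
  have E: "emeasure Uss (?E m) = ennreal (pmf p m) * ennreal (?x ^ fst m * ?z ^ snd m)" for m
  proof -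
    have "emeasure Uss (?E m) = (\<Prod>i\<in>{0,1,2}. emeasure Us (part m i))"
      by (rule PiM_prob_Ball) (simp_all add: ps part_sets)
    also have "... = ennreal (pmf p m) * (ennreal (?x ^ fst m) * ennreal (?z ^ snd m))"
      by (simp add: part_def quantile_first_prob rows_throw_prob[OF B s])
    finally show ?thesis using x by (simp add: ennreal_mult)
  qed
  have disj: "disjoint_family ?E" by (auto simp: disjoint_family_on_def part_def)
  have "emeasure Us {u \<in> space Us. throw_counts a b s p u \<inter> B = {}} = emeasure (distr Us Uss rows) (\<Union>m. ?E m)"
    unfolding throw_counts_parts by (rule emeasure_distr[OF rows_measurable, symmetric]) (intro sets.countable_UN image_subsetI parts_sets)
  also have "... = emeasure Uss (\<Union>m. ?E m)" by (simp only: distr_rows[OF prob_space_U01])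
  also have "... = (\<integral>\<^sup>+m. emeasure Uss (?E m) \<partial>count_space UNIV)"
    by (rule emeasure_UN_countable[OF parts_sets _ disj]) simp
  also have "... = pgf2 p ?x ?z" unfolding E pgf2_def by (rule nn_integral_measure_pmf[symmetric])
  finally show ?thesis .
qed

end

lemma measure_lborel_split:
  fixes A :: "'a::euclidean_space set"
  assumes A: "A \<in> sets borel" "bounded A" and B: "B \<in> sets borel"
  shows "vol (A - B) + vol (A \<inter> B) = vol A"
proof -
  have "vol ((A - B) \<union> (A \<inter> B)) = vol (A - B) + vol (A \<inter> B)"
    using A B emeasure_bounded_finite[OF bounded_subset[OF A(2) Diff_subset]] emeasure_bounded_finite[OF bounded_subset[OF A(2) Int_lower1]]
    by (intro measure_Union) (auto simp: less_top)
  moreover have "(A - B) \<union> (A \<inter> B) = A" by blast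
  ultimately show ?thesis by simp
qed

section \<open>Independent parts of a Poisson process\<close>

lemma poisson_void_indep2:
  fixes X :: "'w \<Rightarrow> 'a::euclidean_space set"
  assumes X: "poisson_void l M X" and A: "A \<in> sets borel" "C \<in> sets borel" "A \<inter> C = {}"
    and E: "E \<in> sets configs" "F \<in> sets configs"
  shows "measure M {\<nu> \<in> space M. X \<nu> \<inter> A \<in> E \<and> X \<nu> \<inter> C \<in> F} =
    measure M {\<nu> \<in> space M. X \<nu> \<inter> A \<in> E} * measure M {\<nu> \<in> space M. X \<nu> \<inter> C \<in> F}"
proof -
  interpret prob_space M using X by (simp add: poisson_void_def)
  let ?A = "case_bool A C" and ?E = "case_bool E F"
  have "disjoint_family_on ?A UNIV" using A(3) by (auto simp: disjoint_family_on_def split: bool.splits)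
  then have "indep_vars (\<lambda>_. configs) (\<lambda>i \<nu>. X \<nu> \<inter> ?A i) UNIV"
    using A by (intro poisson_void_indep[OF X]) (simp_all split: bool.splits)
  then have "prob (\<Inter>i\<in>UNIV. (\<lambda>\<nu>. X \<nu> \<inter> ?A i) -` ?E i \<inter> space M) = (\<Prod>i\<in>UNIV. prob ((\<lambda>\<nu>. X \<nu> \<inter> ?A i) -` ?E i \<inter> space M))"
    using E by (intro indep_varsD[where M'="\<lambda>_. configs" and I=UNIV]) (simp_all split: bool.splits)
  moreover have "(\<Inter>i\<in>UNIV. (\<lambda>\<nu>. X \<nu> \<inter> ?A i) -` ?E i \<inter> space M) = {\<nu> \<in> space M. X \<nu> \<inter> A \<in> E \<and> X \<nu> \<inter> C \<in> F}"
    by (auto simp: UNIV_bool)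
  moreover have "(\<lambda>\<nu>. X \<nu> \<inter> A) -` E \<inter> space M = {\<nu> \<in> space M. X \<nu> \<inter> A \<in> E}"
    "(\<lambda>\<nu>. X \<nu> \<inter> C) -` F \<inter> space M = {\<nu> \<in> space M. X \<nu> \<inter> C \<in> F}" by auto
  ultimately show ?thesis by (simp add: UNIV_bool mult.commute)
qed

lemma poisson_void_single_point:
  fixes X :: "'w \<Rightarrow> 'a::euclidean_space set"
  assumes X: "poisson_void l M X" and l: "0 \<le> l" and A: "A \<in> sets borel" "C \<in> sets borel" "A \<inter> C = {}" and b: "bounded A" "bounded C"
  shows "measure M {\<nu> \<in> space M. card (X \<nu> \<inter> A) = 1 \<and> X \<nu> \<inter> C = {}} = l * vol A * exp (- (l * vol (A \<union> C)))"
proof -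
  have Xm: "X \<in> measurable M configs" using X by (simp add: poisson_void_def)
  let ?E = "{S \<in> space configs. count_in A S = of_nat 1}"
  have E: "?E \<in> sets configs"
    using measurable_sets[OF measurable_count_in[OF A(1)], of "{of_nat 1}"] by (simp add: vimage_def Int_def conj_commute)
  have F: "{S \<in> space configs. S \<inter> C = {}} \<in> sets configs" using A(2) by (rule void_in_configs)
  have sub: "X \<nu> \<inter> D \<in> space configs" if "\<nu> \<in> space M" for \<nu> D
    using measurable_space[OF Xm that] by (auto simp: space_configs intro: locally_finite_subset)
  have cnt: "count_in A (X \<nu> \<inter> A) = of_nat 1 \<longleftrightarrow> card (X \<nu> \<inter> A) = 1" if "\<nu> \<in> space M" for \<nu>
    using count_in_finite[OF sub[OF that, of A] b(1)] by (simp add: Int_assoc) 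
  have cnt': "count_in A (X \<nu>) = of_nat 1 \<longleftrightarrow> card (X \<nu> \<inter> A) = 1" if "\<nu> \<in> space M" for \<nu>
    using count_in_finite[OF measurable_space[OF Xm that] b(1)] by simp
  have e1: "{\<nu> \<in> space M. X \<nu> \<inter> A \<in> ?E \<and> X \<nu> \<inter> C \<in> {S \<in> space configs. S \<inter> C = {}}} = {\<nu> \<in> space M. card (X \<nu> \<inter> A) = 1 \<and> X \<nu> \<inter> C = {}}"
    using cnt sub by auto
  have e2: "{\<nu> \<in> space M. X \<nu> \<inter> A \<in> ?E} = {\<nu> \<in> space M. count_in A (X \<nu>) = of_nat 1}"
    using cnt cnt' sub by auto
  have e3: "{\<nu> \<in> space M. X \<nu> \<inter> C \<in> {S \<in> space configs. S \<inter> C = {}}} = {\<nu> \<in> space M. X \<nu> \<inter> C = {}}"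
    using sub by auto
  have "measure M {\<nu> \<in> space M. card (X \<nu> \<inter> A) = 1 \<and> X \<nu> \<inter> C = {}} =
      measure M {\<nu> \<in> space M. count_in A (X \<nu>) = of_nat 1} * measure M {\<nu> \<in> space M. X \<nu> \<inter> C = {}}"
    using poisson_void_indep2[OF X A E F] unfolding e1 e2 e3 .
  also have "... = l * vol A * exp (- (l * vol A)) * exp (- (l * vol C))"
    using poisson_void_count_bounded[OF X l A(1) b(1), of 1] poisson_voidD[OF X A(2) b(2)] by simp
  also have "... = l * vol A * exp (- (l * (vol A + vol C)))"
    by (simp add: mult.assoc exp_add[symmetric] algebra_simps)
  also have "vol A + vol C = vol (A \<union> C)"
    using A emeasure_bounded_finite[OF b(1)] emeasure_bounded_finite[OF b(2)] by (intro measure_Union[symmetric]) auto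
  finally show ?thesis .
qed

lemma indep_vars_pmfs:
  fixes Y :: "nat \<Rightarrow> 'w \<Rightarrow> 'c"
  assumes fin: "finite (UNIV :: 'c set)" and M: "prob_space M" and Y: "prob_space.indep_vars M (\<lambda>_. count_space UNIV) Y UNIV"
  shows "\<exists>q. (\<forall>j z. pmf (q j) z = measure M {\<nu> \<in> space M. Y j \<nu> = z}) \<and>
    (\<lambda>\<nu> j. Y j \<nu>) \<in> measurable M (pmfs q) \<and> distr M (pmfs q) (\<lambda>\<nu> j. Y j \<nu>) = pmfs q"
proof -
  interpret prob_space M by (rule M)
  have Ym: "Y j \<in> measurable M (count_space UNIV)" for j using Y by (simp add: indep_vars_def)
  define q where "q j = Abs_pmf (distr M (count_space UNIV) (Y j))" for j
  have q: "measure_pmf (q j) = distr M (count_space UNIV) (Y j)" for j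
  proof -
    interpret D: prob_space "distr M (count_space UNIV) (Y j)" by (rule prob_space_distr[OF Ym])
    have "AE x in distr M (count_space UNIV) (Y j). measure (distr M (count_space UNIV) (Y j)) {x} \<noteq> 0"
      using fin by (subst D.AE_support_countable) (auto intro!: exI[of _ UNIV] countable_finite)
    then show ?thesis unfolding q_def by (intro Abs_pmf_inverse) (simp add: D.prob_space_axioms)
  qed
  have p: "pmf (q j) z = prob {\<nu> \<in> space M. Y j \<nu> = z}" for j z
  proof -
    have "pmf (q j) z = measure (distr M (count_space UNIV) (Y j)) {z}" by (simp only: q[symmetric] measure_pmf_single)
    also have "... = prob (Y j -` {z} \<inter> space M)" by (rule measure_distr[OF Ym]) simp
    also have "Y j -` {z} \<inter> space M = {\<nu> \<in> space M. Y j \<nu> = z}" by auto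
    finally show ?thesis .
  qed
  have mY: "(\<lambda>\<nu> j. Y j \<nu>) \<in> measurable M (pmfs q)"
    by (rule measurable_PiM_UNIV) (simp_all add: Ym)
  have "distr M (PiM UNIV (\<lambda>_. count_space UNIV)) (\<lambda>\<nu>. \<lambda>j\<in>UNIV. Y j \<nu>) = PiM UNIV (\<lambda>j. distr M (count_space UNIV) (Y j))"
    using Y by (subst (asm) indep_vars_iff_distr_eq_PiM') (simp_all add: Ym)
  moreover have "distr M (pmfs q) (\<lambda>\<nu> j. Y j \<nu>) = distr M (PiM UNIV (\<lambda>_. count_space UNIV)) (\<lambda>\<nu>. \<lambda>j\<in>UNIV. Y j \<nu>)"
    by (rule distr_cong) (simp_all add: sets_pmfs restrict_def)
  ultimately have "distr M (pmfs q) (\<lambda>\<nu> j. Y j \<nu>) = pmfs q" by (simp only: q)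
  then show ?thesis using p mY by (intro exI[of _ q] conjI allI)
qed

section \<open>The local thickening\<close>

definition occ_pattern :: "nat \<Rightarrow> nat \<Rightarrow> occ" where
  "occ_pattern m n = (if m = 0 \<and> n = 0 then Empty else if m = 1 \<and> n = 0 then Left
     else if m = 0 \<and> n = 1 then Right else Many)"

text \<open>The law \<open>G c\<close> is that of the numbers of points added to the two cubes of a box in state \<open>c\<close>. The equations
  are those of \<open>balanced_counts\<close>; the first hides the occupied cube, and the other two make the outcome
  Poisson of intensity \<open>l + \<rho>\<close>.\<close>

locale local_thickening =
  fixes l \<rho> side :: real and w :: "'a::euclidean_space" and G :: "occ \<Rightarrow> (nat \<times> nat) pmf"
  assumes pos: "0 < l" "0 < \<rho>" "0 < side" and w: "norm w = 1"
    and balance: "\<And>x z. 0 \<le> x \<Longrightarrow> 0 \<le> z \<Longrightarrow> ennreal x * pgf2 (G Left) x z = ennreal z * pgf2 (G Right) x z"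
    and few: "\<And>x z. 0 \<le> x \<Longrightarrow> 0 \<le> z \<Longrightarrow>
      pgf2 (G Empty) x z + ennreal (l * side ^ DIM('a)) * (ennreal x * pgf2 (G Left) x z + ennreal z * pgf2 (G Right) x z) =
      ennreal ((1 + l * side ^ DIM('a) * (x + z)) * exp (- (\<rho> * side ^ DIM('a) * (2 - x - z))))"
    and many: "\<And>x z. 0 \<le> x \<Longrightarrow> 0 \<le> z \<Longrightarrow> pgf2 (G Many) x z = ennreal (exp (- (\<rho> * side ^ DIM('a) * (2 - x - z))))"
begin

definition width :: real where "width = side * DIM('a)"

text \<open>The cubes are lined up in the direction of \<open>w\<close> on one side of the hyperplane, far enough apart to be disjoint
  whatever their orientation relative to \<open>w\<close>.\<close>

definition corner :: "nat \<Rightarrow> 'a" where "corner k = (width + 1 + (2 * width + 1) * real k) *\<^sub>R w"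

definition slot :: "nat \<Rightarrow> 'a set" where "slot k = hcube (corner k) side"

definition box :: "nat \<Rightarrow> 'a set" where "box j = slot (2 * j) \<union> slot (2 * j + 1)"

definition slots :: "'a set" where "slots = (\<Union>j. box j)"

definition occ_of :: "nat \<Rightarrow> 'a set \<Rightarrow> occ" where
  "occ_of j S = occ_pattern (card (S \<inter> slot (2 * j))) (card (S \<inter> slot (2 * j + 1)))"

definition box_seed :: "nat \<Rightarrow> 'a set \<Rightarrow> nat \<Rightarrow> real" where
  "box_seed m S = hidden_seed (\<lambda>k. occ_of (prod_encode (m, k)) S)"

definition add_points :: "nat \<Rightarrow> occ \<Rightarrow> (nat \<Rightarrow> real) \<Rightarrow> 'a set" where
  "add_points j c u = throw_counts (corner (2 * j)) (corner (2 * j + 1)) side (G c) u"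

text \<open>Outside the slots the process that is added is independent of what is seen in them; inside, the points depend on
  the state of the box.\<close>

definition extra :: "'a set \<Rightarrow> 'a set" where
  "extra S = (poisson_of \<rho> (box_seed 0 S) - slots) \<union> (\<Union>j. add_points j (occ_of j S) (box_seed (Suc j) S))"

lemma width_pos: "0 < width" using pos by (simp add: width_def)

lemma slot_near: assumes "x \<in> slot k" shows "norm (x - corner k) \<le> width"
proof -
  have "norm (x - corner k) \<le> (\<Sum>b\<in>Basis. \<bar>(x - corner k) \<bullet> b\<bar>)" by (rule norm_le_l1)
  also have "... \<le> of_nat (card (Basis :: 'a set)) * side"
    using assms by (intro sum_bounded_above) (auto simp: slot_def hcube_def inner_diff_left abs_le_iff intro: less_imp_le)
  finally show ?thesis by (simp add: width_def mult.commute)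
qed

lemma w_inner: "w \<bullet> w = 1" using w by (simp add: dot_square_norm)

lemma slot_height:
  assumes "x \<in> slot k"
  shows "1 + (2 * width + 1) * real k \<le> x \<bullet> w" "x \<bullet> w \<le> (2 * width + 1) * (real k + 1)"
proof -
  have "\<bar>(x - corner k) \<bullet> w\<bar> \<le> norm (x - corner k) * norm w" by (rule Cauchy_Schwarz_ineq2)
  also have "... \<le> width" using slot_near[OF assms] by (simp add: w)
  finally have "\<bar>x \<bullet> w - (width + 1 + (2 * width + 1) * real k)\<bar> \<le> width"
    by (simp add: inner_diff_left corner_def w_inner)
  then show "1 + (2 * width + 1) * real k \<le> x \<bullet> w" "x \<bullet> w \<le> (2 * width + 1) * (real k + 1)"
    by (simp_all add: abs_le_iff algebra_simps)
qed

lemma slot_tube: assumes "x \<in> slot k" shows "norm (x - (x \<bullet> w) *\<^sub>R w) \<le> width"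
proof -
  let ?y = "x - corner k"
  have e: "x - (x \<bullet> w) *\<^sub>R w = ?y - (?y \<bullet> w) *\<^sub>R w"
    by (simp add: inner_diff_left corner_def w_inner scaleR_diff_left)
  have "(norm (?y - (?y \<bullet> w) *\<^sub>R w))\<^sup>2 = (norm ?y)\<^sup>2 - (?y \<bullet> w)\<^sup>2"
    unfolding power2_norm_eq_inner by (simp add: inner_diff_left inner_diff_right w_inner inner_commute power2_eq_square algebra_simps)
  also have "... \<le> (norm ?y)\<^sup>2" by simp
  finally have "norm (?y - (?y \<bullet> w) *\<^sub>R w) \<le> norm ?y" by (rule power2_le_imp_le) simp
  then show ?thesis unfolding e using slot_near[OF assms] by linarith
qed

lemma slot_disjoint: assumes "i \<noteq> k" shows "slot i \<inter> slot k = {}"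
proof -
  have False if "x \<in> slot i" "x \<in> slot k" "i < k" for x i k
  proof -
    have "real i + 1 \<le> real k" using that(3) by linarith
    then have "(2 * width + 1) * (real i + 1) \<le> (2 * width + 1) * real k" using width_pos by (intro mult_left_mono) auto
    then show False using slot_height[OF that(1)] slot_height[OF that(2)] by linarith
  qed
  then show ?thesis using assms by (metis disjoint_iff linorder_neqE_nat)
qed

lemma slot_sets: "slot k \<in> sets borel" and bounded_slot: "bounded (slot k)" by (simp_all add: slot_def hcube_sets bounded_hcube)

lemma box_sets: "box j \<in> sets borel" and bounded_box: "bounded (box j)"
  by (simp_all add: box_def slot_sets bounded_slot sets.Un)

lemma slots_sets: "slots \<in> sets borel"
  unfolding slots_def by (intro sets.countable_UN image_subsetI box_sets)

lemma box_disjoint: "i \<noteq> j \<Longrightarrow> box i \<inter> box j = {}"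
  using slot_disjoint[of "2 * i" "2 * j"] slot_disjoint[of "2 * i" "2 * j + 1"] slot_disjoint[of "2 * i + 1" "2 * j"] slot_disjoint[of "2 * i + 1" "2 * j + 1"]
  unfolding box_def by (simp add: Int_Un_distrib Int_Un_distrib2)

lemma slotsE: assumes "x \<in> slots" obtains k where "x \<in> slot k"
  using assms unfolding slots_def box_def by blast

lemma slots_height: "x \<in> slots \<Longrightarrow> 0 < x \<bullet> w" and slots_tube: "x \<in> slots \<Longrightarrow> norm (x - (x \<bullet> w) *\<^sub>R w) \<le> width"
proof -
  assume "x \<in> slots"
  then obtain k where k: "x \<in> slot k" by (rule slotsE)
  have "0 \<le> (2 * width + 1) * real k" using width_pos by simp
  then show "0 < x \<bullet> w" using slot_height(1)[OF k] by linarith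
  show "norm (x - (x \<bullet> w) *\<^sub>R w) \<le> width" by (rule slot_tube[OF k])
qed

lemma boxes_meeting_bounded:
  assumes "bounded B" obtains N where "\<And>j. N \<le> j \<Longrightarrow> box j \<inter> B = {}"
proof -
  obtain R where R: "\<And>x. x \<in> B \<Longrightarrow> norm x \<le> R" using assms by (auto simp: bounded_iff)
  have "box j \<inter> B = {}" if "nat \<lceil>R\<rceil> \<le> j" for j
  proof -
    have False if "x \<in> slot k" "x \<in> B" "j \<le> k" for x k
    proof -
      have "real k \<le> (2 * width + 1) * real k" using width_pos by (simp add: mult_le_cancel_right1)
      moreover have "x \<bullet> w \<le> norm x * norm w" by (rule norm_cauchy_schwarz)
      moreover have "R \<le> real k" using \<open>nat \<lceil>R\<rceil> \<le> j\<close> that(3) by linarith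
      ultimately show False using slot_height(1)[OF that(1)] R[OF that(2)] w by simp
    qed
    from this[of _ "2 * j"] this[of _ "2 * j + 1"] show ?thesis unfolding box_def by fastforce
  qed
  then show thesis by (rule that)
qed

lemma occ_of_cong: "S \<inter> box j = T \<inter> box j \<Longrightarrow> occ_of j S = occ_of j T"
proof -
  assume "S \<inter> box j = T \<inter> box j"
  then have "S \<inter> slot (2 * j) = T \<inter> slot (2 * j)" "S \<inter> slot (2 * j + 1) = T \<inter> slot (2 * j + 1)" unfolding box_def by blast+
  then show ?thesis by (simp only: occ_of_def)
qed

lemma extra_cong:
  assumes "S \<inter> slots = T \<inter> slots" shows "extra S = extra T"
proof -
  have "occ_of j S = occ_of j T" for j
    using assms by (intro occ_of_cong) (auto simp: slots_def)
  then show ?thesis by (simp add: extra_def box_seed_def)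
qed

lemma add_points_subset: "add_points j c u \<subseteq> box j"
  using throw_counts_subset by (simp add: add_points_def box_def slot_def)

lemma extra_locally_finite: "locally_finite (extra S)"
  unfolding locally_finite_def
proof (intro allI impI)
  fix B :: "'a set" assume B: "bounded B"
  obtain N where N: "\<And>j. N \<le> j \<Longrightarrow> box j \<inter> B = {}" using boxes_meeting_bounded[OF B] by metis
  have "extra S \<inter> B \<subseteq> (poisson_of \<rho> (box_seed 0 S) \<inter> B) \<union> (\<Union>j<N. add_points j (occ_of j S) (box_seed (Suc j) S))"
  proof
    fix x assume x: "x \<in> extra S \<inter> B"
    then consider "x \<in> poisson_of \<rho> (box_seed 0 S)" | j where "x \<in> add_points j (occ_of j S) (box_seed (Suc j) S)" unfolding extra_def by blast
    then show "x \<in> (poisson_of \<rho> (box_seed 0 S) \<inter> B) \<union> (\<Union>j<N. add_points j (occ_of j S) (box_seed (Suc j) S))"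
    proof cases
      case 2
      then have "j < N" using N[of j] x add_points_subset[of j] by (meson IntD2 disjoint_iff not_le subsetD)
      then show ?thesis using 2 by blast
    qed (use x in blast)
  qed
  moreover have "finite (poisson_of \<rho> (box_seed 0 S) \<inter> B)" using poisson_of_locally_finite B unfolding locally_finite_def by blast
  moreover have "finite (\<Union>j<N. add_points j (occ_of j S) (box_seed (Suc j) S))" by (simp add: add_points_def finite_throw_counts)
  ultimately show "finite (extra S \<inter> B)" by (meson finite_UnI finite_subset)
qed

lemma extra_Int_empty_iff:
  "extra S \<inter> B = {} \<longleftrightarrow> poisson_of \<rho> (box_seed 0 S) \<inter> (B - slots) = {} \<and> (\<forall>j. add_points j (occ_of j S) (box_seed (Suc j) S) \<inter> B = {})"
  unfolding extra_def by blast

lemma occ_of_measurable: "occ_of j \<in> measurable configs (count_space UNIV)"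
proof -
  have c: "(\<lambda>S. card (S \<inter> slot k)) \<in> measurable configs (count_space UNIV)" for k
    by (rule card_measurable[OF measurable_ident slot_sets bounded_slot, unfolded id_def])
  have "(\<lambda>S. occ_pattern m (card (S \<inter> slot (2 * j + 1)))) \<in> measurable configs (count_space UNIV)" for m
    by (rule measurable_compose[OF c]) simp
  then have "(\<lambda>S. occ_pattern (card (S \<inter> slot (2 * j))) (card (S \<inter> slot (2 * j + 1)))) \<in> measurable configs (count_space UNIV)"
    by (rule measurable_compose_countable[OF _ c])
  then show ?thesis by (simp add: occ_of_def[abs_def])
qed

lemma occ_of_event: "{S \<in> space configs. occ_of j S = c} \<in> sets configs"
  using measurable_sets[OF occ_of_measurable, of "{c}" j] by (simp add: vimage_def Int_def conj_commute)

lemma box_seed_measurable: "box_seed m \<in> measurable configs Us"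
proof -
  have "(\<lambda>S k. occ_of (prod_encode (m, k)) S) \<in> measurable configs (pmfs (\<lambda>_. return_pmf Empty))"
    by (rule measurable_PiM_UNIV) (simp_all only: occ_of_measurable measurable_pmf_measure2 space_measure_pmf)
  from measurable_compose[OF this hidden_seed_measurable] show ?thesis unfolding box_seed_def .
qed

definition outside_void :: "'a set \<Rightarrow> (nat \<Rightarrow> real) set" where
  "outside_void B = {u \<in> space Us. poisson_of \<rho> u \<inter> (B - slots) = {}}"

definition added_void :: "'a set \<Rightarrow> nat \<Rightarrow> occ \<Rightarrow> (nat \<Rightarrow> real) set" where
  "added_void B j c = {u \<in> space Us. add_points j c u \<inter> B = {}}"

lemma outside_void_sets: "B \<in> sets borel \<Longrightarrow> outside_void B \<in> sets Us"
proof -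
  assume "B \<in> sets borel"
  moreover have "(poisson_of \<rho> :: _ \<Rightarrow> 'a set) \<in> measurable Us configs"
    using poisson_of_void[OF pos(2), where 'a='a] by (simp only: poisson_void_def)
  ultimately show "outside_void B \<in> sets Us"
    unfolding outside_void_def by (intro void_measurable sets.Diff slots_sets)
qed

lemma added_void_sets: "B \<in> sets borel \<Longrightarrow> added_void B j c \<in> sets Us"
  unfolding added_void_def add_points_def by (rule throw_counts_void_sets)

lemma extra_measurable: "extra \<in> measurable configs configs"
proof (rule measurable_configsI[OF extra_locally_finite])
  fix B :: "'a set" assume B: "B \<in> sets borel"
  have seeds: "{S \<in> space configs. box_seed m S \<in> A} \<in> sets configs" if "A \<in> sets Us" for m A
    using measurable_sets[OF box_seed_measurable that, of m] by (simp add: vimage_def Int_def conj_commute)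
  have iff: "extra S \<inter> B = {} \<longleftrightarrow> box_seed 0 S \<in> outside_void B \<and> (\<forall>j. \<forall>c\<in>UNIV. occ_of j S = c \<longrightarrow> box_seed (Suc j) S \<in> added_void B j c)" for S
    unfolding extra_Int_empty_iff outside_void_def added_void_def space_Us by (simp only: mem_Collect_eq UNIV_I simp_thms ball_UNIV)
  have "{S \<in> space configs. extra S \<inter> B = {}} = {S \<in> space configs. box_seed 0 S \<in> outside_void B} \<inter>
      {S \<in> space configs. \<forall>j. \<forall>c\<in>UNIV. occ_of j S = c \<longrightarrow> box_seed (Suc j) S \<in> added_void B j c}"
    unfolding iff by (rule Collect_conj_eq2)
  also have "... \<in> sets configs"
  proof (rule sets.Int[OF seeds[OF outside_void_sets[OF B]]])
    have "(space configs - {S \<in> space configs. occ_of j S = c}) \<union> {S \<in> space configs. box_seed (Suc j) S \<in> added_void B j c} \<in> sets configs" for j c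
      by (rule sets.Un[OF sets.compl_sets[OF occ_of_event] seeds[OF added_void_sets[OF B]]])
    then have "(\<Inter>j. \<Inter>c\<in>UNIV. (space configs - {S \<in> space configs. occ_of j S = c}) \<union> {S \<in> space configs. box_seed (Suc j) S \<in> added_void B j c}) \<in> sets configs"
      using finite_UNIV_occ by (intro sets.countable_INT' sets.finite_INT) auto
    also have "(\<Inter>j. \<Inter>c\<in>UNIV. (space configs - {S \<in> space configs. occ_of j S = c}) \<union> {S \<in> space configs. box_seed (Suc j) S \<in> added_void B j c}) =
        {S \<in> space configs. \<forall>j. \<forall>c\<in>UNIV. occ_of j S = c \<longrightarrow> box_seed (Suc j) S \<in> added_void B j c}"
      by blast
    finally show "{S \<in> space configs. \<forall>j. \<forall>c\<in>UNIV. occ_of j S = c \<longrightarrow> box_seed (Suc j) S \<in> added_void B j c} \<in> sets configs" .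
  qed
  finally show "{S \<in> space configs. extra S \<inter> B = {}} \<in> sets configs" .
qed

lemma measure_slot: "vol (slot k) = side ^ DIM('a)"
  using pos by (simp add: slot_def measure_hcube)

definition missed :: "'a set \<Rightarrow> nat \<Rightarrow> real" where
  "missed B k = 1 - vol (B \<inter> slot k) / side ^ DIM('a)"

lemma volume_pos: "0 < side ^ DIM('a)" using pos by simp

lemma missed_nonneg: assumes "B \<in> sets borel" shows "0 \<le> missed B k"
proof -
  have "vol (B \<inter> slot k) \<le> vol (slot k)"
    using assms emeasure_bounded_finite[OF bounded_slot] by (intro measure_mono_fmeasurable) (auto simp: fmeasurable_def slot_sets sets.Int)
  then show ?thesis using volume_pos by (simp add: missed_def measure_slot)
qed

lemma missed_volume: assumes "B \<in> sets borel" shows "vol (slot k - B) = side ^ DIM('a) * missed B k"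
proof -
  have "side ^ DIM('a) * missed B k = side ^ DIM('a) - vol (B \<inter> slot k)"
    using volume_pos pos(3) by (simp add: missed_def right_diff_distrib)
  then show ?thesis
    using measure_lborel_split[OF slot_sets bounded_slot assms, of k] unfolding measure_slot Int_commute[of B] by linarith
qed

lemma box_volume: "vol (slot (2 * j) \<union> slot (2 * j + 1)) = 2 * side ^ DIM('a)"
  using measure_Union[of lborel "slot (2 * j)" "slot (2 * j + 1)"] slot_disjoint[of "2 * j" "2 * j + 1"]
    emeasure_bounded_finite[OF bounded_slot] by (simp add: slot_sets measure_slot less_top)

lemma box_Int_volume:
  assumes B: "B \<in> sets borel"
  shows "vol (B \<inter> box j) = side ^ DIM('a) * (2 - missed B (2 * j) - missed B (2 * j + 1))"
proof -
  have "vol (B \<inter> box j) = vol (B \<inter> slot (2 * j)) + vol (B \<inter> slot (2 * j + 1))"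
    unfolding box_def Int_Un_distrib
  proof (rule measure_Union)
    show "(B \<inter> slot (2 * j)) \<inter> (B \<inter> slot (2 * j + 1)) = {}" using slot_disjoint[of "2 * j" "2 * j + 1"] by auto
    show "emeasure lborel (B \<inter> slot (2 * j)) \<noteq> \<infinity>" "emeasure lborel (B \<inter> slot (2 * j + 1)) \<noteq> \<infinity>"
      using emeasure_bounded_finite[OF bounded_subset[OF bounded_slot Int_lower2]] by (simp_all add: less_top)
  qed (use B slot_sets in simp_all)
  then show ?thesis using volume_pos pos(3) by (simp add: missed_def field_simps)
qed

lemma added_void_prob:
  assumes "B \<in> sets borel"
  shows "emeasure Us (added_void B j c) = pgf2 (G c) (missed B (2 * j)) (missed B (2 * j + 1))"
  unfolding added_void_def add_points_def missed_def slot_def by (rule throw_counts_void_prob[OF assms pos(3)])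

definition pattern :: "'a set \<Rightarrow> 'a set \<Rightarrow> nat \<Rightarrow> occ \<times> bool" where
  "pattern B S j = (occ_of j S, S \<inter> (box j \<inter> B) = {})"

lemma seed_pattern: "seed m (pattern B S) = box_seed m S"
  by (simp add: seed_def box_seed_def pattern_def)

lemma pattern_measurable:
  assumes B: "B \<in> sets borel" shows "(\<lambda>S. pattern B S j) \<in> measurable configs (count_space UNIV)"
proof -
  have v: "{S \<in> space configs. S \<inter> (box j \<inter> B) = {}} \<in> sets configs" by (rule void_in_configs) (rule sets.Int[OF box_sets B])
  have "(\<lambda>S. pattern B S j) -` {z} \<inter> space configs \<in> sets configs" for z
  proof -
    have "(\<lambda>S. pattern B S j) -` {z} \<inter> space configs = {S \<in> space configs. occ_of j S = fst z} \<inter>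
        (if snd z then {S \<in> space configs. S \<inter> (box j \<inter> B) = {}} else space configs - {S \<in> space configs. S \<inter> (box j \<inter> B) = {}})"
      by (cases z) (auto simp: pattern_def)
    also have "... \<in> sets configs" by (rule sets.Int[OF occ_of_event]) (simp add: v sets.compl_sets)
    finally show ?thesis .
  qed
  moreover have "finite (UNIV :: (occ \<times> bool) set)" using finite_UNIV_occ by (simp add: finite_prod)
  ultimately show ?thesis by (subst measurable_count_space_eq2) simp_all
qed

lemma single_slot_law:
  assumes X: "poisson_void l M X" and B: "B \<in> sets borel" and k: "k \<noteq> k'" and tot: "vol (slot k \<union> slot k') = 2 * side ^ DIM('a)"
  shows "measure M {\<nu> \<in> space M. card (X \<nu> \<inter> slot k) = 1 \<and> card (X \<nu> \<inter> slot k') = 0 \<and> X \<nu> \<inter> ((slot k \<union> slot k') \<inter> B) = {}} =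
    l * side ^ DIM('a) * missed B k * exp (- (2 * (l * side ^ DIM('a))))"
proof -
  have Xm: "X \<in> measurable M configs" using X by (simp add: poisson_void_def)
  have iff: "card (S \<inter> slot k) = 1 \<and> card (S \<inter> slot k') = 0 \<and> S \<inter> ((slot k \<union> slot k') \<inter> B) = {} \<longleftrightarrow>
      card (S \<inter> (slot k - B)) = 1 \<and> S \<inter> (slot k \<inter> B \<union> slot k') = {}" if "S \<in> space configs" for S
  proof -
    have "finite (S \<inter> slot k')" using that bounded_slot by (simp add: space_configs locally_finite_def)
    then have c0: "card (S \<inter> slot k') = 0 \<longleftrightarrow> S \<inter> slot k' = {}" by simp
    have "S \<inter> (slot k - B) = S \<inter> slot k" if "S \<inter> (slot k \<inter> B) = {}" using that by blast
    then show ?thesis unfolding c0 by (metis Int_Un_distrib Int_Un_distrib2 Int_assoc Int_empty_left Un_empty Un_empty_left inf_bot_left)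
  qed
  have un: "(slot k - B) \<union> (slot k \<inter> B \<union> slot k') = slot k \<union> slot k'" by blast
  have "{\<nu> \<in> space M. card (X \<nu> \<inter> slot k) = 1 \<and> card (X \<nu> \<inter> slot k') = 0 \<and> X \<nu> \<inter> ((slot k \<union> slot k') \<inter> B) = {}} =
      {\<nu> \<in> space M. card (X \<nu> \<inter> (slot k - B)) = 1 \<and> X \<nu> \<inter> (slot k \<inter> B \<union> slot k') = {}}"
    by (rule Collect_cong) (use iff measurable_space[OF Xm] in blast)
  then have "measure M {\<nu> \<in> space M. card (X \<nu> \<inter> slot k) = 1 \<and> card (X \<nu> \<inter> slot k') = 0 \<and> X \<nu> \<inter> ((slot k \<union> slot k') \<inter> B) = {}} =
      l * vol (slot k - B) * exp (- (l * vol ((slot k - B) \<union> (slot k \<inter> B \<union> slot k'))))"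
    using poisson_void_single_point[OF X _ sets.Diff[OF slot_sets B] sets.Un[OF sets.Int[OF slot_sets B] slot_sets], of k k k'] pos slot_disjoint[OF k]
      bounded_subset[OF bounded_slot[of k] Diff_subset] bounded_subset[OF bounded_slot[of k] Int_lower1] bounded_slot[of k']
    by auto
  then show ?thesis unfolding un tot missed_volume[OF B] by (simp add: mult_ac)
qed

lemma occ_of_iff:
  "occ_of j S = Left \<longleftrightarrow> card (S \<inter> slot (2 * j)) = 1 \<and> card (S \<inter> slot (2 * j + 1)) = 0"
  "occ_of j S = Right \<longleftrightarrow> card (S \<inter> slot (2 * j + 1)) = 1 \<and> card (S \<inter> slot (2 * j)) = 0"
  "occ_of j S = Empty \<longleftrightarrow> card (S \<inter> slot (2 * j)) = 0 \<and> card (S \<inter> slot (2 * j + 1)) = 0"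
  by (auto simp: occ_of_def occ_pattern_def)

context
  fixes M :: "'w measure" and X :: "'w \<Rightarrow> 'a set" and B :: "'a set"
  assumes X: "poisson_void l M X" and B: "B \<in> sets borel"
begin

lemma X_measurable: "X \<in> measurable M configs" and prob_space_M: "prob_space M" using X by (simp_all add: poisson_void_def)

abbreviation law :: "nat \<Rightarrow> occ \<times> bool \<Rightarrow> real" where
  "law j z \<equiv> measure M {\<nu> \<in> space M. pattern B (X \<nu>) j = z}"

lemma law_Left: "law j (Left, True) = l * side ^ DIM('a) * missed B (2 * j) * exp (- (2 * (l * side ^ DIM('a))))"
  using single_slot_law[OF X B, of "2 * j" "2 * j + 1"] box_volume[of j]
  by (simp add: pattern_def occ_of_iff box_def conj_assoc)

lemma law_Right: "law j (Right, True) = l * side ^ DIM('a) * missed B (2 * j + 1) * exp (- (2 * (l * side ^ DIM('a))))"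
  using single_slot_law[OF X B, of "2 * j + 1" "2 * j"] box_volume[of j]
  by (simp add: pattern_def occ_of_iff box_def conj_assoc Un_commute)

lemma law_Empty: "law j (Empty, True) = exp (- (2 * (l * side ^ DIM('a))))"
proof -
  have iff: "occ_of j S = Empty \<and> S \<inter> (box j \<inter> B) = {} \<longleftrightarrow> S \<inter> box j = {}" if "S \<in> space configs" for S
  proof -
    have "finite (S \<inter> slot k)" for k using that bounded_slot by (simp add: space_configs locally_finite_def)
    then have "occ_of j S = Empty \<longleftrightarrow> S \<inter> box j = {}" unfolding occ_of_iff box_def by auto
    then show ?thesis by blast
  qed
  have "{\<nu> \<in> space M. pattern B (X \<nu>) j = (Empty, True)} = {\<nu> \<in> space M. X \<nu> \<inter> box j = {}}"
    using iff measurable_space[OF X_measurable] by (auto simp: pattern_def)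
  then show ?thesis using poisson_voidD[OF X box_sets bounded_box, of j] box_volume[of j] by (simp add: box_def)
qed

lemma pattern_event: "{\<nu> \<in> space M. pattern B (X \<nu>) j = z} \<in> sets M"
  using measurable_sets[OF measurable_compose[OF X_measurable pattern_measurable[OF B]], of "{z}" j] by (simp add: vimage_def Int_def conj_commute)

lemma law_sum: "law j (Empty, True) + law j (Left, True) + law j (Right, True) + law j (Many, True) = exp (- (l * vol (B \<inter> box j)))"
proof -
  interpret prob_space M by (rule prob_space_M)
  have "prob (\<Union>c\<in>UNIV. {\<nu> \<in> space M. pattern B (X \<nu>) j = (c, True)}) = (\<Sum>c\<in>UNIV. law j (c, True))"
    using finite_UNIV_occ by (intro finite_measure_finite_Union) (auto simp: disjoint_family_on_def pattern_event)
  moreover have "(\<Union>c\<in>UNIV. {\<nu> \<in> space M. pattern B (X \<nu>) j = (c, True)}) = {\<nu> \<in> space M. X \<nu> \<inter> (box j \<inter> B) = {}}"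
    by (auto simp: pattern_def)
  moreover have "bounded (box j \<inter> B)" by (rule bounded_subset[OF bounded_box Int_lower1])
  ultimately show ?thesis
    using poisson_voidD[OF X sets.Int[OF box_sets B], of j] by (simp add: UNIV_occ Int_commute)
qed

text \<open>Averaging over the states of a box turns the void probability of intensity \<open>l\<close> into that of intensity \<open>l + \<rho>\<close>.
  The term of each state is weighted by its probability together with a void of \<open>X\<close>.\<close>

lemma box_factor:
  assumes q: "\<And>z. pmf q z = law j z"
  shows "(\<integral>\<^sup>+x. of_bool (snd x) * emeasure Us (added_void B j (fst x)) \<partial>q) = ennreal (exp (- ((l + \<rho>) * vol (B \<inter> box j))))"
proof -
  define a where "a = l * side ^ DIM('a)"
  define y where "y = \<rho> * side ^ DIM('a)"
  define x where "x = missed B (2 * j)"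
  define z where "z = missed B (2 * j + 1)"
  define F where "F = exp (- (y * (2 - x - z)))"
  define E where "E = exp (- (2 * a))"
  have xz: "0 \<le> x" "0 \<le> z" using missed_nonneg[OF B] by (simp_all add: x_def z_def)
  have a0: "0 < a" using pos by (simp add: a_def)
  have vl: "vol (B \<inter> box j) = side ^ DIM('a) * (2 - x - z)" unfolding x_def z_def by (rule box_Int_volume[OF B])
  let ?e = "\<lambda>c. pgf2 (G c) x z"
  have e: "emeasure Us (added_void B j c) = ?e c" for c unfolding x_def z_def by (rule added_void_prob[OF B])
  have pE: "pmf q (Empty, True) = E" and pL: "pmf q (Left, True) = E * (a * x)" and pR: "pmf q (Right, True) = E * (a * z)"
    unfolding q law_Empty law_Left law_Right a_def E_def x_def z_def by simp_all
  have pM: "pmf q (Many, True) = exp (- (a * (2 - x - z))) - E * (1 + a * (x + z))"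
    using law_sum[of j] unfolding q[symmetric] pE pL pR vl by (simp add: a_def algebra_simps)
  have pM0: "0 \<le> exp (- (a * (2 - x - z))) - E * (1 + a * (x + z))" unfolding pM[symmetric] by simp
  have "(\<integral>\<^sup>+x. of_bool (snd x) * emeasure Us (added_void B j (fst x)) \<partial>q) =
      (\<Sum>x\<in>{(Empty, True), (Left, True), (Right, True), (Many, True)}. of_bool (snd x) * emeasure Us (added_void B j (fst x)) * ennreal (pmf q x))"
  proof (rule nn_integral_measure_pmf_support)
    fix x assume "x \<notin> {(Empty, True), (Left, True), (Right, True), (Many, True)}"
    then show "of_bool (snd x) * emeasure Us (added_void B j (fst x)) = 0" using UNIV_occ by (cases x) auto
  qed simp_all
  also have "... = ?e Empty * ennreal E + (?e Left * ennreal (E * (a * x)) + (?e Right * ennreal (E * (a * z)) + ?e Many * ennreal (pmf q (Many, True))))"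
    by (simp add: e pE pL pR)
  also have "... = ennreal E * (?e Empty + ennreal a * (ennreal x * ?e Left + ennreal z * ?e Right)) + ?e Many * ennreal (pmf q (Many, True))"
    using a0 xz by (simp add: ennreal_mult E_def algebra_simps)
  also have "?e Empty + ennreal a * (ennreal x * ?e Left + ennreal z * ?e Right) = ennreal ((1 + a * (x + z)) * F)"
    using few[OF xz] by (simp only: a_def y_def F_def)
  also have "?e Many = ennreal F" using many[OF xz] by (simp only: y_def F_def)
  also have "ennreal E * ennreal ((1 + a * (x + z)) * F) + ennreal F * ennreal (pmf q (Many, True)) = ennreal (E * ((1 + a * (x + z)) * F) + F * pmf q (Many, True))"
    using a0 xz by (simp add: ennreal_mult[symmetric] ennreal_plus[symmetric] E_def F_def del: ennreal_plus)
  also have "E * ((1 + a * (x + z)) * F) + F * pmf q (Many, True) = exp (- (a * (2 - x - z))) * F"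
    unfolding pM by (simp add: algebra_simps)
  also have "... = exp (- ((l + \<rho>) * vol (B \<inter> box j)))"
    unfolding F_def vl exp_add[symmetric] by (simp add: a_def y_def algebra_simps)
  finally show ?thesis .
qed

end

text \<open>The boxes are independent, so their states have a product law, to which \<open>hidden_information\<close> applies.\<close>

lemma pattern_prob:
  assumes X: "poisson_void l M X" and B: "B \<in> sets borel"
    and N: "\<And>j. N \<le> j \<Longrightarrow> box j \<inter> B = {}" and bB: "bounded B"
  shows "measure M {\<nu> \<in> space M. box_seed 0 (X \<nu>) \<in> outside_void B \<and>
      (\<forall>j<N. X \<nu> \<inter> (box j \<inter> B) = {} \<and> box_seed (Suc j) (X \<nu>) \<in> added_void B j (occ_of j (X \<nu>)))} =
    exp (- (\<rho> * vol (B - slots))) * (\<Prod>j<N. exp (- ((l + \<rho>) * vol (B \<inter> box j))))"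
proof -
  have M: "prob_space M" and Xm: "X \<in> measurable M configs" using X by (simp_all add: poisson_void_def)
  interpret prob_space M by (rule M)
  interpret Us: prob_space Us by simp
  have "indep_vars (\<lambda>_. configs) (\<lambda>j \<nu>. X \<nu> \<inter> box j) UNIV"
    by (rule poisson_void_indep[OF X box_sets]) (auto simp: disjoint_family_on_def box_disjoint)
  then have "indep_vars (\<lambda>_. count_space UNIV) (\<lambda>j \<nu>. pattern B (X \<nu> \<inter> box j) j) UNIV"
    by (rule indep_vars_compose2) (rule pattern_measurable[OF B])
  moreover have "pattern B (S \<inter> box j) j = pattern B S j" for S j
    using occ_of_cong[of "S \<inter> box j" j S] by (simp add: pattern_def Int_assoc Int_left_absorb)
  ultimately have ind: "indep_vars (\<lambda>_. count_space UNIV) (\<lambda>j \<nu>. pattern B (X \<nu>) j) UNIV" by (simp only:)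
  have fin: "finite (UNIV :: (occ \<times> bool) set)" using finite_UNIV_occ by (simp add: finite_prod)
  from indep_vars_pmfs[OF fin M ind] obtain q where Q: "(\<forall>j z. pmf (q j) z = prob {\<nu> \<in> space M. pattern B (X \<nu>) j = z}) \<and>
    (\<lambda>\<nu> j. pattern B (X \<nu>) j) \<in> measurable M (pmfs q) \<and> distr M (pmfs q) (\<lambda>\<nu> j. pattern B (X \<nu>) j) = pmfs q" ..
  have q: "pmf (q j) z = prob {\<nu> \<in> space M. pattern B (X \<nu>) j = z}" for j z by (rule Q[THEN conjunct1, rule_format])
  note qm = Q[THEN conjunct2, THEN conjunct1] and qd = Q[THEN conjunct2, THEN conjunct2]
  define a where "a = l * side ^ DIM('a)"
  have one: "pmf (map_pmf fst (q j)) c = prob {\<nu> \<in> space M. occ_of j (X \<nu>) = c}" for j c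
  proof -
    have "pmf (map_pmf fst (q j)) c = measure (q j) {(c, True), (c, False)}"
      unfolding pmf_map by (rule arg_cong[where f="measure (q j)"]) auto
    also have "... = pmf (q j) (c, True) + pmf (q j) (c, False)" by (simp add: measure_measure_pmf_finite)
    also have "... = prob ({\<nu> \<in> space M. pattern B (X \<nu>) j = (c, True)} \<union> {\<nu> \<in> space M. pattern B (X \<nu>) j = (c, False)})"
      unfolding q by (rule finite_measure_Union[symmetric]) (auto simp: pattern_event[OF X B])
    also have "{\<nu> \<in> space M. pattern B (X \<nu>) j = (c, True)} \<union> {\<nu> \<in> space M. pattern B (X \<nu>) j = (c, False)} = {\<nu> \<in> space M. occ_of j (X \<nu>) = c}"
      by (auto simp: pattern_def)
    finally show ?thesis .
  qed
  have empty: "{\<nu> \<in> space M. pattern {} (X \<nu>) j = (c, True)} = {\<nu> \<in> space M. occ_of j (X \<nu>) = c}" for j c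
    by (simp add: pattern_def)
  have LR: "pmf (map_pmf fst (q j)) Left = a * exp (- (2 * a))" "pmf (map_pmf fst (q j)) Right = a * exp (- (2 * a))" for j
  proof -
    have m: "missed {} k = 1" for k by (simp add: missed_def)
    show "pmf (map_pmf fst (q j)) Left = a * exp (- (2 * a))"
      using law_Left[OF X sets.empty_sets, of j] unfolding one empty m a_def by (simp only: mult_1_right)
    show "pmf (map_pmf fst (q j)) Right = a * exp (- (2 * a))"
      using law_Right[OF X sets.empty_sets, of j] unfolding one empty m a_def by (simp only: mult_1_right)
  qed
  let ?E = "{\<nu> \<in> space (pmfs q). seed 0 \<nu> \<in> outside_void B \<and> (\<forall>j<N. snd (\<nu> j) \<and> seed (Suc j) \<nu> \<in> added_void B j (fst (\<nu> j)))}"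
  have E: "emeasure (pmfs q) ?E = emeasure Us (outside_void B) * (\<Prod>j<N. \<integral>\<^sup>+x. of_bool (snd x) * emeasure Us (added_void B j (fst x)) \<partial>(q j))"
  proof (rule hidden_information[where ?A0.0="outside_void B" and A="added_void B" and q=q and n=N and c="a * exp (- (2 * a))" and ?n0.0=0])
    show "outside_void B \<in> sets Us" by (rule outside_void_sets[OF B])
    show "added_void B j c \<in> sets Us" for j c by (rule added_void_sets[OF B])
    show "symmetric (q k)" for k by (simp add: symmetric_def LR)
    show "0 < a * exp (- (2 * a))" using pos by (simp add: a_def)
    show "a * exp (- (2 * a)) \<le> pmf (map_pmf fst (q k)) Left" for k by (simp add: LR)
    fix j
    define x where "x = missed B (2 * j)"
    define z where "z = missed B (2 * j + 1)"
    have xz: "0 \<le> x" "0 \<le> z" using missed_nonneg[OF B] by (simp_all add: x_def z_def)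
    have "ennreal x * emeasure Us (added_void B j Left) = ennreal z * emeasure Us (added_void B j Right)"
      using balance[OF xz] by (simp only: added_void_prob[OF B] x_def z_def)
    then have "x * measure Us (added_void B j Left) = z * measure Us (added_void B j Right)"
      using xz by (simp add: Us.emeasure_eq_measure ennreal_mult[symmetric])
    then show "pmf (q j) (Left, True) * measure Us (added_void B j Left) = pmf (q j) (Right, True) * measure Us (added_void B j Right)"
      unfolding q law_Left[OF X B] law_Right[OF X B] x_def z_def by (simp add: mult_ac)
  qed
  have out: "emeasure Us (outside_void B) = ennreal (exp (- (\<rho> * vol (B - slots))))"
    using poisson_voidD[OF poisson_of_void[OF pos(2)] sets.Diff[OF B slots_sets] bounded_subset[OF bB Diff_subset]]
    by (simp add: outside_void_def Us.emeasure_eq_measure)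
  have fac: "(\<integral>\<^sup>+x. of_bool (snd x) * emeasure Us (added_void B j (fst x)) \<partial>(q j)) = ennreal (exp (- ((l + \<rho>) * vol (B \<inter> box j))))" for j
    by (rule box_factor[OF X B q])
  have E': "emeasure (pmfs q) ?E = ennreal (exp (- (\<rho> * vol (B - slots))) * (\<Prod>j<N. exp (- ((l + \<rho>) * vol (B \<inter> box j)))))"
  proof -
    have "(\<Prod>j<N. ennreal (exp (- ((l + \<rho>) * vol (B \<inter> box j))))) = ennreal (\<Prod>j<N. exp (- ((l + \<rho>) * vol (B \<inter> box j))))"
      by (rule prod_ennreal) simp
    then show ?thesis unfolding E out fac by (simp only: ennreal_mult prod_nonneg exp_ge_zero)
  qed
  have pos_E: "0 < exp (- (\<rho> * vol (B - slots))) * (\<Prod>j<N. exp (- ((l + \<rho>) * vol (B \<inter> box j))))"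
    by (simp add: prod_pos)
  have E_sets: "?E \<in> sets (pmfs q)"
  proof (rule ccontr)
    assume "?E \<notin> sets (pmfs q)"
    then have "emeasure (pmfs q) ?E = 0" by (rule emeasure_notin_sets)
    then show False using E' pos_E by (simp add: ennreal_eq_0_iff)
  qed
  have pre: "(\<lambda>\<nu> j. pattern B (X \<nu>) j) -` ?E \<inter> space M = {\<nu> \<in> space M. box_seed 0 (X \<nu>) \<in> outside_void B \<and>
      (\<forall>j<N. X \<nu> \<inter> (box j \<inter> B) = {} \<and> box_seed (Suc j) (X \<nu>) \<in> added_void B j (occ_of j (X \<nu>)))}"
    unfolding vimage_def mem_Collect_eq seed_pattern space_pmfs by (auto simp: pattern_def)
  have "emeasure M ((\<lambda>\<nu> j. pattern B (X \<nu>) j) -` ?E \<inter> space M) = emeasure (pmfs q) ?E"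
    using emeasure_distr[OF qm E_sets] unfolding qd by simp
  then show ?thesis unfolding pre E' by (simp add: emeasure_eq_measure prod_nonneg)
qed

text \<open>The set \<open>H\<close> is where the process may be seen; the additional points depend on it in the slots only.\<close>

theorem extra_void:
  assumes X: "poisson_void l M X" and B: "B \<in> sets borel" "bounded B" and H: "H \<in> sets borel" "slots \<inter> B \<subseteq> H"
  shows "measure M {\<nu> \<in> space M. X \<nu> \<inter> (B \<inter> H) = {} \<and> extra (X \<nu>) \<inter> B = {}} = exp (- (l * vol (B \<inter> H) + \<rho> * vol B))"
proof -
  have Xm: "X \<in> measurable M configs" using X by (simp add: poisson_void_def)
  obtain N where N: "\<And>j. N \<le> j \<Longrightarrow> box j \<inter> B = {}" using boxes_meeting_bounded[OF B(2)] by metis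
  let ?R = "\<lambda>S. box_seed 0 S \<in> outside_void B \<and> (\<forall>j<N. S \<inter> (box j \<inter> B) = {} \<and> box_seed (Suc j) S \<in> added_void B j (occ_of j S))"
  let ?E = "{S \<in> space configs. S \<inter> (B \<inter> H - slots) = {}}" and ?F = "{S \<in> space configs. ?R S}"
  have BH: "B \<inter> H \<in> sets borel" by (rule sets.Int[OF B(1) H(1)])
  have sl: "B \<inter> slots = (\<Union>j<N. B \<inter> box j)" 
  proof -
    have "j < N" if "x \<in> box j" "x \<in> B" for x j using N[of j] that by (meson disjoint_iff not_le)
    then show ?thesis unfolding slots_def by blast
  qed
  have add: "add_points j c u \<inter> B = {}" if "N \<le> j" for j c u using N[OF that] add_points_subset[of j c u] by blast
  have iff: "S \<inter> (B \<inter> H) = {} \<and> extra S \<inter> B = {} \<longleftrightarrow> S \<inter> (B \<inter> H - slots) = {} \<and> ?R S" for S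
  proof -
    have "S \<inter> (B \<inter> H) = {} \<longleftrightarrow> S \<inter> (B \<inter> H - slots) = {} \<and> S \<inter> (B \<inter> slots) = {}" using H(2) by blast
    also have "S \<inter> (B \<inter> slots) = {} \<longleftrightarrow> (\<forall>j<N. S \<inter> (box j \<inter> B) = {})" unfolding sl by blast
    finally have 1: "S \<inter> (B \<inter> H) = {} \<longleftrightarrow> S \<inter> (B \<inter> H - slots) = {} \<and> (\<forall>j<N. S \<inter> (box j \<inter> B) = {})" .
    have 2: "(\<forall>j. add_points j (occ_of j S) (box_seed (Suc j) S) \<inter> B = {}) \<longleftrightarrow> (\<forall>j<N. add_points j (occ_of j S) (box_seed (Suc j) S) \<inter> B = {})"
      using add by (meson not_le)
    show ?thesis unfolding 1 extra_Int_empty_iff 2 outside_void_def added_void_def space_Us mem_Collect_eq by (intro iffI conjI allI impI; elim conjE) simp_all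
  qed
  have R_cong: "?R (S \<inter> slots) \<longleftrightarrow> ?R S" for S
  proof -
    have o: "occ_of j (S \<inter> slots) = occ_of j S" for j by (rule occ_of_cong) (auto simp: slots_def)
    have "S \<inter> slots \<inter> (box j \<inter> B) = S \<inter> (box j \<inter> B)" for j by (auto simp: slots_def)
    then show ?thesis unfolding box_seed_def o by (simp only:)
  qed
  have E_cong: "S \<inter> (- slots) \<inter> (B \<inter> H - slots) = S \<inter> (B \<inter> H - slots)" for S by blast
  have E: "?E \<in> sets configs" by (rule void_in_configs) (rule sets.Diff[OF BH slots_sets])
  have F: "?F \<in> sets configs"
  proof -
    have seeds: "{S \<in> space configs. box_seed m S \<in> A} \<in> sets configs" if "A \<in> sets Us" for m A
      using measurable_sets[OF box_seed_measurable that, of m] by (simp add: vimage_def Int_def conj_commute)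
    have j: "{S \<in> space configs. S \<inter> (box j \<inter> B) = {} \<and> box_seed (Suc j) S \<in> added_void B j (occ_of j S)} \<in> sets configs" for j
    proof -
      have "{S \<in> space configs. S \<inter> (box j \<inter> B) = {} \<and> box_seed (Suc j) S \<in> added_void B j (occ_of j S)} =
          {S \<in> space configs. S \<inter> (box j \<inter> B) = {}} \<inter> (\<Union>c\<in>UNIV. {S \<in> space configs. occ_of j S = c} \<inter> {S \<in> space configs. box_seed (Suc j) S \<in> added_void B j c})"
        by auto
      also have "... \<in> sets configs"
        by (rule sets.Int[OF void_in_configs[OF sets.Int[OF box_sets B(1)]]]) (intro sets.finite_UN finite_UNIV_occ sets.Int occ_of_event seeds added_void_sets B)
      finally show ?thesis .
    qed
    have all: "{S \<in> space configs. \<forall>j<N. S \<inter> (box j \<inter> B) = {} \<and> box_seed (Suc j) S \<in> added_void B j (occ_of j S)} \<in> sets configs"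
      by (intro sets.sets_Collect_countable_All sets.sets_Collect_imp j sets.sets_Collect_const)
    show ?thesis unfolding Collect_conj_eq2[where P="\<lambda>S. box_seed 0 S \<in> outside_void B"] by (rule sets.Int[OF seeds[OF outside_void_sets[OF B(1)]] all])
  qed
  have sub: "X \<nu> \<inter> D \<in> space configs" if "\<nu> \<in> space M" for \<nu> D
    using measurable_space[OF Xm that] by (auto simp: space_configs intro: locally_finite_subset)
  have e1: "{\<nu> \<in> space M. X \<nu> \<inter> (- slots) \<in> ?E \<and> X \<nu> \<inter> slots \<in> ?F} = {\<nu> \<in> space M. X \<nu> \<inter> (B \<inter> H) = {} \<and> extra (X \<nu>) \<inter> B = {}}"
    unfolding mem_Collect_eq E_cong R_cong iff using sub by blast
  have e2: "{\<nu> \<in> space M. X \<nu> \<inter> (- slots) \<in> ?E} = {\<nu> \<in> space M. X \<nu> \<inter> (B \<inter> H - slots) = {}}"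
    unfolding mem_Collect_eq E_cong using sub by blast
  have e3: "{\<nu> \<in> space M. X \<nu> \<inter> slots \<in> ?F} = {\<nu> \<in> space M. ?R (X \<nu>)}"
    unfolding mem_Collect_eq R_cong using sub by blast
  have bBH: "bounded (B \<inter> H - slots)" by (rule bounded_subset[OF B(2)]) blast
  have p: "measure M {\<nu> \<in> space M. ?R (X \<nu>)} = exp (- (\<rho> * vol (B - slots))) * (\<Prod>j<N. exp (- ((l + \<rho>) * vol (B \<inter> box j))))"
    by (rule pattern_prob[OF X B(1) N B(2)])
  have "measure M {\<nu> \<in> space M. X \<nu> \<inter> (B \<inter> H) = {} \<and> extra (X \<nu>) \<inter> B = {}} =
      measure M {\<nu> \<in> space M. X \<nu> \<inter> (B \<inter> H - slots) = {}} * measure M {\<nu> \<in> space M. ?R (X \<nu>)}"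
    using poisson_void_indep2[OF X borel_comp[OF slots_sets] slots_sets _ E F] unfolding e1 e2 e3 by simp
  also have "... = exp (- (l * vol (B \<inter> H - slots))) * (exp (- (\<rho> * vol (B - slots))) * (\<Prod>j<N. exp (- ((l + \<rho>) * vol (B \<inter> box j)))))"
    unfolding p poisson_voidD[OF X sets.Diff[OF BH slots_sets] bBH] ..
  also have "(\<Prod>j<N. exp (- ((l + \<rho>) * vol (B \<inter> box j)))) = exp (- ((l + \<rho>) * vol (B \<inter> slots)))"
  proof -
    have "vol (\<Union>j<N. B \<inter> box j) = (\<Sum>j<N. vol (B \<inter> box j))"
    proof (rule measure_finite_Union)
      show "disjoint_family_on (\<lambda>j. B \<inter> box j) {..<N}" using box_disjoint by (fastforce simp: disjoint_family_on_def)
      show "emeasure lborel (B \<inter> box j) \<noteq> \<infinity>" for j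
        using emeasure_bounded_finite[OF bounded_subset[OF bounded_box Int_lower2]] by (simp add: less_top)
    qed (auto simp: box_sets B)
    then show ?thesis unfolding sl by (simp add: exp_sum[symmetric] sum_negf sum_distrib_left)
  qed
  also have "exp (- (l * vol (B \<inter> H - slots))) * (exp (- (\<rho> * vol (B - slots))) * exp (- ((l + \<rho>) * vol (B \<inter> slots)))) =
      exp (- (l * (vol (B \<inter> H - slots) + vol (B \<inter> slots)) + \<rho> * (vol (B - slots) + vol (B \<inter> slots))))"
    unfolding exp_add[symmetric] by (simp add: algebra_simps)
  also have "vol (B \<inter> H - slots) + vol (B \<inter> slots) = vol (B \<inter> H)"
  proof -
    have "B \<inter> slots = B \<inter> H \<inter> slots" using H(2) by blast
    then show ?thesis using measure_lborel_split[OF BH bounded_subset[OF B(2) Int_lower1] slots_sets] by simp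
  qed
  also have "vol (B - slots) + vol (B \<inter> slots) = vol B" by (rule measure_lborel_split[OF B slots_sets])
  finally show ?thesis .
qed

end

text \<open>The inequality of \<open>balanced_counts\<close> fails for small cubes and holds for large ones, since \<open>exp (- y)\<close> beats \<open>y\<close>.\<close>

lemma local_thickening_exists:
  fixes w :: "'a::euclidean_space"
  assumes l: "0 < l" and \<rho>: "0 < \<rho>" and w: "norm w = 1"
  shows "\<exists>side G. local_thickening l \<rho> side w G"
proof -
  define y where "y = 2 + 16 * (l / \<rho>)"
  define side where "side = root DIM('a) (y / \<rho>)"
  have y: "2 \<le> y" "16 * (l / \<rho>) \<le> y" using l \<rho> by (simp_all add: y_def)
  have s: "side ^ DIM('a) = y / \<rho>" unfolding side_def using y \<rho> by (intro real_root_pow_pos2) simp_all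
  have side: "0 < side" unfolding side_def using y \<rho> by simp
  have "1 + y + y\<^sup>2 / 2 \<le> exp y" using y by (intro exp_lower_Taylor_quadratic) linarith
  then have e1: "y\<^sup>2 / 2 \<le> exp y" "2 \<le> exp y" using y(1) zero_le_power2[of y] by linarith+
  have "exp (- y) \<le> 1 / 2" using le_imp_inverse_le[OF e1(2)] by (simp add: exp_minus inverse_eq_divide)
  then have "(1 / 2)\<^sup>2 \<le> (1 - exp (- y))\<^sup>2" by (intro power_mono) simp_all
  then have q: "1 / 4 \<le> (1 - exp (- y))\<^sup>2" by (simp add: power2_eq_square)
  have "2 * (l * (y / \<rho>)) * exp (- y) = 2 * (l / \<rho>) * y / exp y" by (simp only: exp_minus divide_inverse mult_ac)
  also have "... \<le> y / 8 * y / exp y"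
  proof (intro divide_right_mono mult_right_mono)
    show "2 * (l / \<rho>) \<le> y / 8" "0 \<le> y" using y by linarith+
  qed simp
  also have "... \<le> 1 / 4" using e1(1) by (simp add: pos_divide_le_eq power2_eq_square)
  finally have ay: "2 * (l * (y / \<rho>)) * exp (- y) \<le> (1 - exp (- y))\<^sup>2" using q by linarith
  have "0 < l * (y / \<rho>)" "0 < y" using l \<rho> y by simp_all
  show ?thesis
  proof (rule balanced_counts[OF \<open>0 < y\<close> \<open>0 < l * (y / \<rho>)\<close> ay])
  fix G0 GL GR
  assume b: "\<And>x z. 0 \<le> x \<Longrightarrow> 0 \<le> z \<Longrightarrow> ennreal x * pgf2 GL x z = ennreal z * pgf2 GR x z"
    and f: "\<And>x z. 0 \<le> x \<Longrightarrow> 0 \<le> z \<Longrightarrow> pgf2 G0 x z + ennreal (l * (y / \<rho>)) * (ennreal x * pgf2 GL x z + ennreal z * pgf2 GR x z) =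
      ennreal ((1 + l * (y / \<rho>) * (x + z)) * exp (- (y * (2 - x - z))))"
  define G where "G = (\<lambda>c. case c of Empty \<Rightarrow> G0 | Left \<Rightarrow> GL | Right \<Rightarrow> GR | Many \<Rightarrow> pair_pmf (poisson_pmf y) (poisson_pmf y))"
  have yr: "\<rho> * side ^ DIM('a) = y" using \<rho> by (simp add: s)
  have "local_thickening l \<rho> side w G"
  proof
    fix x z :: real assume xz: "0 \<le> x" "0 \<le> z"
    show "ennreal x * pgf2 (G Left) x z = ennreal z * pgf2 (G Right) x z" using b[OF xz] by (simp add: G_def)
    show "pgf2 (G Empty) x z + ennreal (l * side ^ DIM('a)) * (ennreal x * pgf2 (G Left) x z + ennreal z * pgf2 (G Right) x z) =
      ennreal ((1 + l * side ^ DIM('a) * (x + z)) * exp (- (\<rho> * side ^ DIM('a) * (2 - x - z))))"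
      using f[OF xz] unfolding yr unfolding s by (simp add: G_def)
    show "pgf2 (G Many) x z = ennreal (exp (- (\<rho> * side ^ DIM('a) * (2 - x - z))))"
      using pgf2_pair_poisson[OF \<open>0 < y\<close> xz] unfolding yr by (simp add: G_def)
  qed (use l \<rho> side w in simp_all)
  then show ?thesis by blast
  qed
qed

section \<open>Measurable constructions with points\<close>

lemma pred_ex_point:
  fixes \<sigma> :: "'t \<Rightarrow> 'a::euclidean_space set"
  assumes \<sigma>: "\<sigma> \<in> measurable N configs" and P: "Measurable.pred (N \<Otimes>\<^sub>M borel) (\<lambda>p. P (fst p) (snd p))"
  shows "Measurable.pred N (\<lambda>t. \<exists>y\<in>\<sigma> t. P t y)"
  unfolding pred_def by (rule measurable_ex_point[OF \<sigma> P[unfolded pred_def]])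

lemma Un_configs_measurable:
  fixes F G :: "'t \<Rightarrow> 'a::euclidean_space set"
  assumes F: "F \<in> measurable N configs" and G: "G \<in> measurable N configs"
  shows "(\<lambda>t. F t \<union> G t) \<in> measurable N configs"
proof (rule measurable_configsI)
  show "locally_finite (F t \<union> G t)" if "t \<in> space N" for t
    using measurable_space[OF F that] measurable_space[OF G that] by (simp add: space_configs locally_finite_Un)
  fix B :: "'a set" assume B: "B \<in> sets borel"
  have "{t \<in> space N. (F t \<union> G t) \<inter> B = {}} = {t \<in> space N. F t \<inter> B = {}} \<inter> {t \<in> space N. G t \<inter> B = {}}" by blast
  then show "{t \<in> space N. (F t \<union> G t) \<inter> B = {}} \<in> sets N"
    using sets.Int[OF void_measurable[OF F B] void_measurable[OF G B]] by (simp only:)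
qed

context local_thickening
begin

section \<open>Nuclei and their cells\<close>

definition proj :: "'a \<Rightarrow> 'a" where "proj x = x - (x \<bullet> w) *\<^sub>R w"

text \<open>The isolated points of the slab just below the hyperplane, where distances are measured between the projections.
  The inequality \<open>0 < norm (y - x)\<close> stands for \<open>y \<noteq> x\<close> in a form that is visibly Borel.\<close>

definition isolated_at :: "'a set \<Rightarrow> 'a \<Rightarrow> bool" where
  "isolated_at S x \<longleftrightarrow> -1 \<le> x \<bullet> w \<and> x \<bullet> w < 0 \<and>
     \<not> (\<exists>y\<in>S. -1 \<le> y \<bullet> w \<and> y \<bullet> w < 0 \<and> 0 < norm (y - x) \<and> norm (proj y - proj x) \<le> 2 * width)"

definition nuclei :: "'a set \<Rightarrow> 'a set" where
  "nuclei S = {proj x | x. x \<in> S \<and> isolated_at S x}"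

definition nearest :: "'a set \<Rightarrow> 'a \<Rightarrow> 'a \<Rightarrow> bool" where
  "nearest S n y \<longleftrightarrow> \<not> (\<exists>x\<in>S. isolated_at S x \<and> 0 < norm (proj x - n) \<and> norm (proj y - proj x) \<le> norm (proj y - n))"

text \<open>The set \<open>S\<close> supplies the nuclei and \<open>T\<close> the points in the boxes. They are kept apart because the
  two are independent when they are the parts of a Poisson process below and above the hyperplane.\<close>

definition grown :: "'a set \<Rightarrow> 'a set \<Rightarrow> 'a set" where
  "grown S T = {z + proj x | x z. x \<in> S \<and> isolated_at S x \<and> z \<in> extra (shift (- proj x) T) \<and> nearest S (proj x) (z + proj x)}"

lemma proj_measurable [measurable]: "proj \<in> borel_measurable borel"
  unfolding proj_def by measurable

lemma proj_inner: "proj x \<bullet> w = 0" by (simp add: proj_def inner_diff_left w_inner)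

lemma proj_add: "v \<bullet> w = 0 \<Longrightarrow> proj (x + v) = proj x + v" by (simp add: proj_def inner_add_left)

lemma norm_proj_le: "norm (proj x) \<le> norm x"
proof -
  have "(norm (proj x))\<^sup>2 = (norm x)\<^sup>2 - (x \<bullet> w)\<^sup>2"
    unfolding power2_norm_eq_inner proj_def by (simp add: inner_diff_left inner_diff_right w_inner inner_commute power2_eq_square algebra_simps)
  also have "... \<le> (norm x)\<^sup>2" by simp
  finally show ?thesis by (rule power2_le_imp_le) simp
qed

lemma norm_le_proj: "norm x \<le> norm (proj x) + \<bar>x \<bullet> w\<bar>"
proof -
  have "x = proj x + (x \<bullet> w) *\<^sub>R w" by (simp add: proj_def)
  then have "norm x \<le> norm (proj x) + norm ((x \<bullet> w) *\<^sub>R w)" by (metis norm_triangle_ineq)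
  then show ?thesis by (simp add: w)
qed

lemma nearest_iff: "nearest S n y \<longleftrightarrow> (\<forall>m\<in>nuclei S. m \<noteq> n \<longrightarrow> norm (proj y - n) < norm (proj y - m))"
  unfolding nearest_def nuclei_def by (auto simp: not_le)

lemma grown_eq: "grown S T = (\<Union>n\<in>nuclei S. {y. nearest S n y \<and> y - n \<in> extra (shift (- n) T)})"
proof -
  have "y \<in> grown S T \<longleftrightarrow> (\<exists>n\<in>nuclei S. nearest S n y \<and> y - n \<in> extra (shift (- n) T))" for y
  proof
    assume "y \<in> grown S T"
    then obtain x z where "y = z + proj x" "x \<in> S" "isolated_at S x" "z \<in> extra (shift (- proj x) T)" "nearest S (proj x) (z + proj x)"
      unfolding grown_def by blast
    then show "\<exists>n\<in>nuclei S. nearest S n y \<and> y - n \<in> extra (shift (- n) T)"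
      by (intro bexI[of _ "proj x"]) (auto simp: nuclei_def)
  next
    assume "\<exists>n\<in>nuclei S. nearest S n y \<and> y - n \<in> extra (shift (- n) T)"
    then obtain x where "x \<in> S" "isolated_at S x" "nearest S (proj x) y" "y - proj x \<in> extra (shift (- proj x) T)"
      unfolding nuclei_def by blast
    then show "y \<in> grown S T"
      unfolding grown_def by (intro CollectI exI[of _ x] exI[of _ "y - proj x"]) simp
  qed
  then show ?thesis by blast
qed

lemma nuclei_inner: "n \<in> nuclei S \<Longrightarrow> n \<bullet> w = 0" by (auto simp: nuclei_def proj_inner)

lemma nuclei_apart:
  assumes "n \<in> nuclei S" "m \<in> nuclei S" "n \<noteq> m" shows "2 * width < norm (n - m)"
proof -
  obtain x y where x: "x \<in> S" "isolated_at S x" "n = proj x" and y: "y \<in> S" "isolated_at S y" "m = proj y"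
    using assms(1,2) unfolding nuclei_def by blast
  have "x \<noteq> y" using assms(3) x(3) y(3) by blast
  then have "0 < norm (x - y)" by simp
  moreover have "-1 \<le> x \<bullet> w" "x \<bullet> w < 0" using x(2) by (simp_all add: isolated_at_def)
  ultimately have "\<not> norm (proj x - proj y) \<le> 2 * width" using y(2) x(1) unfolding isolated_at_def by blast
  then show ?thesis using x(3) y(3) by simp
qed

lemma nearest_unique: "n \<in> nuclei S \<Longrightarrow> m \<in> nuclei S \<Longrightarrow> nearest S n y \<Longrightarrow> nearest S m y \<Longrightarrow> n = m"
  unfolding nearest_iff by (metis less_asym)

text \<open>The slots of a nucleus stay within \<open>width\<close> of its axis, and nuclei are more than twice as far apart; so each cell
  contains the boxes that it uses.\<close>

lemma nearest_slots:
  assumes n: "n \<in> nuclei S" and z: "z \<in> slots" shows "nearest S n (z + n)"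
  unfolding nearest_iff
proof (intro ballI impI)
  fix m assume m: "m \<in> nuclei S" "m \<noteq> n"
  have p: "proj (z + n) = proj z + n" by (rule proj_add[OF nuclei_inner[OF n]])
  have "norm (proj z) \<le> width" using slots_tube[OF z] by (simp add: proj_def)
  moreover have "2 * width < norm (n - m)" using nuclei_apart[OF n m(1)] m(2) by blast
  moreover have "norm (n - m) \<le> norm (proj z + n - m) + norm (proj z)"
    using norm_triangle_ineq4[of "proj z + n - m" "proj z"] by (simp add: algebra_simps)
  ultimately show "norm (proj (z + n) - n) < norm (proj (z + n) - m)" unfolding p by simp
qed

lemma finite_nuclei:
  assumes S: "S \<in> space configs" shows "finite (nuclei S \<inter> cball 0 K)"
proof -
  have "nuclei S \<inter> cball 0 K \<subseteq> proj ` (S \<inter> cball 0 (K + 1))"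
  proof
    fix n assume n: "n \<in> nuclei S \<inter> cball 0 K"
    then obtain x where x: "x \<in> S" "isolated_at S x" "n = proj x" unfolding nuclei_def by blast
    have "\<bar>x \<bullet> w\<bar> \<le> 1" using x(2) by (simp add: isolated_at_def abs_le_iff)
    then have "norm x \<le> K + 1" using norm_le_proj[of x] n x(3) by simp
    then show "n \<in> proj ` (S \<inter> cball 0 (K + 1))" using x by simp
  qed
  moreover have "finite (S \<inter> cball 0 (K + 1))" using S by (simp add: space_configs locally_finite_def)
  ultimately show ?thesis by (meson finite_imageI finite_subset)
qed

lemma countable_nuclei: assumes "S \<in> space configs" shows "countable (nuclei S)"
proof -
  have "nuclei S = (\<Union>k::nat. nuclei S \<inter> cball 0 (real k))"
    by (auto simp: real_arch_simple)
  moreover have "countable (\<Union>k::nat. nuclei S \<inter> cball 0 (real k))"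
    by (rule countable_UN) (simp_all add: countable_finite finite_nuclei[OF assms])
  ultimately show ?thesis by simp
qed

lemma finite_relevant:
  assumes S: "S \<in> space configs" and B: "bounded B" shows "finite {n \<in> nuclei S. \<exists>y\<in>B. nearest S n y}"
proof (cases "nuclei S = {}")
  case False
  then obtain n0 where n0: "n0 \<in> nuclei S" by blast
  obtain R where R: "\<And>x. x \<in> B \<Longrightarrow> norm x \<le> R" using B by (auto simp: bounded_iff)
  have "{n \<in> nuclei S. \<exists>y\<in>B. nearest S n y} \<subseteq> nuclei S \<inter> cball 0 (2 * R + norm n0)"
  proof
    fix n assume "n \<in> {n \<in> nuclei S. \<exists>y\<in>B. nearest S n y}"
    then obtain y where n: "n \<in> nuclei S" and y: "y \<in> B" "nearest S n y" by blast
    have "norm (proj y - n) \<le> norm (proj y - n0)"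
      using y(2) n0 unfolding nearest_iff by (cases "n = n0") (auto intro: less_imp_le)
    moreover have "norm n \<le> norm (proj y - n) + norm (proj y)" using norm_triangle_ineq4[of "proj y" "proj y - n"] by simp
    moreover have "norm (proj y - n0) \<le> norm (proj y) + norm n0" by (rule norm_triangle_ineq4)
    moreover have "norm (proj y) \<le> R" using norm_proj_le[of y] R[OF y(1)] by linarith
    ultimately show "n \<in> nuclei S \<inter> cball 0 (2 * R + norm n0)" using n by simp
  qed
  then show ?thesis using finite_nuclei[OF S] by (rule finite_subset)
qed simp

lemma grown_locally_finite: assumes S: "S \<in> space configs" shows "locally_finite (grown S T)"
  unfolding locally_finite_def
proof (intro allI impI)
  fix B :: "'a set" assume B: "bounded B"
  let ?F = "{n \<in> nuclei S. \<exists>y\<in>B. nearest S n y}"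
  have "grown S T \<inter> B \<subseteq> (\<Union>n\<in>?F. (\<lambda>z. z + n) ` (extra (shift (- n) T) \<inter> (\<lambda>z. z + n) -` B))"
  proof
    fix y assume "y \<in> grown S T \<inter> B"
    then obtain n where n: "n \<in> nuclei S" "nearest S n y" "y - n \<in> extra (shift (- n) T)" and y: "y \<in> B" unfolding grown_eq by blast
    have "y = (y - n) + n" "y - n \<in> (\<lambda>z. z + n) -` B" using y by simp_all
    then have "y \<in> (\<lambda>z. z + n) ` (extra (shift (- n) T) \<inter> (\<lambda>z. z + n) -` B)" using n(3) by blast
    then show "y \<in> (\<Union>n\<in>?F. (\<lambda>z. z + n) ` (extra (shift (- n) T) \<inter> (\<lambda>z. z + n) -` B))" using n y by blast
  qed
  moreover have "finite (extra (shift (- n) T) \<inter> (\<lambda>z. z + n) -` B)" for n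
    using extra_locally_finite bounded_vimage_plus[OF B] unfolding locally_finite_def by blast
  ultimately show "finite (grown S T \<inter> B)" using finite_relevant[OF S B] by (meson finite_UN_I finite_imageI finite_subset)
qed

section \<open>Measurability of the construction\<close>

lemma pred_isolated: "Measurable.pred (configs \<Otimes>\<^sub>M borel) (\<lambda>p. isolated_at (fst p) (snd p))"
proof -
  have ex: "Measurable.pred (configs \<Otimes>\<^sub>M borel) (\<lambda>p. \<exists>y\<in>fst p. -1 \<le> y \<bullet> w \<and> y \<bullet> w < 0 \<and> 0 < norm (y - snd p) \<and> norm (proj y - proj (snd p)) \<le> 2 * width)"
  proof (rule pred_ex_point[OF measurable_fst])
    show "Measurable.pred ((configs \<Otimes>\<^sub>M borel) \<Otimes>\<^sub>M borel) (\<lambda>q. -1 \<le> snd q \<bullet> w \<and> snd q \<bullet> w < 0 \<and> 0 < norm (snd q - snd (fst q)) \<and> norm (proj (snd q) - proj (snd (fst q))) \<le> 2 * width)"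
      by measurable
  qed
  have slab: "Measurable.pred (configs \<Otimes>\<^sub>M borel) (\<lambda>p. -1 \<le> snd p \<bullet> w)" "Measurable.pred (configs \<Otimes>\<^sub>M borel) (\<lambda>p. snd p \<bullet> w < 0)"
    by measurable
  show ?thesis unfolding isolated_at_def by (intro pred_intros_logic slab ex)
qed

lemma pred_nearest: "Measurable.pred (configs \<Otimes>\<^sub>M (borel \<Otimes>\<^sub>M borel)) (\<lambda>t. nearest (fst t) (fst (snd t)) (snd (snd t)))"
proof -
  let ?N = "configs \<Otimes>\<^sub>M ((borel :: 'a measure) \<Otimes>\<^sub>M (borel :: 'a measure))"
  have "Measurable.pred ?N (\<lambda>t. \<exists>x\<in>fst t. isolated_at (fst t) x \<and> 0 < norm (proj x - fst (snd t)) \<and> norm (proj (snd (snd t)) - proj x) \<le> norm (proj (snd (snd t)) - fst (snd t)))"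
  proof (rule pred_ex_point[OF measurable_fst])
    have m: "(\<lambda>q. (fst (fst q), snd q)) \<in> measurable (?N \<Otimes>\<^sub>M borel) (configs \<Otimes>\<^sub>M borel)" by measurable
    have i: "Measurable.pred (?N \<Otimes>\<^sub>M borel) (\<lambda>q. isolated_at (fst (fst q)) (snd q))"
      using measurable_compose[OF m pred_isolated] by (simp only: fst_conv snd_conv)
    have a: "Measurable.pred (?N \<Otimes>\<^sub>M borel) (\<lambda>q. 0 < norm (proj (snd q) - fst (snd (fst q))))" by measurable
    have b: "Measurable.pred (?N \<Otimes>\<^sub>M borel) (\<lambda>q. norm (proj (snd (snd (fst q))) - proj (snd q)) \<le> norm (proj (snd (snd (fst q))) - fst (snd (fst q))))" by measurable
    show "Measurable.pred (?N \<Otimes>\<^sub>M borel) (\<lambda>q. isolated_at (fst (fst q)) (snd q) \<and> 0 < norm (proj (snd q) - fst (snd (fst q))) \<and>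
        norm (proj (snd (snd (fst q))) - proj (snd q)) \<le> norm (proj (snd (snd (fst q))) - fst (snd (fst q))))"
      by (intro pred_intros_logic i a b)
  qed
  then show ?thesis unfolding nearest_def by (rule pred_intros_logic(2))
qed

lemma shift_proj_measurable: "(\<lambda>p. shift (- proj (snd p)) (fst p)) \<in> measurable (configs \<Otimes>\<^sub>M borel) configs"
proof (rule measurable_configsI)
  show "locally_finite (shift (- proj (snd p)) (fst p))" if "p \<in> space (configs \<Otimes>\<^sub>M borel)" for p
    using that by (intro locally_finite_shift) (simp add: space_pair_measure mem_Times_iff space_configs)
  fix B :: "'a set" assume B [measurable]: "B \<in> sets borel"
  have ex: "Measurable.pred (configs \<Otimes>\<^sub>M borel) (\<lambda>p. \<exists>y\<in>fst p. y + - proj (snd p) \<in> B)"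
  proof (rule pred_ex_point[OF measurable_fst])
    show "Measurable.pred ((configs \<Otimes>\<^sub>M borel) \<Otimes>\<^sub>M borel) (\<lambda>q. snd q + - proj (snd (fst q)) \<in> B)" by measurable
  qed
  have e: "shift (- proj (snd p)) (fst p) \<inter> B = {} \<longleftrightarrow> \<not> (\<exists>y\<in>fst p. y + - proj (snd p) \<in> B)" for p :: "'a set \<times> 'a"
    unfolding shift_def by blast
  show "{p \<in> space (configs \<Otimes>\<^sub>M borel). shift (- proj (snd p)) (fst p) \<inter> B = {}} \<in> sets (configs \<Otimes>\<^sub>M borel)"
    unfolding e pred_def[symmetric] by (rule pred_intros_logic(2)[OF ex])
qed

lemma grown_measurable: "(\<lambda>t. grown (fst t) (snd t)) \<in> measurable (configs \<Otimes>\<^sub>M configs) configs"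
proof (rule measurable_configsI)
  let ?N = "(configs :: 'a set measure) \<Otimes>\<^sub>M (configs :: 'a set measure)"
  let ?N2 = "?N \<Otimes>\<^sub>M (borel :: 'a measure)"
  show "locally_finite (grown (fst t) (snd t))" if "t \<in> space ?N" for t
    using that by (intro grown_locally_finite) (simp add: space_pair_measure mem_Times_iff)
  fix B :: "'a set" assume B [measurable]: "B \<in> sets borel"
  have ex: "Measurable.pred ?N (\<lambda>t. \<exists>x\<in>fst t. isolated_at (fst t) x \<and> (\<exists>z\<in>extra (shift (- proj x) (snd t)). z + proj x \<in> B \<and> nearest (fst t) (proj x) (z + proj x)))"
  proof (rule pred_ex_point[OF measurable_fst])
    have m: "(\<lambda>q. (fst (fst q), snd q)) \<in> measurable ?N2 (configs \<Otimes>\<^sub>M borel)" by measurable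
    have i: "Measurable.pred ?N2 (\<lambda>q. isolated_at (fst (fst q)) (snd q))"
      using measurable_compose[OF m pred_isolated] by (simp only: fst_conv snd_conv)
    have m2: "(\<lambda>q. (snd (fst q), snd q)) \<in> measurable ?N2 (configs \<Otimes>\<^sub>M borel)" by measurable
    have s: "(\<lambda>q. extra (shift (- proj (snd q)) (snd (fst q)))) \<in> measurable ?N2 configs"
      using measurable_compose[OF measurable_compose[OF m2 shift_proj_measurable] extra_measurable] by (simp only: fst_conv snd_conv)
    have ex2: "Measurable.pred ?N2 (\<lambda>q. \<exists>z\<in>extra (shift (- proj (snd q)) (snd (fst q))). z + proj (snd q) \<in> B \<and> nearest (fst (fst q)) (proj (snd q)) (z + proj (snd q)))"
    proof (rule pred_ex_point[OF s])
      have m3: "(\<lambda>r. (fst (fst (fst r)), (proj (snd (fst r)), snd r + proj (snd (fst r))))) \<in> measurable (?N2 \<Otimes>\<^sub>M borel) (configs \<Otimes>\<^sub>M (borel \<Otimes>\<^sub>M borel))"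
        by measurable
      have n: "Measurable.pred (?N2 \<Otimes>\<^sub>M borel) (\<lambda>r. nearest (fst (fst (fst r))) (proj (snd (fst r))) (snd r + proj (snd (fst r))))"
        using measurable_compose[OF m3 pred_nearest] by (simp only: fst_conv snd_conv)
      have b: "Measurable.pred (?N2 \<Otimes>\<^sub>M borel) (\<lambda>r. snd r + proj (snd (fst r)) \<in> B)" by measurable
      show "Measurable.pred (?N2 \<Otimes>\<^sub>M borel) (\<lambda>r. snd r + proj (snd (fst r)) \<in> B \<and> nearest (fst (fst (fst r))) (proj (snd (fst r))) (snd r + proj (snd (fst r))))"
        by (intro pred_intros_logic b n)
    qed
    show "Measurable.pred ?N2 (\<lambda>q. isolated_at (fst (fst q)) (snd q) \<and> (\<exists>z\<in>extra (shift (- proj (snd q)) (snd (fst q))). z + proj (snd q) \<in> B \<and> nearest (fst (fst q)) (proj (snd q)) (z + proj (snd q))))"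
      by (intro pred_intros_logic i ex2)
  qed
  have e: "grown S T \<inter> B = {} \<longleftrightarrow> \<not> (\<exists>x\<in>S. isolated_at S x \<and> (\<exists>z\<in>extra (shift (- proj x) T). z + proj x \<in> B \<and> nearest S (proj x) (z + proj x)))" for S T
    unfolding grown_def by blast
  show "{t \<in> space ?N. grown (fst t) (snd t) \<inter> B = {}} \<in> sets ?N"
    unfolding e pred_def[symmetric] by (rule pred_intros_logic(2)[OF ex])
qed

definition cell_of :: "'a set \<Rightarrow> 'a \<Rightarrow> 'a set" where "cell_of S n = {y. nearest S n y}"

lemma cell_of_sets: assumes S: "S \<in> space configs" shows "cell_of S n \<in> sets borel"
proof -
  have m: "(\<lambda>y. (S, (n, y))) \<in> measurable borel (configs \<Otimes>\<^sub>M (borel \<Otimes>\<^sub>M borel))"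
    by (intro measurable_Pair measurable_const S measurable_ident_sets[OF refl]) simp_all
  have "Measurable.pred borel (\<lambda>y. nearest S n y)"
    using measurable_compose[OF m pred_nearest] by (simp only: fst_conv snd_conv)
  then show ?thesis unfolding pred_def cell_of_def by simp
qed

section \<open>The cells, given the points below the hyperplane\<close>

abbreviation upper :: "'a set" where "upper \<equiv> {x. 0 \<le> x \<bullet> w}"

lemma upper_sets: "upper \<in> sets borel" by measurable

text \<open>Ties between nuclei lie on hyperplanes.\<close>

lemma ties_null:
  assumes S: "S \<in> space configs" and ne: "nuclei S \<noteq> {}" and D: "D \<in> sets borel" "\<And>n. n \<in> nuclei S \<Longrightarrow> D \<inter> cell_of S n = {}"
  shows "vol D = 0"
proof -
  let ?h = "\<lambda>n m. {y. (2 *\<^sub>R (m - n)) \<bullet> y = m \<bullet> m - n \<bullet> n}"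
  have sub: "D \<subseteq> (\<Union>(n, m)\<in>{(n, m). n \<in> nuclei S \<and> m \<in> nuclei S \<and> n \<noteq> m}. ?h n m)"
  proof
    fix y assume y: "y \<in> D"
    obtain n0 where n0: "n0 \<in> nuclei S" using ne by blast
    let ?K = "norm (proj y) + norm (proj y - n0)"
    let ?A = "{n \<in> nuclei S. norm (proj y - n) \<le> norm (proj y - n0)}"
    have "?A \<subseteq> nuclei S \<inter> cball 0 ?K"
    proof
      fix n assume "n \<in> ?A"
      then show "n \<in> nuclei S \<inter> cball 0 ?K" using norm_triangle_ineq4[of "proj y" "proj y - n"] by simp
    qed
    then have fin: "finite ?A" using finite_nuclei[OF S] by (rule finite_subset)
    have neA: "?A \<noteq> {}" using n0 by blast
    obtain n where n: "n \<in> ?A" "\<And>m. m \<in> ?A \<Longrightarrow> norm (proj y - n) \<le> norm (proj y - m)"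
      using ex_min_if_finite[of "(\<lambda>n. norm (proj y - n)) ` ?A"] fin neA
      by (metis (no_types, lifting) arg_min_if_finite(1) arg_min_least)
    have min: "norm (proj y - n) \<le> norm (proj y - m)" if "m \<in> nuclei S" for m
    proof (cases "m \<in> ?A")
      case False
      then show ?thesis using that n(1) by simp
    qed (rule n(2))
    have nn: "n \<in> nuclei S" using n(1) by simp
    have "y \<notin> cell_of S n" using D(2)[OF nn] y by blast
    then obtain m where m: "m \<in> nuclei S" "m \<noteq> n" "norm (proj y - m) \<le> norm (proj y - n)"
      unfolding cell_of_def nearest_iff by (auto simp: not_less)
    have "norm (proj y - m) = norm (proj y - n)" using min[OF m(1)] m(3) by linarith
    then have "(proj y - m) \<bullet> (proj y - m) = (proj y - n) \<bullet> (proj y - n)" by (simp add: dot_square_norm)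
    then have q: "2 * (proj y \<bullet> m) - 2 * (proj y \<bullet> n) = m \<bullet> m - n \<bullet> n"
      by (simp add: inner_diff_left inner_diff_right inner_commute)
    have p: "proj y \<bullet> k = y \<bullet> k" if "k \<in> nuclei S" for k
    proof -
      have "w \<bullet> k = 0" using nuclei_inner[OF that] by (simp add: inner_commute)
      then show ?thesis by (simp add: proj_def inner_diff_left)
    qed
    have "y \<in> ?h n m" using q unfolding p[OF m(1)] p[OF nn] by (simp add: inner_diff_left inner_commute algebra_simps)
    then show "y \<in> (\<Union>(n, m)\<in>{(n, m). n \<in> nuclei S \<and> m \<in> nuclei S \<and> n \<noteq> m}. ?h n m)" using m(1,2) nn by blast
  qed
  have cnt: "countable {(n, m). n \<in> nuclei S \<and> m \<in> nuclei S \<and> n \<noteq> m}"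
    by (rule countable_subset[OF _ countable_SIGMA[OF countable_nuclei[OF S] countable_nuclei[OF S]]]) blast
  have "(\<Union>(n, m)\<in>{(n, m). n \<in> nuclei S \<and> m \<in> nuclei S \<and> n \<noteq> m}. ?h n m) \<in> null_sets lebesgue"
  proof (rule null_sets_UN'[OF cnt])
    fix p assume p: "p \<in> {(n, m). n \<in> nuclei S \<and> m \<in> nuclei S \<and> n \<noteq> m}"
    obtain n m where nm: "p = (n, m)" by (cases p)
    have "negligible (?h n m)" using p nm by (intro negligible_hyperplane) auto
    then show "(case p of (n, m) \<Rightarrow> ?h n m) \<in> null_sets lebesgue" by (simp add: nm negligible_iff_null_sets)
  qed
  then have "D \<in> null_sets lebesgue" using sub D(1) by (intro null_sets_subset[OF _ _ sub]) auto
  then have "D \<in> null_sets lborel" using D(1) by (subst (asm) null_sets_completion_iff) auto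
  then show ?thesis by (simp add: measure_eq_0_null_sets)
qed

text \<open>Given the nuclei, different cells look at disjoint parts of \<open>X\<close>, so their voids are independent. Finitely many
  cells meet \<open>B\<close>, and they cover it up to ties.\<close>

theorem grown_void:
  assumes S: "S \<in> space configs" and ne: "nuclei S \<noteq> {}" and X: "poisson_void l M X" and B: "B \<in> sets borel" "bounded B"
  shows "measure M {\<nu> \<in> space M. X \<nu> \<inter> (B \<inter> upper) = {} \<and> grown S (X \<nu> \<inter> upper) \<inter> B = {}} =
    exp (- (l * vol (B \<inter> upper) + \<rho> * vol B))"
proof -
  interpret prob_space M using X by (simp add: poisson_void_def)
  have Xm: "X \<in> measurable M configs" using X by (simp add: poisson_void_def)
  define F where "F = {n \<in> nuclei S. \<exists>y\<in>B. nearest S n y}"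
  have F: "finite F" unfolding F_def by (rule finite_relevant[OF S B(2)])
  have F_nuc: "n \<in> nuclei S" if "n \<in> F" for n using that by (simp add: F_def)
  let ?C = "cell_of S" and ?H = upper
  have C: "?C n \<in> sets borel" for n by (rule cell_of_sets[OF S])
  define B' where "B' n = (\<lambda>x. x + n) -` (B \<inter> ?C n)" for n
  have B': "B' n \<in> sets borel" "bounded (B' n)" for n
    unfolding B'_def by (rule vimage_plus_borel[OF sets.Int[OF B(1) C]], rule bounded_vimage_plus[OF bounded_subset[OF B(2) Int_lower1]])
  have disjC: "?C n \<inter> ?C m = {}" if "n \<in> nuclei S" "m \<in> nuclei S" "n \<noteq> m" for n m
    using nearest_unique[OF that(1,2)] that(3) unfolding cell_of_def by blast
  define A where "A n = {T \<in> space configs. T \<inter> (B \<inter> ?C n \<inter> ?H) = {} \<and> extra (shift (- n) T) \<inter> B' n = {}}" for n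
  have A: "A n \<in> sets configs" for n
  proof -
    have "A n = {T \<in> space configs. T \<inter> (B \<inter> ?C n \<inter> ?H) = {}} \<inter> {T \<in> space configs. extra (shift (- n) T) \<inter> B' n = {}}" unfolding A_def by blast
    then show ?thesis
      using sets.Int[OF void_in_configs[OF sets.Int[OF sets.Int[OF B(1) C] upper_sets]] void_measurable[OF measurable_compose[OF shift_measurable extra_measurable] B'(1)]]
      by (simp only:)
  qed
  let ?K = "\<lambda>n. ?C n \<inter> ?H"
  have K: "?K n \<in> sets borel" for n by (rule sets.Int[OF C upper_sets])
  have Xs: "X \<nu> \<in> space configs" if "\<nu> \<in> space M" for \<nu> by (rule measurable_space[OF Xm that])
  have sub: "X \<nu> \<inter> D \<in> space configs" if "\<nu> \<in> space M" for \<nu> D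
    using Xs[OF that] by (auto simp: space_configs intro: locally_finite_subset)
  have extra_K: "extra (shift (- n) (T \<inter> D)) = extra (shift (- n) T)" if "n \<in> nuclei S" "?K n \<subseteq> D" for n T D
  proof (rule extra_cong)
    have "z + n \<in> D" if "z \<in> slots" for z
    proof -
      have "z + n \<in> ?C n" unfolding cell_of_def using nearest_slots[OF \<open>n \<in> nuclei S\<close> that] by simp
      moreover have "z + n \<in> ?H" using slots_height[OF that] nuclei_inner[OF \<open>n \<in> nuclei S\<close>] by (simp add: inner_add_left)
      ultimately show ?thesis using \<open>?K n \<subseteq> D\<close> by blast
    qed
    then have "s \<in> D" if "s + - n \<in> slots" for s using that by (metis diff_add_cancel add_uminus_conv_diff)
    then show "shift (- n) (T \<inter> D) \<inter> slots = shift (- n) T \<inter> slots" unfolding shift_def by blast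
  qed
  have A_iff: "X \<nu> \<inter> ?K n \<in> A n \<longleftrightarrow> X \<nu> \<inter> (B \<inter> ?C n \<inter> ?H) = {} \<and> extra (shift (- n) (X \<nu>)) \<inter> B' n = {}"
    if "\<nu> \<in> space M" "n \<in> nuclei S" for \<nu> n
  proof -
    have "X \<nu> \<inter> ?K n \<inter> (B \<inter> ?C n \<inter> ?H) = X \<nu> \<inter> (B \<inter> ?C n \<inter> ?H)" by blast
    then show ?thesis unfolding A_def using sub[OF that(1)] extra_K[OF that(2) subset_refl, of "X \<nu>"] by simp
  qed
  have pA: "prob {\<nu> \<in> space M. X \<nu> \<inter> ?K n \<in> A n} = exp (- (l * vol (B \<inter> ?H \<inter> ?C n) + \<rho> * vol (B \<inter> ?C n)))" if n: "n \<in> nuclei S" for n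
  proof -
    have nw: "n \<bullet> w = 0" by (rule nuclei_inner[OF n])
    have v: "(\<lambda>x. x + - n) -` (B' n \<inter> ?H) = B \<inter> ?C n \<inter> ?H" unfolding B'_def using nw by (auto simp: inner_add_left inner_diff_left)
    have v': "B' n \<inter> ?H = (\<lambda>x. x + n) -` (B \<inter> ?H \<inter> ?C n)" unfolding B'_def using nw by (auto simp: inner_add_left)
    have "{\<nu> \<in> space M. X \<nu> \<inter> ?K n \<in> A n} = {\<nu> \<in> space M. shift (- n) (X \<nu>) \<inter> (B' n \<inter> ?H) = {} \<and> extra (shift (- n) (X \<nu>)) \<inter> B' n = {}}"
      unfolding shift_Int_empty_iff v using A_iff[OF _ n] by blast
    moreover have "slots \<inter> B' n \<subseteq> ?H" using slots_height by (auto intro: less_imp_le)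
    ultimately have "prob {\<nu> \<in> space M. X \<nu> \<inter> ?K n \<in> A n} = exp (- (l * vol (B' n \<inter> ?H) + \<rho> * vol (B' n)))"
      using extra_void[OF poisson_void_shift[OF X] B' upper_sets, of n "- n"] by simp
    also have "vol (B' n \<inter> ?H) = vol (B \<inter> ?H \<inter> ?C n)"
      unfolding v' by (rule measure_lborel_vimage_plus[OF sets.Int[OF sets.Int[OF B(1) upper_sets] C]])
    also have "vol (B' n) = vol (B \<inter> ?C n)"
      unfolding B'_def by (rule measure_lborel_vimage_plus[OF sets.Int[OF B(1) C]])
    finally show ?thesis .
  qed
  have EK: "{\<nu> \<in> space M. X \<nu> \<inter> ?K n \<in> A n} \<in> events" for n
    using measurable_sets[OF measurable_compose[OF Xm configs_restrict_measurable[OF K]] A, of n n] by (simp add: vimage_def Int_def conj_commute)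
  let ?R = "{\<nu> \<in> space M. \<forall>n\<in>F. X \<nu> \<inter> ?K n \<in> A n}"
  have R_sets: "?R \<in> events" using F by (intro sets.sets_Collect_finite_All EK)
  have pR: "prob ?R = (\<Prod>n\<in>F. prob {\<nu> \<in> space M. X \<nu> \<inter> ?K n \<in> A n})"
  proof (cases "F = {}")
    case True
    then show ?thesis by (simp add: prob_space)
  next
    case False
    have "indep_vars (\<lambda>_. configs) (\<lambda>n \<nu>. X \<nu> \<inter> ?K n) F"
    proof (rule poisson_void_indep[OF X K])
      show "disjoint_family_on ?K F" unfolding disjoint_family_on_def
      proof (intro ballI impI)
        fix m n assume mn: "m \<in> F" "n \<in> F" "m \<noteq> n"
        show "?K m \<inter> ?K n = {}" using disjC[OF F_nuc[OF mn(1)] F_nuc[OF mn(2)] mn(3)] by blast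
      qed
    qed
    then have "prob (\<Inter>n\<in>F. (\<lambda>\<nu>. X \<nu> \<inter> ?K n) -` A n \<inter> space M) = (\<Prod>n\<in>F. prob ((\<lambda>\<nu>. X \<nu> \<inter> ?K n) -` A n \<inter> space M))"
      using False F A by (intro indep_varsD[where M'="\<lambda>_. configs" and I=F]) simp_all
    moreover have "(\<Inter>n\<in>F. (\<lambda>\<nu>. X \<nu> \<inter> ?K n) -` A n \<inter> space M) = ?R" using False by auto
    moreover have "(\<lambda>\<nu>. X \<nu> \<inter> ?K n) -` A n \<inter> space M = {\<nu> \<in> space M. X \<nu> \<inter> ?K n \<in> A n}" for n by auto
    ultimately show ?thesis by (simp only:)
  qed
  let ?U = "\<Union>n\<in>F. ?C n"
  have U: "?U \<in> sets borel" using F by (intro sets.finite_UN C)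
  have null: "vol (A' - ?U) = 0" if "A' \<in> sets borel" "A' \<subseteq> B" for A'
  proof (rule ties_null[OF S ne sets.Diff[OF that(1) U]])
    show "(A' - ?U) \<inter> ?C n = {}" if "n \<in> nuclei S" for n
      using that \<open>A' \<subseteq> B\<close> unfolding F_def cell_of_def by blast
  qed
  have sum: "(\<Sum>n\<in>F. vol (A' \<inter> ?C n)) = vol A'" if A': "A' \<in> sets borel" "A' \<subseteq> B" for A'
  proof -
    have b: "bounded A'" by (rule bounded_subset[OF B(2) A'(2)])
    have "vol (\<Union>n\<in>F. A' \<inter> ?C n) = (\<Sum>n\<in>F. vol (A' \<inter> ?C n))"
    proof (rule measure_finite_Union[OF F])
      show "disjoint_family_on (\<lambda>n. A' \<inter> ?C n) F" unfolding disjoint_family_on_def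
      proof (intro ballI impI)
        fix m n assume mn: "m \<in> F" "n \<in> F" "m \<noteq> n"
        show "(A' \<inter> ?C m) \<inter> (A' \<inter> ?C n) = {}" using disjC[OF F_nuc[OF mn(1)] F_nuc[OF mn(2)] mn(3)] by blast
      qed
      show "emeasure lborel (A' \<inter> ?C n) \<noteq> \<infinity>" for n
        using emeasure_bounded_finite[OF bounded_subset[OF b Int_lower1]] by (simp add: less_top)
    qed (use C A' in auto)
    moreover have "(\<Union>n\<in>F. A' \<inter> ?C n) = A' \<inter> ?U" by blast
    ultimately show ?thesis using measure_lborel_split[OF A'(1) b U] null[OF A'] by simp
  qed
  have BH: "B \<inter> ?H \<in> sets borel" by (rule sets.Int[OF B(1) upper_sets])
  let ?T = "{\<nu> \<in> space M. X \<nu> \<inter> (B \<inter> ?H - ?U) = {}}"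
  have T: "?T \<in> events" by (rule void_measurable[OF Xm sets.Diff[OF BH U]])
  have "prob ?T = 1"
    using poisson_voidD[OF X sets.Diff[OF BH U] bounded_subset[OF B(2)]] null[OF BH Int_lower1] by auto
  then have AE_T: "AE \<nu> in M. \<nu> \<in> ?T" using prob_eq_1[OF T] by simp
  let ?G = "{\<nu> \<in> space M. X \<nu> \<inter> (B \<inter> ?H) = {} \<and> grown S (X \<nu> \<inter> ?H) \<inter> B = {}}"
  have G_iff: "\<nu> \<in> ?G \<longleftrightarrow> \<nu> \<in> ?R \<and> \<nu> \<in> ?T" if \<nu>: "\<nu> \<in> space M" for \<nu>
  proof -
    have "X \<nu> \<inter> (B \<inter> ?H) = {} \<longleftrightarrow> (\<forall>n\<in>F. X \<nu> \<inter> (B \<inter> ?C n \<inter> ?H) = {}) \<and> X \<nu> \<inter> (B \<inter> ?H - ?U) = {}" by blast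
    moreover have "grown S (X \<nu> \<inter> ?H) \<inter> B = {} \<longleftrightarrow> (\<forall>n\<in>F. extra (shift (- n) (X \<nu>)) \<inter> B' n = {})"
    proof -
      have "grown S (X \<nu> \<inter> ?H) \<inter> B = {} \<longleftrightarrow> (\<forall>n\<in>nuclei S. \<forall>y\<in>B. nearest S n y \<longrightarrow> y - n \<notin> extra (shift (- n) (X \<nu> \<inter> ?H)))"
        unfolding grown_eq by blast
      also have "... \<longleftrightarrow> (\<forall>n\<in>F. \<forall>y\<in>B. nearest S n y \<longrightarrow> y - n \<notin> extra (shift (- n) (X \<nu> \<inter> ?H)))"
        unfolding F_def by blast
      also have "... \<longleftrightarrow> (\<forall>n\<in>F. \<forall>y\<in>B. nearest S n y \<longrightarrow> y - n \<notin> extra (shift (- n) (X \<nu>)))"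
        using extra_K[OF F_nuc Int_lower2] by simp
      also have "... \<longleftrightarrow> (\<forall>n\<in>F. extra (shift (- n) (X \<nu>)) \<inter> B' n = {})"
      proof (rule ball_cong[OF refl])
        fix n
        have "y - n \<in> B' n \<longleftrightarrow> y \<in> B \<and> nearest S n y" for y by (simp add: B'_def cell_of_def)
        then show "(\<forall>y\<in>B. nearest S n y \<longrightarrow> y - n \<notin> extra (shift (- n) (X \<nu>))) \<longleftrightarrow> extra (shift (- n) (X \<nu>)) \<inter> B' n = {}"
          by (metis (no_types, lifting) add_diff_cancel disjoint_iff)
      qed
      finally show ?thesis .
    qed
    ultimately show ?thesis using \<nu> A_iff[OF \<nu> F_nuc] by auto
  qed
  have G_eq: "?G = ?R \<inter> ?T" using G_iff by blast
  have "prob ?G = prob ?R"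
  proof (rule finite_measure_eq_AE)
    show "AE \<nu> in M. \<nu> \<in> ?G \<longleftrightarrow> \<nu> \<in> ?R" using AE_T unfolding G_eq by (auto elim!: eventually_mono)
    show "?G \<in> events" unfolding G_eq by (rule sets.Int[OF R_sets T])
  qed (rule R_sets)
  also have "... = (\<Prod>n\<in>F. exp (- (l * vol (B \<inter> ?H \<inter> ?C n) + \<rho> * vol (B \<inter> ?C n))))"
    unfolding pR by (rule prod.cong[OF refl pA[OF F_nuc]])
  also have "... = exp (- (l * (\<Sum>n\<in>F. vol (B \<inter> ?H \<inter> ?C n)) + \<rho> * (\<Sum>n\<in>F. vol (B \<inter> ?C n))))"
    unfolding exp_sum[OF F, symmetric] by (simp add: sum_negf sum.distrib sum_distrib_left sum_subtractf)
  finally show ?thesis unfolding sum[OF BH Int_lower1] sum[OF B(1) subset_refl] .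
qed

end

context local_thickening
begin

section \<open>Almost surely there is a nucleus\<close>

text \<open>The regions \<open>Z k\<close> are disjoint translates of each other along \<open>e\<close>. Each of them contains a nucleus with the same
  positive probability, independently of the others.\<close>

lemma nuclei_nonempty:
  assumes X: "poisson_void l M X" and e: "e \<bullet> w = 0" "norm e = 1"
  shows "AE \<nu> in M. nuclei (X \<nu>) \<noteq> {}"
proof -
  interpret prob_space M using X by (simp add: poisson_void_def)
  have Xm: "X \<in> measurable M configs" using X by (simp add: poisson_void_def)
  let ?c = "\<lambda>k::nat. (7 * width * real k) *\<^sub>R e"
  define Z where "Z k r = {y. -1 \<le> y \<bullet> w \<and> y \<bullet> w < 0 \<and> norm (proj y - (7 * width * real k) *\<^sub>R e) \<le> r}" for k :: nat and r :: real
  have cw: "?c k \<bullet> w = 0" for k using e(1) by simp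
  have Z_sets: "Z k r \<in> sets borel" for k r
  proof -
    have "Measurable.pred borel (\<lambda>y. -1 \<le> y \<bullet> w \<and> y \<bullet> w < 0 \<and> norm (proj y - ?c k) \<le> r)" by measurable
    then show ?thesis unfolding pred_def Z_def by simp
  qed
  have Z_bdd: "bounded (Z k r)" for k r
  proof (rule boundedI)
    fix y assume y: "y \<in> Z k r"
    have "norm (proj y) \<le> norm (proj y - ?c k) + norm (?c k)" by (metis diff_add_cancel norm_triangle_ineq)
    moreover have "\<bar>y \<bullet> w\<bar> \<le> 1" using y by (simp add: Z_def abs_le_iff)
    ultimately show "norm y \<le> r + norm (?c k) + 1" using norm_le_proj[of y] y by (simp add: Z_def)
  qed
  have Z_shift: "Z k r = (\<lambda>y. y + - ?c k) -` Z 0 r" for k r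
  proof -
    have "proj (y + - ?c k) = proj y - ?c k" for y using proj_add[of "- ?c k" y] cw by simp
    moreover have "(y + - ?c k) \<bullet> w = y \<bullet> w" for y using cw[of k] by (simp only: inner_add_left inner_minus_left)
    ultimately show ?thesis unfolding Z_def by auto
  qed
  have Z_vol: "vol (Z k r) = vol (Z 0 r)" for k r
    unfolding Z_shift[of k] by (rule measure_lborel_vimage_plus[OF Z_sets])
  have Z_disj: "Z i (3 * width) \<inter> Z k (3 * width) = {}" if "i \<noteq> k" for i k
  proof -
    have False if y: "y \<in> Z i (3 * width)" "y \<in> Z k (3 * width)"
    for y
    proof -
      have "norm (?c i - ?c k) \<le> norm (proj y - ?c k) + norm (proj y - ?c i)"
        using norm_triangle_ineq4[of "proj y - ?c k" "proj y - ?c i"] by simp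
      also have "... \<le> 6 * width" using y by (simp add: Z_def)
      finally have "norm ((7 * width * (real i - real k)) *\<^sub>R e) \<le> 6 * width" by (simp add: scaleR_diff_left[symmetric] right_diff_distrib)
      then have "7 * width * \<bar>real i - real k\<bar> \<le> 6 * width" using width_pos e(2) by (simp add: abs_mult)
      moreover have "1 \<le> \<bar>real i - real k\<bar>" using \<open>i \<noteq> k\<close> by linarith
      then have "7 * width * 1 \<le> 7 * width * \<bar>real i - real k\<bar>" using width_pos by (intro mult_left_mono) auto
      ultimately show False using width_pos by linarith
    qed
    then show ?thesis by blast
  qed
  have Z_sub: "Z k width \<subseteq> Z k (3 * width)" for k using width_pos by (auto simp: Z_def)
  let ?D = "\<lambda>k. Z k (3 * width) - Z k width"
  define p where "p = l * vol (Z 0 width) * exp (- (l * vol (Z 0 (3 * width))))"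
  have p_pos: "0 < p"
  proof -
    define \<delta> where "\<delta> = min (1 / 2) width"
    have d: "0 < \<delta>" "\<delta> \<le> 1 / 2" "\<delta> \<le> width" using width_pos by (simp_all add: \<delta>_def)
    have "ball ((- (1 / 2)) *\<^sub>R w) \<delta> \<subseteq> Z 0 width"
    proof
      fix y assume "y \<in> ball ((- (1 / 2)) *\<^sub>R w) \<delta>"
      then have y: "norm (y + (1 / 2) *\<^sub>R w) < \<delta>" by (simp add: dist_norm norm_minus_commute)
      have "\<bar>(y + (1 / 2) *\<^sub>R w) \<bullet> w\<bar> \<le> norm (y + (1 / 2) *\<^sub>R w) * norm w" by (rule Cauchy_Schwarz_ineq2)
      then have "\<bar>y \<bullet> w + 1 / 2\<bar> < 1 / 2" using y d(2) w by (simp add: inner_add_left w_inner)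
      then have "-1 \<le> y \<bullet> w" "y \<bullet> w < 0" unfolding abs_less_iff by linarith+
      moreover have "proj y = proj (y + (1 / 2) *\<^sub>R w)" by (simp add: proj_def inner_add_left w_inner scaleR_add_left)
      then have "norm (proj y) \<le> width" using norm_proj_le[of "y + (1 / 2) *\<^sub>R w"] y d(3) by simp
      ultimately show "y \<in> Z 0 width" by (simp add: Z_def)
    qed
    then have "vol (ball ((- (1 / 2)) *\<^sub>R w) \<delta>) \<le> vol (Z 0 width)"
      using emeasure_bounded_finite[OF Z_bdd] Z_sets by (intro measure_mono_fmeasurable) (auto simp: fmeasurable_def)
    moreover have "0 < vol (ball ((- (1 / 2)) *\<^sub>R w) \<delta>)" by (rule content_ball_pos[OF d(1)])
    ultimately have "0 < vol (Z 0 width)" by linarith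
    then show ?thesis using pos by (simp add: p_def)
  qed
  define E where "E k = {S \<in> space configs. \<not> (card (S \<inter> Z k width) = 1 \<and> S \<inter> ?D k = {})}" for k
  have E: "E k \<in> sets configs" for k
  proof -
    have c: "{S \<in> space configs. card (S \<inter> Z k width) = 1} \<in> sets configs"
      using measurable_sets[OF card_measurable[OF measurable_ident_sets[OF refl] Z_sets[of k width] Z_bdd[of k width]], of "{1}"]
      by (simp add: vimage_def Int_def conj_commute)
    have d: "{S \<in> space configs. S \<inter> ?D k = {}} \<in> sets configs" by (rule void_in_configs) (rule sets.Diff[OF Z_sets Z_sets])
    have "E k = space configs - ({S \<in> space configs. card (S \<inter> Z k width) = 1} \<inter> {S \<in> space configs. S \<inter> ?D k = {}})" unfolding E_def by blast
    then show ?thesis using sets.compl_sets[OF sets.Int[OF c d]] by (simp only:)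
  qed
  have sub: "X \<nu> \<inter> D \<in> space configs" if "\<nu> \<in> space M" for \<nu> D
    using measurable_space[OF Xm that] by (auto simp: space_configs intro: locally_finite_subset)
  have E_iff: "X \<nu> \<inter> Z k (3 * width) \<in> E k \<longleftrightarrow> \<not> (card (X \<nu> \<inter> Z k width) = 1 \<and> X \<nu> \<inter> ?D k = {})" if "\<nu> \<in> space M" for \<nu> k
  proof -
    have "X \<nu> \<inter> Z k (3 * width) \<inter> Z k width = X \<nu> \<inter> Z k width" "X \<nu> \<inter> Z k (3 * width) \<inter> ?D k = X \<nu> \<inter> ?D k" using Z_sub[of k] by blast+
    then show ?thesis using sub[OF that] unfolding E_def by simp
  qed
  have EX: "(\<lambda>\<nu>. X \<nu> \<inter> Z k (3 * width)) -` E k \<inter> space M \<in> events" for k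
    by (rule measurable_sets[OF measurable_compose[OF Xm configs_restrict_measurable[OF Z_sets]] E])
  have pE: "prob ((\<lambda>\<nu>. X \<nu> \<inter> Z k (3 * width)) -` E k \<inter> space M) = 1 - p" for k
  proof -
    have c: "(\<lambda>\<nu>. X \<nu> \<inter> Z k (3 * width)) -` E k \<inter> space M = space M - {\<nu> \<in> space M. card (X \<nu> \<inter> Z k width) = 1 \<and> X \<nu> \<inter> ?D k = {}}"
      using E_iff by auto
    have s: "{\<nu> \<in> space M. card (X \<nu> \<inter> Z k width) = 1 \<and> X \<nu> \<inter> ?D k = {}} \<in> events"
    proof -
      have "{\<nu> \<in> space M. card (X \<nu> \<inter> Z k width) = 1 \<and> X \<nu> \<inter> ?D k = {}} = space M - ((\<lambda>\<nu>. X \<nu> \<inter> Z k (3 * width)) -` E k \<inter> space M)" unfolding c by blast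
      then show ?thesis using sets.compl_sets[OF EX[of k]] by (simp only:)
    qed
    have u: "Z k width \<union> ?D k = Z k (3 * width)" using Z_sub[of k] by blast
    have "prob {\<nu> \<in> space M. card (X \<nu> \<inter> Z k width) = 1 \<and> X \<nu> \<inter> ?D k = {}} = l * vol (Z k width) * exp (- (l * vol (Z k width \<union> ?D k)))"
    proof (rule poisson_void_single_point[OF X])
      show "0 \<le> l" using pos by simp
      show "Z k width \<inter> ?D k = {}" by blast
      show "bounded (?D k)" by (rule bounded_subset[OF Z_bdd Diff_subset])
      show "?D k \<in> sets borel" by (rule sets.Diff[OF Z_sets Z_sets])
    qed (rule Z_sets, rule Z_bdd)
    also have "... = p" unfolding u p_def Z_vol[of k] ..
    finally show ?thesis unfolding c by (subst prob_compl[OF s]) simp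
  qed
  have nucleus: "nuclei S \<noteq> {}" if one: "card (S \<inter> Z k width) = 1" and none: "S \<inter> ?D k = {}" for S k
  proof -
    obtain x where x: "S \<inter> Z k width = {x}" using one by (auto simp: card_1_singleton_iff)
    have xZ: "x \<in> S" "-1 \<le> x \<bullet> w" "x \<bullet> w < 0" "norm (proj x - ?c k) \<le> width" using x unfolding Z_def by blast+
    have "isolated_at S x" unfolding isolated_at_def
    proof (intro conjI xZ(2,3) notI)
      assume "\<exists>y\<in>S. -1 \<le> y \<bullet> w \<and> y \<bullet> w < 0 \<and> 0 < norm (y - x) \<and> norm (proj y - proj x) \<le> 2 * width"
      then obtain y where y: "y \<in> S" "-1 \<le> y \<bullet> w" "y \<bullet> w < 0" "0 < norm (y - x)" "norm (proj y - proj x) \<le> 2 * width" by blast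
      have "norm (proj y - ?c k) \<le> norm (proj y - proj x) + norm (proj x - ?c k)"
        using norm_triangle_ineq[of "proj y - proj x" "proj x - ?c k"] by simp
      then have "y \<in> Z k (3 * width)" using y xZ(4) by (simp add: Z_def)
      then have "y \<in> S \<inter> Z k width" using none y(1) by blast
      then show False using x y(4) by auto
    qed
    then show ?thesis using xZ(1) unfolding nuclei_def by blast
  qed
  let ?N = "{\<nu> \<in> space M. nuclei (X \<nu>) = {}}"
  have le: "prob ?N \<le> (1 - p) ^ n" if n: "0 < n" for n
  proof -
    let ?I = "\<Inter>k\<in>{..<n}. (\<lambda>\<nu>. X \<nu> \<inter> Z k (3 * width)) -` E k \<inter> space M"
    have "indep_vars (\<lambda>_. configs) (\<lambda>k \<nu>. X \<nu> \<inter> Z k (3 * width)) {..<n}"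
      by (rule poisson_void_indep[OF X Z_sets]) (auto simp: disjoint_family_on_def Z_disj)
    then have "prob ?I = (\<Prod>k\<in>{..<n}. prob ((\<lambda>\<nu>. X \<nu> \<inter> Z k (3 * width)) -` E k \<inter> space M))"
      using n E by (intro indep_varsD[where M'="\<lambda>_. configs" and I="{..<n}"]) auto
    also have "... = (1 - p) ^ n" unfolding pE by simp
    finally have I: "prob ?I = (1 - p) ^ n" .
    have "?N \<subseteq> ?I"
    proof
      fix \<nu> assume \<nu>: "\<nu> \<in> ?N"
      have "X \<nu> \<inter> Z k (3 * width) \<in> E k" for k using E_iff[of \<nu> k] nucleus[of "X \<nu>" k] \<nu> by blast
      then show "\<nu> \<in> ?I" using \<nu> by blast
    qed
    moreover have "?I \<in> events" using n by (intro sets.finite_INT EX) auto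
    ultimately have "prob ?N \<le> prob ?I" by (rule finite_measure_mono)
    then show ?thesis by (simp only: I)
  qed
  have p1: "p \<le> 1" using pE[of 0] measure_nonneg[of M "(\<lambda>\<nu>. X \<nu> \<inter> Z 0 (3 * width)) -` E 0 \<inter> space M"] by linarith
  have "(\<lambda>n. (1 - p) ^ n) \<longlonglongrightarrow> 0" using p_pos p1 by (intro LIMSEQ_power_zero) simp
  then have "prob ?N \<le> 0" using le by (intro LIMSEQ_le_const) (auto intro!: exI[of _ 1])
  then have z: "prob ?N = 0" using measure_nonneg[of M ?N] by linarith
  have N: "?N \<in> events"
  proof -
    have m: "(\<lambda>\<nu>. nuclei (X \<nu>) = {}) = (\<lambda>\<nu>. \<not> (\<exists>x\<in>X \<nu>. isolated_at (X \<nu>) x))" unfolding nuclei_def by blast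
    have mm: "(\<lambda>q. (X (fst q), snd q)) \<in> measurable (M \<Otimes>\<^sub>M borel) (configs \<Otimes>\<^sub>M borel)"
      by (intro measurable_Pair measurable_compose[OF measurable_fst Xm] measurable_snd)
    have "Measurable.pred M (\<lambda>\<nu>. \<exists>x\<in>X \<nu>. isolated_at (X \<nu>) x)"
    proof (rule pred_ex_point[OF Xm])
      show "Measurable.pred (M \<Otimes>\<^sub>M borel) (\<lambda>q. isolated_at (X (fst q)) (snd q))"
        using measurable_compose[OF mm pred_isolated] by (simp only: fst_conv snd_conv)
    qed
    from pred_intros_logic(2)[OF this] show ?thesis unfolding m[symmetric] pred_def .
  qed
  show ?thesis
  proof (rule AE_I'[of ?N])
    show "?N \<in> null_sets M" using N z by (simp add: null_sets_def emeasure_eq_measure)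
  qed auto
qed

section \<open>Conditioning on the points below the hyperplane\<close>

abbreviation lower :: "'a set" where "lower \<equiv> - upper"

definition voronoi_thickening :: "'a set \<Rightarrow> 'a set" where
  "voronoi_thickening S = S \<union> grown S S"

lemma voronoi_measurable: "voronoi_thickening \<in> measurable configs configs"
proof -
  have "(\<lambda>S. (S, S)) \<in> measurable (configs :: 'a set measure) (configs \<Otimes>\<^sub>M configs)"
    by (intro measurable_Pair measurable_ident_sets[OF refl])
  from measurable_compose[OF this grown_measurable]
  have "(\<lambda>S. grown S S) \<in> measurable configs configs" by (simp only: fst_conv snd_conv)
  from Un_configs_measurable[OF measurable_ident_sets[OF refl] this] show ?thesis by (simp only: voronoi_thickening_def[abs_def])
qed

lemma isolated_lower: "isolated_at (S \<inter> lower) x \<longleftrightarrow> isolated_at S x"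
  unfolding isolated_at_def by auto

lemma nuclei_lower: "nuclei (S \<inter> lower) = nuclei S"
proof -
  have "x \<in> lower" if "isolated_at S x" for x using that by (simp add: isolated_at_def)
  then show ?thesis unfolding nuclei_def isolated_lower by blast
qed

lemma grown_split: "grown S S = grown (S \<inter> lower) (S \<inter> upper)"
proof -
  have "extra (shift (- n) (S \<inter> upper)) = extra (shift (- n) S)" if n: "n \<in> nuclei S" for n
  proof (rule extra_cong)
    have "s \<in> upper" if "s + - n \<in> slots" for s
      using slots_height[OF that] nuclei_inner[OF n] by (simp add: inner_diff_left)
    then show "shift (- n) (S \<inter> upper) \<inter> slots = shift (- n) S \<inter> slots" unfolding shift_def by blast
  qed
  then show ?thesis unfolding grown_eq nuclei_lower nearest_iff by simp
qed

text \<open>The nuclei are determined by the points below the hyperplane, which are independent of those above; given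
  the former, \<open>grown_void\<close> applies to the latter.\<close>

theorem voronoi_void:
  assumes X: "poisson_void l M X" and e: "e \<bullet> w = 0" "norm e = 1"
  shows "poisson_void (l + \<rho>) M (\<lambda>\<nu>. voronoi_thickening (X \<nu>))"
proof -
  interpret prob_space M using X by (simp add: poisson_void_def)
  have Xm: "X \<in> measurable M configs" using X by (simp add: poisson_void_def)
  have lower_sets: "lower \<in> sets borel" by (rule borel_comp[OF upper_sets])
  have m1: "(\<lambda>\<nu>. X \<nu> \<inter> lower) \<in> measurable M configs" and m2: "(\<lambda>\<nu>. X \<nu> \<inter> upper) \<in> measurable M configs"
    by (rule measurable_compose[OF Xm configs_restrict_measurable[OF lower_sets]], rule measurable_compose[OF Xm configs_restrict_measurable[OF upper_sets]])
  let ?L = "distr M configs (\<lambda>\<nu>. X \<nu> \<inter> lower)" and ?U = "distr M configs (\<lambda>\<nu>. X \<nu> \<inter> upper)"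
  interpret L: prob_space ?L by (rule prob_space_distr[OF m1])
  interpret U: prob_space ?U by (rule prob_space_distr[OF m2])
  have joint: "distr M (configs \<Otimes>\<^sub>M configs) (\<lambda>\<nu>. (X \<nu> \<inter> lower, X \<nu> \<inter> upper)) = ?L \<Otimes>\<^sub>M ?U"
  proof -
    have "indep_vars (\<lambda>_. configs) (\<lambda>i \<nu>. X \<nu> \<inter> case_bool lower upper i) UNIV"
      using lower_sets upper_sets by (intro poisson_void_indep[OF X]) (auto simp: disjoint_family_on_def split: bool.splits)
    moreover have "(\<lambda>i \<nu>. X \<nu> \<inter> case_bool lower upper i) = case_bool (\<lambda>\<nu>. X \<nu> \<inter> lower) (\<lambda>\<nu>. X \<nu> \<inter> upper)"
      by (rule ext) (simp split: bool.split)
    moreover have "(\<lambda>_. configs) = case_bool (configs :: 'a set measure) configs" by (rule ext) (simp split: bool.split)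
    ultimately have "indep_var configs (\<lambda>\<nu>. X \<nu> \<inter> lower) configs (\<lambda>\<nu>. X \<nu> \<inter> upper)" unfolding indep_var_def by (simp only:)
    then have "?L \<Otimes>\<^sub>M ?U = distr M (configs \<Otimes>\<^sub>M configs) (\<lambda>\<nu>. (X \<nu> \<inter> lower, X \<nu> \<inter> upper))"
      unfolding indep_var_distribution_eq by (elim conjE)
    then show ?thesis by (rule sym)
  qed
  have pm: "(\<lambda>\<nu>. (X \<nu> \<inter> lower, X \<nu> \<inter> upper)) \<in> measurable M (configs \<Otimes>\<^sub>M configs)" by (rule measurable_Pair[OF m1 m2])
  show ?thesis unfolding poisson_void_def
  proof (intro conjI ballI impI)
    show "prob_space M" by (rule prob_space_axioms)
    show "(\<lambda>\<nu>. voronoi_thickening (X \<nu>)) \<in> measurable M configs" by (rule measurable_compose[OF Xm voronoi_measurable])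
    fix B :: "'a set" assume B: "B \<in> sets borel" and bB: "bounded B"
    let ?W = "{t \<in> space (configs \<Otimes>\<^sub>M configs). fst t \<inter> B = {}} \<inter> ({t \<in> space (configs \<Otimes>\<^sub>M configs). snd t \<inter> (B \<inter> upper) = {}} \<inter> {t \<in> space (configs \<Otimes>\<^sub>M configs). grown (fst t) (snd t) \<inter> B = {}})"
    have BU: "B \<inter> upper \<in> sets borel" by (rule sets.Int[OF B upper_sets])
    have W: "?W \<in> sets (configs \<Otimes>\<^sub>M configs)"
      by (rule sets.Int[OF void_measurable[OF measurable_fst B] sets.Int[OF void_measurable[OF measurable_snd BU] void_measurable[OF grown_measurable B]]])
    define c where "c = exp (- (l * vol (B \<inter> upper) + \<rho> * vol B))"
    have split: "S \<inter> B = {} \<longleftrightarrow> S \<inter> lower \<inter> B = {} \<and> S \<inter> upper \<inter> (B \<inter> upper) = {}" for S by blast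
    have pre: "{\<nu> \<in> space M. voronoi_thickening (X \<nu>) \<inter> B = {}} = (\<lambda>\<nu>. (X \<nu> \<inter> lower, X \<nu> \<inter> upper)) -` ?W \<inter> space M"
    proof -
      have "voronoi_thickening (X \<nu>) \<inter> B = {} \<longleftrightarrow> (X \<nu> \<inter> lower, X \<nu> \<inter> upper) \<in> ?W" if "\<nu> \<in> space M" for \<nu>
      proof -
        have "voronoi_thickening (X \<nu>) \<inter> B = {} \<longleftrightarrow> X \<nu> \<inter> B = {} \<and> grown (X \<nu> \<inter> lower) (X \<nu> \<inter> upper) \<inter> B = {}"
          unfolding voronoi_thickening_def grown_split[of "X \<nu>"] Int_Un_distrib2 by simp
        then show ?thesis using measurable_space[OF pm that] unfolding split[of "X \<nu>"] by simp
      qed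
      then show ?thesis by blast
    qed
    have inner: "emeasure ?U (Pair S -` ?W) = ennreal c * indicator {S \<in> space configs. S \<inter> B = {}} S" if S: "S \<in> space configs" and ne: "nuclei S \<noteq> {}" for S
    proof (cases "S \<inter> B = {}")
      case True
      have s: "Pair S -` ?W \<in> sets configs" by (rule sets_Pair1[OF W])
      have eq: "(\<lambda>\<nu>. X \<nu> \<inter> upper) -` (Pair S -` ?W) \<inter> space M = {\<nu> \<in> space M. X \<nu> \<inter> (B \<inter> upper) = {} \<and> grown S (X \<nu> \<inter> upper) \<inter> B = {}}"
      proof -
        have "X \<nu> \<inter> upper \<inter> (B \<inter> upper) = X \<nu> \<inter> (B \<inter> upper)" for \<nu> by blast
        then show ?thesis using True S measurable_space[OF m2] by (auto simp: space_pair_measure)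
      qed
      have "emeasure ?U (Pair S -` ?W) = emeasure M ((\<lambda>\<nu>. X \<nu> \<inter> upper) -` (Pair S -` ?W) \<inter> space M)" by (rule emeasure_distr[OF m2 s])
      also have "... = ennreal c" unfolding eq emeasure_eq_measure grown_void[OF S ne X B bB] c_def ..
      finally show ?thesis using True S by simp
    next
      case False
      then have "Pair S -` ?W = {}" by auto
      then show ?thesis using False by simp
    qed
    have Lv: "{S \<in> space configs. S \<inter> B = {}} \<in> sets ?L" using void_in_configs[OF B] by simp
    have AE: "AE S in ?L. nuclei S \<noteq> {}"
    proof (subst AE_distr_iff[OF m1])
      have m: "(\<lambda>S. nuclei S \<noteq> {}) = (\<lambda>S. \<exists>x\<in>S. isolated_at S x)" unfolding nuclei_def by blast
      have "Measurable.pred configs (\<lambda>S. \<exists>x\<in>S. isolated_at S x)" by (rule pred_ex_point[OF measurable_ident_sets[OF refl] pred_isolated])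
      then show "{S \<in> space configs. nuclei S \<noteq> {}} \<in> sets configs" unfolding m[symmetric] pred_def .
      show "AE \<nu> in M. nuclei (X \<nu> \<inter> lower) \<noteq> {}" unfolding nuclei_lower by (rule nuclei_nonempty[OF X e])
    qed
    have "emeasure M {\<nu> \<in> space M. voronoi_thickening (X \<nu>) \<inter> B = {}} = emeasure (?L \<Otimes>\<^sub>M ?U) ?W"
      unfolding pre joint[symmetric] by (rule emeasure_distr[OF pm W, symmetric])
    also have "... = (\<integral>\<^sup>+S. emeasure ?U (Pair S -` ?W) \<partial>?L)"
    proof (rule U.emeasure_pair_measure_alt)
      have "sets (?L \<Otimes>\<^sub>M ?U) = sets (configs \<Otimes>\<^sub>M configs)" by (rule sets_pair_measure_cong) simp_all
      then show "?W \<in> sets (?L \<Otimes>\<^sub>M ?U)" using W by (simp only:)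
    qed
    also have "... = (\<integral>\<^sup>+S. ennreal c * indicator {S \<in> space configs. S \<inter> B = {}} S \<partial>?L)"
    proof (rule nn_integral_cong_AE)
      show "AE S in ?L. emeasure ?U (Pair S -` ?W) = ennreal c * indicator {S \<in> space configs. S \<inter> B = {}} S"
        using AE AE_space
      proof eventually_elim
        case (elim S)
        then show ?case by (intro inner) simp_all
      qed
    qed
    also have "... = ennreal c * emeasure ?L {S \<in> space configs. S \<inter> B = {}}" by (rule nn_integral_cmult_indicator[OF Lv])
    also have "emeasure ?L {S \<in> space configs. S \<inter> B = {}} = emeasure M {\<nu> \<in> space M. X \<nu> \<inter> (B \<inter> lower) = {}}"
    proof -
      have "(\<lambda>\<nu>. X \<nu> \<inter> lower) -` {S \<in> space configs. S \<inter> B = {}} \<inter> space M = {\<nu> \<in> space M. X \<nu> \<inter> (B \<inter> lower) = {}}"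
        using measurable_space[OF m1] by blast
      then show ?thesis using emeasure_distr[OF m1 void_in_configs[OF B]] by (simp only:)
    qed
    also have "... = ennreal (exp (- (l * vol (B \<inter> lower))))"
      using poisson_voidD[OF X sets.Int[OF B lower_sets] bounded_subset[OF bB Int_lower1]] by (simp add: emeasure_eq_measure)
    also have "ennreal c * ennreal (exp (- (l * vol (B \<inter> lower)))) = ennreal (exp (- ((l + \<rho>) * vol B)))"
    proof -
      have "B \<inter> lower = B - upper" by blast
      then have "vol (B \<inter> lower) + vol (B \<inter> upper) = vol B"
        using measure_lborel_split[OF B bB upper_sets] by simp
      then have "l * vol B = l * vol (B \<inter> lower) + l * vol (B \<inter> upper)"
        by (simp only: distrib_left[symmetric])
      then have "c * exp (- (l * vol (B \<inter> lower))) = exp (- ((l + \<rho>) * vol B))"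
        unfolding c_def exp_add[symmetric] by (simp add: distrib_right)
      then show ?thesis by (simp add: ennreal_mult[symmetric] c_def)
    qed
    finally show "prob {\<nu> \<in> space M. voronoi_thickening (X \<nu>) \<inter> B = {}} = exp (- ((l + \<rho>) * vol B))"
      unfolding emeasure_eq_measure by (subst (asm) ennreal_inj) simp_all
  qed
qed

section \<open>Equivariance\<close>

lemma isolated_shift: "v \<bullet> w = 0 \<Longrightarrow> isolated_at (shift v S) (x + v) \<longleftrightarrow> isolated_at S x"
  unfolding isolated_at_def shift_def by (simp add: inner_add_left proj_add)

lemma nuclei_shift: assumes v: "v \<bullet> w = 0" shows "nuclei (shift v S) = (\<lambda>n. n + v) ` nuclei S"
proof -
  have "nuclei (shift v S) = {proj (x + v) | x. x \<in> S \<and> isolated_at (shift v S) (x + v)}" unfolding nuclei_def by (auto simp: shift_def)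
  also have "... = (\<lambda>n. n + v) ` nuclei S" unfolding isolated_shift[OF v] proj_add[OF v] nuclei_def by blast
  finally show ?thesis .
qed

lemma grown_shift: assumes v: "v \<bullet> w = 0" shows "grown (shift v S) (shift v T) = shift v (grown S T)"
proof -
  have n: "nearest (shift v S) (n + v) (y + v) \<longleftrightarrow> nearest S n y" for n y
    unfolding nearest_iff nuclei_shift[OF v] ball_simps proj_add[OF v] by simp
  have s: "shift (- (n + v)) (shift v T) = shift (- n) T" for n by (simp add: shift_shift)
  have "y \<in> grown (shift v S) (shift v T) \<longleftrightarrow> y - v \<in> grown S T" for y
  proof -
    have "y \<in> grown (shift v S) (shift v T) \<longleftrightarrow> (\<exists>n\<in>nuclei S. nearest (shift v S) (n + v) ((y - v) + v) \<and> y - (n + v) \<in> extra (shift (- (n + v)) (shift v T)))"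
      unfolding grown_eq nuclei_shift[OF v] by simp
    also have "... \<longleftrightarrow> y - v \<in> grown S T" unfolding n s grown_eq by (simp add: algebra_simps)
    finally show ?thesis .
  qed
  moreover have "y \<in> shift v (grown S T) \<longleftrightarrow> y - v \<in> grown S T" for y
    unfolding shift_def by (metis (no_types, lifting) add_diff_cancel diff_add_cancel image_iff)
  ultimately show ?thesis by blast
qed

lemma voronoi_commutes: "v \<bullet> w = 0 \<Longrightarrow> commutes_with_shift voronoi_thickening v"
  unfolding commutes_with_shift_def voronoi_thickening_def by (simp add: grown_shift) (simp add: shift_def image_Un)

lemma extra_thickening_void:
  assumes X: "poisson_void l M X" shows "poisson_void (l + \<rho>) M (\<lambda>\<nu>. X \<nu> \<union> extra (X \<nu>))"
  unfolding poisson_void_def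
proof (intro conjI ballI impI)
  show "prob_space M" using X by (simp add: poisson_void_def)
  have Xm: "X \<in> measurable M configs" using X by (simp add: poisson_void_def)
  show "(\<lambda>\<nu>. X \<nu> \<union> extra (X \<nu>)) \<in> measurable M configs"
    by (rule Un_configs_measurable[OF Xm measurable_compose[OF Xm extra_measurable]])
  fix B :: "'a set" assume B: "B \<in> sets borel" "bounded B"
  have U: "(UNIV :: 'a set) \<in> sets borel" by simp
  have "measure M {\<nu> \<in> space M. X \<nu> \<inter> (B \<inter> UNIV) = {} \<and> extra (X \<nu>) \<inter> B = {}} = exp (- (l * vol (B \<inter> UNIV) + \<rho> * vol B))"
    by (rule extra_void[OF X B U]) simp
  moreover have "{\<nu> \<in> space M. X \<nu> \<inter> (B \<inter> UNIV) = {} \<and> extra (X \<nu>) \<inter> B = {}} = {\<nu> \<in> space M. (X \<nu> \<union> extra (X \<nu>)) \<inter> B = {}}" by blast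
  ultimately show "measure M {\<nu> \<in> space M. (X \<nu> \<union> extra (X \<nu>)) \<inter> B = {}} = exp (- ((l + \<rho>) * vol B))"
    by (simp add: distrib_right)
qed

end

lemma thickening_of_voids:
  fixes f :: "'a::euclidean_space set \<Rightarrow> 'a set"
  assumes l: "0 < l" "l < l'" and f: "f \<in> measurable configs configs" and sup: "\<And>S. S \<subseteq> f S"
    and void: "\<And>M (X :: 'a set \<Rightarrow> 'a set). poisson_void l M X \<Longrightarrow> poisson_void l' M (\<lambda>\<nu>. f (X \<nu>))"
  shows "thickening l l' f"
proof -
  have "S \<union> f S = f S" for S using sup[of S] by blast
  then show ?thesis
    unfolding thickening_def using f l void by (simp add: poisson_process_iff_void)
qed

text \<open>If \<open>V\<close> contains no direction in which nuclei could be found, it is \<open>{0}\<close>, and the construction from a single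
  starting point commutes with the one shift in it.\<close>

theorem hyperplane_thickening:
  fixes V :: "'a::euclidean_space set"
  assumes l: "0 < l" "l < l'" and V: "subspace V" "dim V = DIM('a) - 1"
  shows "\<exists>f. thickening l l' f \<and> (\<forall>v\<in>V. commutes_with_shift f v)"
proof -
  obtain a where a: "a \<noteq> 0" "span V = {x. a \<bullet> x = 0}" using V(2) dim_eq_hyperplane by blast
  have spV: "span V = V" using V(1) by (simp add: span_eq_iff)
  define w where "w = a /\<^sub>R norm a"
  have w: "norm w = 1" using a(1) by (simp add: w_def)
  have Vw: "v \<in> V \<longleftrightarrow> v \<bullet> w = 0" for v
    using a unfolding spV by (simp add: w_def inner_commute)
  define \<rho> where "\<rho> = l' - l"
  have \<rho>: "0 < \<rho>" "l + \<rho> = l'" using l by (simp_all add: \<rho>_def)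
  obtain side G where T: "local_thickening l \<rho> side w G" using local_thickening_exists[OF l(1) \<rho>(1) w] by blast
  interpret local_thickening l \<rho> side w G by (rule T)
  show ?thesis
  proof (cases "V \<subseteq> {0}")
    case True
    let ?f = "\<lambda>S. S \<union> extra S"
    have "thickening l l' ?f"
    proof (rule thickening_of_voids[OF l])
      show "?f \<in> measurable configs configs" by (rule Un_configs_measurable[OF measurable_ident_sets[OF refl] extra_measurable])
      show "poisson_void l' M (\<lambda>\<nu>. X \<nu> \<union> extra (X \<nu>))" if "poisson_void l M X" for M and X :: "'a set \<Rightarrow> 'a set"
        using extra_thickening_void[OF that] by (simp only: \<rho>(2))
    qed blast
    moreover have "commutes_with_shift ?f v" if "v \<in> V" for v
    proof -
      have "v = 0" using that True by blast
      then show ?thesis by (simp add: commutes_with_shift_def)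
    qed
    ultimately show ?thesis by blast
  next
    case False
    then obtain u where u: "u \<in> V" "u \<noteq> 0" by blast
    let ?e = "u /\<^sub>R norm u"
    have e: "?e \<bullet> w = 0" "norm ?e = 1" using u Vw[of u] by simp_all
    have "thickening l l' voronoi_thickening"
    proof (rule thickening_of_voids[OF l voronoi_measurable])
      show "S \<subseteq> voronoi_thickening S" for S unfolding voronoi_thickening_def by blast
      show "poisson_void l' M (\<lambda>\<nu>. voronoi_thickening (X \<nu>))" if "poisson_void l M X" for M and X :: "'a set \<Rightarrow> 'a set"
        using voronoi_void[OF that e] by (simp only: \<rho>(2))
    qed
    moreover have "commutes_with_shift voronoi_thickening v" if "v \<in> V" for v using voronoi_commutes that Vw by blast
    ultimately show ?thesis by blast
  qed
qed

section \<open>Thickenings that commute with shifts\<close>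

theorem theorem1p4:
  fixes l l' :: real
  assumes "0 < l" and "l < l'"
  shows "(\<forall>v :: 'd::finite \<Rightarrow> real ^ 'd. inj v \<and> independent (range v) \<longrightarrow>
            \<not> (\<exists>f. thickening l l' f \<and> (\<forall>i. commutes_with_shift f (v i)))) \<and>
         (\<forall>V :: (real ^ 'd) set. subspace V \<and> dim V = CARD('d) - 1 \<longrightarrow>
            (\<exists>f. thickening l l' f \<and> (\<forall>v\<in>V. commutes_with_shift f v)))"
proof (intro conjI allI impI)
  fix v :: "'d \<Rightarrow> real ^ 'd"
  assume v: "inj v \<and> independent (range v)"
  show "\<not> (\<exists>f. thickening l l' f \<and> (\<forall>i. commutes_with_shift f (v i)))"
  proof
    assume "\<exists>f. thickening l l' f \<and> (\<forall>i. commutes_with_shift f (v i))"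
    then obtain f where f: "thickening l l' f" "\<And>i. commutes_with_shift f (v i)" by blast
    show False by (rule no_lattice_thickening[OF assms conjunct1[OF v] conjunct2[OF v] f])
  qed
next
  fix V :: "(real ^ 'd) set"
  assume V: "subspace V \<and> dim V = CARD('d) - 1"
  then have "dim V = DIM(real ^ 'd) - 1" by simp
  from hyperplane_thickening[OF assms conjunct1[OF V] this]
  show "\<exists>f. thickening l l' f \<and> (\<forall>v\<in>V. commutes_with_shift f v)" .
qed

end
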